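(* Let $\mathcal{E}$ be a Hom-finite exact cluster category with a weak cluster structure. For each cluster-tilting subcategory $\mathcal{T}$ of $\mathcal{E}$, let $\langle-,-\rangle^{\mathrm{p}}_{\mathcal{T}}\colon\mathsf{K}_0(\mathcal{T})\times\mathsf{K}_0(\mathcal{T})\to\mathbb{Z}$ be the bilinear form determined by \[\langle[T_1],[T_2]\rangle^{\mathrm{p}}_{\mathcal{T}}=\dim_{\mathbb{K}}\operatorname{Hom}_{\mathcal{E}}(T_1,T_2)-\dim_{\mathbb{K}}\operatorname{Hom}_{\mathcal{E}}(T_2,T_1)\] for $T_1,T_2\in\mathcal{T}$. Then the forms $\langle-,-\rangle^{\mathrm{p}}_{\mathcal{T}}$ defined in this way are a quantum structure on $\mathcal{E}$.
   Context: $\mathbb{K}$ is a perfect field; categories are additive and $\mathbb{K}$-linear; $\operatorname{indec}\mathcal{A}$ is a set of representatives of the isomorphism classes of indecomposable objects of $\mathcal{A}$. Exact cluster categories. A Frobenius exact category $\mathcal{E}$ is one with enough projectives and enough injectives, which coincide; its stable category $\underline{\mathcal{E}}$ (quotient by projectives) is triangulated with suspension $\Sigma$. A right $\mathcal{T}$-approximation of $X$ is a map $T_0\to X$ with $T_0\in\mathcal{T}$ through which every map from an object of $\mathcal{T}$ to $X$ factors; left approximations are dual. A full subcategory $\mathcal{T}\subseteq\mathcal{E}$ is cluster-tilting if $\mathcal{T}=\{X:\operatorname{Ext}^1(T,X)=0\ \forall T\in\mathcal{T}\}=\{X:\operatorname{Ext}^1(X,T)=0\ \forall T\in\mathcal{T}\}$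 and every object has a left $\mathcal{T}$-approximation which is an admissible monomorphism and a right $\mathcal{T}$-approximation which is an admissible epimorphism. An exact cluster category is an idempotent complete Frobenius exact category having a cluster-tilting subcategory and such that $\underline{\mathcal{E}}$ is Hom-finite and $2$-Calabi--Yau (functorially $\operatorname{Hom}(X,Y)\cong\operatorname{Hom}_{\mathbb{K}}(\operatorname{Hom}(Y,\Sigma^2X),\mathbb{K})$). $\underline{\mathcal{T}}$ is the image of $\mathcal{T}$ in $\underline{\mathcal{E}}$. Mutation. For $T\in\operatorname{indec}\mathcal{T}$, $\mathcal{T}\setminus T$ is the additively closed subcategory with indecomposables $\operatorname{indec}\mathcal{T}\setminus\{T\}$. $T$ is mutable in $\mathcal{T}$ if there is an indecomposable $T^*\not\cong T$ such that $\operatorname{add}(\mathcal{T}\setminus T\cup\{T^*\})$ is cluster-tilting and there are non-split short exact sequences $0\to T^*\to T^+\to T\to0$ and $0\to T\to T^-\to T^*\to0$ in which $T^+\to T$ and $T\to T^-$ are right and left $(\mathcal{T}\setminus T)$-approximations. A Krull--Schmidt cluster category has a weak cluster structure if every cluster-tilting subcategory is maximally mutable, i.e. all its non-projective indecomposables are mutable. Index, coindex, $\beta$. $\mathsf{K}_0(\mathcal{T})$ is the Grothendieck group of $\mathcal{T}$ with its split exact structure. For $X\in\mathcal{E}$ there are admissible short exact sequences $0\to K\to R\to X\to0$ and $0\to X\to L\to C\to0$ with $K,R,L,C\in\mathcal{T}$; put $\operatorname{ind}_{\mathcal{E}}^{\mathcal{T}}[X]=[R]-[K]$ and $\operatorname{coind}_{\mathcal{E}}^{\mathcal{T}}[X]=[L]-[C]$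 in $\mathsf{K}_0(\mathcal{T})$ (independent of choices). For another cluster-tilting $\mathcal{U}$, $\operatorname{ind}_{\mathcal{U}}^{\mathcal{T}}\colon\mathsf{K}_0(\mathcal{U})\to\mathsf{K}_0(\mathcal{T})$ sends $[U]$ to $\operatorname{ind}_{\mathcal{E}}^{\mathcal{T}}[U]$. A $\mathcal{T}$-module is a contravariant $\mathbb{K}$-linear functor $\mathcal{T}\to\operatorname{Mod}\mathbb{K}$ (a $\underline{\mathcal{T}}$-module is one vanishing on projectives); $\operatorname{fd}\underline{\mathcal{T}}$ consists of those with finite-dimensional values, non-zero on only finitely many indecomposables. When $\mathcal{T}$ is maximally mutable every $M\in\operatorname{fd}\underline{\mathcal{T}}$ is isomorphic to $\mathsf{E}^{\mathcal{T}}X=\operatorname{Ext}^1_{\mathcal{E}}(-,X)|_{\mathcal{T}}$ for some $X\in\mathcal{E}$, and $\beta_{\mathcal{T}}\colon\mathsf{K}_0(\operatorname{fd}\underline{\mathcal{T}})\to\mathsf{K}_0(\mathcal{T})$ is the well-defined homomorphism with $\beta_{\mathcal{T}}[\mathsf{E}^{\mathcal{T}}X]=\operatorname{coind}_{\mathcal{E}}^{\mathcal{T}}[X]-\operatorname{ind}_{\mathcal{E}}^{\mathcal{T}}[X]$. Quantum structures. A quantum datum for a maximally mutable $\mathcal{T}$ is a bilinear form $\langle-,-\rangle^{\mathrm{p}}_{\mathcal{T}}$ on $\mathsf{K}_0(\mathcal{T})$ with values in $\mathbb{Z}$ that is skew-symmetric and compatible with $\beta_{\mathcal{T}}$: $\langle\beta_{\mathcal{T}}[M],[T]\rangle^{\mathrm{p}}_{\mathcal{T}}=2\dim_{\mathbb{K}}M(T)$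 for all $M\in\operatorname{fd}\underline{\mathcal{T}}$, $T\in\mathcal{T}$. A quantum structure is a choice of quantum datum $\langle-,-\rangle^{\mathrm{p}}_{\mathcal{T}}$ for every cluster-tilting $\mathcal{T}$ such that $\langle\operatorname{ind}_{\mathcal{U}}^{\mathcal{T}}u,\operatorname{ind}_{\mathcal{U}}^{\mathcal{T}}v\rangle^{\mathrm{p}}_{\mathcal{T}}=\langle u,v\rangle^{\mathrm{p}}_{\mathcal{U}}$ for all cluster-tilting $\mathcal{T},\mathcal{U}$ and $u,v\in\mathsf{K}_0(\mathcal{U})$. *)

theory Defs
  imports
    "HOL-Algebra.Free_Abelian_Groups"
    "HOL-Computational_Algebra.Polynomial_Factorial"
begin

definition perfect_field :: "'k::field itself \<Rightarrow> bool" where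
  "perfect_field _ \<longleftrightarrow>
     (\<forall>f::'k poly. Factorial_Ring.irreducible f \<longrightarrow> Rings.coprime f (pderiv f))"


section \<open>Exact \<open>k\<close>-linear categories\<close>

text \<open>
  The objects are the elements of the type \<open>'o\<close>. All morphism spaces are subspaces of one
  ambient vector space \<open>'m\<close>, on which \<open>Comp\<close> is a single operation (\<open>Comp E g f\<close> is \<open>g\<close> after
  \<open>f\<close>) that is only specified on composable pairs. This loses no generality: for any
  \<open>k\<close>-linear category take for \<open>'m\<close> the direct sum of all the morphism spaces, with matrix
  multiplication. Distinct morphism spaces are not assumed to be disjoint (they share \<open>0\<close>), so
  notions depending on source and target carry the objects as arguments.

  \<open>(X, i, F, p, Y) \<in> Confl E\<close> says that \<open>X \<rightarrow> F \<rightarrow> Y\<close>, with maps \<open>i\<close> and \<open>p\<close>, is an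
  admissible short exact sequence.
\<close>

record ('o, 'm, 'k) exact_cat =
  Hom :: "'o \<Rightarrow> 'o \<Rightarrow> 'm set"
  Comp :: "'m \<Rightarrow> 'm \<Rightarrow> 'm"
  Idm :: "'o \<Rightarrow> 'm"
  Scale :: "'k \<Rightarrow> 'm \<Rightarrow> 'm"
  Confl :: "('o \<times> 'm \<times> 'o \<times> 'm \<times> 'o) set"

locale linear_category =
  fixes E :: "('o, 'm::ab_group_add, 'k::field) exact_cat"
  assumes vector_space_Scale: "vector_space (Scale E)"
    and subspace_Hom: "module.subspace (Scale E) (Hom E X Y)"
    and Idm_in_Hom: "Idm E X \<in> Hom E X X"
    and Comp_in_Hom: "\<lbrakk>f \<in> Hom E X Y; g \<in> Hom E Y Z\<rbrakk> \<Longrightarrow> Comp E g f \<in> Hom E X Z"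
    and Comp_assoc: "\<lbrakk>f \<in> Hom E W X; g \<in> Hom E X Y; h \<in> Hom E Y Z\<rbrakk>
        \<Longrightarrow> Comp E h (Comp E g f) = Comp E (Comp E h g) f"
    and Comp_Idm_right: "f \<in> Hom E X Y \<Longrightarrow> Comp E f (Idm E X) = f"
    and Comp_Idm_left: "f \<in> Hom E X Y \<Longrightarrow> Comp E (Idm E Y) f = f"
    and Comp_add_right: "\<lbrakk>f \<in> Hom E X Y; f' \<in> Hom E X Y; g \<in> Hom E Y Z\<rbrakk>
        \<Longrightarrow> Comp E g (f + f') = Comp E g f + Comp E g f'"
    and Comp_add_left: "\<lbrakk>f \<in> Hom E X Y; g \<in> Hom E Y Z; g' \<in> Hom E Y Z\<rbrakk>
        \<Longrightarrow> Comp E (g + g') f = Comp E g f + Comp E g' f"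
    and Comp_scale_right: "\<lbrakk>f \<in> Hom E X Y; g \<in> Hom E Y Z\<rbrakk>
        \<Longrightarrow> Comp E g (Scale E c f) = Scale E c (Comp E g f)"
    and Comp_scale_left: "\<lbrakk>f \<in> Hom E X Y; g \<in> Hom E Y Z\<rbrakk>
        \<Longrightarrow> Comp E (Scale E c g) f = Scale E c (Comp E g f)"

definition hom_dim ::
    "('o, 'm::ab_group_add, 'k::field) exact_cat \<Rightarrow> 'o \<Rightarrow> 'o \<Rightarrow> nat" where
  "hom_dim E X Y = vector_space.dim (Scale E) (Hom E X Y)"

definition hom_finite :: "('o, 'm::ab_group_add, 'k::field) exact_cat \<Rightarrow> bool" where
  "hom_finite E \<longleftrightarrow> (\<forall>X Y. \<exists>B. finite B \<and> module.span (Scale E) B = Hom E X Y)"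

definition is_iso ::
    "('o, 'm::ab_group_add, 'k::field) exact_cat \<Rightarrow> 'o \<Rightarrow> 'o \<Rightarrow> 'm \<Rightarrow> bool" where
  "is_iso E X Y f \<longleftrightarrow> f \<in> Hom E X Y \<and>
     (\<exists>g\<in>Hom E Y X. Comp E g f = Idm E X \<and> Comp E f g = Idm E Y)"

definition iso_obj ::
    "('o, 'm::ab_group_add, 'k::field) exact_cat \<Rightarrow> 'o \<Rightarrow> 'o \<Rightarrow> bool" where
  "iso_obj E X Y \<longleftrightarrow> (\<exists>f. is_iso E X Y f)"

definition is_zero :: "('o, 'm::ab_group_add, 'k::field) exact_cat \<Rightarrow> 'o \<Rightarrow> bool" where
  "is_zero E Z \<longleftrightarrow> (\<forall>X. Hom E X Z = {0} \<and> Hom E Z X = {0})"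

definition biproduct ::
    "('o, 'm::ab_group_add, 'k::field) exact_cat \<Rightarrow>
     'o \<Rightarrow> 'o \<Rightarrow> 'o \<Rightarrow> 'm \<Rightarrow> 'm \<Rightarrow> 'm \<Rightarrow> 'm \<Rightarrow> bool" where
  "biproduct E A B S i1 i2 p1 p2 \<longleftrightarrow>
     i1 \<in> Hom E A S \<and> i2 \<in> Hom E B S \<and> p1 \<in> Hom E S A \<and> p2 \<in> Hom E S B \<and>
     Comp E p1 i1 = Idm E A \<and> Comp E p2 i2 = Idm E B \<and>
     Comp E p2 i1 = 0 \<and> Comp E p1 i2 = 0 \<and>
     Comp E i1 p1 + Comp E i2 p2 = Idm E S"

definition direct_sum ::
    "('o, 'm::ab_group_add, 'k::field) exact_cat \<Rightarrow> 'o \<Rightarrow> 'o \<Rightarrow> 'o \<Rightarrow> bool" where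
  "direct_sum E A B S \<longleftrightarrow> (\<exists>i1 i2 p1 p2. biproduct E A B S i1 i2 p1 p2)"

definition indecomposable :: "('o, 'm::ab_group_add, 'k::field) exact_cat \<Rightarrow> 'o \<Rightarrow> bool" where
  "indecomposable E X \<longleftrightarrow> \<not> is_zero E X \<and>
     (\<forall>A B. direct_sum E A B X \<longrightarrow> is_zero E A \<or> is_zero E B)"

definition idempotent_complete :: "('o, 'm::ab_group_add, 'k::field) exact_cat \<Rightarrow> bool" where
  "idempotent_complete E \<longleftrightarrow> (\<forall>X. \<forall>e\<in>Hom E X X. Comp E e e = e \<longrightarrow>
     (\<exists>Y. \<exists>r\<in>Hom E X Y. \<exists>s\<in>Hom E Y X. Comp E s r = e \<and> Comp E r s = Idm E Y))"

locale additive_category = linear_category E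
  for E :: "('o, 'm::ab_group_add, 'k::field) exact_cat" +
  assumes ex_zero: "\<exists>Z. is_zero E Z"
    and ex_direct_sum: "\<exists>S. direct_sum E A B S"

definition is_kernel ::
    "('o, 'm::ab_group_add, 'k::field) exact_cat \<Rightarrow> 'o \<Rightarrow> 'o \<Rightarrow> 'o \<Rightarrow> 'm \<Rightarrow> 'm \<Rightarrow> bool" where
  "is_kernel E X F Y i p \<longleftrightarrow>
     i \<in> Hom E X F \<and> p \<in> Hom E F Y \<and> Comp E p i = 0 \<and>
     (\<forall>W. \<forall>f\<in>Hom E W F. Comp E p f = 0 \<longrightarrow> (\<exists>!g. g \<in> Hom E W X \<and> Comp E i g = f))"

definition is_cokernel ::
    "('o, 'm::ab_group_add, 'k::field) exact_cat \<Rightarrow> 'o \<Rightarrow> 'o \<Rightarrow> 'o \<Rightarrow> 'm \<Rightarrow> 'm \<Rightarrow> bool" where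
  "is_cokernel E X F Y i p \<longleftrightarrow>
     i \<in> Hom E X F \<and> p \<in> Hom E F Y \<and> Comp E p i = 0 \<and>
     (\<forall>W. \<forall>f\<in>Hom E F W. Comp E f i = 0 \<longrightarrow> (\<exists>!g. g \<in> Hom E Y W \<and> Comp E g p = f))"

text \<open>The square with sides \<open>f : X \<rightarrow> Y\<close>, \<open>g : X \<rightarrow> Z\<close>, \<open>g' : Y \<rightarrow> W\<close>, \<open>f' : Z \<rightarrow> W\<close>.\<close>

definition is_pushout ::
    "('o, 'm::ab_group_add, 'k::field) exact_cat \<Rightarrow>
     'o \<Rightarrow> 'o \<Rightarrow> 'o \<Rightarrow> 'o \<Rightarrow> 'm \<Rightarrow> 'm \<Rightarrow> 'm \<Rightarrow> 'm \<Rightarrow> bool" where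
  "is_pushout E X Y Z W f g g' f' \<longleftrightarrow>
     f \<in> Hom E X Y \<and> g \<in> Hom E X Z \<and> g' \<in> Hom E Y W \<and> f' \<in> Hom E Z W \<and>
     Comp E g' f = Comp E f' g \<and>
     (\<forall>V. \<forall>a\<in>Hom E Y V. \<forall>b\<in>Hom E Z V. Comp E a f = Comp E b g \<longrightarrow>
       (\<exists>!u. u \<in> Hom E W V \<and> Comp E u g' = a \<and> Comp E u f' = b))"

definition is_pullback ::
    "('o, 'm::ab_group_add, 'k::field) exact_cat \<Rightarrow>
     'o \<Rightarrow> 'o \<Rightarrow> 'o \<Rightarrow> 'o \<Rightarrow> 'm \<Rightarrow> 'm \<Rightarrow> 'm \<Rightarrow> 'm \<Rightarrow> bool" where
  "is_pullback E X Y Z W f g g' f' \<longleftrightarrow>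
     f \<in> Hom E X Y \<and> g \<in> Hom E X Z \<and> g' \<in> Hom E Y W \<and> f' \<in> Hom E Z W \<and>
     Comp E g' f = Comp E f' g \<and>
     (\<forall>V. \<forall>a\<in>Hom E V Y. \<forall>b\<in>Hom E V Z. Comp E g' a = Comp E f' b \<longrightarrow>
       (\<exists>!u. u \<in> Hom E V X \<and> Comp E f u = a \<and> Comp E g u = b))"

definition inflation ::
    "('o, 'm::ab_group_add, 'k::field) exact_cat \<Rightarrow> 'o \<Rightarrow> 'o \<Rightarrow> 'm \<Rightarrow> bool" where
  "inflation E X F i \<longleftrightarrow> (\<exists>p Y. (X, i, F, p, Y) \<in> Confl E)"

definition deflation ::
    "('o, 'm::ab_group_add, 'k::field) exact_cat \<Rightarrow> 'o \<Rightarrow> 'o \<Rightarrow> 'm \<Rightarrow> bool" where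
  "deflation E F Y p \<longleftrightarrow> (\<exists>X i. (X, i, F, p, Y) \<in> Confl E)"

locale exact_category = additive_category E
  for E :: "('o, 'm::ab_group_add, 'k::field) exact_cat" +
  assumes Confl_kernel: "(X, i, F, p, Y) \<in> Confl E \<Longrightarrow> is_kernel E X F Y i p"
    and Confl_cokernel: "(X, i, F, p, Y) \<in> Confl E \<Longrightarrow> is_cokernel E X F Y i p"
    and Confl_iso: "\<lbrakk>(X, i, F, p, Y) \<in> Confl E;
        is_iso E X X' a; is_iso E F F' b; is_iso E Y Y' c;
        i' \<in> Hom E X' F'; p' \<in> Hom E F' Y';
        Comp E b i = Comp E i' a; Comp E c p = Comp E p' b\<rbrakk>
        \<Longrightarrow> (X', i', F', p', Y') \<in> Confl E"
    and inflation_Idm: "inflation E X X (Idm E X)"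
    and deflation_Idm: "deflation E X X (Idm E X)"
    and inflation_Comp: "\<lbrakk>inflation E X Y i; inflation E Y Z j\<rbrakk>
        \<Longrightarrow> inflation E X Z (Comp E j i)"
    and deflation_Comp: "\<lbrakk>deflation E X Y p; deflation E Y Z q\<rbrakk>
        \<Longrightarrow> deflation E X Z (Comp E q p)"
    and inflation_pushout: "\<lbrakk>inflation E X Y i; f \<in> Hom E X Z\<rbrakk>
        \<Longrightarrow> \<exists>W f' i'. is_pushout E X Y Z W i f f' i' \<and> inflation E Z W i'"
    and deflation_pullback: "\<lbrakk>deflation E Y W p; f \<in> Hom E Z W\<rbrakk>
        \<Longrightarrow> \<exists>X f' p'. is_pullback E X Y Z W f' p' p f \<and> deflation E X Z p'"


section \<open>Frobenius categories and their stable categories\<close>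

definition projective :: "('o, 'm::ab_group_add, 'k::field) exact_cat \<Rightarrow> 'o \<Rightarrow> bool" where
  "projective E P \<longleftrightarrow> (\<forall>F Y p. deflation E F Y p \<longrightarrow>
     (\<forall>f\<in>Hom E P Y. \<exists>g\<in>Hom E P F. Comp E p g = f))"

definition injective :: "('o, 'm::ab_group_add, 'k::field) exact_cat \<Rightarrow> 'o \<Rightarrow> bool" where
  "injective E Q \<longleftrightarrow> (\<forall>X F i. inflation E X F i \<longrightarrow>
     (\<forall>f\<in>Hom E X Q. \<exists>g\<in>Hom E F Q. Comp E g i = f))"

definition frobenius :: "('o, 'm::ab_group_add, 'k::field) exact_cat \<Rightarrow> bool" where
  "frobenius E \<longleftrightarrow>
     (\<forall>X. \<exists>P p. projective E P \<and> deflation E P X p) \<and>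
     (\<forall>X. \<exists>Q i. injective E Q \<and> inflation E X Q i) \<and>
     (\<forall>X. projective E X \<longleftrightarrow> injective E X)"

definition proj_maps ::
    "('o, 'm::ab_group_add, 'k::field) exact_cat \<Rightarrow> 'o \<Rightarrow> 'o \<Rightarrow> 'm set" where
  "proj_maps E X Y =
     {Comp E g f | f g P. projective E P \<and> f \<in> Hom E X P \<and> g \<in> Hom E P Y}"

definition stable_class ::
    "('o, 'm::ab_group_add, 'k::field) exact_cat \<Rightarrow> 'o \<Rightarrow> 'o \<Rightarrow> 'm \<Rightarrow> 'm set" where
  "stable_class E X Y f = {g \<in> Hom E X Y. g - f \<in> proj_maps E X Y}"

definition stable_hom ::
    "('o, 'm::ab_group_add, 'k::field) exact_cat \<Rightarrow> 'o \<Rightarrow> 'o \<Rightarrow> 'm set set" where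
  "stable_hom E X Y = stable_class E X Y ` Hom E X Y"

definition stable_hom_finite :: "('o, 'm::ab_group_add, 'k::field) exact_cat \<Rightarrow> bool" where
  "stable_hom_finite E \<longleftrightarrow> (\<forall>X Y. \<exists>B. finite B \<and> B \<subseteq> Hom E X Y \<and>
     stable_hom E X Y = stable_class E X Y ` module.span (Scale E) B)"

definition stable_dual ::
    "('o, 'm::ab_group_add, 'k::field) exact_cat \<Rightarrow> 'o \<Rightarrow> 'o \<Rightarrow> ('m set \<Rightarrow> 'k) set" where
  "stable_dual E X Y = {l \<in> extensional (stable_hom E X Y).
     (\<forall>f\<in>Hom E X Y. \<forall>g\<in>Hom E X Y.
        l (stable_class E X Y (f + g)) = l (stable_class E X Y f) + l (stable_class E X Y g)) \<and>
     (\<forall>c. \<forall>f\<in>Hom E X Y. l (stable_class E X Y (Scale E c f)) = c * l (stable_class E X Y f))}"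

text \<open>
  A choice of suspension: for each \<open>X\<close> a conflation \<open>X \<rightarrow> Q X \<rightarrow> S X\<close> with \<open>Q X\<close> injective.
  In the stable category, the suspension of the class of \<open>f\<close> is the class of any \<open>g\<close> with
  \<open>suspends E Q S i p X Y f g\<close>.
\<close>

definition suspension ::
    "('o, 'm::ab_group_add, 'k::field) exact_cat \<Rightarrow>
     ('o \<Rightarrow> 'o) \<Rightarrow> ('o \<Rightarrow> 'o) \<Rightarrow> ('o \<Rightarrow> 'm) \<Rightarrow> ('o \<Rightarrow> 'm) \<Rightarrow> bool" where
  "suspension E Q S i p \<longleftrightarrow> (\<forall>X. injective E (Q X) \<and> (X, i X, Q X, p X, S X) \<in> Confl E)"

definition suspends ::
    "('o, 'm::ab_group_add, 'k::field) exact_cat \<Rightarrow>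
     ('o \<Rightarrow> 'o) \<Rightarrow> ('o \<Rightarrow> 'o) \<Rightarrow> ('o \<Rightarrow> 'm) \<Rightarrow> ('o \<Rightarrow> 'm) \<Rightarrow> 'o \<Rightarrow> 'o \<Rightarrow> 'm \<Rightarrow> 'm \<Rightarrow> bool" where
  "suspends E Q S i p X Y f g \<longleftrightarrow>
     f \<in> Hom E X Y \<and> g \<in> Hom E (S X) (S Y) \<and>
     (\<exists>h\<in>Hom E (Q X) (Q Y). Comp E h (i X) = Comp E (i Y) f \<and> Comp E g (p X) = Comp E (p Y) h)"

text \<open>
  The stable category is 2-Calabi--Yau: there are \<open>k\<close>-linear bijections \<open>D X Y\<close> from
  \<open>stable_hom E X Y\<close> to the dual of \<open>stable_hom E Y (S (S X))\<close>, natural in \<open>Y\<close> and in \<open>X\<close>.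
\<close>

definition stable_two_calabi_yau :: "('o, 'm::ab_group_add, 'k::field) exact_cat \<Rightarrow> bool" where
  "stable_two_calabi_yau E \<longleftrightarrow> (\<exists>Q S i p. \<exists>D :: 'o \<Rightarrow> 'o \<Rightarrow> 'm set \<Rightarrow> 'm set \<Rightarrow> 'k.
     suspension E Q S i p \<and>
     (\<forall>X Y. bij_betw (D X Y) (stable_hom E X Y) (stable_dual E Y (S (S X)))) \<and>
     (\<forall>X Y. \<forall>f\<in>Hom E X Y. \<forall>g\<in>Hom E X Y. \<forall>h\<in>Hom E Y (S (S X)).
        D X Y (stable_class E X Y (f + g)) (stable_class E Y (S (S X)) h) =
        D X Y (stable_class E X Y f) (stable_class E Y (S (S X)) h) +
        D X Y (stable_class E X Y g) (stable_class E Y (S (S X)) h)) \<and>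
     (\<forall>X Y c. \<forall>f\<in>Hom E X Y. \<forall>h\<in>Hom E Y (S (S X)).
        D X Y (stable_class E X Y (Scale E c f)) (stable_class E Y (S (S X)) h) =
        c * D X Y (stable_class E X Y f) (stable_class E Y (S (S X)) h)) \<and>
     (\<forall>X Y Y'. \<forall>f\<in>Hom E X Y. \<forall>b\<in>Hom E Y Y'. \<forall>h\<in>Hom E Y' (S (S X)).
        D X Y' (stable_class E X Y' (Comp E b f)) (stable_class E Y' (S (S X)) h) =
        D X Y (stable_class E X Y f) (stable_class E Y (S (S X)) (Comp E h b))) \<and>
     (\<forall>X X' Y a a' a''. \<forall>f\<in>Hom E X Y. \<forall>h\<in>Hom E Y (S (S X')).
        suspends E Q S i p X' X a a' \<and> suspends E Q S i p (S X') (S X) a' a'' \<longrightarrow>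
        D X' Y (stable_class E X' Y (Comp E f a)) (stable_class E Y (S (S X')) h) =
        D X Y (stable_class E X Y f) (stable_class E Y (S (S X)) (Comp E a'' h))))"


section \<open>Yoneda extensions\<close>

text \<open>\<open>(i, F, p) \<in> extensions E T X\<close> stands for the conflation \<open>X \<rightarrow> F \<rightarrow> T\<close>.\<close>

definition extensions ::
    "('o, 'm::ab_group_add, 'k::field) exact_cat \<Rightarrow> 'o \<Rightarrow> 'o \<Rightarrow> ('m \<times> 'o \<times> 'm) set" where
  "extensions E T X = {(i, F, p). (X, i, F, p, T) \<in> Confl E}"

definition ext_equiv ::
    "('o, 'm::ab_group_add, 'k::field) exact_cat \<Rightarrow> 'o \<Rightarrow> 'o \<Rightarrow>
     (('m \<times> 'o \<times> 'm) \<times> ('m \<times> 'o \<times> 'm)) set" where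
  "ext_equiv E T X = {((i, F, p), (i', F', p')).
     (i, F, p) \<in> extensions E T X \<and> (i', F', p') \<in> extensions E T X \<and>
     (\<exists>h. is_iso E F F' h \<and> Comp E h i = i' \<and> Comp E p' h = p)}"

definition Ext1 ::
    "('o, 'm::ab_group_add, 'k::field) exact_cat \<Rightarrow> 'o \<Rightarrow> 'o \<Rightarrow> ('m \<times> 'o \<times> 'm) set set" where
  "Ext1 E T X = extensions E T X // ext_equiv E T X"

definition split_ext ::
    "('o, 'm::ab_group_add, 'k::field) exact_cat \<Rightarrow> 'o \<Rightarrow> ('m \<times> 'o \<times> 'm) \<Rightarrow> bool" where
  "split_ext E T = (\<lambda>(i, F, p). \<exists>s\<in>Hom E T F. Comp E p s = Idm E T)"

definition ext_zero ::
    "('o, 'm::ab_group_add, 'k::field) exact_cat \<Rightarrow> 'o \<Rightarrow> 'o \<Rightarrow> ('m \<times> 'o \<times> 'm) set" where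
  "ext_zero E T X = {x \<in> extensions E T X. split_ext E T x}"

text \<open>
  Pullback of a class of extensions of \<open>T\<close> by \<open>X\<close> along \<open>f : T' \<rightarrow> T\<close>, and pushout along
  \<open>a : X \<rightarrow> X'\<close>. A morphism of conflations which is the identity on one end term exhibits the
  pullback, respectively pushout, so the sets below are again equivalence classes.
\<close>

definition ext_pull ::
    "('o, 'm::ab_group_add, 'k::field) exact_cat \<Rightarrow> 'o \<Rightarrow> 'o \<Rightarrow> 'm \<Rightarrow>
     ('m \<times> 'o \<times> 'm) set \<Rightarrow> ('m \<times> 'o \<times> 'm) set" where
  "ext_pull E T' X f c = {(i', F', p') \<in> extensions E T' X.
     \<exists>(i, F, p)\<in>c. \<exists>g\<in>Hom E F' F. Comp E g i' = i \<and> Comp E p g = Comp E f p'}"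

definition ext_push ::
    "('o, 'm::ab_group_add, 'k::field) exact_cat \<Rightarrow> 'o \<Rightarrow> 'o \<Rightarrow> 'm \<Rightarrow>
     ('m \<times> 'o \<times> 'm) set \<Rightarrow> ('m \<times> 'o \<times> 'm) set" where
  "ext_push E T X' a c = {(i', F', p') \<in> extensions E T X'.
     \<exists>(i, F, p)\<in>c. \<exists>g\<in>Hom E F F'. Comp E g i = Comp E i' a \<and> Comp E p' g = p}"

text \<open>
  The Baer sum: form the direct sum of two extensions, pull back along the diagonal
  \<open>T \<rightarrow> T \<oplus> T\<close> and push out along the codiagonal \<open>X \<oplus> X \<rightarrow> X\<close>. Here \<open>u1, u2, v1, v2\<close> are
  the injections and projections of \<open>X \<oplus> X\<close>, \<open>j1, j2, q1, q2\<close> those of \<open>F1 \<oplus> F2\<close>, and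
  \<open>s1, s2, t1, t2\<close> those of \<open>T \<oplus> T\<close>.
\<close>

definition ext_add ::
    "('o, 'm::ab_group_add, 'k::field) exact_cat \<Rightarrow> 'o \<Rightarrow> 'o \<Rightarrow>
     ('m \<times> 'o \<times> 'm) set \<Rightarrow> ('m \<times> 'o \<times> 'm) set \<Rightarrow> ('m \<times> 'o \<times> 'm) set" where
  "ext_add E T X c d = {x. \<exists>(i1, F1, p1)\<in>c. \<exists>(i2, F2, p2)\<in>d.
     \<exists>XX u1 u2 v1 v2 FF j1 j2 q1 q2 TT s1 s2 t1 t2.
       biproduct E X X XX u1 u2 v1 v2 \<and>
       biproduct E F1 F2 FF j1 j2 q1 q2 \<and>
       biproduct E T T TT s1 s2 t1 t2 \<and>
       x \<in> ext_push E T X (v1 + v2) (ext_pull E T XX (s1 + s2)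
         {(Comp E j1 (Comp E i1 v1) + Comp E j2 (Comp E i2 v2), FF,
           Comp E s1 (Comp E p1 q1) + Comp E s2 (Comp E p2 q2))})}"

definition ext_scale ::
    "('o, 'm::ab_group_add, 'k::field) exact_cat \<Rightarrow> 'o \<Rightarrow> 'o \<Rightarrow> 'k \<Rightarrow>
     ('m \<times> 'o \<times> 'm) set \<Rightarrow> ('m \<times> 'o \<times> 'm) set" where
  "ext_scale E T X k c = ext_push E T X (Scale E k (Idm E X)) c"


section \<open>Cluster-tilting subcategories and mutation\<close>

text \<open>A full subcategory is given by its set of objects.\<close>

definition right_approx ::
    "('o, 'm::ab_group_add, 'k::field) exact_cat \<Rightarrow> 'o set \<Rightarrow> 'o \<Rightarrow> 'o \<Rightarrow> 'm \<Rightarrow> bool" where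
  "right_approx E \<T> R X p \<longleftrightarrow> R \<in> \<T> \<and> p \<in> Hom E R X \<and>
     (\<forall>T\<in>\<T>. \<forall>f\<in>Hom E T X. \<exists>g\<in>Hom E T R. Comp E p g = f)"

definition left_approx ::
    "('o, 'm::ab_group_add, 'k::field) exact_cat \<Rightarrow> 'o set \<Rightarrow> 'o \<Rightarrow> 'o \<Rightarrow> 'm \<Rightarrow> bool" where
  "left_approx E \<T> X L i \<longleftrightarrow> L \<in> \<T> \<and> i \<in> Hom E X L \<and>
     (\<forall>T\<in>\<T>. \<forall>f\<in>Hom E X T. \<exists>g\<in>Hom E L T. Comp E g i = f)"

definition cluster_tilting ::
    "('o, 'm::ab_group_add, 'k::field) exact_cat \<Rightarrow> 'o set \<Rightarrow> bool" where
  "cluster_tilting E \<T> \<longleftrightarrow>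
     \<T> = {X. \<forall>T\<in>\<T>. Ext1 E T X = {ext_zero E T X}} \<and>
     \<T> = {X. \<forall>T\<in>\<T>. Ext1 E X T = {ext_zero E X T}} \<and>
     (\<forall>X. \<exists>L i. left_approx E \<T> X L i \<and> inflation E X L i) \<and>
     (\<forall>X. \<exists>R p. right_approx E \<T> R X p \<and> deflation E R X p)"

definition exact_cluster_category :: "('o, 'm::ab_group_add, 'k::field) exact_cat \<Rightarrow> bool" where
  "exact_cluster_category E \<longleftrightarrow>
     exact_category E \<and> idempotent_complete E \<and> frobenius E \<and>
     (\<exists>\<T>. cluster_tilting E \<T>) \<and> stable_hom_finite E \<and> stable_two_calabi_yau E"

inductive_set add_closure ::
    "('o, 'm::ab_group_add, 'k::field) exact_cat \<Rightarrow> 'o set \<Rightarrow> 'o set"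
  for E :: "('o, 'm::ab_group_add, 'k::field) exact_cat" and \<S> :: "'o set" where
  base: "X \<in> \<S> \<Longrightarrow> X \<in> add_closure E \<S>"
| zero: "is_zero E Z \<Longrightarrow> Z \<in> add_closure E \<S>"
| sum: "\<lbrakk>A \<in> add_closure E \<S>; B \<in> add_closure E \<S>; direct_sum E A B S\<rbrakk> \<Longrightarrow> S \<in> add_closure E \<S>"
| summand: "\<lbrakk>S \<in> add_closure E \<S>; direct_sum E A B S\<rbrakk> \<Longrightarrow> A \<in> add_closure E \<S>"

definition remove_indec ::
    "('o, 'm::ab_group_add, 'k::field) exact_cat \<Rightarrow> 'o set \<Rightarrow> 'o \<Rightarrow> 'o set" where
  "remove_indec E \<T> T = add_closure E {S \<in> \<T>. indecomposable E S \<and> \<not> iso_obj E S T}"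

definition mutable_in ::
    "('o, 'm::ab_group_add, 'k::field) exact_cat \<Rightarrow> 'o set \<Rightarrow> 'o \<Rightarrow> bool" where
  "mutable_in E \<T> T \<longleftrightarrow> T \<in> \<T> \<and> indecomposable E T \<and>
     (\<exists>T'. indecomposable E T' \<and> \<not> iso_obj E T' T \<and>
        cluster_tilting E (add_closure E (remove_indec E \<T> T \<union> {T'})) \<and>
        (\<exists>i B p. (T', i, B, p, T) \<in> Confl E \<and> \<not> split_ext E T (i, B, p) \<and>
           right_approx E (remove_indec E \<T> T) B T p) \<and>
        (\<exists>i C p. (T, i, C, p, T') \<in> Confl E \<and> \<not> split_ext E T' (i, C, p) \<and>
           left_approx E (remove_indec E \<T> T) T C i))"

definition maximally_mutable ::
    "('o, 'm::ab_group_add, 'k::field) exact_cat \<Rightarrow> 'o set \<Rightarrow> bool" where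
  "maximally_mutable E \<T> \<longleftrightarrow>
     (\<forall>T\<in>\<T>. indecomposable E T \<and> \<not> projective E T \<longrightarrow> mutable_in E \<T> T)"

text \<open>
  This is used for Krull--Schmidt categories; a Hom-finite idempotent complete category is
  automatically Krull--Schmidt.
\<close>

definition weak_cluster_structure :: "('o, 'm::ab_group_add, 'k::field) exact_cat \<Rightarrow> bool" where
  "weak_cluster_structure E \<longleftrightarrow> (\<forall>\<T>. cluster_tilting E \<T> \<longrightarrow> maximally_mutable E \<T>)"


section \<open>Grothendieck groups, index and coindex\<close>

text \<open>Grothendieck groups are groups in the sense of HOL-Algebra, so they are written
  multiplicatively.\<close>

definition grothendieck_group :: "'a set \<Rightarrow> ('a \<Rightarrow>\<^sub>0 int) set \<Rightarrow> ('a \<Rightarrow>\<^sub>0 int) set monoid" where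
  "grothendieck_group A R = free_Abelian_group A Mod generate (free_Abelian_group A) R"

definition grothendieck_class ::
    "'a set \<Rightarrow> ('a \<Rightarrow>\<^sub>0 int) set \<Rightarrow> 'a \<Rightarrow> ('a \<Rightarrow>\<^sub>0 int) set" where
  "grothendieck_class A R x =
     generate (free_Abelian_group A) R #>\<^bsub>free_Abelian_group A\<^esub> frag_of x"

definition split_relations ::
    "('o, 'm::ab_group_add, 'k::field) exact_cat \<Rightarrow> 'o set \<Rightarrow> ('o \<Rightarrow>\<^sub>0 int) set" where
  "split_relations E \<T> = {frag_of S - frag_of A - frag_of B | A B S.
     A \<in> \<T> \<and> B \<in> \<T> \<and> S \<in> \<T> \<and> direct_sum E A B S}"

definition K0 ::
    "('o, 'm::ab_group_add, 'k::field) exact_cat \<Rightarrow> 'o set \<Rightarrow> ('o \<Rightarrow>\<^sub>0 int) set monoid" where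
  "K0 E \<T> = grothendieck_group \<T> (split_relations E \<T>)"

definition K0_class ::
    "('o, 'm::ab_group_add, 'k::field) exact_cat \<Rightarrow> 'o set \<Rightarrow> 'o \<Rightarrow> ('o \<Rightarrow>\<^sub>0 int) set" where
  "K0_class E \<T> T = grothendieck_class \<T> (split_relations E \<T>) T"

definition ind ::
    "('o, 'm::ab_group_add, 'k::field) exact_cat \<Rightarrow> 'o set \<Rightarrow> 'o \<Rightarrow> ('o \<Rightarrow>\<^sub>0 int) set" where
  "ind E \<T> X = (SOME u. \<exists>K\<in>\<T>. \<exists>R\<in>\<T>. \<exists>i p. (K, i, R, p, X) \<in> Confl E \<and>
     u = K0_class E \<T> R \<otimes>\<^bsub>K0 E \<T>\<^esub> inv\<^bsub>K0 E \<T>\<^esub> K0_class E \<T> K)"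

definition coind ::
    "('o, 'm::ab_group_add, 'k::field) exact_cat \<Rightarrow> 'o set \<Rightarrow> 'o \<Rightarrow> ('o \<Rightarrow>\<^sub>0 int) set" where
  "coind E \<T> X = (SOME u. \<exists>L\<in>\<T>. \<exists>C\<in>\<T>. \<exists>i p. (X, i, L, p, C) \<in> Confl E \<and>
     u = K0_class E \<T> L \<otimes>\<^bsub>K0 E \<T>\<^esub> inv\<^bsub>K0 E \<T>\<^esub> K0_class E \<T> C)"

text \<open>
  Here and below, \<open>SOME\<close> selects a homomorphism (or bilinear form) prescribed on generators; it
  is unique on the carrier, and its values elsewhere are irrelevant.
\<close>

definition ind_hom ::
    "('o, 'm::ab_group_add, 'k::field) exact_cat \<Rightarrow> 'o set \<Rightarrow> 'o set \<Rightarrow>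
     ('o \<Rightarrow>\<^sub>0 int) set \<Rightarrow> ('o \<Rightarrow>\<^sub>0 int) set" where
  "ind_hom E \<U> \<T> = (SOME h. h \<in> hom (K0 E \<U>) (K0 E \<T>) \<and>
     (\<forall>U\<in>\<U>. h (K0_class E \<U> U) = ind E \<T> U))"


section \<open>Modules over a cluster-tilting subcategory\<close>

text \<open>
  Since only modules with finite-dimensional values are needed, and only up to isomorphism, the
  values are taken to be subspaces of the vector space \<open>'k poly\<close> of countable dimension.
  For \<open>f : S \<rightarrow> T\<close>, \<open>Act M S T f\<close> is the induced map \<open>Val M T \<rightarrow> Val M S\<close>.
\<close>

record ('o, 'm, 'v) cat_module =
  Val :: "'o \<Rightarrow> 'v set"
  Act :: "'o \<Rightarrow> 'o \<Rightarrow> 'm \<Rightarrow> 'v \<Rightarrow> 'v"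

definition is_module ::
    "('o, 'm::ab_group_add, 'k::field) exact_cat \<Rightarrow> 'o set \<Rightarrow>
     ('o, 'm, 'k poly) cat_module \<Rightarrow> bool" where
  "is_module E \<T> M \<longleftrightarrow>
     (\<forall>T\<in>\<T>. module.subspace smult (Val M T)) \<and>
     (\<forall>S\<in>\<T>. \<forall>T\<in>\<T>. \<forall>f\<in>Hom E S T. \<forall>v\<in>Val M T. Act M S T f v \<in> Val M S) \<and>
     (\<forall>S\<in>\<T>. \<forall>T\<in>\<T>. \<forall>f\<in>Hom E S T. \<forall>v\<in>Val M T. \<forall>w\<in>Val M T.
        Act M S T f (v + w) = Act M S T f v + Act M S T f w) \<and>
     (\<forall>S\<in>\<T>. \<forall>T\<in>\<T>. \<forall>f\<in>Hom E S T. \<forall>v\<in>Val M T. \<forall>c.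
        Act M S T f (smult c v) = smult c (Act M S T f v)) \<and>
     (\<forall>S\<in>\<T>. \<forall>T\<in>\<T>. \<forall>f\<in>Hom E S T. \<forall>g\<in>Hom E S T. \<forall>v\<in>Val M T.
        Act M S T (f + g) v = Act M S T f v + Act M S T g v) \<and>
     (\<forall>S\<in>\<T>. \<forall>T\<in>\<T>. \<forall>f\<in>Hom E S T. \<forall>c. \<forall>v\<in>Val M T.
        Act M S T (Scale E c f) v = smult c (Act M S T f v)) \<and>
     (\<forall>T\<in>\<T>. \<forall>v\<in>Val M T. Act M T T (Idm E T) v = v) \<and>
     (\<forall>R\<in>\<T>. \<forall>S\<in>\<T>. \<forall>T\<in>\<T>. \<forall>f\<in>Hom E R S. \<forall>g\<in>Hom E S T. \<forall>v\<in>Val M T.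
        Act M R T (Comp E g f) v = Act M R S f (Act M S T g v))"

definition fd_stable_modules ::
    "('o, 'm::ab_group_add, 'k::field) exact_cat \<Rightarrow> 'o set \<Rightarrow>
     ('o, 'm, 'k poly) cat_module set" where
  "fd_stable_modules E \<T> = {M. is_module E \<T> M \<and>
     (\<forall>P\<in>\<T>. projective E P \<longrightarrow> Val M P = {0}) \<and>
     (\<forall>T\<in>\<T>. \<exists>B. finite B \<and> module.span smult B = Val M T) \<and>
     (\<exists>\<F>. finite \<F> \<and>
        (\<forall>T\<in>\<T>. indecomposable E T \<and> Val M T \<noteq> {0} \<longrightarrow> (\<exists>S\<in>\<F>. iso_obj E T S)))}"

definition module_hom ::
    "('o, 'm::ab_group_add, 'k::field) exact_cat \<Rightarrow> 'o set \<Rightarrow>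
     ('o, 'm, 'k poly) cat_module \<Rightarrow> ('o, 'm, 'k poly) cat_module \<Rightarrow>
     ('o \<Rightarrow> 'k poly \<Rightarrow> 'k poly) \<Rightarrow> bool" where
  "module_hom E \<T> M N \<alpha> \<longleftrightarrow>
     (\<forall>T\<in>\<T>. \<forall>v\<in>Val M T. \<alpha> T v \<in> Val N T) \<and>
     (\<forall>T\<in>\<T>. \<forall>v\<in>Val M T. \<forall>w\<in>Val M T. \<alpha> T (v + w) = \<alpha> T v + \<alpha> T w) \<and>
     (\<forall>T\<in>\<T>. \<forall>c. \<forall>v\<in>Val M T. \<alpha> T (smult c v) = smult c (\<alpha> T v)) \<and>
     (\<forall>S\<in>\<T>. \<forall>T\<in>\<T>. \<forall>f\<in>Hom E S T. \<forall>v\<in>Val M T.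
        \<alpha> S (Act M S T f v) = Act N S T f (\<alpha> T v))"

definition module_short_exact ::
    "('o, 'm::ab_group_add, 'k::field) exact_cat \<Rightarrow> 'o set \<Rightarrow>
     ('o, 'm, 'k poly) cat_module \<Rightarrow> ('o, 'm, 'k poly) cat_module \<Rightarrow>
     ('o, 'm, 'k poly) cat_module \<Rightarrow> bool" where
  "module_short_exact E \<T> L M N \<longleftrightarrow> (\<exists>\<alpha> \<gamma>. module_hom E \<T> L M \<alpha> \<and> module_hom E \<T> M N \<gamma> \<and>
     (\<forall>T\<in>\<T>. inj_on (\<alpha> T) (Val L T) \<and> \<gamma> T ` Val M T = Val N T \<and>
        \<alpha> T ` Val L T = {v \<in> Val M T. \<gamma> T v = 0}))"

definition fd_relations ::
    "('o, 'm::ab_group_add, 'k::field) exact_cat \<Rightarrow> 'o set \<Rightarrow>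
     (('o, 'm, 'k poly) cat_module \<Rightarrow>\<^sub>0 int) set" where
  "fd_relations E \<T> = {frag_of M - frag_of L - frag_of N | L M N.
     L \<in> fd_stable_modules E \<T> \<and> M \<in> fd_stable_modules E \<T> \<and> N \<in> fd_stable_modules E \<T> \<and>
     module_short_exact E \<T> L M N}"

definition K0_fd ::
    "('o, 'm::ab_group_add, 'k::field) exact_cat \<Rightarrow> 'o set \<Rightarrow>
     (('o, 'm, 'k poly) cat_module \<Rightarrow>\<^sub>0 int) set monoid" where
  "K0_fd E \<T> = grothendieck_group (fd_stable_modules E \<T>) (fd_relations E \<T>)"

definition K0_fd_class ::
    "('o, 'm::ab_group_add, 'k::field) exact_cat \<Rightarrow> 'o set \<Rightarrow>
     ('o, 'm, 'k poly) cat_module \<Rightarrow> (('o, 'm, 'k poly) cat_module \<Rightarrow>\<^sub>0 int) set" where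
  "K0_fd_class E \<T> M = grothendieck_class (fd_stable_modules E \<T>) (fd_relations E \<T>) M"

text \<open>\<open>M\<close> is isomorphic, as a module over \<open>\<T>\<close>, to the restriction to \<open>\<T>\<close> of the functor
  \<open>Ext1 E _ X\<close>.\<close>

definition iso_Ext_module ::
    "('o, 'm::ab_group_add, 'k::field) exact_cat \<Rightarrow> 'o set \<Rightarrow>
     ('o, 'm, 'k poly) cat_module \<Rightarrow> 'o \<Rightarrow> bool" where
  "iso_Ext_module E \<T> M X \<longleftrightarrow> (\<exists>\<phi> :: 'o \<Rightarrow> 'k poly \<Rightarrow> ('m \<times> 'o \<times> 'm) set.
     (\<forall>T\<in>\<T>. bij_betw (\<phi> T) (Val M T) (Ext1 E T X)) \<and>
     (\<forall>T\<in>\<T>. \<forall>v\<in>Val M T. \<forall>w\<in>Val M T. \<phi> T (v + w) = ext_add E T X (\<phi> T v) (\<phi> T w)) \<and>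
     (\<forall>T\<in>\<T>. \<forall>c. \<forall>v\<in>Val M T. \<phi> T (smult c v) = ext_scale E T X c (\<phi> T v)) \<and>
     (\<forall>S\<in>\<T>. \<forall>T\<in>\<T>. \<forall>f\<in>Hom E S T. \<forall>v\<in>Val M T.
        \<phi> S (Act M S T f v) = ext_pull E S X f (\<phi> T v)))"

definition beta ::
    "('o, 'm::ab_group_add, 'k::field) exact_cat \<Rightarrow> 'o set \<Rightarrow>
     (('o, 'm, 'k poly) cat_module \<Rightarrow>\<^sub>0 int) set \<Rightarrow> ('o \<Rightarrow>\<^sub>0 int) set" where
  "beta E \<T> = (SOME b. b \<in> hom (K0_fd E \<T>) (K0 E \<T>) \<and>
     (\<forall>M\<in>fd_stable_modules E \<T>. \<forall>X. iso_Ext_module E \<T> M X \<longrightarrow>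
        b (K0_fd_class E \<T> M) = coind E \<T> X \<otimes>\<^bsub>K0 E \<T>\<^esub> inv\<^bsub>K0 E \<T>\<^esub> ind E \<T> X))"


section \<open>Quantum structures\<close>

definition bilinear_form :: "('a, 'b) monoid_scheme \<Rightarrow> ('a \<Rightarrow> 'a \<Rightarrow> int) \<Rightarrow> bool" where
  "bilinear_form G q \<longleftrightarrow>
     (\<forall>u\<in>carrier G. (\<lambda>v. q u v) \<in> hom G integer_group) \<and>
     (\<forall>v\<in>carrier G. (\<lambda>u. q u v) \<in> hom G integer_group)"

definition quantum_datum ::
    "('o, 'm::ab_group_add, 'k::field) exact_cat \<Rightarrow> 'o set \<Rightarrow>
     (('o \<Rightarrow>\<^sub>0 int) set \<Rightarrow> ('o \<Rightarrow>\<^sub>0 int) set \<Rightarrow> int) \<Rightarrow> bool" where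
  "quantum_datum E \<T> q \<longleftrightarrow>
     bilinear_form (K0 E \<T>) q \<and>
     (\<forall>u\<in>carrier (K0 E \<T>). \<forall>v\<in>carrier (K0 E \<T>). q u v = - q v u) \<and>
     (\<forall>M\<in>fd_stable_modules E \<T>. \<forall>T\<in>\<T>.
        q (beta E \<T> (K0_fd_class E \<T> M)) (K0_class E \<T> T) =
        2 * int (vector_space.dim smult (Val M T)))"

definition quantum_structure ::
    "('o, 'm::ab_group_add, 'k::field) exact_cat \<Rightarrow>
     ('o set \<Rightarrow> ('o \<Rightarrow>\<^sub>0 int) set \<Rightarrow> ('o \<Rightarrow>\<^sub>0 int) set \<Rightarrow> int) \<Rightarrow> bool" where
  "quantum_structure E q \<longleftrightarrow>
     (\<forall>\<T>. cluster_tilting E \<T> \<longrightarrow> quantum_datum E \<T> (q \<T>)) \<and>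
     (\<forall>\<T> \<U>. cluster_tilting E \<T> \<and> cluster_tilting E \<U> \<longrightarrow>
        (\<forall>u\<in>carrier (K0 E \<U>). \<forall>v\<in>carrier (K0 E \<U>).
           q \<T> (ind_hom E \<U> \<T> u) (ind_hom E \<U> \<T> v) = q \<U> u v))"

definition hom_form ::
    "('o, 'm::ab_group_add, 'k::field) exact_cat \<Rightarrow> 'o set \<Rightarrow>
     ('o \<Rightarrow>\<^sub>0 int) set \<Rightarrow> ('o \<Rightarrow>\<^sub>0 int) set \<Rightarrow> int" where
  "hom_form E \<T> = (SOME q. bilinear_form (K0 E \<T>) q \<and>
     (\<forall>T1\<in>\<T>. \<forall>T2\<in>\<T>. q (K0_class E \<T> T1) (K0_class E \<T> T2) =
        int (hom_dim E T1 T2) - int (hom_dim E T2 T1)))"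

end

theory Submission
  imports Defs
begin

text \<open>
  Let \<open>K \<rightarrow> R \<rightarrow> X\<close> and \<open>X \<rightarrow> L \<rightarrow> C\<close> be conflations with \<open>K, R, L, C\<close> in \<open>\<T>\<close>. Exactness of
  \<open>Hom(T, _)\<close> and \<open>Hom(_, T)\<close> on them shows that the form, evaluated at \<open>coind X - ind X\<close> and
  \<open>T\<close>, is \<open>dim Ext\<^sup>1(X, T) + dim Ext\<^sup>1(T, X)\<close>, and the two summands agree by the Calabi--Yau
  property. Invariance is the identity \<open>hom(ind U, ind V) = hom(U, V)\<close>, a consequence of the
  rigidity of \<open>\<T>\<close> and \<open>\<U>\<close>.

  What remains is the existence of \<open>\<beta>\<close>. Splicing the two conflations gives a resolution of length
  three of \<open>Ext\<^sup>1(_, X)\<close> by representable functors on \<open>\<T>\<close>; so \<open>coind X - ind X\<close> is minus the Euler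
  characteristic of this module, which is additive by the horseshoe and Schanuel lemmas. Every
  module in \<open>fd\<close> is finitely presented, by devissage along the sink maps supplied by mutation, and a
  presentation \<open>L \<rightarrow> C\<close> can be chosen to be a deflation, whose kernel \<open>X\<close> satisfies
  \<open>M \<cong> Ext\<^sup>1(_, X)\<close>.
\<close>

section \<open>Linear maps defined on a subspace\<close>

text \<open>Of the sets built from morphisms only \<open>Hom\<close> carries a dimension:
  \<open>Ext1\<close> is a set of Yoneda classes and a stable morphism space is a set of cosets.
  Dimensions of extension spaces are therefore replaced by alternating sums of dimensions of
  \<open>Hom\<close>, and one such sum is turned into another by counting morphisms of conflations
  (\<open>balance\<close>). In this way the Calabi--Yau duality enters as a numerical symmetry. The
  index, the coindex, \<open>ind_hom\<close>, \<open>hom_form\<close> and \<open>beta\<close> are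
  defined by a choice, so a witness must be produced before anything can be said about them. For
  \<open>beta\<close> this takes independence of \<open>X\<close>, additivity on short exact
  sequences, and an \<open>X\<close> for every module, without which the prescribed values would not
  constrain \<open>beta\<close> on that module. Resolutions are not complexes of modules but chains
  of maps in \<open>\<T>\<close>; a module enters only through the annihilator of a generator. This
  is why each module is first shown to have one generator at one object. Fitting's lemma makes
  endomorphism rings of indecomposables local, which serves both to build sink maps and as a
  Nakayama argument in the devissage.\<close>

lemma (in vector_space) subspace_finite_basis:
  assumes "finite B" "span B = V"
  obtains b where "finite b" "b \<subseteq> V" "independent b" "span b = V" "card b = dim V"
proof -
  obtain b where b: "b \<subseteq> V" "independent b" "V \<subseteq> span b" "card b = dim V"
    using basis_exists by blast
  have "finite b"
    using independent_span_bound[OF assms(1) b(2)] b(1) assms(2) by auto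
  moreover have "span b = V"
    using b(1,3) assms(2) by (metis span_mono span_span subset_antisym)
  ultimately show ?thesis using b that by blast
qed

lemma (in vector_space) finite_span_subspace:
  assumes "finite B" "span B = V" "subspace W" "W \<subseteq> V"
  obtains b where "finite b" "b \<subseteq> W" "independent b" "span b = W" "card b = dim W"
proof -
  obtain b where b: "b \<subseteq> W" "independent b" "W \<subseteq> span b" "card b = dim W"
    using basis_exists by blast
  have "finite b"
    using independent_span_bound[OF assms(1) b(2)] b(1) assms by auto
  moreover have "span b = W"
    using b(1,3) assms(3) by (meson span_minimal subset_antisym)
  ultimately show ?thesis using b that by blast
qed

lemma (in vector_space) finite_span_extend:
  assumes "finite B" "span B = V" "independent b" "b \<subseteq> V"
  obtains b' where "finite b'" "b \<subseteq> b'" "b' \<subseteq> V" "independent b'" "span b' = V" "card b' = dim V"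
proof -
  obtain b' where b: "b \<subseteq> b'" "b' \<subseteq> V" "independent b'" "V \<subseteq> span b'"
    using maximal_independent_subset_extend[OF assms(4,3)] by blast
  have "finite b'"
    using independent_span_bound[OF assms(1) b(3)] b(2) assms(2) by auto
  moreover have "span b' = V"
    using b assms(2) by (metis span_mono span_span subset_antisym)
  moreover have "card b' = dim V"
    using b(2,3,4) by (metis dim_unique)
  ultimately show ?thesis using b that by blast
qed

text \<open>The ambient space need not be finite-dimensional, so the comparison runs inside
  \<open>V\<close>: a basis of \<open>U\<close> is extended to one of \<open>W\<close>, and equal
  cardinalities make the two bases coincide. The second clause later converts maximal or stationary
  dimensions into equalities of subspaces.\<close>

lemma (in vector_space) dim_mono_finite:
  assumes "finite B" "span B = V" "subspace U" "subspace W" "U \<subseteq> W" "W \<subseteq> V"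
  shows "dim U \<le> dim W" and "dim U = dim W \<Longrightarrow> U = W"
proof -
  obtain w where w: "finite w" "w \<subseteq> W" "independent w" "span w = W" "card w = dim W"
    using finite_span_subspace[OF assms(1,2,4,6)] .
  obtain u where u: "finite u" "u \<subseteq> U" "independent u" "span u = U" "card u = dim U"
    using finite_span_subspace[OF w(1,4) assms(3,5)] .
  obtain u' where u': "finite u'" "u \<subseteq> u'" "u' \<subseteq> W" "independent u'" "span u' = W" "card u' = dim W"
    using finite_span_extend[OF w(1,4) u(3)] u(2) assms(5) by blast
  show "dim U \<le> dim W"
    using u'(1,2,6) u(5) card_mono by metis
  assume "dim U = dim W"
  then have "u = u'" using u'(1,2,6) u(5) card_subset_eq by metis
  then show "U = W" using u(4) u'(5) by simp
qed

lemma (in vector_space_pair) subspace_image_on: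
  assumes V: "vs1.subspace V"
    and add: "\<And>x y. x \<in> V \<Longrightarrow> y \<in> V \<Longrightarrow> f (x + y) = f x + f y"
    and scale: "\<And>c x. x \<in> V \<Longrightarrow> f (s1 c x) = s2 c (f x)"
  shows "vs2.subspace (f ` V)"
  unfolding vs2.subspace_def
proof (intro conjI ballI allI)
  have "f 0 = 0" using scale[of 0 0] vs1.subspace_0[OF V] by simp
  then show "0 \<in> f ` V" using vs1.subspace_0[OF V] by (metis imageI)
  show "x + y \<in> f ` V" if "x \<in> f ` V" "y \<in> f ` V" for x y
    using that add vs1.subspace_add[OF V] by (metis (no_types, lifting) imageE imageI)
  show "s2 c x \<in> f ` V" if "x \<in> f ` V" for c x
    using that scale vs1.subspace_scale[OF V] by (metis (no_types, lifting) imageE imageI)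
qed

text \<open>Composition is specified on composable pairs only, so the maps of interest are linear on
  one \<open>Hom\<close> space and arbitrary outside it. Replacing them by a globally linear map
  gives access to the theory of \<open>Vector_Spaces.linear\<close>.\<close>

lemma (in vector_space_pair) linear_extension_on:
  assumes "finite B" "vs1.span B = V"
    and add: "\<And>x y. x \<in> V \<Longrightarrow> y \<in> V \<Longrightarrow> f (x + y) = f x + f y"
    and scale: "\<And>c x. x \<in> V \<Longrightarrow> f (s1 c x) = s2 c (f x)"
  obtains g where "Vector_Spaces.linear s1 s2 g" "\<And>x. x \<in> V \<Longrightarrow> g x = f x"
proof -
  obtain b where b: "finite b" "b \<subseteq> V" "vs1.independent b" "vs1.span b = V"
    using vs1.subspace_finite_basis[OF assms(1,2)] by metis
  obtain g where g: "Vector_Spaces.linear s1 s2 g" "\<forall>x\<in>b. g x = f x"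
    using linear_independent_extend[OF b(3)] by blast
  interpret g: Vector_Spaces.linear s1 s2 g by fact
  have "g x = f x \<and> x \<in> V" if "x \<in> vs1.span b" for x
    using that
  proof (induction rule: vs1.span_induct_alt)
    case base
    have "0 \<in> V" using b(4) vs1.span_zero by blast
    then have "f (s1 0 0) = s2 0 (f 0)" using scale by blast
    then show ?case using \<open>0 \<in> V\<close> g.zero by simp
  next
    case (step c x y)
    have x: "x \<in> V" using step b(2) by blast
    then have "s1 c x \<in> V" using b(4) vs1.span_scale by blast
    then show ?case using step g(2) x scale add b(4) vs1.span_add
      by (metis g.add g.scale)
  qed
  then show ?thesis using that[OF g(1)] b(4) by blast
qed

text \<open>A basis \<open>bk\<close> of the kernel is extended to a basis \<open>b\<close> of
  \<open>V\<close>; the added vectors \<open>d\<close> span a complement of the kernel and are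
  mapped injectively to a basis of the image.\<close>

lemma (in vector_space_pair) rank_nullity_on:
  assumes fin: "finite B" "vs1.span B = V"
    and add: "\<And>x y. x \<in> V \<Longrightarrow> y \<in> V \<Longrightarrow> f (x + y) = f x + f y"
    and scale: "\<And>c x. x \<in> V \<Longrightarrow> f (s1 c x) = s2 c (f x)"
  shows "vs1.dim V = vs1.dim {x \<in> V. f x = 0} + vs2.dim (f ` V)"
proof -
  obtain g where g: "Vector_Spaces.linear s1 s2 g" "\<And>x. x \<in> V \<Longrightarrow> g x = f x"
    using linear_extension_on[OF assms] by blast
  interpret g: Vector_Spaces.linear s1 s2 g by fact
  define K where "K = {x \<in> V. g x = 0}"
  have sV: "vs1.subspace V" using fin(2) vs1.subspace_span by blast
  have sK: "vs1.subspace K"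
    using sV unfolding K_def vs1.subspace_def by (simp add: g.zero g.add g.scale)
  obtain bk where bk: "finite bk" "bk \<subseteq> K" "vs1.independent bk" "vs1.span bk = K" "card bk = vs1.dim K"
    using vs1.finite_span_subspace[OF fin sK] K_def by blast
  obtain b where b: "finite b" "bk \<subseteq> b" "b \<subseteq> V" "vs1.independent b" "vs1.span b = V" "card b = vs1.dim V"
    using vs1.finite_span_extend[OF fin bk(3)] bk(2) K_def by blast
  define d where "d = b - bk"
  have d: "vs1.independent d" "d \<subseteq> V" "finite d"
    unfolding d_def using b vs1.independent_mono by auto
  \<comment> \<open>The coordinates in \<open>b\<close> of a vector in both spans would be supported
    in \<open>bk\<close> and in \<open>d\<close>, which are disjoint.\<close>
  have disj: "vs1.span d \<inter> K = {0}"
  proof -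
    have "vs1.span bk \<inter> vs1.span d = {0}"
    proof -
      have bb: "vs1.representation b x = vs1.representation bk x" if "x \<in> vs1.span bk" for x
        using vs1.representation_extend[OF b(4) that b(2)] .
      have bd: "vs1.representation b x = vs1.representation d x" if "x \<in> vs1.span d" for x
        using vs1.representation_extend[OF b(4) that] d_def by blast
      { fix x assume x: "x \<in> vs1.span bk" "x \<in> vs1.span d"
        have r0: "vs1.representation b x v = 0" for v
        proof (rule ccontr)
          assume a: "vs1.representation b x v \<noteq> 0"
          then have "v \<in> bk" using bb[OF x(1)] vs1.representation_ne_zero[of bk x v] by simp
          moreover have "v \<in> d" using a bd[OF x(2)] vs1.representation_ne_zero[of d x v] by simp
          ultimately show False unfolding d_def by blast
        qed
        have "x \<in> vs1.span b" using x(1) vs1.span_mono[OF b(2)] by blast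
        then have "x = 0"
          using vs1.sum_nonzero_representation_eq[OF b(4), of x] r0 by simp }
      then show ?thesis using vs1.span_zero by blast
    qed
    then show ?thesis using bk(4) by blast
  qed
  have inj: "inj_on g (vs1.span d)"
  proof (rule inj_onI)
    fix x y assume xy: "x \<in> vs1.span d" "y \<in> vs1.span d" "g x = g y"
    then have "x - y \<in> vs1.span d" "g (x - y) = 0" using vs1.span_diff g.diff by auto
    moreover have "vs1.span d \<subseteq> V" using d(2) sV vs1.span_minimal by blast
    ultimately have "x - y \<in> vs1.span d \<inter> K" unfolding K_def by auto
    then show "x = y" using disj by auto
  qed
  have ind: "vs2.independent (g ` d)"
    using linear_independent_injective_image[OF g(1) d(1) inj] .
  have spn: "vs2.span (g ` d) = g ` V"
  proof
    show "vs2.span (g ` d) \<subseteq> g ` V"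
      using d(2) g.subspace_image[OF sV] by (meson image_mono vs2.span_minimal)
    show "g ` V \<subseteq> vs2.span (g ` d)"
    proof -
      have "g ` V = vs2.span (g ` b)" using linear_span_image[OF g(1)] b(5) by metis
      also have "\<dots> \<subseteq> vs2.span (g ` d)"
      proof (rule vs2.span_minimal)
        show "g ` b \<subseteq> vs2.span (g ` d)"
        proof
          fix y assume "y \<in> g ` b"
          then obtain x where x: "x \<in> b" "y = g x" by blast
          show "y \<in> vs2.span (g ` d)"
          proof (cases "x \<in> bk")
            case True
            then have "y = 0" using x bk(2) K_def by auto
            then show ?thesis by (simp add: vs2.span_zero)
          next
            case False
            then have "y \<in> g ` d" using x d_def by blast
            then show ?thesis by (rule vs2.span_base)
          qed
        qed
      qed simp
      finally show ?thesis .
    qed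
  qed
  have "vs2.dim (g ` V) = card (g ` d)"
    using vs2.dim_span_eq_card_independent[OF ind] spn by simp
  also have "\<dots> = card d" using inj by (meson card_image inj_on_subset vs1.span_superset)
  also have "\<dots> = card b - card bk" unfolding d_def using b(2) bk(1) by (simp add: card_Diff_subset)
  finally have "vs1.dim V = vs1.dim K + vs2.dim (g ` V)"
    using b(6) bk(5) card_mono[OF b(1,2)] by simp
  moreover have "g ` V = f ` V" "K = {x \<in> V. f x = 0}" unfolding K_def using g(2) by auto
  ultimately show ?thesis by simp
qed

section \<open>Composition with explicit objects\<close>

sublocale linear_category \<subseteq> vs: vector_space "Scale E"
  by (rule vector_space_Scale)

context linear_category
begin

text \<open>Since source and target of a morphism cannot be read off from it, the simplifier could not
  discharge the typing conditions of the category laws for \<open>Comp E\<close>. The objects are therefore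
  recorded in the term: \<open>cm X Y Z g f\<close> is the composite \<open>X \<rightarrow> Y \<rightarrow> Z\<close>.\<close>

definition cm :: "'o \<Rightarrow> 'o \<Rightarrow> 'o \<Rightarrow> 'm \<Rightarrow> 'm \<Rightarrow> 'm" where
  "cm X Y Z g f = Comp E g f"

lemma hom_0 [simp]: "0 \<in> Hom E X Y"
  using subspace_Hom vs.subspace_0 by blast

lemma hom_add [simp]: "f \<in> Hom E X Y \<Longrightarrow> g \<in> Hom E X Y \<Longrightarrow> f + g \<in> Hom E X Y"
  using subspace_Hom vs.subspace_add by blast

lemma hom_diff [simp]: "f \<in> Hom E X Y \<Longrightarrow> g \<in> Hom E X Y \<Longrightarrow> f - g \<in> Hom E X Y"
  using subspace_Hom vs.subspace_diff by blast

lemma hom_neg [simp]: "f \<in> Hom E X Y \<Longrightarrow> - f \<in> Hom E X Y"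
  using subspace_Hom vs.subspace_neg by blast

lemma hom_scale [simp]: "f \<in> Hom E X Y \<Longrightarrow> Scale E c f \<in> Hom E X Y"
  using subspace_Hom vs.subspace_scale by blast

lemma id_in [simp]: "Idm E X \<in> Hom E X X"
  by (rule Idm_in_Hom)

lemma cm_in [simp]: "f \<in> Hom E X Y \<Longrightarrow> g \<in> Hom E Y Z \<Longrightarrow> cm X Y Z g f \<in> Hom E X Z"
  by (simp add: cm_def Comp_in_Hom)

lemma cm_assoc [simp]: "f \<in> Hom E W X \<Longrightarrow> g \<in> Hom E X Y \<Longrightarrow> h \<in> Hom E Y Z \<Longrightarrow>
    cm W X Z (cm X Y Z h g) f = cm W Y Z h (cm W X Y g f)"
  by (simp add: cm_def Comp_assoc)

lemma cm_id_right [simp]: "f \<in> Hom E X Y \<Longrightarrow> cm X X Y f (Idm E X) = f"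
  by (simp add: cm_def Comp_Idm_right)

lemma cm_id_left [simp]: "f \<in> Hom E X Y \<Longrightarrow> cm X Y Y (Idm E Y) f = f"
  by (simp add: cm_def Comp_Idm_left)

lemma cm_add_right [simp]: "f \<in> Hom E X Y \<Longrightarrow> f' \<in> Hom E X Y \<Longrightarrow> g \<in> Hom E Y Z \<Longrightarrow>
    cm X Y Z g (f + f') = cm X Y Z g f + cm X Y Z g f'"
  by (simp add: cm_def Comp_add_right)

lemma cm_add_left [simp]: "f \<in> Hom E X Y \<Longrightarrow> g \<in> Hom E Y Z \<Longrightarrow> g' \<in> Hom E Y Z \<Longrightarrow>
    cm X Y Z (g + g') f = cm X Y Z g f + cm X Y Z g' f"
  by (simp add: cm_def Comp_add_left)

lemma cm_scale_right [simp]: "f \<in> Hom E X Y \<Longrightarrow> g \<in> Hom E Y Z \<Longrightarrow>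
    cm X Y Z g (Scale E c f) = Scale E c (cm X Y Z g f)"
  by (simp add: cm_def Comp_scale_right)

lemma cm_scale_left [simp]: "f \<in> Hom E X Y \<Longrightarrow> g \<in> Hom E Y Z \<Longrightarrow>
    cm X Y Z (Scale E c g) f = Scale E c (cm X Y Z g f)"
  by (simp add: cm_def Comp_scale_left)

lemma cm_0_right [simp]: "g \<in> Hom E Y Z \<Longrightarrow> cm X Y Z g 0 = 0"
  using cm_add_right[of 0 X Y 0 g Z] by simp

lemma cm_0_left [simp]: "f \<in> Hom E X Y \<Longrightarrow> cm X Y Z 0 f = 0"
  using cm_add_left[of f X Y 0 Z 0] by simp

lemma cm_neg_right [simp]: "f \<in> Hom E X Y \<Longrightarrow> g \<in> Hom E Y Z \<Longrightarrow> cm X Y Z g (- f) = - cm X Y Z g f"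
  using cm_add_right[of f X Y "- f" g Z] by (simp add: eq_neg_iff_add_eq_0 add.commute)

lemma cm_neg_left [simp]: "f \<in> Hom E X Y \<Longrightarrow> g \<in> Hom E Y Z \<Longrightarrow> cm X Y Z (- g) f = - cm X Y Z g f"
  using cm_add_left[of f X Y g Z "- g"] by (simp add: eq_neg_iff_add_eq_0 add.commute)

lemma cm_diff_right [simp]: "f \<in> Hom E X Y \<Longrightarrow> f' \<in> Hom E X Y \<Longrightarrow> g \<in> Hom E Y Z \<Longrightarrow>
    cm X Y Z g (f - f') = cm X Y Z g f - cm X Y Z g f'"
  using cm_add_right[of f X Y "- f'" g Z] by simp

lemma cm_diff_left [simp]: "f \<in> Hom E X Y \<Longrightarrow> g \<in> Hom E Y Z \<Longrightarrow> g' \<in> Hom E Y Z \<Longrightarrow>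
    cm X Y Z (g - g') f = cm X Y Z g f - cm X Y Z g' f"
  using cm_add_left[of f X Y g Z "- g'"] by simp

lemma subspace_image_Hom:
  assumes "\<And>x y. x \<in> Hom E X Y \<Longrightarrow> y \<in> Hom E X Y \<Longrightarrow> f (x + y) = f x + f y"
    and "\<And>c x. x \<in> Hom E X Y \<Longrightarrow> f (Scale E c x) = Scale E c (f x)"
  shows "vs.subspace (f ` Hom E X Y)"
proof -
  interpret vp: vector_space_pair "Scale E" "Scale E" by unfold_locales
  show ?thesis by (rule vp.subspace_image_on[OF subspace_Hom assms])
qed

text \<open>The simplifier associates composites to the right, so an equation for
  \<open>cm X Y Z h g\<close> no longer matches once something is composed in front. This form lets
  a given equation be applied inside a longer composite.\<close>

lemma cm_red: "cm X Y Z h g = k \<Longrightarrow> g \<in> Hom E X Y \<Longrightarrow> h \<in> Hom E Y Z \<Longrightarrow> f \<in> Hom E W X \<Longrightarrow>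
    cm W Y Z h (cm W X Y g f) = cm W X Z k f"
  using cm_assoc by metis

lemma is_iso_cm: "is_iso E X Y f \<longleftrightarrow> f \<in> Hom E X Y \<and>
    (\<exists>g\<in>Hom E Y X. cm X Y X g f = Idm E X \<and> cm Y X Y f g = Idm E Y)"
  by (simp add: is_iso_def cm_def)

lemma is_isoI: "f \<in> Hom E X Y \<Longrightarrow> g \<in> Hom E Y X \<Longrightarrow> cm X Y X g f = Idm E X \<Longrightarrow>
    cm Y X Y f g = Idm E Y \<Longrightarrow> is_iso E X Y f"
  by (auto simp: is_iso_cm)

lemma is_isoE:
  assumes "is_iso E X Y f"
  obtains g where "f \<in> Hom E X Y" "g \<in> Hom E Y X" "cm X Y X g f = Idm E X" "cm Y X Y f g = Idm E Y"
  using assms by (auto simp: is_iso_cm)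

lemma is_iso_id [simp]: "is_iso E X X (Idm E X)"
  by (rule is_isoI[of _ _ _ "Idm E X"]) auto

lemma is_iso_comp:
  assumes "is_iso E X Y f" "is_iso E Y Z g"
  shows "is_iso E X Z (cm X Y Z g f)"
proof -
  obtain f' where f: "f \<in> Hom E X Y" "f' \<in> Hom E Y X" "cm X Y X f' f = Idm E X" "cm Y X Y f f' = Idm E Y"
    using assms(1) by (rule is_isoE)
  obtain g' where g: "g \<in> Hom E Y Z" "g' \<in> Hom E Z Y" "cm Y Z Y g' g = Idm E Y" "cm Z Y Z g g' = Idm E Z"
    using assms(2) by (rule is_isoE)
  show ?thesis
    by (rule is_isoI[of _ _ _ "cm Z Y X f' g'"])
      (use f g in \<open>simp_all add: cm_red[OF f(3)] cm_red[OF f(4)] cm_red[OF g(3)] cm_red[OF g(4)]\<close>)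
qed

lemma is_iso_inv:
  assumes "is_iso E X Y f"
  obtains g where "is_iso E Y X g" "cm X Y X g f = Idm E X" "cm Y X Y f g = Idm E Y"
  using assms by (auto simp: is_iso_cm)

lemma iso_obj_sym: "iso_obj E X Y \<Longrightarrow> iso_obj E Y X"
  by (auto simp: iso_obj_def is_iso_cm)

lemma iso_obj_refl [simp]: "iso_obj E X X"
  unfolding iso_obj_def using is_iso_id by blast

lemma iso_obj_trans: "iso_obj E X Y \<Longrightarrow> iso_obj E Y Z \<Longrightarrow> iso_obj E X Z"
  unfolding iso_obj_def using is_iso_comp by blast

lemma is_zero_iff: "is_zero E Z \<longleftrightarrow> Idm E Z = 0"
proof
  assume "is_zero E Z" then show "Idm E Z = 0" unfolding is_zero_def using id_in by blast
next
  assume a: "Idm E Z = 0"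
  have "f = 0" if "f \<in> Hom E X Z" for f X
    using cm_id_left[OF that] a that by simp
  moreover have "f = 0" if "f \<in> Hom E Z X" for f X
    using cm_id_right[OF that] a that by simp
  ultimately show "is_zero E Z" unfolding is_zero_def using hom_0 by blast
qed

lemma is_zeroD: "is_zero E Z \<Longrightarrow> f \<in> Hom E X Z \<Longrightarrow> f = 0" "is_zero E Z \<Longrightarrow> g \<in> Hom E Z X \<Longrightarrow> g = 0"
  unfolding is_zero_def by auto

text \<open>Morphism spaces are groups, so uniqueness of a factorisation is the same as cancelling
  zero; existence and uniqueness can then be used separately. The same is done for
  cokernels.\<close>

lemma is_kernel_cm: "is_kernel E X F Y i p \<longleftrightarrow> i \<in> Hom E X F \<and> p \<in> Hom E F Y \<and> cm X F Y p i = 0 \<and>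
    (\<forall>W. \<forall>f\<in>Hom E W F. cm W F Y p f = 0 \<longrightarrow> (\<exists>g\<in>Hom E W X. cm W X F i g = f)) \<and>
    (\<forall>W. \<forall>g\<in>Hom E W X. cm W X F i g = 0 \<longrightarrow> g = 0)"
  (is "?L \<longleftrightarrow> ?R")
proof
  assume L: ?L
  have ip: "i \<in> Hom E X F" "p \<in> Hom E F Y" "cm X F Y p i = 0" using L by (auto simp: is_kernel_def cm_def)
  have u: "\<exists>!g. g \<in> Hom E W X \<and> cm W X F i g = f" if "f \<in> Hom E W F" "cm W F Y p f = 0" for f W
    using L that by (auto simp: is_kernel_def cm_def)
  have "g = 0" if "g \<in> Hom E W X" "cm W X F i g = 0" for g W
  proof -
    have "\<exists>!g. g \<in> Hom E W X \<and> cm W X F i g = 0" by (rule u) (use ip in auto)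
    then show ?thesis using that ip by (metis hom_0 cm_0_right)
  qed
  then show ?R using ip u by blast
next
  assume R: ?R
  then have ip: "i \<in> Hom E X F" "p \<in> Hom E F Y" "cm X F Y p i = 0" by auto
  have "\<exists>!g. g \<in> Hom E W X \<and> cm W X F i g = f" if f: "f \<in> Hom E W F" "cm W F Y p f = 0" for f W
  proof (rule ex_ex1I)
    show "\<exists>g. g \<in> Hom E W X \<and> cm W X F i g = f" using R f by blast
    fix g h assume gh: "g \<in> Hom E W X \<and> cm W X F i g = f" "h \<in> Hom E W X \<and> cm W X F i h = f"
    then have "cm W X F i (g - h) = 0" "g - h \<in> Hom E W X" using ip by auto
    then have "g - h = 0" using R by blast
    then show "g = h" by simp
  qed
  then show ?L using ip by (auto simp: is_kernel_def cm_def)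
qed

lemma is_cokernel_cm: "is_cokernel E X F Y i p \<longleftrightarrow> i \<in> Hom E X F \<and> p \<in> Hom E F Y \<and> cm X F Y p i = 0 \<and>
    (\<forall>W. \<forall>f\<in>Hom E F W. cm X F W f i = 0 \<longrightarrow> (\<exists>g\<in>Hom E Y W. cm F Y W g p = f)) \<and>
    (\<forall>W. \<forall>g\<in>Hom E Y W. cm F Y W g p = 0 \<longrightarrow> g = 0)"
  (is "?L \<longleftrightarrow> ?R")
proof
  assume L: ?L
  have ip: "i \<in> Hom E X F" "p \<in> Hom E F Y" "cm X F Y p i = 0" using L by (auto simp: is_cokernel_def cm_def)
  have u: "\<exists>!g. g \<in> Hom E Y W \<and> cm F Y W g p = f" if "f \<in> Hom E F W" "cm X F W f i = 0" for f W
    using L that by (auto simp: is_cokernel_def cm_def)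
  have "g = 0" if "g \<in> Hom E Y W" "cm F Y W g p = 0" for g W
  proof -
    have "\<exists>!g. g \<in> Hom E Y W \<and> cm F Y W g p = 0" by (rule u) (use ip in auto)
    then show ?thesis using that ip by (metis hom_0 cm_0_left)
  qed
  then show ?R using ip u by blast
next
  assume R: ?R
  then have ip: "i \<in> Hom E X F" "p \<in> Hom E F Y" "cm X F Y p i = 0" by auto
  have "\<exists>!g. g \<in> Hom E Y W \<and> cm F Y W g p = f" if f: "f \<in> Hom E F W" "cm X F W f i = 0" for f W
  proof (rule ex_ex1I)
    show "\<exists>g. g \<in> Hom E Y W \<and> cm F Y W g p = f" using R f by blast
    fix g h assume gh: "g \<in> Hom E Y W \<and> cm F Y W g p = f" "h \<in> Hom E Y W \<and> cm F Y W h p = f"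
    then have "cm F Y W (g - h) p = 0" "g - h \<in> Hom E Y W" using ip by auto
    then have "g - h = 0" using R by blast
    then show "g = h" by simp
  qed
  then show ?L using ip by (auto simp: is_cokernel_def cm_def)
qed

lemma biproduct_cm: "biproduct E A B S i1 i2 p1 p2 \<longleftrightarrow>
     i1 \<in> Hom E A S \<and> i2 \<in> Hom E B S \<and> p1 \<in> Hom E S A \<and> p2 \<in> Hom E S B \<and>
     cm A S A p1 i1 = Idm E A \<and> cm B S B p2 i2 = Idm E B \<and>
     cm A S B p2 i1 = 0 \<and> cm B S A p1 i2 = 0 \<and>
     cm S A S i1 p1 + cm S B S i2 p2 = Idm E S"
  by (simp add: biproduct_def cm_def)

lemma split_ext_cm: "split_ext E T (i, F, p) \<longleftrightarrow> (\<exists>s\<in>Hom E T F. cm T F T p s = Idm E T)"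
  by (simp add: split_ext_def cm_def)

end

locale biprod = linear_category E
  for E :: "('o, 'm::ab_group_add, 'k::field) exact_cat" +
  fixes A B S i1 i2 p1 p2
  assumes biprod: "biproduct E A B S i1 i2 p1 p2"
begin

lemma i1 [simp]: "i1 \<in> Hom E A S" and i2 [simp]: "i2 \<in> Hom E B S"
  and p1 [simp]: "p1 \<in> Hom E S A" and p2 [simp]: "p2 \<in> Hom E S B"
  and p1_i1 [simp]: "cm A S A p1 i1 = Idm E A" and p2_i2 [simp]: "cm B S B p2 i2 = Idm E B"
  and p2_i1 [simp]: "cm A S B p2 i1 = 0" and p1_i2 [simp]: "cm B S A p1 i2 = 0"
  and id_sum: "cm S A S i1 p1 + cm S B S i2 p2 = Idm E S"
  using biprod by (auto simp: biproduct_cm)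

lemma direct_sum: "direct_sum E A B S"
  using biprod unfolding direct_sum_def by blast

lemma p1_i1_comp [simp]: "f \<in> Hom E X A \<Longrightarrow> cm X S A p1 (cm X A S i1 f) = f"
  by (simp add: cm_red[OF p1_i1])

lemma p2_i2_comp [simp]: "f \<in> Hom E X B \<Longrightarrow> cm X S B p2 (cm X B S i2 f) = f"
  by (simp add: cm_red[OF p2_i2])

lemma p2_i1_comp [simp]: "f \<in> Hom E X A \<Longrightarrow> cm X S B p2 (cm X A S i1 f) = 0"
  by (simp add: cm_red[OF p2_i1])

lemma p1_i2_comp [simp]: "f \<in> Hom E X B \<Longrightarrow> cm X S A p1 (cm X B S i2 f) = 0"
  by (simp add: cm_red[OF p1_i2])

lemma decomp: "f \<in> Hom E X S \<Longrightarrow> cm X A S i1 (cm X S A p1 f) + cm X B S i2 (cm X S B p2 f) = f"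
  using id_sum cm_add_left[of f X S "cm S A S i1 p1" S "cm S B S i2 p2"] by simp

lemma codecomp: "f \<in> Hom E S X \<Longrightarrow> cm S A X (cm A S X f i1) p1 + cm S B X (cm B S X f i2) p2 = f"
  using id_sum cm_add_right[of "cm S A S i1 p1" S S "cm S B S i2 p2" f X] by simp

lemma eqI: "f \<in> Hom E X S \<Longrightarrow> g \<in> Hom E X S \<Longrightarrow> cm X S A p1 f = cm X S A p1 g \<Longrightarrow>
    cm X S B p2 f = cm X S B p2 g \<Longrightarrow> f = g"
  using decomp by metis

lemma swap: "biproduct E B A S i2 i1 p2 p1"
  using biprod by (auto simp: biproduct_cm add.commute)

end

context linear_category
begin

lemma direct_sum_sym: "direct_sum E A B S \<Longrightarrow> direct_sum E B A S"
proof -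
  assume "direct_sum E A B S"
  then obtain i1 i2 p1 p2 where "biproduct E A B S i1 i2 p1 p2" unfolding direct_sum_def by blast
  then interpret biprod E A B S i1 i2 p1 p2 by unfold_locales
  show ?thesis using swap unfolding direct_sum_def by blast
qed

text \<open>Makes isomorphism a special case of a direct sum, so that relations imposed for direct
  sums alone already identify isomorphic objects.\<close>

lemma direct_sum_iso_zero:
  assumes "iso_obj E S A" "is_zero E Z"
  shows "direct_sum E A Z S"
proof -
  obtain f g where "f \<in> Hom E S A" "g \<in> Hom E A S" "cm S A S g f = Idm E S" "cm A S A f g = Idm E A"
    using assms(1) unfolding iso_obj_def is_iso_cm by blast
  moreover have "Idm E Z = 0" using assms(2) is_zero_iff by blast
  ultimately have "biproduct E A Z S g 0 f 0" by (simp add: biproduct_cm)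
  then show ?thesis unfolding direct_sum_def by blast
qed

end

section \<open>Exact categories\<close>

locale conflation = exact_category E
  for E :: "('o, 'm::ab_group_add, 'k::field) exact_cat" +
  fixes X i F p Y
  assumes confl: "(X, i, F, p, Y) \<in> Confl E"
begin

lemma i [simp]: "i \<in> Hom E X F" and p [simp]: "p \<in> Hom E F Y" and p_i [simp]: "cm X F Y p i = 0"
  using Confl_kernel[OF confl] by (auto simp: is_kernel_cm)

lemma p_i_comp [simp]: "f \<in> Hom E W X \<Longrightarrow> cm W F Y p (cm W X F i f) = 0"
  by (simp add: cm_red[OF p_i])

lemma lift:
  assumes "f \<in> Hom E W F" "cm W F Y p f = 0"
  obtains g where "g \<in> Hom E W X" "cm W X F i g = f"
  using Confl_kernel[OF confl] assms that unfolding is_kernel_cm by blast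

lemma mono: "g \<in> Hom E W X \<Longrightarrow> cm W X F i g = 0 \<Longrightarrow> g = 0"
  using Confl_kernel[OF confl] unfolding is_kernel_cm by blast

lemma mono_eq: "g \<in> Hom E W X \<Longrightarrow> h \<in> Hom E W X \<Longrightarrow> cm W X F i g = cm W X F i h \<Longrightarrow> g = h"
  using mono[of "g - h" W] by simp

lemma colift:
  assumes "f \<in> Hom E F W" "cm X F W f i = 0"
  obtains g where "g \<in> Hom E Y W" "cm F Y W g p = f"
  using Confl_cokernel[OF confl] assms that unfolding is_cokernel_cm by blast

lemma epi: "g \<in> Hom E Y W \<Longrightarrow> cm F Y W g p = 0 \<Longrightarrow> g = 0"
  using Confl_cokernel[OF confl] unfolding is_cokernel_cm by blast

lemma epi_eq: "g \<in> Hom E Y W \<Longrightarrow> h \<in> Hom E Y W \<Longrightarrow> cm F Y W g p = cm F Y W h p \<Longrightarrow> g = h"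
  using epi[of "g - h" W] by simp

text \<open>The map \<open>1 - s p\<close> is killed by \<open>p\<close>, hence factors through the
  kernel \<open>i\<close>, and the factor is the required retraction.\<close>

lemma section_imp_retraction:
  assumes s: "s \<in> Hom E Y F" "cm Y F Y p s = Idm E Y"
  obtains r where "biproduct E X Y F i s r p"
proof -
  have "cm F F Y p (Idm E F - cm F Y F s p) = 0" using s by (simp add: cm_red[OF s(2)])
  then obtain r where r: "r \<in> Hom E F X" "cm F X F i r = Idm E F - cm F Y F s p"
    using lift[of "Idm E F - cm F Y F s p" F] s by auto
  have "cm X F X r i = Idm E X"
    by (rule mono_eq[where W=X]) (use r s in \<open>simp_all add: cm_red[OF r(2)]\<close>)
  moreover have "cm Y F X r s = 0"
    by (rule mono[where W=Y]) (use r s in \<open>simp_all add: cm_red[OF r(2)]\<close>)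
  ultimately have "biproduct E X Y F i s r p" using r s by (simp add: biproduct_cm)
  then show thesis by (rule that)
qed

lemma retraction_imp_section:
  assumes r: "r \<in> Hom E F X" "cm X F X r i = Idm E X"
  obtains s where "biproduct E X Y F i s r p"
proof -
  have "cm X F F (Idm E F - cm F X F i r) i = 0" using r by simp
  then obtain s where s: "s \<in> Hom E Y F" "cm F Y F s p = Idm E F - cm F X F i r"
    using colift[of "Idm E F - cm F X F i r" F] r by auto
  have "cm Y F Y p s = Idm E Y"
    by (rule epi_eq[where W=Y]) (use r s in simp_all)
  moreover have "cm Y F X r s = 0"
    by (rule epi[where W=X]) (use r s in \<open>simp_all add: cm_red[OF r(2)]\<close>)
  ultimately have "biproduct E X Y F i s r p" using r s by (simp add: biproduct_cm)
  then show thesis by (rule that)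
qed

end

context exact_category
begin

lemma conflI: "(X, i, F, p, Y) \<in> Confl E \<Longrightarrow> conflation E X i F p Y"
  by unfold_locales

lemma Confl_iso_cm: "(X, i, F, p, Y) \<in> Confl E \<Longrightarrow>
    is_iso E X X' a \<Longrightarrow> is_iso E F F' b \<Longrightarrow> is_iso E Y Y' c \<Longrightarrow>
    i' \<in> Hom E X' F' \<Longrightarrow> p' \<in> Hom E F' Y' \<Longrightarrow>
    cm X F F' b i = cm X X' F' i' a \<Longrightarrow> cm F Y Y' c p = cm F F' Y' p' b \<Longrightarrow>
    (X', i', F', p', Y') \<in> Confl E"
  unfolding cm_def by (rule Confl_iso)

text \<open>\<open>deflation\<close> hides the kernel that belongs to it. Any other kernel is
  isomorphic to the hidden one, and conflations are closed under isomorphism.\<close>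

lemma deflation_kernel:
  assumes "deflation E F Y p" "is_kernel E X F Y i p"
  shows "(X, i, F, p, Y) \<in> Confl E"
proof -
  obtain X' i' where c: "(X', i', F, p, Y) \<in> Confl E" using assms(1) unfolding deflation_def by blast
  interpret c: conflation E X' i' F p Y using c by (rule conflI)
  have i: "i \<in> Hom E X F" "cm X F Y p i = 0" using assms(2) by (auto simp: is_kernel_cm)
  obtain b where b: "b \<in> Hom E X X'" "cm X X' F i' b = i" using c.lift[OF i] .
  obtain a where a: "a \<in> Hom E X' X" "cm X' X F i a = i'"
    using assms(2) c.i c.p_i unfolding is_kernel_cm by blast
  have "cm X' X X' b a = Idm E X'"
    by (rule c.mono_eq[where W=X']) (use a b in \<open>simp_all add: cm_red[OF b(2)]\<close>)
  moreover have "cm X X' X a b - Idm E X = 0"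
  proof -
    have "cm X X F i (cm X X' X a b - Idm E X) = 0" using a b i by (simp add: cm_red[OF a(2)])
    moreover have "cm X X' X a b - Idm E X \<in> Hom E X X" using a b by simp
    ultimately show ?thesis using assms(2) unfolding is_kernel_cm by blast
  qed
  ultimately have "is_iso E X' X a" using a b by (intro is_isoI[of _ _ _ b]) auto
  then show ?thesis
    by (rule Confl_iso_cm[OF c _ is_iso_id is_iso_id]) (use i a in simp_all)
qed

lemma inflation_cokernel:
  assumes "inflation E X F i" "is_cokernel E X F Y i p"
  shows "(X, i, F, p, Y) \<in> Confl E"
proof -
  obtain Y' p' where c: "(X, i, F, p', Y') \<in> Confl E" using assms(1) unfolding inflation_def by blast
  interpret c: conflation E X i F p' Y' using c by (rule conflI)
  have p: "p \<in> Hom E F Y" "cm X F Y p i = 0" using assms(2) by (auto simp: is_cokernel_cm)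
  obtain b where b: "b \<in> Hom E Y' Y" "cm F Y' Y b p' = p" using c.colift[OF p] .
  obtain a where a: "a \<in> Hom E Y Y'" "cm F Y Y' a p = p'"
    using assms(2) c.p c.p_i unfolding is_cokernel_cm by blast
  have "cm Y' Y Y' a b = Idm E Y'"
    by (rule c.epi_eq[where W=Y']) (use a b in simp_all)
  moreover have "cm Y Y' Y b a - Idm E Y = 0"
  proof -
    have "cm F Y Y (cm Y Y' Y b a - Idm E Y) p = 0" using a b p by simp
    moreover have "cm Y Y' Y b a - Idm E Y \<in> Hom E Y Y" using a b by simp
    ultimately show ?thesis using assms(2) unfolding is_cokernel_cm by blast
  qed
  ultimately have "is_iso E Y' Y b" using a b by (intro is_isoI[of _ _ _ a]) auto
  then show ?thesis
    by (rule Confl_iso_cm[OF c is_iso_id is_iso_id]) (use p b in simp_all)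
qed

end

section \<open>Base change of conflations\<close>

context exact_category
begin

text \<open>The axiom yields a square whose side \<open>q\<close> is a deflation; since the square
  is a pullback, \<open>q\<close> has the same kernel object as \<open>p\<close>. The last two
  clauses are the universal property, split into existence and joint monicity.\<close>

lemma confl_pullback:
  assumes "(X, i, F, p, Y) \<in> Confl E" "f \<in> Hom E Z Y"
  obtains P j q g where "(X, j, P, q, Z) \<in> Confl E" "g \<in> Hom E P F" "cm X P F g j = i"
    "cm P F Y p g = cm P Z Y f q"
    "\<And>W a b. a \<in> Hom E W F \<Longrightarrow> b \<in> Hom E W Z \<Longrightarrow> cm W F Y p a = cm W Z Y f b \<Longrightarrow>
      \<exists>u\<in>Hom E W P. cm W P F g u = a \<and> cm W P Z q u = b"
    "\<And>W u. u \<in> Hom E W P \<Longrightarrow> cm W P F g u = 0 \<Longrightarrow> cm W P Z q u = 0 \<Longrightarrow> u = 0"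
proof -
  interpret c: conflation E X i F p Y using assms(1) by (rule conflI)
  have "deflation E F Y p" using assms(1) unfolding deflation_def by blast
  then obtain P g q where pb: "is_pullback E P F Z Y g q p f" and d: "deflation E P Z q"
    using deflation_pullback assms(2) by blast
  have t: "g \<in> Hom E P F" "q \<in> Hom E P Z" "cm P F Y p g = cm P Z Y f q"
    using pb by (auto simp: is_pullback_def cm_def)
  have ex: "\<exists>!u. u \<in> Hom E W P \<and> cm W P F g u = a \<and> cm W P Z q u = b"
    if "a \<in> Hom E W F" "b \<in> Hom E W Z" "cm W F Y p a = cm W Z Y f b" for a b W
    using pb that unfolding is_pullback_def cm_def by blast
  have jm: "u = 0" if u: "u \<in> Hom E W P" "cm W P F g u = 0" "cm W P Z q u = 0" for u W
  proof -
    have "\<exists>!u. u \<in> Hom E W P \<and> cm W P F g u = 0 \<and> cm W P Z q u = 0"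
      by (rule ex) (use t assms in auto)
    then show ?thesis using u t hom_0 cm_0_right by metis
  qed
  \<comment> \<open>The inclusion of the kernel is the map into the pullback induced by
    \<open>i\<close> and \<open>0\<close>.\<close>
  obtain j where j: "j \<in> Hom E X P" "cm X P F g j = i" "cm X P Z q j = 0"
    using ex[of i X 0] assms(2) by auto
  have "is_kernel E X P Z j q"
    unfolding is_kernel_cm
  proof (intro conjI allI ballI impI)
    fix W h assume h: "h \<in> Hom E W P" "cm W P Z q h = 0"
    have "cm W F Y p (cm W P F g h) = 0"
      using h t assms(2) by (simp add: cm_red[OF t(3)])
    then obtain k where k: "k \<in> Hom E W X" "cm W X F i k = cm W P F g h"
      using c.lift[of "cm W P F g h" W] h t by auto
    have "cm W X P j k - h = 0"
      by (rule jm[where W = W]) (use k h j t in \<open>simp_all add: cm_red[OF j(2)] cm_red[OF j(3)]\<close>)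
    then show "\<exists>k\<in>Hom E W X. cm W X P j k = h" using k by auto
  next
    fix W k assume k: "k \<in> Hom E W X" "cm W X P j k = 0"
    have "cm W X F i k = cm W P F g (cm W X P j k)" using k(1) j t by (simp add: cm_red[OF j(2)])
    then have "cm W X F i k = 0" using k(2) t(1) by simp
    with k(1) show "k = 0" by (rule c.mono)
  qed (use j t in auto)
  then have "(X, j, P, q, Z) \<in> Confl E" by (rule deflation_kernel[OF d])
  then show thesis using that[of j P q g] t j ex jm by blast
qed

lemma confl_pushout:
  assumes "(X, i, F, p, Y) \<in> Confl E" "f \<in> Hom E X Z"
  obtains P j q g where "(Z, j, P, q, Y) \<in> Confl E" "g \<in> Hom E F P" "cm F P Y q g = p"
    "cm X F P g i = cm X Z P j f"
    "\<And>W a b. a \<in> Hom E F W \<Longrightarrow> b \<in> Hom E Z W \<Longrightarrow> cm X F W a i = cm X Z W b f \<Longrightarrow>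
      \<exists>u\<in>Hom E P W. cm F P W u g = a \<and> cm Z P W u j = b"
    "\<And>W u. u \<in> Hom E P W \<Longrightarrow> cm F P W u g = 0 \<Longrightarrow> cm Z P W u j = 0 \<Longrightarrow> u = 0"
proof -
  interpret c: conflation E X i F p Y using assms(1) by (rule conflI)
  have "inflation E X F i" using assms(1) unfolding inflation_def by blast
  then obtain P g j where pb: "is_pushout E X F Z P i f g j" and d: "inflation E Z P j"
    using inflation_pushout assms(2) by blast
  have t: "g \<in> Hom E F P" "j \<in> Hom E Z P" "cm X F P g i = cm X Z P j f"
    using pb by (auto simp: is_pushout_def cm_def)
  have ex: "\<exists>!u. u \<in> Hom E P W \<and> cm F P W u g = a \<and> cm Z P W u j = b"
    if "a \<in> Hom E F W" "b \<in> Hom E Z W" "cm X F W a i = cm X Z W b f" for a b W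
    using pb that unfolding is_pushout_def cm_def by blast
  have jm: "u = 0" if u: "u \<in> Hom E P W" "cm F P W u g = 0" "cm Z P W u j = 0" for u W
  proof -
    have "\<exists>!u. u \<in> Hom E P W \<and> cm F P W u g = 0 \<and> cm Z P W u j = 0"
      by (rule ex) (use t assms in auto)
    then show ?thesis using u t hom_0 cm_0_left by metis
  qed
  obtain q where q: "q \<in> Hom E P Y" "cm F P Y q g = p" "cm Z P Y q j = 0"
    using ex[of p Y 0] assms(2) by auto
  have "is_cokernel E Z P Y j q"
    unfolding is_cokernel_cm
  proof (intro conjI allI ballI impI)
    fix W h assume h: "h \<in> Hom E P W" "cm Z P W h j = 0"
    have "cm X F W (cm F P W h g) i = cm X Z W (cm Z P W h j) f"
      using h(1) t assms(2) by simp
    then have "cm X F W (cm F P W h g) i = 0" using h(2) assms(2) by simp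
    then obtain k where k: "k \<in> Hom E Y W" "cm F Y W k p = cm F P W h g"
      using c.colift[of "cm F P W h g" W] h t by auto
    have "cm P Y W k q - h = 0"
      by (rule jm[where W = W]) (use k h q t in \<open>simp_all\<close>)
    then show "\<exists>k\<in>Hom E Y W. cm P Y W k q = h" using k by auto
  next
    fix W k assume k: "k \<in> Hom E Y W" "cm P Y W k q = 0"
    have "cm F Y W k p = cm F P W (cm P Y W k q) g" using k(1) q t by simp
    then show "k = 0" using k t by (intro c.epi[of k W]) auto
  qed (use q t in auto)
  then have "(Z, j, P, q, Y) \<in> Confl E" by (rule inflation_cokernel[OF d])
  then show thesis using that[of j P q g] t q ex jm by blast
qed

text \<open>In the pullback \<open>D\<close> of the two deflations the map to \<open>F'\<close> is a deflation, hence a cokernel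
  of its kernel, and the candidate for the inverse of \<open>w\<close> factors through it.\<close>

lemma five_lemma:
  assumes "(X, i, F, p, Y) \<in> Confl E" "(X, i', F', p', Y) \<in> Confl E" "w \<in> Hom E F F'"
    "cm X F F' w i = i'" "cm F F' Y p' w = p"
  shows "is_iso E F F' w"
proof -
  interpret c: conflation E X i F p Y using assms(1) by (rule conflI)
  interpret c': conflation E X i' F' p' Y using assms(2) by (rule conflI)
  have w_mono: "u = 0" if u: "u \<in> Hom E Z F" "cm Z F F' w u = 0" for u Z
  proof -
    have "cm Z F Y p u = cm Z F' Y p' (cm Z F F' w u)" using u(1) assms(3) by (simp add: cm_red[OF assms(5)])
    then have "cm Z F Y p u = 0" using u(2) by simp
    then obtain y where y: "y \<in> Hom E Z X" "cm Z X F i y = u" using c.lift[OF u(1)] by blast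
    have "cm Z X F' i' y = cm Z F F' w (cm Z X F i y)" using y(1) assms(3) by (simp add: cm_red[OF assms(4)])
    then have "y = 0" using y u(2) by (intro c'.mono[of y Z]) auto
    then show ?thesis using y by simp
  qed
  obtain D j d2 d1 where D: "(X, j, D, d2, F') \<in> Confl E" "d1 \<in> Hom E D F" "cm X D F d1 j = i"
    "cm D F Y p d1 = cm D F' Y p' d2"
    using confl_pullback[OF assms(1) c'.p] by metis
  interpret D: conflation E X j D d2 F' using D(1) by (rule conflI)
  have "cm D F' Y p' (d2 - cm D F F' w d1) = 0"
    using D(2) assms(3) by (simp add: cm_red[OF assms(5)] D(4))
  then obtain t where t: "t \<in> Hom E D X" "cm D X F' i' t = d2 - cm D F F' w d1"
    using c'.lift[of "d2 - cm D F F' w d1" D] D(2) assms(3) by auto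
  \<comment> \<open>The maps \<open>w d1\<close> and \<open>d2\<close> agree after
    \<open>p'\<close>, so they differ by a map \<open>t\<close> into \<open>X\<close>; adding it to
    \<open>d1\<close> gives a map with \<open>w \<psi> = d2\<close>. As \<open>w\<close> is monic,
    \<open>\<psi>\<close> kills \<open>j\<close> and descends along \<open>d2\<close>.\<close>
  define \<psi> where "\<psi> = d1 + cm D X F i t"
  have \<psi>: "\<psi> \<in> Hom E D F" unfolding \<psi>_def using D(2) t by simp
  have w\<psi>: "cm D F F' w \<psi> = d2"
    unfolding \<psi>_def using D(2) t assms(3) by (simp add: cm_red[OF assms(4)])
  have "cm X D F \<psi> j = 0"
    by (rule w_mono[where Z = X]) (use \<psi> w\<psi> assms(3) in \<open>simp_all add: cm_red[OF w\<psi>]\<close>)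
  then obtain \<omega> where \<omega>: "\<omega> \<in> Hom E F' F" "cm D F' F \<omega> d2 = \<psi>" using D.colift[OF \<psi>] by blast
  have w\<omega>: "cm F' F F' w \<omega> = Idm E F'"
    by (rule D.epi_eq[where W = F']) (use \<omega> assms(3) w\<psi> in simp_all)
  have "cm F F' F \<omega> w - Idm E F = 0"
    by (rule w_mono[where Z = F]) (use \<omega> assms(3) in \<open>simp_all add: cm_red[OF w\<omega>]\<close>)
  then show ?thesis using w\<omega> \<omega> assms(3) by (intro is_isoI[of _ _ _ \<omega>]) auto
qed

text \<open>A morphism of conflations that is the identity on the right-hand ends is a pushout
  square: the five lemma identifies it with the constructed pushout. As \<open>ext_push\<close> asks
  only for such a morphism, this is what supplies its universal property.\<close>

lemma pushout_of_morphism: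
  assumes "(X, i, F, p, Y) \<in> Confl E" "(X', i', F', p', Y) \<in> Confl E" "a \<in> Hom E X X'" "g \<in> Hom E F F'"
    "cm X F F' g i = cm X X' F' i' a" "cm F F' Y p' g = p"
    and uw: "u \<in> Hom E F V" "w \<in> Hom E X' V" "cm X F V u i = cm X X' V w a"
  obtains h where "h \<in> Hom E F' V" "cm F F' V h g = u" "cm X' F' V h i' = w"
proof -
  interpret c: conflation E X i F p Y using assms(1) by (rule conflI)
  interpret c': conflation E X' i' F' p' Y using assms(2) by (rule conflI)
  obtain P j q k where P: "(X', j, P, q, Y) \<in> Confl E" "k \<in> Hom E F P" "cm F P Y q k = p"
    "cm X F P k i = cm X X' P j a"
    and ex: "\<And>W a' b. a' \<in> Hom E F W \<Longrightarrow> b \<in> Hom E X' W \<Longrightarrow> cm X F W a' i = cm X X' W b a \<Longrightarrow>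
      \<exists>u\<in>Hom E P W. cm F P W u k = a' \<and> cm X' P W u j = b"
    and jm: "\<And>W u. u \<in> Hom E P W \<Longrightarrow> cm F P W u k = 0 \<Longrightarrow> cm X' P W u j = 0 \<Longrightarrow> u = 0"
    using confl_pushout[OF assms(1,3)] by metis
  interpret P: conflation E X' j P q Y using P(1) by (rule conflI)
  obtain r where r: "r \<in> Hom E P F'" "cm F P F' r k = g" "cm X' P F' r j = i'"
    using ex[OF assms(4) c'.i assms(5)] by blast
  have "cm P F' Y p' r - q = 0"
    by (rule jm[where W = Y]) (use r P assms in simp_all)
  then have "is_iso E P F' r"
    by (intro five_lemma[OF P(1) assms(2) r(1)]) (use r in simp_all)
  then obtain s where s: "s \<in> Hom E F' P" "cm P F' P s r = Idm E P" "cm F' P F' r s = Idm E F'"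
    by (auto elim: is_isoE)
  obtain h where h: "h \<in> Hom E P V" "cm F P V h k = u" "cm X' P V h j = w"
    using ex[OF uw] by blast
  have "cm F F' V (cm F' P V h s) (cm F P F' r k) = u"
    using h s r(1) P(2) by (simp add: cm_red[OF s(2)])
  moreover have "cm X' F' V (cm F' P V h s) (cm X' P F' r j) = w"
    using h s r(1) P.i by (simp add: cm_red[OF s(2)])
  ultimately show thesis using that[of "cm F' P V h s"] h(1) s(1) r(2,3) by simp
qed

text \<open>Two conflations over the same map \<open>f\<close> are both pullbacks along \<open>f\<close>.\<close>

lemma pullback_unique:
  assumes "(X, i, F, p, Y) \<in> Confl E" "f \<in> Hom E Z Y"
    "(X, i1, F1, p1, Z) \<in> Confl E" "g1 \<in> Hom E F1 F" "cm X F1 F g1 i1 = i" "cm F1 F Y p g1 = cm F1 Z Y f p1"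
    "(X, i2, F2, p2, Z) \<in> Confl E" "g2 \<in> Hom E F2 F" "cm X F2 F g2 i2 = i" "cm F2 F Y p g2 = cm F2 Z Y f p2"
  obtains h where "is_iso E F1 F2 h" "cm X F1 F2 h i1 = i2" "cm F1 F2 Z p2 h = p1"
proof -
  interpret c: conflation E X i F p Y using assms(1) by (rule conflI)
  obtain P j q k where P: "(X, j, P, q, Z) \<in> Confl E" "k \<in> Hom E P F" "cm X P F k j = i"
    "cm P F Y p k = cm P Z Y f q"
    and ex: "\<And>W a b. a \<in> Hom E W F \<Longrightarrow> b \<in> Hom E W Z \<Longrightarrow> cm W F Y p a = cm W Z Y f b \<Longrightarrow>
      \<exists>u\<in>Hom E W P. cm W P F k u = a \<and> cm W P Z q u = b"
    and jm: "\<And>W u. u \<in> Hom E W P \<Longrightarrow> cm W P F k u = 0 \<Longrightarrow> cm W P Z q u = 0 \<Longrightarrow> u = 0"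
    using confl_pullback[OF assms(1,2)] by metis
  interpret P: conflation E X j P q Z using P(1) by (rule conflI)
  have iso: "\<exists>h. is_iso E G P h \<and> h \<in> Hom E G P \<and> cm X G P h i' = j \<and> cm G P Z q h = p'"
    if c': "(X, i', G, p', Z) \<in> Confl E" and g: "g \<in> Hom E G F" "cm X G F g i' = i" "cm G F Y p g = cm G Z Y f p'"
    for i' G p' g
  proof -
    interpret c': conflation E X i' G p' Z using c' by (rule conflI)
    obtain h where h: "h \<in> Hom E G P" "cm G P F k h = g" "cm G P Z q h = p'"
      using ex[OF g(1) c'.p g(3)] by blast
    have "cm X G P h i' - j = 0"
      by (rule jm[where W = X]) (use h P g in \<open>simp_all add: cm_red[OF h(2)] cm_red[OF h(3)] flip: cm_assoc\<close>)
    then show ?thesis using five_lemma[OF c' P(1) h(1)] h by auto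
  qed
  interpret c1: conflation E X i1 F1 p1 Z using assms(3) by (rule conflI)
  obtain h1 where h1: "is_iso E F1 P h1" "h1 \<in> Hom E F1 P" "cm X F1 P h1 i1 = j" "cm F1 P Z q h1 = p1"
    using iso[OF assms(3-6)] by blast
  interpret c2: conflation E X i2 F2 p2 Z using assms(7) by (rule conflI)
  obtain h2 where h2: "is_iso E F2 P h2" "h2 \<in> Hom E F2 P" "cm X F2 P h2 i2 = j" "cm F2 P Z q h2 = p2"
    using iso[OF assms(7-10)] by blast
  obtain s where s: "is_iso E P F2 s" "s \<in> Hom E P F2" "cm F2 P F2 s h2 = Idm E F2" "cm P F2 P h2 s = Idm E P"
    using is_iso_inv[OF h2(1)] by (metis is_isoE)
  have sj: "cm X P F2 s j = i2"
  proof -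
    have "cm X P F2 s (cm X F2 P h2 i2) = i2" using s h2(2) c2.i by (simp add: cm_red[OF s(3)])
    then show ?thesis using h2(3) by simp
  qed
  have ps: "cm P F2 Z p2 s = q"
  proof -
    have "cm P F2 Z (cm F2 P Z q h2) s = q" using s h2(2) by simp
    then show ?thesis using h2(4) by simp
  qed
  have "is_iso E F1 F2 (cm F1 P F2 s h1)" using h1(1) s(1) by (rule is_iso_comp)
  moreover have "cm X F1 F2 (cm F1 P F2 s h1) i1 = i2" using h1 s sj by simp
  moreover have "cm F1 F2 Z p2 (cm F1 P F2 s h1) = p1" using h1 s by (simp add: cm_red[OF ps])
  ultimately show thesis by (rule that)
qed

text \<open>The identity of \<open>A\<close> is an inflation; its conflation, pulled back along the
  zero map from \<open>B\<close>, has end terms \<open>A\<close> and \<open>B\<close> and a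
  retraction, hence splits. Its middle term is then isomorphic to the given biproduct.\<close>

lemma biproduct_confl:
  assumes "biproduct E A B S i1 i2 p1 p2"
  shows "(A, i1, S, p2, B) \<in> Confl E"
proof -
  interpret S: biprod E A B S i1 i2 p1 p2 using assms by unfold_locales
  obtain Z q where Z: "(A, Idm E A, A, q, Z) \<in> Confl E"
    using inflation_Idm[of A] unfolding inflation_def by blast
  interpret Z: conflation E A "Idm E A" A q Z using Z by (rule conflI)
  obtain P j r g where P: "(A, j, P, r, B) \<in> Confl E" "g \<in> Hom E P A" "cm A P A g j = Idm E A"
    using confl_pullback[OF Z hom_0[of B Z]] by metis
  interpret P: conflation E A j P r B using P(1) by (rule conflI)
  obtain s where "biproduct E A B P j s g r" using P.retraction_imp_section[OF P(2,3)] by blast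
  then interpret Q: biprod E A B P j s g r by unfold_locales
  define h where "h = cm P A S i1 g + cm P B S i2 r"
  define h' where "h' = cm S A P j p1 + cm S B P s p2"
  have h: "h \<in> Hom E P S" "h' \<in> Hom E S P" unfolding h_def h'_def by simp_all
  have "cm P S P h' h = Idm E P"
    unfolding h_def h'_def using Q.id_sum by simp
  moreover have "cm S P S h h' = Idm E S"
    unfolding h_def h'_def using S.id_sum by simp
  ultimately have "is_iso E P S h" using h by (intro is_isoI[of _ _ _ h']) auto
  then show ?thesis
    by (rule Confl_iso_cm[OF P(1) is_iso_id _ is_iso_id]) (simp_all add: h_def)
qed

section \<open>Vanishing of extensions\<close>

text \<open>Vanishing of Ext^1(S, X), phrased through splittings so that arguments about lifting and
  extending maps need not mention Yoneda classes.\<close>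

definition ext_van :: "'o \<Rightarrow> 'o \<Rightarrow> bool" where
  "ext_van S X \<longleftrightarrow> (\<forall>i F p. (X, i, F, p, S) \<in> Confl E \<longrightarrow> (\<exists>s\<in>Hom E S F. cm S F S p s = Idm E S))"

lemma ext_equiv_cm: "((i, F, p), (i', F', p')) \<in> ext_equiv E S X \<longleftrightarrow>
    (X, i, F, p, S) \<in> Confl E \<and> (X, i', F', p', S) \<in> Confl E \<and>
    (\<exists>h. is_iso E F F' h \<and> cm X F F' h i = i' \<and> cm F F' S p' h = p)"
  by (simp add: ext_equiv_def extensions_def cm_def)

lemma ext_equiv_refl: "(X, i, F, p, S) \<in> Confl E \<Longrightarrow> ((i, F, p), (i, F, p)) \<in> ext_equiv E S X"
proof -
  assume c: "(X, i, F, p, S) \<in> Confl E"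
  interpret c: conflation E X i F p S using c by (rule conflI)
  show ?thesis unfolding ext_equiv_cm using c is_iso_id[of F] by (auto intro!: exI[of _ "Idm E F"])
qed

lemma ext_equiv_sym: "(x, y) \<in> ext_equiv E S X \<Longrightarrow> (y, x) \<in> ext_equiv E S X"
proof -
  assume a: "(x, y) \<in> ext_equiv E S X"
  obtain i F p i' F' p' where xy: "x = (i, F, p)" "y = (i', F', p')" by (metis prod_cases3)
  obtain h where c: "(X, i, F, p, S) \<in> Confl E" "(X, i', F', p', S) \<in> Confl E"
    and h: "is_iso E F F' h" "cm X F F' h i = i'" "cm F F' S p' h = p"
    using a unfolding xy ext_equiv_cm by blast
  interpret c: conflation E X i F p S using c(1) by (rule conflI)
  interpret c': conflation E X i' F' p' S using c(2) by (rule conflI)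
  obtain g where g: "is_iso E F' F g" "cm F F' F g h = Idm E F" "cm F' F F' h g = Idm E F'"
    using is_iso_inv[OF h(1)] .
  have t: "h \<in> Hom E F F'" "g \<in> Hom E F' F" using h g by (auto simp: is_iso_cm)
  have "cm X F' F g (cm X F F' h i) = i" using t by (simp add: cm_red[OF g(2)])
  moreover have "cm F' F S (cm F F' S p' h) g = p'" using t g by simp
  ultimately show ?thesis unfolding xy ext_equiv_cm using c g h by auto
qed

lemma ext_equiv_trans: "(x, y) \<in> ext_equiv E S X \<Longrightarrow> (y, z) \<in> ext_equiv E S X \<Longrightarrow> (x, z) \<in> ext_equiv E S X"
proof -
  assume a: "(x, y) \<in> ext_equiv E S X" "(y, z) \<in> ext_equiv E S X"
  obtain i F p i' F' p' i'' F'' p'' where xy: "x = (i, F, p)" "y = (i', F', p')" "z = (i'', F'', p'')"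
    by (metis prod_cases3)
  obtain h where c: "(X, i, F, p, S) \<in> Confl E" "(X, i', F', p', S) \<in> Confl E"
    and h: "is_iso E F F' h" "cm X F F' h i = i'" "cm F F' S p' h = p"
    using a unfolding xy ext_equiv_cm by blast
  obtain k where c': "(X, i'', F'', p'', S) \<in> Confl E"
    and k: "is_iso E F' F'' k" "cm X F' F'' k i' = i''" "cm F' F'' S p'' k = p'"
    using a unfolding xy ext_equiv_cm by blast
  interpret c: conflation E X i F p S using c(1) by (rule conflI)
  interpret c': conflation E X i' F' p' S using c(2) by (rule conflI)
  interpret c'': conflation E X i'' F'' p'' S using c' by (rule conflI)
  have t: "h \<in> Hom E F F'" "k \<in> Hom E F' F''" using h k by (auto simp: is_iso_cm)
  have "cm X F F'' (cm F F' F'' k h) i = i''" using t h k by simp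
  moreover have "cm F F'' S p'' (cm F F' F'' k h) = p" using t h by (simp add: cm_red[OF k(3)])
  ultimately show ?thesis unfolding xy ext_equiv_cm using c(1) c' is_iso_comp[OF h(1) k(1)] by blast
qed

lemma ext_equiv_equiv: "equiv (extensions E S X) (ext_equiv E S X)"
proof (rule equivI)
  show "ext_equiv E S X \<subseteq> extensions E S X \<times> extensions E S X" by (auto simp: ext_equiv_def)
  show "refl_on (extensions E S X) (ext_equiv E S X)"
    by (rule refl_onI) (auto simp: extensions_def ext_equiv_refl)
  show "sym (ext_equiv E S X)" by (rule symI) (rule ext_equiv_sym)
  show "trans (ext_equiv E S X)" by (rule transI) (rule ext_equiv_trans)
qed

lemma split_ext_equiv:
  assumes "(X, i, F, p, S) \<in> Confl E" "s \<in> Hom E S F" "cm S F S p s = Idm E S"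
    "(X, i', F', p', S) \<in> Confl E" "s' \<in> Hom E S F'" "cm S F' S p' s' = Idm E S"
  shows "((i, F, p), (i', F', p')) \<in> ext_equiv E S X"
proof -
  interpret c: conflation E X i F p S using assms(1) by (rule conflI)
  interpret c': conflation E X i' F' p' S using assms(4) by (rule conflI)
  obtain r where "biproduct E X S F i s r p" using c.section_imp_retraction[OF assms(2,3)] .
  then interpret r: biprod E X S F i s r p by unfold_locales
  define h where "h = cm F X F' i' r + cm F S F' s' p"
  have h: "h \<in> Hom E F F'" "cm X F F' h i = i'" "cm F F' S p' h = p"
    unfolding h_def using assms(5) by (simp_all add: cm_red[OF assms(6)])
  then show ?thesis unfolding ext_equiv_cm using assms five_lemma[OF assms(1,4) h] by blast
qed

lemma split_equiv_split:
  assumes "((i, F, p), (i', F', p')) \<in> ext_equiv E S X" "s \<in> Hom E S F" "cm S F S p s = Idm E S"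
  shows "\<exists>s\<in>Hom E S F'. cm S F' S p' s = Idm E S"
proof -
  obtain h where h: "h \<in> Hom E F F'" "cm F F' S p' h = p" and c: "(X, i', F', p', S) \<in> Confl E"
    using assms(1) unfolding ext_equiv_cm is_iso_cm by blast
  interpret c: conflation E X i' F' p' S using c by (rule conflI)
  have "cm S F' S p' (cm S F F' h s) = Idm E S" using h assms by (simp add: cm_red[OF h(2)])
  then show ?thesis using h(1) assms(2) cm_in by blast
qed

lemma ext_zero_nonempty: obtains i F p s where "(i, F, p) \<in> ext_zero E S X" "(X, i, F, p, S) \<in> Confl E"
   "s \<in> Hom E S F" "cm S F S p s = Idm E S"
proof -
  obtain F i1 i2 p1 p2 where b: "biproduct E X S F i1 i2 p1 p2"
    using ex_direct_sum[of X S] unfolding direct_sum_def by blast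
  interpret b: biprod E X S F i1 i2 p1 p2 using b by unfold_locales
  have "(X, i1, F, p2, S) \<in> Confl E" using biproduct_confl[OF b] .
  moreover have "(i1, F, p2) \<in> ext_zero E S X"
    unfolding ext_zero_def using calculation
    by (simp add: extensions_def split_ext_cm) (intro bexI[of _ i2], simp_all)
  ultimately show thesis using that b.i2 b.p2_i2 by blast
qed

lemma ext_zero_in_Ext1: "ext_zero E S X \<in> Ext1 E S X"
proof -
  obtain i F p s where z: "(i, F, p) \<in> ext_zero E S X" "(X, i, F, p, S) \<in> Confl E"
   "s \<in> Hom E S F" "cm S F S p s = Idm E S" using ext_zero_nonempty .
  have "ext_zero E S X = ext_equiv E S X `` {(i, F, p)}"
  proof (intro equalityI subsetI)
    fix x assume x: "x \<in> ext_zero E S X"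
    obtain i' F' p' where "x = (i', F', p')" by (metis prod_cases3)
    then show "x \<in> ext_equiv E S X `` {(i, F, p)}"
      using x z split_ext_equiv by (auto simp: ext_zero_def extensions_def split_ext_cm)
  next
    fix x assume x: "x \<in> ext_equiv E S X `` {(i, F, p)}"
    obtain i' F' p' where xx: "x = (i', F', p')" by (metis prod_cases3)
    have r: "((i, F, p), (i', F', p')) \<in> ext_equiv E S X" using x xx by simp
    show "x \<in> ext_zero E S X"
      using split_equiv_split[OF r z(3,4)] r unfolding xx ext_equiv_cm
      by (auto simp: ext_zero_def extensions_def split_ext_cm)
  qed
  then show ?thesis unfolding Ext1_def quotient_def using z(2) by (auto simp: extensions_def)
qed

text \<open>The split extensions form exactly one equivalence class, which is not empty because
  direct sums exist; so \<open>Ext1\<close> reduces to this class precisely when every conflation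
  splits.\<close>

lemma ext_van_iff: "Ext1 E S X = {ext_zero E S X} \<longleftrightarrow> ext_van S X"
proof
  assume a: "Ext1 E S X = {ext_zero E S X}"
  show "ext_van S X"
    unfolding ext_van_def
  proof (intro allI impI)
    fix i F p assume c: "(X, i, F, p, S) \<in> Confl E"
    then have "ext_equiv E S X `` {(i, F, p)} \<in> Ext1 E S X"
      unfolding Ext1_def quotient_def by (auto simp: extensions_def)
    then have "ext_equiv E S X `` {(i, F, p)} = ext_zero E S X" using a by simp
    moreover have "(i, F, p) \<in> ext_equiv E S X `` {(i, F, p)}" using ext_equiv_refl[OF c] by simp
    ultimately have "(i, F, p) \<in> ext_zero E S X" by simp
    then show "\<exists>s\<in>Hom E S F. cm S F S p s = Idm E S" by (auto simp: ext_zero_def split_ext_cm)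
  qed
next
  assume a: "ext_van S X"
  have "C = ext_zero E S X" if C: "C \<in> Ext1 E S X" for C
  proof -
    obtain x where x: "C = ext_equiv E S X `` {x}" "x \<in> extensions E S X"
      using C unfolding Ext1_def quotient_def by blast
    obtain i F p where xx: "x = (i, F, p)" by (metis prod_cases3)
    have "x \<in> C" using x ext_equiv_refl unfolding xx by (auto simp: extensions_def)
    note x = this x(2)
    have "x \<in> ext_zero E S X" using x a xx
      by (auto simp: ext_zero_def extensions_def split_ext_cm ext_van_def)
    then show ?thesis using x that ext_zero_in_Ext1[of S X] quotient_disj[OF ext_equiv_equiv]
      unfolding Ext1_def by blast
  qed
  then show "Ext1 E S X = {ext_zero E S X}" using ext_zero_in_Ext1 by blast
qed

text \<open>The obstruction to lifting \<open>f\<close> is the pullback of the conflation along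
  \<open>f\<close>. A section of the pullback, followed by its map to \<open>F\<close>, is the lift.
  The next lemma is the dual statement, with a pushout and a retraction.\<close>

lemma ext_van_lift:
  assumes "(X, i, F, p, Y) \<in> Confl E" "ext_van Z X" "f \<in> Hom E Z Y"
  obtains g where "g \<in> Hom E Z F" "cm Z F Y p g = f"
proof -
  interpret c: conflation E X i F p Y using assms(1) by (rule conflI)
  obtain P j q g where P: "(X, j, P, q, Z) \<in> Confl E" "g \<in> Hom E P F" "cm P F Y p g = cm P Z Y f q"
    using confl_pullback[OF assms(1,3)] by metis
  interpret P: conflation E X j P q Z using P(1) by (rule conflI)
  obtain s where s: "s \<in> Hom E Z P" "cm Z P Z q s = Idm E Z" using assms(2) P(1) unfolding ext_van_def by blast
  have "cm Z F Y p (cm Z P F g s) = f" using s P assms(3) by (simp add: cm_red[OF P(3)])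
  then show thesis using that[of "cm Z P F g s"] s P by simp
qed

lemma ext_van_extend:
  assumes "(X, i, F, p, Y) \<in> Confl E" "ext_van Y Z" "f \<in> Hom E X Z"
  obtains g where "g \<in> Hom E F Z" "cm X F Z g i = f"
proof -
  interpret c: conflation E X i F p Y using assms(1) by (rule conflI)
  obtain P j q g where P: "(Z, j, P, q, Y) \<in> Confl E" "g \<in> Hom E F P" "cm X F P g i = cm X Z P j f"
    using confl_pushout[OF assms(1,3)] by metis
  interpret P: conflation E Z j P q Y using P(1) by (rule conflI)
  obtain s where s: "s \<in> Hom E Y P" "cm Y P Y q s = Idm E Y" using assms(2) P(1) unfolding ext_van_def by blast
  obtain r where r: "biproduct E Z Y P j s r q" using P.section_imp_retraction[OF s] .
  interpret r: biprod E Z Y P j s r q using r by unfold_locales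
  have "cm X F Z (cm F P Z r g) i = f" using s P assms(3) by simp
  then show thesis using that[of "cm F P Z r g"] P by simp
qed

lemma ext_vanI_retraction:
  assumes "\<And>i F p. (X, i, F, p, S) \<in> Confl E \<Longrightarrow> \<exists>r\<in>Hom E F X. cm X F X r i = Idm E X"
  shows "ext_van S X"
  unfolding ext_van_def
proof (intro allI impI)
  fix i F p assume c: "(X, i, F, p, S) \<in> Confl E"
  interpret c: conflation E X i F p S using c by (rule conflI)
  obtain r where "r \<in> Hom E F X" "cm X F X r i = Idm E X" using assms[OF c] by blast
  then obtain s where "biproduct E X S F i s r p" using c.retraction_imp_section by blast
  then interpret r: biprod E X S F i s r p by unfold_locales
  show "\<exists>s\<in>Hom E S F. cm S F S p s = Idm E S" using r.i2 r.p2_i2 by blast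
qed

lemma ext_van_sum:
  assumes "ext_van S A" "ext_van S B" "direct_sum E A B X"
  shows "ext_van S X"
proof -
  obtain i1 i2 p1 p2 where "biproduct E A B X i1 i2 p1 p2" using assms(3) unfolding direct_sum_def by blast
  then interpret b: biprod E A B X i1 i2 p1 p2 by unfold_locales
  show ?thesis
  proof (rule ext_vanI_retraction)
    fix i F p assume c: "(X, i, F, p, S) \<in> Confl E"
    interpret c: conflation E X i F p S using c by (rule conflI)
    obtain f where f: "f \<in> Hom E F A" "cm X F A f i = p1" using ext_van_extend[OF c assms(1) b.p1] .
    obtain g where g: "g \<in> Hom E F B" "cm X F B g i = p2" using ext_van_extend[OF c assms(2) b.p2] .
    have "cm X F X (cm F A X i1 f + cm F B X i2 g) i = Idm E X"
      using f g b.id_sum by simp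
    then show "\<exists>r\<in>Hom E F X. cm X F X r i = Idm E X" using f g by (intro bexI[of _ "cm F A X i1 f + cm F B X i2 g"]) simp_all
  qed
qed

lemma ext_van_summand:
  assumes "ext_van S X" "direct_sum E A B X"
  shows "ext_van S A"
proof -
  obtain i1 i2 p1 p2 where "biproduct E A B X i1 i2 p1 p2" using assms(2) unfolding direct_sum_def by blast
  then interpret b: biprod E A B X i1 i2 p1 p2 by unfold_locales
  show ?thesis
  proof (rule ext_vanI_retraction)
    fix i F p assume c: "(A, i, F, p, S) \<in> Confl E"
    interpret c: conflation E A i F p S using c by (rule conflI)
    obtain f where f: "f \<in> Hom E F X" "cm A F X f i = i1" using ext_van_extend[OF c assms(1) b.i1] .
    have "cm A F A (cm F X A p1 f) i = Idm E A" using f by simp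
    then show "\<exists>r\<in>Hom E F A. cm A F A r i = Idm E A" using f by (intro bexI[of _ "cm F X A p1 f"]) simp_all
  qed
qed

lemma ext_van_zero: "is_zero E Z \<Longrightarrow> ext_van S Z"
proof (rule ext_vanI_retraction)
  fix i F p assume Z: "is_zero E Z" and c: "(Z, i, F, p, S) \<in> Confl E"
  interpret c: conflation E Z i F p S using c by (rule conflI)
  show "\<exists>r\<in>Hom E F Z. cm Z F Z r i = Idm E Z"
    using Z by (intro bexI[of _ 0]) (simp_all add: is_zero_iff)
qed

lemma ext_van_injective: "injective E Q \<Longrightarrow> ext_van S Q"
proof (rule ext_vanI_retraction)
  fix i F p assume Q: "injective E Q" and c: "(Q, i, F, p, S) \<in> Confl E"
  then show "\<exists>r\<in>Hom E F Q. cm Q F Q r i = Idm E Q"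
    unfolding injective_def inflation_def cm_def using id_in[of Q] by blast
qed

lemma ext_van_projective: "projective E P \<Longrightarrow> ext_van P X"
  unfolding ext_van_def projective_def deflation_def cm_def using id_in[of P] by blast

end

section \<open>Grothendieck groups\<close>

locale grothendieck =
  fixes A :: "'a set" and R :: "('a \<Rightarrow>\<^sub>0 int) set"
  assumes rel_keys: "r \<in> R \<Longrightarrow> Poly_Mapping.keys r \<subseteq> A"
begin

abbreviation "F \<equiv> free_Abelian_group A"
abbreviation "rel \<equiv> generate F R"
abbreviation "G \<equiv> grothendieck_group A R"

text \<open>Calculations take place with formal sums in additive notation; \<open>cl\<close> passes
  to the multiplicatively written quotient only at the end.\<close>

definition cl :: "('a \<Rightarrow>\<^sub>0 int) \<Rightarrow> ('a \<Rightarrow>\<^sub>0 int) set" where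
  "cl e = rel #>\<^bsub>F\<^esub> e"

lemma class_eq: "grothendieck_class A R x = cl (frag_of x)"
  by (simp add: grothendieck_class_def cl_def)

lemma R_carrier: "R \<subseteq> carrier F"
  using rel_keys by auto

lemma rel_subgroup: "subgroup rel F"
  using group.generate_is_subgroup[OF group_free_Abelian_group R_carrier] .

lemma rel_normal: "rel \<lhd> F"
  using comm_group.subgroup_imp_normal[OF abelian_free_Abelian_group rel_subgroup] .

lemma rel_keysD: "r \<in> rel \<Longrightarrow> Poly_Mapping.keys r \<subseteq> A"
  using subgroup.mem_carrier[OF rel_subgroup] by fastforce

lemma rel_0: "0 \<in> rel"
  using generate.one[of F R] by simp

lemma rel_incl: "r \<in> R \<Longrightarrow> r \<in> rel"
  by (rule generate.incl)

lemma rel_add: "x \<in> rel \<Longrightarrow> y \<in> rel \<Longrightarrow> x + y \<in> rel"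
  using generate.eng[of x F R y] by simp

lemma rel_neg: "x \<in> rel \<Longrightarrow> - x \<in> rel"
  using group.generate_m_inv_closed[OF group_free_Abelian_group R_carrier, of x] rel_keysD by simp

lemma rel_diff: "x \<in> rel \<Longrightarrow> y \<in> rel \<Longrightarrow> x - y \<in> rel"
  using rel_add[of x "- y"] rel_neg by simp

lemma comm_group_G: "comm_group G"
  unfolding grothendieck_group_def
  using comm_group.abelian_FactGroup[OF abelian_free_Abelian_group rel_subgroup] .

lemma group_G: "group G"
  using comm_group_G comm_group.axioms(2) by blast

lemma cl_hom: "cl \<in> hom F G"
  using normal.r_coset_hom_Mod[OF rel_normal] unfolding cl_def[abs_def] grothendieck_group_def .

lemma carrier_G: "carrier G = cl ` {e. Poly_Mapping.keys e \<subseteq> A}"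
  unfolding grothendieck_group_def carrier_FactGroup cl_def by (auto simp: free_Abelian_group_def)

lemma cl_closed: "Poly_Mapping.keys e \<subseteq> A \<Longrightarrow> cl e \<in> carrier G"
  unfolding carrier_G by blast

lemma class_closed: "x \<in> A \<Longrightarrow> grothendieck_class A R x \<in> carrier G"
  unfolding class_eq by (rule cl_closed) simp

lemma cl_add: "Poly_Mapping.keys e \<subseteq> A \<Longrightarrow> Poly_Mapping.keys e' \<subseteq> A \<Longrightarrow> cl (e + e') = cl e \<otimes>\<^bsub>G\<^esub> cl e'"
  using hom_mult[OF cl_hom, of e e'] by simp

lemma cl_neg: "Poly_Mapping.keys e \<subseteq> A \<Longrightarrow> cl (- e) = inv\<^bsub>G\<^esub> cl e"
  using group_hom.hom_inv[OF group_hom.intro[OF group_free_Abelian_group group_G], of A cl e] cl_hom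
  by (simp add: group_hom_axioms_def)

lemma cl_diff: "Poly_Mapping.keys e \<subseteq> A \<Longrightarrow> Poly_Mapping.keys e' \<subseteq> A \<Longrightarrow>
    cl (e - e') = cl e \<otimes>\<^bsub>G\<^esub> inv\<^bsub>G\<^esub> cl e'"
  using cl_add[of e "- e'"] cl_neg[of e'] by simp

lemma cl_cong:
  assumes "Poly_Mapping.keys e' \<subseteq> A" "e - e' \<in> rel"
  shows "cl e = cl e'"
proof -
  have "e \<in> rel #>\<^bsub>F\<^esub> e'" unfolding r_coset_def using assms(2) by (auto intro!: bexI[of _ "e - e'"])
  then show ?thesis unfolding cl_def
    using group.repr_independence[OF group_free_Abelian_group _ _ rel_subgroup, of e e'] assms(1) by simp
qed

lemma group_homI: "group H \<Longrightarrow> h \<in> hom G H \<Longrightarrow> group_hom G H h"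
  using group_G by (simp add: group_hom_def group_hom_axioms_def)

lemma hom_diff:
  assumes "group H" "h \<in> hom G H" "u \<in> carrier G" "v \<in> carrier G"
  shows "h (u \<otimes>\<^bsub>G\<^esub> inv\<^bsub>G\<^esub> v) = h u \<otimes>\<^bsub>H\<^esub> inv\<^bsub>H\<^esub> h v"
proof -
  interpret h: group_hom G H h using assms by (intro group_homI)
  show ?thesis using assms(3,4) by simp
qed

lemma G_induct [consumes 1, case_names one diff cls]:
  assumes "u \<in> carrier G"
    and one: "P \<one>\<^bsub>G\<^esub>"
    and diff: "\<And>u v. u \<in> carrier G \<Longrightarrow> v \<in> carrier G \<Longrightarrow> P u \<Longrightarrow> P v \<Longrightarrow> P (u \<otimes>\<^bsub>G\<^esub> inv\<^bsub>G\<^esub> v)"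
    and gen: "\<And>x. x \<in> A \<Longrightarrow> P (grothendieck_class A R x)"
  shows "P u"
proof -
  have "P (cl e)" if "Poly_Mapping.keys e \<subseteq> A" for e
  proof (rule free_Abelian_group_induct[OF that])
    show "P (cl 0)" using one group_hom.hom_one[of F G cl] cl_hom group_G
      by (simp add: group_hom_def group_hom_axioms_def)
    show "P (cl (x - y))" if "Poly_Mapping.keys x \<subseteq> A" "Poly_Mapping.keys y \<subseteq> A" "P (cl x)" "P (cl y)" for x y
      using that diff cl_diff cl_closed by simp
    show "P (cl (frag_of x))" if "x \<in> A" for x
      using that gen class_eq by simp
  qed
  then show ?thesis using assms(1) unfolding carrier_G by blast
qed

lemma hom_ext:
  assumes "group H" "h \<in> hom G H" "h' \<in> hom G H"
    and "\<And>x. x \<in> A \<Longrightarrow> h (grothendieck_class A R x) = h' (grothendieck_class A R x)"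
    and "u \<in> carrier G"
  shows "h u = h' u"
proof -
  interpret h: group_hom G H h using assms(1,2) by (intro group_homI)
  interpret h': group_hom G H h' using assms(1,3) by (intro group_homI)
  show ?thesis using assms(5) by (induction rule: G_induct) (auto simp: assms(4))
qed

text \<open>Fixing the shape of the relations makes additivity of \<open>f\<close> on the triples of
  \<open>Q\<close> the only condition to check. This covers both the split relations and those from
  short exact sequences of modules.\<close>

lemma hom_exists:
  assumes H: "comm_group H" and f: "\<And>x. x \<in> A \<Longrightarrow> f x \<in> carrier H"
    and R: "R = {frag_of S - frag_of X - frag_of Y | X Y S. Q X Y S}"
    and Q: "\<And>X Y S. Q X Y S \<Longrightarrow> X \<in> A \<and> Y \<in> A \<and> S \<in> A \<and> f S = f X \<otimes>\<^bsub>H\<^esub> f Y"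
  obtains h where "h \<in> hom G H" "\<And>x. x \<in> A \<Longrightarrow> h (grothendieck_class A R x) = f x"
proof -
  interpret H: comm_group H by fact
  obtain h where h: "h \<in> hom F H" "\<And>x. x \<in> A \<Longrightarrow> h (frag_of x) = f x"
    using H.free_Abelian_group_universal[of f A] f by blast
  interpret h: group_hom F H h using h(1) by (simp add: group_hom_def group_hom_axioms_def)
  have hd: "h (x - y) = h x \<otimes>\<^bsub>H\<^esub> inv\<^bsub>H\<^esub> h y" if "Poly_Mapping.keys x \<subseteq> A" "Poly_Mapping.keys y \<subseteq> A" for x y
  proof -
    have "h (x - y) = h x \<otimes>\<^bsub>H\<^esub> h (- y)" using h.hom_mult[of x "- y"] that by simp
    moreover have "h (- y) = inv\<^bsub>H\<^esub> h y" using h.hom_inv[of y] that by simp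
    ultimately show ?thesis by simp
  qed
  have "h r = \<one>\<^bsub>H\<^esub>" if r: "r \<in> R" for r
  proof -
    obtain X Y S where s: "r = frag_of S - frag_of X - frag_of Y" "Q X Y S" using r unfolding R by blast
    note q = Q[OF s(2)]
    have k: "Poly_Mapping.keys (frag_of S - frag_of X) \<subseteq> A" using q keys_diff[of "frag_of S" "frag_of X"] by auto
    have "h r = f S \<otimes>\<^bsub>H\<^esub> inv\<^bsub>H\<^esub> f X \<otimes>\<^bsub>H\<^esub> inv\<^bsub>H\<^esub> f Y"
      unfolding s(1) using q h(2) hd k by simp
    also have "\<dots> = \<one>\<^bsub>H\<^esub>" using q f by (metis H.inv_closed H.m_assoc H.m_closed H.m_comm H.r_inv H.r_one H.inv_mult)
    finally show ?thesis .
  qed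
  then have "R \<subseteq> kernel F H h" using R_carrier unfolding kernel_def by blast
  then have "rel \<subseteq> kernel F H h"
    using h.subgroup_kernel h.generate_subgroup_incl by blast
  then obtain g where g: "g \<in> hom (F Mod rel) H" "\<And>x. x \<in> carrier F \<Longrightarrow> g (r_coset F rel x) = h x"
    using h.FactGroup_universal_kernel[OF rel_normal] by blast
  show thesis
    by (rule that[of g]) (use g h in \<open>auto simp: grothendieck_group_def grothendieck_class_def\<close>)
qed

end

section \<open>Resolutions by objects of a subcategory closed under sums\<close>

locale sum_closed = additive_category E
  for E :: "('o, 'm::ab_group_add, 'k::field) exact_cat" +
  fixes \<T> :: "'o set"
  assumes zero_mem: "is_zero E Z \<Longrightarrow> Z \<in> \<T>"
    and sum_mem: "A \<in> \<T> \<Longrightarrow> B \<in> \<T> \<Longrightarrow> direct_sum E A B S \<Longrightarrow> S \<in> \<T>"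
begin

sublocale K0: grothendieck \<T> "split_relations E \<T>"
proof
  fix r assume "r \<in> split_relations E \<T>"
  then obtain S A B where s: "r = frag_of S - frag_of A - frag_of B" "S \<in> \<T>" "A \<in> \<T>" "B \<in> \<T>"
    unfolding split_relations_def by blast
  then show "Poly_Mapping.keys r \<subseteq> \<T>"
    using keys_diff[of "frag_of S - frag_of A" "frag_of B"] keys_diff[of "frag_of S" "frag_of A"] by auto
qed

text \<open>Equality of classes in \<open>K0\<close>, kept at the level of formal sums.\<close>

definition keq :: "('o \<Rightarrow>\<^sub>0 int) \<Rightarrow> ('o \<Rightarrow>\<^sub>0 int) \<Rightarrow> bool" where
  "keq e e' \<longleftrightarrow> e - e' \<in> K0.rel"

lemma keq_refl [simp]: "keq e e"
  by (simp add: keq_def K0.rel_0)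

lemma keq_sym: "keq e e' \<Longrightarrow> keq e' e"
  unfolding keq_def using K0.rel_neg by fastforce

lemma keq_trans: "keq e e' \<Longrightarrow> keq e' e'' \<Longrightarrow> keq e e''"
  unfolding keq_def using K0.rel_add[of "e - e'" "e' - e''"] by simp

lemma keq_add: "keq e e' \<Longrightarrow> keq f f' \<Longrightarrow> keq (e + f) (e' + f')"
  unfolding keq_def using K0.rel_add[of "e - e'" "f - f'"] by (simp add: algebra_simps)

lemma keq_diff: "keq e e' \<Longrightarrow> keq f f' \<Longrightarrow> keq (e - f) (e' - f')"
  unfolding keq_def using K0.rel_diff[of "e - e'" "f - f'"] by (simp add: algebra_simps)

lemma keq_sum:
  assumes "A \<in> \<T>" "B \<in> \<T>" "direct_sum E A B S"
  shows "keq (frag_of S) (frag_of A + frag_of B)"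
proof -
  have "frag_of S - frag_of A - frag_of B \<in> split_relations E \<T>"
    unfolding split_relations_def using assms sum_mem by blast
  then show ?thesis unfolding keq_def using K0.rel_incl by (metis diff_diff_eq)
qed

lemma keq_zero:
  assumes "is_zero E Z" shows "keq (frag_of Z) 0"
proof -
  have "keq (frag_of Z) (frag_of Z + frag_of Z)"
    using keq_sum[of Z Z Z] direct_sum_iso_zero[OF iso_obj_refl assms] zero_mem[OF assms] by blast
  then show ?thesis unfolding keq_def using K0.rel_neg by fastforce
qed

lemma keq_iso:
  assumes "iso_obj E A B" "B \<in> \<T>"
  shows "keq (frag_of A) (frag_of B)"
proof -
  obtain Z where Z: "is_zero E Z" using ex_zero by blast
  have "keq (frag_of A) (frag_of B + frag_of Z)"
    using keq_sum[OF assms(2) zero_mem[OF Z]] direct_sum_iso_zero[OF assms(1) Z] by blast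
  moreover have "keq (frag_of B + frag_of Z) (frag_of B + 0)"
    using keq_add[OF keq_refl keq_zero[OF Z]] .
  ultimately show ?thesis using keq_trans by simp
qed

text \<open>\<open>N\<close> is a family of subgroups of \<open>Hom E S G\<close> (think of the kernel of a map from the
  functor \<open>Hom E _ G\<close> on \<open>\<T>\<close>), and \<open>tres n G N e\<close> says that \<open>Hom E _ G\<close> modulo \<open>N\<close> has a
  resolution of length \<open>n\<close> by representable functors, ending in \<open>Hom E _ G\<close>, with Euler
  characteristic \<open>e\<close>.\<close>

primrec tres :: "nat \<Rightarrow> 'o \<Rightarrow> ('o \<Rightarrow> 'm set) \<Rightarrow> ('o \<Rightarrow>\<^sub>0 int) \<Rightarrow> bool" where
  "tres 0 G N e \<longleftrightarrow> G \<in> \<T> \<and> (\<forall>S\<in>\<T>. N S = {0}) \<and> e = frag_of G"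
| "tres (Suc n) G N e \<longleftrightarrow> G \<in> \<T> \<and> (\<exists>R r e'. r \<in> Hom E R G \<and> (\<forall>S\<in>\<T>. N S = cm S R G r ` Hom E S R) \<and>
     tres n R (\<lambda>S. {f \<in> Hom E S R. cm S R G r f = 0}) e' \<and> e = frag_of G - e')"

definition subfun :: "('o \<Rightarrow> 'm set) \<Rightarrow> 'o \<Rightarrow> bool" where
  "subfun N G \<longleftrightarrow> (\<forall>S\<in>\<T>. N S \<subseteq> Hom E S G \<and> 0 \<in> N S \<and> (\<forall>x\<in>N S. \<forall>y\<in>N S. x + y \<in> N S \<and> x - y \<in> N S) \<and>
     (\<forall>S'\<in>\<T>. \<forall>x\<in>N S. \<forall>f\<in>Hom E S' S. cm S' S G x f \<in> N S'))"

lemma subfunD: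
  assumes "subfun N G" "S \<in> \<T>"
  shows "x \<in> N S \<Longrightarrow> x \<in> Hom E S G" "0 \<in> N S" "x \<in> N S \<Longrightarrow> y \<in> N S \<Longrightarrow> x + y \<in> N S"
    "x \<in> N S \<Longrightarrow> y \<in> N S \<Longrightarrow> x - y \<in> N S"
    "S' \<in> \<T> \<Longrightarrow> x \<in> N S \<Longrightarrow> f \<in> Hom E S' S \<Longrightarrow> cm S' S G x f \<in> N S'"
  using assms unfolding subfun_def by blast+

lemma subfun_ker: "r \<in> Hom E R G \<Longrightarrow> subfun (\<lambda>S. {f \<in> Hom E S R. cm S R G r f = 0}) R"
  unfolding subfun_def by (auto simp flip: cm_assoc)

lemma tres_mem: "tres n G N e \<Longrightarrow> G \<in> \<T>"
  by (cases n) auto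

lemma tres_keys: "tres n G N e \<Longrightarrow> Poly_Mapping.keys e \<subseteq> \<T>"
proof (induction n arbitrary: G N e)
  case (Suc n)
  then obtain R N' e' where "tres n R N' e'" "e = frag_of G - e'" "G \<in> \<T>" by auto
  then show ?case using Suc.IH keys_diff[of "frag_of G" e'] by fastforce
qed auto

lemma tres_cong: "tres n G N e \<Longrightarrow> (\<And>S. S \<in> \<T> \<Longrightarrow> N S = N' S) \<Longrightarrow> tres n G N' e"
  by (cases n) auto

text \<open>A zero object is appended at the far end. The horseshoe lemma asks for equal lengths,
  while in the Schanuel argument one summand is a representable functor, whose own resolution has
  length zero.\<close>

lemma tres_pad: "tres n G N e \<Longrightarrow> \<exists>e'. tres (Suc n) G N e' \<and> keq e' e"
proof (induction n arbitrary: G N e)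
  case 0
  obtain Z where Z: "is_zero E Z" using ex_zero by blast
  have "{f \<in> Hom E S Z. cm S Z G 0 f = 0} = {0}" "cm S Z G 0 ` Hom E S Z = {0}" for S
    using Z unfolding is_zero_def by auto
  then have "tres (Suc 0) G N (frag_of G - frag_of Z)"
    using 0 zero_mem[OF Z] by (auto intro!: exI[of _ Z] exI[of _ 0])
  moreover have "keq (frag_of G - frag_of Z) (frag_of G - 0)"
    by (intro keq_diff keq_refl keq_zero Z)
  moreover have "e = frag_of G" using 0 by simp
  ultimately show ?case by (metis diff_zero)
next
  case (Suc n)
  then obtain R r e' where R: "G \<in> \<T>" "r \<in> Hom E R G" "\<forall>S\<in>\<T>. N S = cm S R G r ` Hom E S R"
     "tres n R (\<lambda>S. {f \<in> Hom E S R. cm S R G r f = 0}) e'" "e = frag_of G - e'" by auto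
  obtain e'' where e: "tres (Suc n) R (\<lambda>S. {f \<in> Hom E S R. cm S R G r f = 0}) e''" "keq e'' e'"
    using Suc.IH[OF R(4)] by blast
  have "tres (Suc (Suc n)) G N (frag_of G - e'')"
    unfolding tres.simps(2)[of "Suc n" G] using R e by blast
  moreover have "keq (frag_of G - e'') e" unfolding R(5) using e(2) by (intro keq_diff keq_refl)
  ultimately show ?case by blast
qed

lemma tres_object: "G \<in> \<T> \<Longrightarrow> \<exists>e. tres n G (\<lambda>S. {0}) e \<and> keq e (frag_of G)"
proof (induction n)
  case (Suc n)
  then show ?case using tres_pad keq_trans by blast
qed auto

text \<open>The last three hypotheses express that 0 -> N1 -> N -> N3 -> 0 is exact. The map
  \<open>r3\<close> is lifted to \<open>N\<close>, which gives a map from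
  \<open>R1 \<oplus> R3\<close> onto \<open>N\<close>, and the kernels of the three maps form an
  exact sequence of the same kind.\<close>

lemma tres_horseshoe:
  assumes "tres n G1 N1 e1" "tres n G3 N3 e3" "biproduct E G1 G3 G i1 i3 p1 p3" "subfun N G"
    and "\<And>S f. S \<in> \<T> \<Longrightarrow> f \<in> Hom E S G1 \<Longrightarrow> cm S G1 G i1 f \<in> N S \<longleftrightarrow> f \<in> N1 S"
    and "\<And>S h. S \<in> \<T> \<Longrightarrow> h \<in> N S \<Longrightarrow> cm S G G3 p3 h \<in> N3 S"
    and "\<And>S g. S \<in> \<T> \<Longrightarrow> g \<in> N3 S \<Longrightarrow> \<exists>h\<in>N S. cm S G G3 p3 h = g"
  shows "\<exists>e. tres n G N e \<and> keq e (e1 + e3)"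
  using assms
proof (induction n arbitrary: G1 N1 e1 G3 N3 e3 G i1 i3 p1 p3 N)
  case 0
  interpret b: biprod E G1 G3 G i1 i3 p1 p3 using 0(3) by unfold_locales
  have G: "G \<in> \<T>" "keq (frag_of G) (e1 + e3)"
    using 0(1,2) sum_mem[OF _ _ b.direct_sum] keq_sum[OF _ _ b.direct_sum] by simp_all
  have "N S = {0}" if S: "S \<in> \<T>" for S
  proof -
    have "h = 0" if h: "h \<in> N S" for h
    proof -
      have hh: "h \<in> Hom E S G" using subfunD(1)[OF 0(4) S h] .
      have "cm S G G3 p3 h = 0" using 0(6)[OF S h] 0(2) S by auto
      then have "h = cm S G1 G i1 (cm S G G1 p1 h)" using b.decomp[OF hh] hh by simp
      moreover have "cm S G G1 p1 h = 0"
        using 0(5)[OF S, of "cm S G G1 p1 h"] calculation h hh 0(1) S by auto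
      ultimately show ?thesis by simp
    qed
    then show ?thesis using subfunD(2)[OF 0(4) S] by auto
  qed
  then show ?case using G by auto
next
  case (Suc n)
  interpret b: biprod E G1 G3 G i1 i3 p1 p3 using Suc.prems(3) by unfold_locales
  obtain R1 r1 e1' where R1: "G1 \<in> \<T>" "r1 \<in> Hom E R1 G1" "\<forall>S\<in>\<T>. N1 S = cm S R1 G1 r1 ` Hom E S R1"
     "tres n R1 (\<lambda>S. {f \<in> Hom E S R1. cm S R1 G1 r1 f = 0}) e1'" "e1 = frag_of G1 - e1'"
    using Suc.prems(1) by auto
  obtain R3 r3 e3' where R3: "G3 \<in> \<T>" "r3 \<in> Hom E R3 G3" "\<forall>S\<in>\<T>. N3 S = cm S R3 G3 r3 ` Hom E S R3"
     "tres n R3 (\<lambda>S. {f \<in> Hom E S R3. cm S R3 G3 r3 f = 0}) e3'" "e3 = frag_of G3 - e3'"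
    using Suc.prems(2) by auto
  have RT: "R1 \<in> \<T>" "R3 \<in> \<T>" using tres_mem R1(4) R3(4) by auto
  have "r3 \<in> N3 R3" using R3 RT by (auto intro!: image_eqI[of _ _ "Idm E R3"])
  then obtain h3 where h3: "h3 \<in> N R3" "cm R3 G G3 p3 h3 = r3" using Suc.prems(7) RT by blast
  have h3h: "h3 \<in> Hom E R3 G" using subfunD(1)[OF Suc.prems(4) RT(2) h3(1)] .
  obtain R j1 j3 q1 q3 where R: "biproduct E R1 R3 R j1 j3 q1 q3"
    using ex_direct_sum unfolding direct_sum_def by blast
  interpret R: biprod E R1 R3 R j1 j3 q1 q3 using R by unfold_locales
  define r where "r = cm R R1 G (cm R1 G1 G i1 r1) q1 + cm R R3 G h3 q3"
  have r: "r \<in> Hom E R G" unfolding r_def using R1(2) h3h by simp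
  have p3r: "cm S G G3 p3 (cm S R G r x) = cm S R3 G3 r3 (cm S R R3 q3 x)" if "x \<in> Hom E S R" for S x
    unfolding r_def using that R1(2) h3h by (simp add: cm_red[OF h3(2)])
  have N: "N S = cm S R G r ` Hom E S R" if S: "S \<in> \<T>" for S
  proof (intro equalityI subsetI)
    fix h assume h: "h \<in> N S"
    have hh: "h \<in> Hom E S G" using subfunD(1)[OF Suc.prems(4) S h] .
    obtain y where y: "y \<in> Hom E S R3" "cm S R3 G3 r3 y = cm S G G3 p3 h"
      using Suc.prems(6)[OF S h] R3(3) S by auto
    define k where "k = h - cm S R3 G h3 y"
    have k: "k \<in> Hom E S G" unfolding k_def using hh h3h y by simp
    have kN: "k \<in> N S" unfolding k_def
      using subfunD(4)[OF Suc.prems(4) S h] subfunD(5)[OF Suc.prems(4) RT(2) S h3(1) y(1)] by blast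
    have "cm S G G3 p3 k = 0" unfolding k_def using hh h3h y by (simp add: cm_red[OF h3(2)])
    then have keq: "k = cm S G1 G i1 (cm S G G1 p1 k)" using b.decomp[OF k] k by simp
    then have "cm S G G1 p1 k \<in> N1 S" using Suc.prems(5)[OF S, of "cm S G G1 p1 k"] kN k by auto
    then obtain x where x: "x \<in> Hom E S R1" "cm S R1 G1 r1 x = cm S G G1 p1 k" using R1(3) S by auto
    have "cm S R G r (cm S R1 R j1 x + cm S R3 R j3 y) = cm S G1 G i1 (cm S R1 G1 r1 x) + cm S R3 G h3 y"
      unfolding r_def using x(1) y(1) R1(2) h3h by simp
    also have "\<dots> = h" using keq x(2) unfolding k_def by simp
    finally show "h \<in> cm S R G r ` Hom E S R"
      using x y by (intro image_eqI[of _ _ "cm S R1 R j1 x + cm S R3 R j3 y"]) simp_all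
  next
    fix h assume "h \<in> cm S R G r ` Hom E S R"
    then obtain x where x: "x \<in> Hom E S R" "h = cm S R G r x" by blast
    have "cm S R1 G1 r1 (cm S R R1 q1 x) \<in> N1 S" using R1(3) S x(1) by auto
    then have "cm S G1 G i1 (cm S R1 G1 r1 (cm S R R1 q1 x)) \<in> N S"
      using Suc.prems(5)[OF S, of "cm S R1 G1 r1 (cm S R R1 q1 x)"] x(1) R1(2) by auto
    moreover have "cm S R3 G h3 (cm S R R3 q3 x) \<in> N S"
      using subfunD(5)[OF Suc.prems(4) RT(2) S h3(1)] x(1) by simp
    ultimately have "cm S G1 G i1 (cm S R1 G1 r1 (cm S R R1 q1 x)) + cm S R3 G h3 (cm S R R3 q3 x) \<in> N S"
      by (rule subfunD(3)[OF Suc.prems(4) S])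
    then show "h \<in> N S" unfolding x(2) r_def using x(1) R1(2) h3h by simp
  qed
  have "\<exists>e. tres n R (\<lambda>S. {f \<in> Hom E S R. cm S R G r f = 0}) e \<and> keq e (e1' + e3')"
  proof (rule Suc.IH[OF R1(4) R3(4) R subfun_ker[OF r]])
    fix S f assume S: "S \<in> \<T>" and f: "f \<in> Hom E S R1"
    have "cm S R G r (cm S R1 R j1 f) = cm S G1 G i1 (cm S R1 G1 r1 f)"
      unfolding r_def using f R1(2) h3h by simp
    moreover have "cm S G1 G i1 (cm S R1 G1 r1 f) = 0 \<longleftrightarrow> cm S R1 G1 r1 f = 0"
      using b.p1_i1_comp[of "cm S R1 G1 r1 f" S] f R1(2) by fastforce
    ultimately show "cm S R1 R j1 f \<in> {f \<in> Hom E S R. cm S R G r f = 0} \<longleftrightarrow> f \<in> {f \<in> Hom E S R1. cm S R1 G1 r1 f = 0}"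
      using f by simp
  next
    fix S h assume S: "S \<in> \<T>" and h: "h \<in> {f \<in> Hom E S R. cm S R G r f = 0}"
    then have "cm S R3 G3 r3 (cm S R R3 q3 h) = 0" using p3r[of h S] by simp
    then show "cm S R R3 q3 h \<in> {f \<in> Hom E S R3. cm S R3 G3 r3 f = 0}" using h by simp
  next
    fix S y assume S: "S \<in> \<T>" and "y \<in> {f \<in> Hom E S R3. cm S R3 G3 r3 f = 0}"
    then have y: "y \<in> Hom E S R3" "cm S R3 G3 r3 y = 0" by auto
    \<comment> \<open>As in the snake lemma: \<open>k\<close> lies in \<open>N\<close> and dies
      under \<open>p3\<close>, so it comes from \<open>N1\<close>, hence from some \<open>x\<close>
      in \<open>R1\<close>; subtracting \<open>x\<close> corrects the lift of \<open>y\<close> to an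
      element of the kernel.\<close>
    define k where "k = cm S R3 G h3 y"
    have k: "k \<in> Hom E S G" "k \<in> N S" unfolding k_def
      using subfunD(5)[OF Suc.prems(4) RT(2) S h3(1)] y h3h by simp_all
    have "cm S G G3 p3 k = 0" unfolding k_def using h3h y by (simp add: cm_red[OF h3(2)])
    then have keq: "k = cm S G1 G i1 (cm S G G1 p1 k)" using b.decomp[OF k(1)] k by simp
    then have "cm S G G1 p1 k \<in> N1 S" using Suc.prems(5)[OF S, of "cm S G G1 p1 k"] k by auto
    then obtain x where x: "x \<in> Hom E S R1" "cm S R1 G1 r1 x = cm S G G1 p1 k" using R1(3) S by auto
    have "cm S R G r (cm S R3 R j3 y - cm S R1 R j1 x) = cm S R3 G h3 y - cm S G1 G i1 (cm S R1 G1 r1 x)"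
      unfolding r_def using x(1) y(1) R1(2) h3h by simp
    also have "\<dots> = 0" using keq x(2) unfolding k_def by simp
    finally show "\<exists>h\<in>{f \<in> Hom E S R. cm S R G r f = 0}. cm S R R3 q3 h = y"
      using x y by (intro bexI[of _ "cm S R3 R j3 y - cm S R1 R j1 x"]) simp_all
  qed
  then obtain e where e: "tres n R (\<lambda>S. {f \<in> Hom E S R. cm S R G r f = 0}) e" "keq e (e1' + e3')" by blast
  have G: "G \<in> \<T>" "keq (frag_of G) (frag_of G1 + frag_of G3)"
    using R1(1) R3(1) sum_mem[OF _ _ b.direct_sum] keq_sum[OF _ _ b.direct_sum] by simp_all
  have "tres (Suc n) G N (frag_of G - e)" using G(1) r N e(1) by auto
  moreover have "keq (frag_of G - e) (e1 + e3)"
    using keq_diff[OF G(2) e(2)] unfolding R1(5) R3(5) by (simp add: algebra_simps)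
  ultimately show ?case by blast
qed

text \<open>Generalised Schanuel lemma: a resolution \<open>R \<rightarrow> G\<close> and a resolution \<open>R' \<rightarrow> G'\<close> of the same
  functor are compared one step further up, on \<open>R \<oplus> G'\<close> and \<open>R' \<oplus> G\<close>.\<close>

lemma tres_compare:
  assumes "tres n G N e" "tres n G' N' e'" "subfun N G" "subfun N' G'"
    "a \<in> Hom E G' G" "b \<in> Hom E G G'"
    "\<And>S f. S \<in> \<T> \<Longrightarrow> f \<in> N S \<Longrightarrow> cm S G G' b f \<in> N' S"
    "\<And>S f. S \<in> \<T> \<Longrightarrow> f \<in> N' S \<Longrightarrow> cm S G' G a f \<in> N S"
    "Idm E G - cm G G' G a b \<in> N G" "Idm E G' - cm G' G G' b a \<in> N' G'"
  shows "keq e e'"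
  using assms
proof (induction n arbitrary: G N e G' N' e' a b)
  case 0
  then have "cm G G' G a b = Idm E G" "cm G' G G' b a = Idm E G'" by auto
  then have "iso_obj E G G'" unfolding iso_obj_def is_iso_cm using 0(5,6) by blast
  then show ?case using 0(1,2) keq_iso by auto
next
  case (Suc n)
  note ab = Suc.prems(5,6)
  obtain R r d where R: "G \<in> \<T>" "r \<in> Hom E R G" "\<forall>S\<in>\<T>. N S = cm S R G r ` Hom E S R"
     "tres n R (\<lambda>S. {f \<in> Hom E S R. cm S R G r f = 0}) d" "e = frag_of G - d"
    using Suc.prems(1) by auto
  obtain R' r' d' where R': "G' \<in> \<T>" "r' \<in> Hom E R' G'" "\<forall>S\<in>\<T>. N' S = cm S R' G' r' ` Hom E S R'"
     "tres n R' (\<lambda>S. {f \<in> Hom E S R'. cm S R' G' r' f = 0}) d'" "e' = frag_of G' - d'"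
    using Suc.prems(2) by auto
  have RT: "R \<in> \<T>" "R' \<in> \<T>" using tres_mem R(4) R'(4) by auto
  have rN: "r \<in> N R" "r' \<in> N' R'"
    using R(2,3) R'(2,3) RT image_eqI[of r "cm R R G r" "Idm E R" "Hom E R R"]
      image_eqI[of r' "cm R' R' G' r'" "Idm E R'" "Hom E R' R'"] by simp_all
  obtain W j1 j2 k1 k2 where W: "biproduct E R G' W j1 j2 k1 k2"
    using ex_direct_sum unfolding direct_sum_def by blast
  interpret W: biprod E R G' W j1 j2 k1 k2 using W by unfold_locales
  obtain W' l1 l2 q1 q2 where W': "biproduct E R' G W' l1 l2 q1 q2"
    using ex_direct_sum unfolding direct_sum_def by blast
  interpret W': biprod E R' G W' l1 l2 q1 q2 using W' by unfold_locales
  have WT: "W \<in> \<T>" "W' \<in> \<T>" 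
    using sum_mem[OF _ _ W.direct_sum] sum_mem[OF _ _ W'.direct_sum] R(1) R'(1) RT by simp_all
  \<comment> \<open>\<open>M\<close> is the kernel of \<open>r\<close> placed in the first summand
    of \<open>W\<close>, so \<open>Hom E _ W\<close> modulo \<open>M\<close> is the direct sum of
    \<open>N\<close> and \<open>Hom E _ G'\<close>. Likewise \<open>W'\<close> modulo
    \<open>M'\<close> is the sum of \<open>N'\<close> and \<open>Hom E _ G\<close>.\<close>
  define M where "M = (\<lambda>S. {h \<in> Hom E S W. cm S W G' k2 h = 0 \<and> cm S R G r (cm S W R k1 h) = 0})"
  define M' where "M' = (\<lambda>S. {h \<in> Hom E S W'. cm S W' G q2 h = 0 \<and> cm S R' G' r' (cm S W' R' q1 h) = 0})"
  have sM: "subfun M W"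
    unfolding M_def subfun_def using R(2) by (auto simp flip: cm_assoc)
  have sM': "subfun M' W'"
    unfolding M'_def subfun_def using R'(2) by (auto simp flip: cm_assoc)
  obtain g' where g': "tres n G' (\<lambda>S. {0}) g'" "keq g' (frag_of G')" using tres_object[OF R'(1)] by blast
  obtain g where g: "tres n G (\<lambda>S. {0}) g" "keq g (frag_of G)" using tres_object[OF R(1)] by blast
  have "\<exists>m. tres n W M m \<and> keq m (d + g')"
  proof (rule tres_horseshoe[OF R(4) g'(1) W sM])
    fix S f assume S: "S \<in> \<T>" "f \<in> Hom E S R"
    then show "cm S R W j1 f \<in> M S \<longleftrightarrow> f \<in> {f \<in> Hom E S R. cm S R G r f = 0}" by (simp add: M_def)
  next
    fix S h show "h \<in> M S \<Longrightarrow> cm S W G' k2 h \<in> {0}" by (simp add: M_def)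
  next
    fix S and h :: 'm show "h \<in> {0} \<Longrightarrow> \<exists>h'\<in>M S. cm S W G' k2 h' = h"
      using R(2) by (auto simp: M_def intro!: exI[of _ 0])
  qed
  then obtain m where m: "tres n W M m" "keq m (d + g')" by blast
  have "\<exists>m. tres n W' M' m \<and> keq m (d' + g)"
  proof (rule tres_horseshoe[OF R'(4) g(1) W' sM'])
    fix S f assume S: "S \<in> \<T>" "f \<in> Hom E S R'"
    then show "cm S R' W' l1 f \<in> M' S \<longleftrightarrow> f \<in> {f \<in> Hom E S R'. cm S R' G' r' f = 0}" by (simp add: M'_def)
  next
    fix S h show "h \<in> M' S \<Longrightarrow> cm S W' G q2 h \<in> {0}" by (simp add: M'_def)
  next
    fix S and h :: 'm show "h \<in> {0} \<Longrightarrow> \<exists>h'\<in>M' S. cm S W' G q2 h' = h"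
      using R'(2) by (auto simp: M'_def intro!: exI[of _ 0])
  qed
  then obtain m' where m': "tres n W' M' m'" "keq m' (d' + g)" by blast
  \<comment> \<open>The Schanuel isomorphism from N' + G to N + G' sends (n', g) to (g - a y, y)
    with y = n' + b g; its inverse sends (n, g') to (g' - b z, z) with z = n + a g'. Below,
    \<open>x\<close> and \<open>x'\<close> lift the first components to \<open>R\<close> and
    \<open>R'\<close>, and \<open>A\<close>, \<open>B\<close> are the resulting maps between
    \<open>W'\<close> and \<open>W\<close>.\<close>
  define y where "y = cm W' R' G' r' q1 + cm W' G G' b q2"
  define z where "z = cm W R G r k1 + cm W G' G a k2"
  have yz: "y \<in> Hom E W' G'" "z \<in> Hom E W G" unfolding y_def z_def using R(2) R'(2) ab by simp_all
  have "q2 - cm W' G' G a y = cm W' G G (Idm E G - cm G G' G a b) q2 - cm W' G' G a (cm W' R' G' r' q1)"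
    unfolding y_def using R'(2) ab by simp
  moreover have "cm W' G G (Idm E G - cm G G' G a b) q2 \<in> N W'"
    using subfunD(5)[OF Suc.prems(3) R(1) WT(2) Suc.prems(9)] by simp
  moreover have "cm W' G' G a (cm W' R' G' r' q1) \<in> N W'"
    using Suc.prems(8)[OF WT(2)] subfunD(5)[OF Suc.prems(4) RT(2) WT(2) rN(2)] by simp
  ultimately have "q2 - cm W' G' G a y \<in> N W'" using subfunD(4)[OF Suc.prems(3) WT(2)] by simp
  then obtain x where x: "x \<in> Hom E W' R" "cm W' R G r x = q2 - cm W' G' G a y"
    using R(3) WT(2) by auto
  have "k2 - cm W G G' b z = cm W G' G' (Idm E G' - cm G' G G' b a) k2 - cm W G G' b (cm W R G r k1)"
    unfolding z_def using R(2) ab by simp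
  moreover have "cm W G' G' (Idm E G' - cm G' G G' b a) k2 \<in> N' W"
    using subfunD(5)[OF Suc.prems(4) R'(1) WT(1) Suc.prems(10)] by simp
  moreover have "cm W G G' b (cm W R G r k1) \<in> N' W"
    using Suc.prems(7)[OF WT(1)] subfunD(5)[OF Suc.prems(3) RT(1) WT(1) rN(1)] by simp
  ultimately have "k2 - cm W G G' b z \<in> N' W" using subfunD(4)[OF Suc.prems(4) WT(1)] by simp
  then obtain x' where x': "x' \<in> Hom E W R'" "cm W R' G' r' x' = k2 - cm W G G' b z"
    using R'(3) WT(1) by auto
  define A where "A = cm W' R W j1 x + cm W' G' W j2 y"
  define B where "B = cm W R' W' l1 x' + cm W G W' l2 z"
  have AB: "A \<in> Hom E W' W" "B \<in> Hom E W W'" unfolding A_def B_def using x x' yz by simp_all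
  have cA: "cm W' W R k1 A = x" "cm W' W G' k2 A = y" unfolding A_def using x yz by simp_all
  have cB: "cm W W' R' q1 B = x'" "cm W W' G q2 B = z" unfolding B_def using x' yz by simp_all
  have yB: "cm W W' G' y B = k2"
    unfolding y_def using AB R'(2) ab by (simp add: cB x'(2))
  have zA: "cm W' W G z A = q2"
    unfolding z_def using AB R(2) ab by (simp add: cA x(2))
  have "keq m m'"
  proof (rule Suc.IH[OF m(1) m'(1) sM sM' AB])
    fix S f assume S: "S \<in> \<T>" "f \<in> M S"
    then have f: "f \<in> Hom E S W" "cm S W G' k2 f = 0" "cm S R G r (cm S W R k1 f) = 0" by (auto simp: M_def)
    have "cm S W G z f = 0" unfolding z_def using f R(2) ab by simp
    then have "cm S W R' x' f \<in> Hom E S R'" "cm S R' G' r' (cm S W R' x' f) = 0"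
      using f x'(1) R'(2) ab yz by (simp_all add: cm_red[OF x'(2)])
    with \<open>cm S W G z f = 0\<close> show "cm S W W' B f \<in> M' S"
      unfolding M'_def using f AB by (simp add: cm_red[OF cB(1)] cm_red[OF cB(2)])
  next
    fix S f assume S: "S \<in> \<T>" "f \<in> M' S"
    then have f: "f \<in> Hom E S W'" "cm S W' G q2 f = 0" "cm S R' G' r' (cm S W' R' q1 f) = 0" by (auto simp: M'_def)
    have "cm S W' G' y f = 0" unfolding y_def using f R'(2) ab by simp
    then have "cm S W' R x f \<in> Hom E S R" "cm S R G r (cm S W' R x f) = 0"
      using f x(1) R(2) ab yz by (simp_all add: cm_red[OF x(2)])
    with \<open>cm S W' G' y f = 0\<close> show "cm S W' W A f \<in> M S"
      unfolding M_def using f AB by (simp add: cm_red[OF cA(1)] cm_red[OF cA(2)])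
  next
    have "cm W W G' k2 (Idm E W - cm W W' W A B) = 0"
      using AB by (simp add: cm_red[OF cA(2)] yB)
    moreover have "cm W R G r (cm W W R k1 (Idm E W - cm W W' W A B)) = 0"
      using AB x(1) R(2) yz ab by (simp add: cm_red[OF cA(1)] cm_red[OF x(2)] cB yB) (simp add: z_def)
    ultimately show "Idm E W - cm W W' W A B \<in> M W" unfolding M_def using AB by simp
  next
    have "cm W' W' G q2 (Idm E W' - cm W' W W' B A) = 0"
      using AB by (simp add: cm_red[OF cB(2)] zA)
    moreover have "cm W' R' G' r' (cm W' W' R' q1 (Idm E W' - cm W' W W' B A)) = 0"
      using AB x'(1) R'(2) yz ab by (simp add: cm_red[OF cB(1)] cm_red[OF x'(2)] cA zA) (simp add: y_def)
    ultimately show "Idm E W' - cm W' W W' B A \<in> M' W'" unfolding M'_def using AB by simp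
  qed
  then have "keq (d + frag_of G') (d' + frag_of G)"
    using keq_trans[OF keq_sym[OF keq_trans[OF m(2) keq_add[OF keq_refl g'(2)]]]]
      keq_trans[OF m'(2) keq_add[OF keq_refl g(2)]] keq_trans by blast
  then have "keq (frag_of G + d') (frag_of G' + d)" using keq_sym by (simp add: add.commute)
  then show ?case unfolding R(5) R'(5) keq_def by (simp add: algebra_simps)
qed

end

section \<open>Dimensions of morphism spaces\<close>

locale hom_finite_category = linear_category E
  for E :: "('o, 'm::ab_group_add, 'k::field) exact_cat" +
  assumes hom_finite: "hom_finite E"
begin

lemma hom_basis: obtains B where "finite B" "vs.span B = Hom E X Y"
  using hom_finite unfolding hom_finite_def by blast

lemma rank_nullity:
  assumes "vs.subspace V" "V \<subseteq> Hom E X Y"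
    and "\<And>x y. x \<in> V \<Longrightarrow> y \<in> V \<Longrightarrow> f (x + y) = f x + f y"
    and "\<And>c x. x \<in> V \<Longrightarrow> f (Scale E c x) = Scale E c (f x)"
  shows "vs.dim V = vs.dim {x \<in> V. f x = 0} + vs.dim (f ` V)"
proof -
  interpret vp: vector_space_pair "Scale E" "Scale E" by unfold_locales
  obtain B where B: "finite B" "vs.span B = Hom E X Y" by (rule hom_basis)
  obtain b where b: "finite b" "vs.span b = V"
    using vs.finite_span_subspace[OF B assms(1,2)] by metis
  show ?thesis by (rule vp.rank_nullity_on[OF b assms(3,4)])
qed

lemma dim_0 [simp]: "vs.dim {0} = 0"
  using vs.dim_span_eq_card_independent[OF vs.independent_empty] by simp

lemma dim_image_inj:
  assumes "\<And>x y. x \<in> Hom E X Y \<Longrightarrow> y \<in> Hom E X Y \<Longrightarrow> f (x + y) = f x + f y"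
    and "\<And>c x. x \<in> Hom E X Y \<Longrightarrow> f (Scale E c x) = Scale E c (f x)"
    and "\<And>x. x \<in> Hom E X Y \<Longrightarrow> f x = 0 \<Longrightarrow> x = 0" and "f 0 = 0"
  shows "vs.dim (f ` Hom E X Y) = hom_dim E X Y"
proof -
  have "{x \<in> Hom E X Y. f x = 0} = {0}" using assms(3,4) hom_0 by blast
  then show ?thesis using rank_nullity[OF subspace_Hom order_refl assms(1,2)] unfolding hom_dim_def by simp
qed

lemma hom_dim_sum_left:
  assumes "direct_sum E A B S" shows "hom_dim E S Y = hom_dim E A Y + hom_dim E B Y"
proof -
  obtain i1 i2 p1 p2 where "biproduct E A B S i1 i2 p1 p2" using assms unfolding direct_sum_def by blast
  then interpret b: biprod E A B S i1 i2 p1 p2 by unfold_locales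
  have "vs.dim (Hom E S Y) = vs.dim {x \<in> Hom E S Y. cm A S Y x i1 = 0} + vs.dim ((\<lambda>x. cm A S Y x i1) ` Hom E S Y)"
    by (rule rank_nullity[OF subspace_Hom order_refl]) simp_all
  moreover have "(\<lambda>x. cm A S Y x i1) ` Hom E S Y = Hom E A Y"
  proof (intro equalityI subsetI)
    fix x assume "x \<in> Hom E A Y"
    then show "x \<in> (\<lambda>x. cm A S Y x i1) ` Hom E S Y" by (intro image_eqI[of _ _ "cm S A Y x p1"]) simp_all
  qed auto
  moreover have "{x \<in> Hom E S Y. cm A S Y x i1 = 0} = (\<lambda>x. cm S B Y x p2) ` Hom E B Y"
  proof (intro equalityI subsetI)
    fix x assume "x \<in> {x \<in> Hom E S Y. cm A S Y x i1 = 0}"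
    then have x: "x \<in> Hom E S Y" "cm A S Y x i1 = 0" by auto
    then have "x = cm S B Y (cm B S Y x i2) p2" using b.codecomp[OF x(1)] by simp
    then show "x \<in> (\<lambda>x. cm S B Y x p2) ` Hom E B Y" using x by (intro image_eqI[of _ _ "cm B S Y x i2"]) simp_all
  qed auto
  moreover have "vs.dim ((\<lambda>x. cm S B Y x p2) ` Hom E B Y) = hom_dim E B Y"
  proof (rule dim_image_inj)
    fix x assume x: "x \<in> Hom E B Y" "cm S B Y x p2 = 0"
    have "cm B S Y (cm S B Y x p2) i2 = x" using x(1) by simp
    then show "x = 0" using x(2) by simp
  qed simp_all
  ultimately show ?thesis unfolding hom_dim_def by simp
qed

lemma hom_dim_sum_right:
  assumes "direct_sum E A B S" shows "hom_dim E Y S = hom_dim E Y A + hom_dim E Y B"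
proof -
  obtain i1 i2 p1 p2 where "biproduct E A B S i1 i2 p1 p2" using assms unfolding direct_sum_def by blast
  then interpret b: biprod E A B S i1 i2 p1 p2 by unfold_locales
  have "vs.dim (Hom E Y S) = vs.dim {x \<in> Hom E Y S. cm Y S A p1 x = 0} + vs.dim ((\<lambda>x. cm Y S A p1 x) ` Hom E Y S)"
    by (rule rank_nullity[OF subspace_Hom order_refl]) simp_all
  moreover have "(\<lambda>x. cm Y S A p1 x) ` Hom E Y S = Hom E Y A"
  proof (intro equalityI subsetI)
    fix x assume "x \<in> Hom E Y A"
    then show "x \<in> (\<lambda>x. cm Y S A p1 x) ` Hom E Y S" by (intro image_eqI[of _ _ "cm Y A S i1 x"]) simp_all
  qed auto
  moreover have "{x \<in> Hom E Y S. cm Y S A p1 x = 0} = (\<lambda>x. cm Y B S i2 x) ` Hom E Y B"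
  proof (intro equalityI subsetI)
    fix x assume "x \<in> {x \<in> Hom E Y S. cm Y S A p1 x = 0}"
    then have x: "x \<in> Hom E Y S" "cm Y S A p1 x = 0" by auto
    then have "x = cm Y B S i2 (cm Y S B p2 x)" using b.decomp[OF x(1)] by simp
    then show "x \<in> (\<lambda>x. cm Y B S i2 x) ` Hom E Y B" using x by (intro image_eqI[of _ _ "cm Y S B p2 x"]) simp_all
  qed auto
  moreover have "vs.dim ((\<lambda>x. cm Y B S i2 x) ` Hom E Y B) = hom_dim E Y B"
  proof (rule dim_image_inj)
    fix x assume x: "x \<in> Hom E Y B" "cm Y B S i2 x = 0"
    have "cm Y S B p2 (cm Y B S i2 x) = x" using x(1) by simp
    then show "x = 0" using x(2) by simp
  qed simp_all
  ultimately show ?thesis unfolding hom_dim_def by simp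
qed

end

locale hom_finite_exact = hom_finite_category E + exact_category E
  for E :: "('o, 'm::ab_group_add, 'k::field) exact_cat"
begin

text \<open>Only left exactness enters, so the dimension of the image stays as a term. The image is
  all of \<open>Hom E S Y\<close> when Ext^1(S, X) vanishes, and consists of the maps through
  projectives when \<open>F\<close> is projective.\<close>

lemma dim_ker_post:
  assumes "(X, i, F, p, Y) \<in> Confl E"
  shows "hom_dim E S F = hom_dim E S X + vs.dim (cm S F Y p ` Hom E S F)"
proof -
  interpret c: conflation E X i F p Y using assms by (rule conflI)
  have "vs.dim (Hom E S F) = vs.dim {x \<in> Hom E S F. cm S F Y p x = 0} + vs.dim (cm S F Y p ` Hom E S F)"
    by (rule rank_nullity[OF subspace_Hom order_refl]) simp_all
  moreover have "{x \<in> Hom E S F. cm S F Y p x = 0} = cm S X F i ` Hom E S X"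
    using c.lift by (auto simp: image_iff) (metis (no_types))
  moreover have "vs.dim (cm S X F i ` Hom E S X) = hom_dim E S X"
    by (rule dim_image_inj) (use c.mono in simp_all)
  ultimately show ?thesis unfolding hom_dim_def by simp
qed

lemma dim_ker_pre:
  assumes "(X, i, F, p, Y) \<in> Confl E"
  shows "hom_dim E F S = hom_dim E Y S + vs.dim ((\<lambda>f. cm X F S f i) ` Hom E F S)"
proof -
  interpret c: conflation E X i F p Y using assms by (rule conflI)
  have "vs.dim (Hom E F S) = vs.dim {x \<in> Hom E F S. cm X F S x i = 0} + vs.dim ((\<lambda>f. cm X F S f i) ` Hom E F S)"
    by (rule rank_nullity[OF subspace_Hom order_refl]) simp_all
  moreover have "{x \<in> Hom E F S. cm X F S x i = 0} = (\<lambda>f. cm F Y S f p) ` Hom E Y S"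
    using c.colift by (auto simp: image_iff) (metis (no_types))
  moreover have "vs.dim ((\<lambda>f. cm F Y S f p) ` Hom E Y S) = hom_dim E Y S"
    by (rule dim_image_inj) (use c.epi in simp_all)
  ultimately show ?thesis unfolding hom_dim_def by simp
qed

lemma hom_dim_exact_post:
  assumes "(X, i, F, p, Y) \<in> Confl E" "ext_van S X"
  shows "hom_dim E S F = hom_dim E S X + hom_dim E S Y"
proof -
  interpret c: conflation E X i F p Y using assms(1) by (rule conflI)
  have "cm S F Y p ` Hom E S F = Hom E S Y"
    using ext_van_lift[OF assms] by (auto simp: image_iff)
  then show ?thesis using dim_ker_post[OF assms(1), of S] unfolding hom_dim_def by simp
qed

lemma hom_dim_exact_pre:
  assumes "(X, i, F, p, Y) \<in> Confl E" "ext_van Y S"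
  shows "hom_dim E F S = hom_dim E Y S + hom_dim E X S"
proof -
  interpret c: conflation E X i F p Y using assms(1) by (rule conflI)
  have "(\<lambda>f. cm X F S f i) ` Hom E F S = Hom E X S"
    using ext_van_extend[OF assms] by (auto simp: image_iff)
  then show ?thesis using dim_ker_pre[OF assms(1), of S] unfolding hom_dim_def by simp
qed

text \<open>Both sides compute the dimension of the space of morphisms between the two conflations,
  parametrised by their middle components.\<close>

lemma balance:
  assumes K: "(K, i, R, p, X) \<in> Confl E" and T: "(T, j, Q, q, S) \<in> Confl E"
    and vR: "ext_van R T" and vX: "ext_van X Q"
  shows "hom_dim E K T + hom_dim E X Q = hom_dim E X S + hom_dim E R T"
proof -
  interpret k: conflation E K i R p X using K by (rule conflI)
  interpret t: conflation E T j Q q S using T by (rule conflI)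
  define V where "V = {r \<in> Hom E R Q. cm K Q S q (cm K R Q r i) = 0}"
  have V: "vs.subspace V" "V \<subseteq> Hom E R Q" unfolding V_def vs.subspace_def by auto
  \<comment> \<open>First count, by restriction to \<open>K\<close>: the kernel is
    \<open>Hom E X Q\<close>, and every map from \<open>K\<close> to \<open>T\<close> occurs because
    Ext^1(X, Q) vanishes.\<close>
  have "vs.dim V = vs.dim {r \<in> V. cm K R Q r i = 0} + vs.dim ((\<lambda>r. cm K R Q r i) ` V)"
    by (rule rank_nullity[OF V]) (use V in \<open>auto simp: subset_iff\<close>)
  moreover have "{r \<in> V. cm K R Q r i = 0} = (\<lambda>x. cm R X Q x p) ` Hom E X Q"
    unfolding V_def using k.colift by (auto simp: image_iff) metis
  moreover have "(\<lambda>r. cm K R Q r i) ` V = cm K T Q j ` Hom E K T"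
  proof (intro equalityI subsetI)
    fix x assume "x \<in> (\<lambda>r. cm K R Q r i) ` V"
    then obtain r where r: "r \<in> Hom E R Q" "cm K Q S q x = 0" "x = cm K R Q r i"
      unfolding V_def by auto
    have "x \<in> Hom E K Q" using r(1,3) by simp
    then obtain a where "a \<in> Hom E K T" "cm K T Q j a = x" using r(2) by (rule t.lift)
    then show "x \<in> cm K T Q j ` Hom E K T" by blast
  next
    fix x assume "x \<in> cm K T Q j ` Hom E K T"
    then obtain a where a: "a \<in> Hom E K T" "x = cm K T Q j a" by blast
    then obtain r where r: "r \<in> Hom E R Q" "cm K R Q r i = x" using ext_van_extend[OF K vX, of x] by auto
    then have "r \<in> V" unfolding V_def using a by simp
    then show "x \<in> (\<lambda>r. cm K R Q r i) ` V" using r by blast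
  qed
  moreover have "vs.dim ((\<lambda>x. cm R X Q x p) ` Hom E X Q) = hom_dim E X Q"
    by (rule dim_image_inj) (use k.epi in simp_all)
  moreover have "vs.dim (cm K T Q j ` Hom E K T) = hom_dim E K T"
    by (rule dim_image_inj) (use t.mono in simp_all)
  ultimately have 1: "vs.dim V = hom_dim E X Q + hom_dim E K T" by simp
  \<comment> \<open>Second count, by composition with \<open>q\<close>: the kernel is
    \<open>Hom E R T\<close>, and every map from \<open>X\<close> to \<open>S\<close> occurs because
    Ext^1(R, T) vanishes.\<close>
  have "vs.dim V = vs.dim {r \<in> V. cm R Q S q r = 0} + vs.dim (cm R Q S q ` V)"
    by (rule rank_nullity[OF V]) (use V in \<open>auto simp: subset_iff\<close>)
  moreover have "{r \<in> V. cm R Q S q r = 0} = cm R T Q j ` Hom E R T"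
  proof (intro equalityI subsetI)
    fix x assume "x \<in> {r \<in> V. cm R Q S q r = 0}"
    then have "x \<in> Hom E R Q" "cm R Q S q x = 0" using V(2) by auto
    then obtain a where "a \<in> Hom E R T" "cm R T Q j a = x" by (rule t.lift)
    then show "x \<in> cm R T Q j ` Hom E R T" by blast
  next
    fix x assume "x \<in> cm R T Q j ` Hom E R T"
    then show "x \<in> {r \<in> V. cm R Q S q r = 0}" unfolding V_def by auto
  qed
  moreover have "cm R Q S q ` V = (\<lambda>x. cm R X S x p) ` Hom E X S"
  proof (intro equalityI subsetI)
    fix x assume "x \<in> cm R Q S q ` V"
    then obtain r where r: "r \<in> Hom E R Q" "cm K Q S q (cm K R Q r i) = 0" "x = cm R Q S q r"
      unfolding V_def by auto
    have "x \<in> Hom E R S" "cm K R S x i = 0" using r by simp_all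
    then obtain a where "a \<in> Hom E X S" "cm R X S a p = x" by (rule k.colift)
    then show "x \<in> (\<lambda>x. cm R X S x p) ` Hom E X S" by blast
  next
    fix x assume "x \<in> (\<lambda>x. cm R X S x p) ` Hom E X S"
    then obtain a where a: "a \<in> Hom E X S" "x = cm R X S a p" by blast
    then obtain r where r: "r \<in> Hom E R Q" "cm R Q S q r = x" using ext_van_lift[OF T vR, of x] by auto
    have "cm K R S (cm R Q S q r) i = 0" unfolding r(2) a(2) using a(1) by simp
    then have "r \<in> V" unfolding V_def using r(1) by simp
    then show "x \<in> cm R Q S q ` V" using r by blast
  qed
  moreover have "vs.dim (cm R T Q j ` Hom E R T) = hom_dim E R T"
    by (rule dim_image_inj) (use t.mono in simp_all)
  moreover have "vs.dim ((\<lambda>x. cm R X S x p) ` Hom E X S) = hom_dim E X S"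
    by (rule dim_image_inj) (use k.epi in simp_all)
  ultimately have 2: "vs.dim V = hom_dim E R T + hom_dim E X S" by simp
  show ?thesis using 1 2 by simp
qed

end

section \<open>Stable dimensions and the Calabi--Yau property\<close>

locale frobenius_cy = hom_finite_exact E
  for E :: "('o, 'm::ab_group_add, 'k::field) exact_cat" +
  assumes frobenius: "frobenius E" and calabi_yau: "stable_two_calabi_yau E"
begin

lemma projective_iff_injective: "projective E X \<longleftrightarrow> injective E X"
  using frobenius unfolding frobenius_def by blast

lemma proj_maps_cm: "proj_maps E X Y = {cm X P Y g f | f g P. projective E P \<and> f \<in> Hom E X P \<and> g \<in> Hom E P Y}"
  unfolding proj_maps_def cm_def ..

text \<open>A map from a projective to \<open>Y\<close> lifts along \<open>p\<close>, so one fixed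
  projective suffices for all factorisations. This also shows that the maps through projectives form
  a subspace, which is not apparent from their definition.\<close>

lemma proj_maps_target:
  assumes "(K, i, P, p, Y) \<in> Confl E" "projective E P"
  shows "proj_maps E X Y = cm X P Y p ` Hom E X P"
proof (intro equalityI subsetI)
  interpret c: conflation E K i P p Y using assms(1) by (rule conflI)
  fix x assume "x \<in> proj_maps E X Y"
  then obtain f g Q where x: "x = cm X Q Y g f" "projective E Q" "f \<in> Hom E X Q" "g \<in> Hom E Q Y"
    unfolding proj_maps_cm by blast
  obtain h where h: "h \<in> Hom E Q P" "cm Q P Y p h = g"
    using ext_van_lift[OF assms(1) ext_van_projective[OF x(2)] x(4)] .
  have "x = cm X P Y p (cm X Q P h f)" unfolding x(1) using h x by (simp flip: h(2))
  then show "x \<in> cm X P Y p ` Hom E X P" using h x by simp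
next
  interpret c: conflation E K i P p Y using assms(1) by (rule conflI)
  fix x assume "x \<in> cm X P Y p ` Hom E X P"
  then show "x \<in> proj_maps E X Y" unfolding proj_maps_cm using assms(2) c.p by blast
qed

lemma proj_maps_source:
  assumes "(X, i, Q, p, C) \<in> Confl E" "injective E Q"
  shows "proj_maps E X Y = (\<lambda>g. cm X Q Y g i) ` Hom E Q Y"
proof (intro equalityI subsetI)
  interpret c: conflation E X i Q p C using assms(1) by (rule conflI)
  fix x assume "x \<in> proj_maps E X Y"
  then obtain f g P where x: "x = cm X P Y g f" "projective E P" "f \<in> Hom E X P" "g \<in> Hom E P Y"
    unfolding proj_maps_cm by blast
  then have "ext_van C P" using ext_van_injective projective_iff_injective by blast
  then obtain h where h: "h \<in> Hom E Q P" "cm X Q P h i = f"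
    using ext_van_extend[OF assms(1) _ x(3)] by blast
  have "x = cm X Q Y (cm Q P Y g h) i" unfolding x(1) using h x by simp
  then show "x \<in> (\<lambda>g. cm X Q Y g i) ` Hom E Q Y" by (rule image_eqI) (use h(1) x(4) in simp)
next
  interpret c: conflation E X i Q p C using assms(1) by (rule conflI)
  fix x assume "x \<in> (\<lambda>g. cm X Q Y g i) ` Hom E Q Y"
  then show "x \<in> proj_maps E X Y" unfolding proj_maps_cm using assms(2) projective_iff_injective c.i by blast
qed

lemma projective_cover: obtains K i P p where "(K, i, P, p, Y) \<in> Confl E" "projective E P"
  using frobenius unfolding frobenius_def deflation_def by metis

lemma proj_maps_subspace: "vs.subspace (proj_maps E X Y)" "proj_maps E X Y \<subseteq> Hom E X Y"
proof -
  obtain K i P p where c: "(K, i, P, p, Y) \<in> Confl E" "projective E P" by (rule projective_cover)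
  interpret c: conflation E K i P p Y using c(1) by (rule conflI)
  note e = proj_maps_target[OF c]
  show "proj_maps E X Y \<subseteq> Hom E X Y" unfolding e by auto
  show "vs.subspace (proj_maps E X Y)" unfolding e by (rule subspace_image_Hom) simp_all
qed

text \<open>The dimension of the morphism space in the stable category, as a difference because that
  space is only a set of cosets.\<close>

definition sdim :: "'o \<Rightarrow> 'o \<Rightarrow> int" where
  "sdim X Y = int (hom_dim E X Y) - int (vs.dim (proj_maps E X Y))"

lemma sdim_target:
  assumes "(T, j, Q, q, S) \<in> Confl E" "injective E Q"
  shows "sdim X S = int (hom_dim E X S) - int (hom_dim E X Q) + int (hom_dim E X T)"
  using dim_ker_post[OF assms(1), of X] proj_maps_target[OF assms(1)] assms(2) projective_iff_injective
  unfolding sdim_def by simp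

lemma sdim_source:
  assumes "(X, i, Q, p, C) \<in> Confl E" "injective E Q"
  shows "sdim X Y = int (hom_dim E X Y) - int (hom_dim E Q Y) + int (hom_dim E C Y)"
  using dim_ker_pre[OF assms(1), of Y] proj_maps_source[OF assms] unfolding sdim_def by simp

lemma stable_class_eq:
  assumes "f \<in> Hom E X Y" "g \<in> Hom E X Y"
  shows "stable_class E X Y f = stable_class E X Y g \<longleftrightarrow> f - g \<in> proj_maps E X Y"
proof
  assume "stable_class E X Y f = stable_class E X Y g"
  moreover have "f \<in> stable_class E X Y f"
    unfolding stable_class_def using assms vs.subspace_0[OF proj_maps_subspace(1)] by simp
  ultimately show "f - g \<in> proj_maps E X Y" unfolding stable_class_def by simp
next
  assume a: "f - g \<in> proj_maps E X Y"
  have "h - f \<in> proj_maps E X Y \<longleftrightarrow> h - g \<in> proj_maps E X Y" for h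
    using vs.subspace_add[OF proj_maps_subspace(1) _ a, of "h - f"]
      vs.subspace_diff[OF proj_maps_subspace(1) _ a, of "h - g"] by auto
  then show "stable_class E X Y f = stable_class E X Y g" unfolding stable_class_def by blast
qed

text \<open>A perfect-pairing argument, with the dual space represented inside \<open>Hom E Y Z\<close> by means of
  a basis of a complement of the maps factoring through projectives.\<close>

lemma sdim_eq_of_duality:
  fixes D :: "'m set \<Rightarrow> 'm set \<Rightarrow> 'k"
  assumes bij: "bij_betw D (stable_hom E X Y) (stable_dual E Y Z)"
    and add: "\<And>f g h. f \<in> Hom E X Y \<Longrightarrow> g \<in> Hom E X Y \<Longrightarrow> h \<in> Hom E Y Z \<Longrightarrow>
        D (stable_class E X Y (f + g)) (stable_class E Y Z h) =
        D (stable_class E X Y f) (stable_class E Y Z h) + D (stable_class E X Y g) (stable_class E Y Z h)"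
    and scale: "\<And>c f h. f \<in> Hom E X Y \<Longrightarrow> h \<in> Hom E Y Z \<Longrightarrow>
        D (stable_class E X Y (Scale E c f)) (stable_class E Y Z h) =
        c * D (stable_class E X Y f) (stable_class E Y Z h)"
  shows "sdim X Y = sdim Y Z"
proof -
  define B where "B f h = D (stable_class E X Y f) (stable_class E Y Z h)" for f h
  obtain b0 where b0: "finite b0" "vs.span b0 = Hom E Y Z" by (rule hom_basis)
  obtain bp where bp: "finite bp" "bp \<subseteq> proj_maps E Y Z" "vs.independent bp" "vs.span bp = proj_maps E Y Z"
      "card bp = vs.dim (proj_maps E Y Z)"
    using vs.finite_span_subspace[OF b0 proj_maps_subspace] .
  have "bp \<subseteq> Hom E Y Z" using bp(2) proj_maps_subspace(2) by (rule order_trans)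
  then obtain b where b: "finite b" "bp \<subseteq> b" "b \<subseteq> Hom E Y Z" "vs.independent b" "vs.span b = Hom E Y Z"
      "card b = vs.dim (Hom E Y Z)"
    by (rule vs.finite_span_extend[OF b0 bp(3)])
  define bs where "bs = b - bp"
  have bs: "finite bs" "bs \<subseteq> Hom E Y Z" "vs.independent bs"
    unfolding bs_def using b(1,3) vs.independent_mono[OF b(4)] by auto
  have cbs: "int (card bs) = sdim Y Z"
    unfolding bs_def sdim_def hom_dim_def using b(1,2,6) bp(1,5) card_mono[OF b(1,2)]
    by (simp add: card_Diff_subset)
  have Bmem: "D (stable_class E X Y f) \<in> stable_dual E Y Z" if "f \<in> Hom E X Y" for f
    using bij that unfolding bij_betw_def stable_hom_def by blast
  have Badd: "B f (g + h) = B f g + B f h" if "f \<in> Hom E X Y" "g \<in> Hom E Y Z" "h \<in> Hom E Y Z" for f g h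
    using Bmem[OF that(1)] that(2,3) unfolding B_def stable_dual_def by blast
  have Bscale: "B f (Scale E c h) = c * B f h" if "f \<in> Hom E X Y" "h \<in> Hom E Y Z" for f h c
    using Bmem[OF that(1)] that(2) unfolding B_def stable_dual_def by blast
  have Bproj: "B f h = 0" if "f \<in> Hom E X Y" "h \<in> proj_maps E Y Z" for f h
  proof -
    have h: "h \<in> Hom E Y Z" using that(2) proj_maps_subspace(2) by blast
    have "stable_class E Y Z h = stable_class E Y Z 0" using stable_class_eq[OF h hom_0] that(2) by simp
    then have "B f h = B f (Scale E 0 h)" unfolding B_def using h by simp
    then show ?thesis using Bscale[OF that(1) h, of 0] by simp
  qed
  have Beq: "f \<in> proj_maps E X Y" if f: "f \<in> Hom E X Y" and z: "\<And>h. h \<in> bs \<Longrightarrow> B f h = 0" for f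
  proof -
    have zero: "h \<in> Hom E Y Z \<and> B f h = 0" if "h \<in> vs.span b" for h
      using that
    proof (induction rule: vs.span_induct_alt)
      case base
      show ?case using Bproj[OF f vs.subspace_0[OF proj_maps_subspace(1)]] by simp
    next
      case (step c x y)
      have x: "x \<in> Hom E Y Z" using step b(3) by blast
      have y: "y \<in> Hom E Y Z" using step by blast
      have "B f x = 0" using z[of x] Bproj[OF f, of x] step(1) bp(2) unfolding bs_def by blast
      then show ?case using Badd[OF f, of "Scale E c x" y] Bscale[OF f x] x y step by simp
    qed
    have "D (stable_class E X Y f) u = D (stable_class E X Y 0) u" for u
    proof (cases "u \<in> stable_hom E Y Z")
      case True
      then obtain h where h: "h \<in> Hom E Y Z" "u = stable_class E Y Z h" unfolding stable_hom_def by blast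
      have "B 0 h = 0" using scale[of 0 h 0] h(1) unfolding B_def by simp
      then show ?thesis using zero[of h] h b(5) unfolding B_def by simp
    next
      \<comment> \<open>Members of \<open>stable_dual\<close> are extensional, so outside the stable
        morphism space both sides take the same default value.\<close>
      case False
      then show ?thesis using Bmem[OF f] Bmem[OF hom_0] unfolding stable_dual_def extensional_def by simp
    qed
    then have "D (stable_class E X Y f) = D (stable_class E X Y 0)" by blast
    then have "stable_class E X Y f = stable_class E X Y 0"
      using bij f hom_0[of X Y] unfolding bij_betw_def stable_hom_def inj_on_def by blast
    then show ?thesis using stable_class_eq[OF f hom_0] by simp
  qed
  \<comment> \<open>The functional attached to \<open>f\<close> is encoded as the vector whose
    coordinate at \<open>h\<close> is its value on \<open>h\<close>. Injectivity of the duality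
    identifies the kernel of \<open>\<Phi>\<close> with the maps through projectives, and
    surjectivity makes its image the span of \<open>bs\<close>.\<close>
  define \<Phi> where "\<Phi> f = (\<Sum>h\<in>bs. Scale E (B f h) h)" for f
  have \<Phi>_add: "\<Phi> (x + y) = \<Phi> x + \<Phi> y" if "x \<in> Hom E X Y" "y \<in> Hom E X Y" for x y
  proof -
    have "B (x + y) h = B x h + B y h" if "h \<in> bs" for h
      using add[OF \<open>x \<in> Hom E X Y\<close> \<open>y \<in> Hom E X Y\<close>] that bs(2) unfolding B_def by blast
    then show ?thesis unfolding \<Phi>_def by (simp add: vs.scale_left_distrib sum.distrib)
  qed
  have \<Phi>_scale: "\<Phi> (Scale E c x) = Scale E c (\<Phi> x)" if "x \<in> Hom E X Y" for c x
  proof -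
    have "B (Scale E c x) h = c * B x h" if "h \<in> bs" for h
      using scale[OF \<open>x \<in> Hom E X Y\<close>] that bs(2) unfolding B_def by blast
    then show ?thesis unfolding \<Phi>_def by (simp add: vs.scale_sum_right)
  qed
  have "vs.dim (Hom E X Y) = vs.dim {f \<in> Hom E X Y. \<Phi> f = 0} + vs.dim (\<Phi> ` Hom E X Y)"
    by (rule rank_nullity[OF subspace_Hom order_refl \<Phi>_add \<Phi>_scale])
  moreover have "{f \<in> Hom E X Y. \<Phi> f = 0} = proj_maps E X Y"
  proof (intro equalityI subsetI)
    fix f assume "f \<in> {f \<in> Hom E X Y. \<Phi> f = 0}"
    then have f: "f \<in> Hom E X Y" "(\<Sum>h\<in>bs. Scale E (B f h) h) = 0" unfolding \<Phi>_def by auto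
    have "B f h = 0" if "h \<in> bs" for h
      using vs.independentD[OF bs(3,1) order_refl f(2) that] .
    then show "f \<in> proj_maps E X Y" using Beq[OF f(1)] by blast
  next
    fix f assume f: "f \<in> proj_maps E X Y"
    then have fh: "f \<in> Hom E X Y" using proj_maps_subspace(2) by blast
    have "stable_class E X Y f = stable_class E X Y 0" using stable_class_eq[OF fh hom_0] f by simp
    then have "B f h = 0" if "h \<in> bs" for h
      using scale[of 0 h 0] that bs(2) unfolding B_def by auto
    then have "\<Phi> f = 0" unfolding \<Phi>_def by simp
    then show "f \<in> {f \<in> Hom E X Y. \<Phi> f = 0}" using fh by simp
  qed
  moreover have "\<Phi> ` Hom E X Y = vs.span bs"
  proof (intro equalityI subsetI)
    fix x assume "x \<in> \<Phi> ` Hom E X Y"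
    then show "x \<in> vs.span bs" unfolding \<Phi>_def
      by (auto intro!: vs.span_sum vs.span_scale intro: vs.span_base)
  next
    have sub: "vs.subspace (\<Phi> ` Hom E X Y)"
      by (rule subspace_image_Hom[OF \<Phi>_add \<Phi>_scale])
    have "bs \<subseteq> \<Phi> ` Hom E X Y"
    proof
      fix h0 assume h0: "h0 \<in> bs"
      \<comment> \<open>The coordinate functional dual to \<open>h0\<close>. It vanishes on maps
        through projectives, whose coordinates live on \<open>bp\<close>, and therefore descends to
        stable classes as \<open>L\<close>.\<close>
      define l where "l h = vs.representation b h h0" for h
      have lproj: "l h = 0" if "h \<in> proj_maps E Y Z" for h
      proof -
        have "vs.representation b h = vs.representation bp h"
          using vs.representation_extend[OF b(4) _ b(2)] that bp(4) by blast
        then show ?thesis unfolding l_def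
          using vs.representation_ne_zero[of bp h h0] h0 unfolding bs_def by auto
      qed
      have ladd: "l (g + h) = l g + l h" if "g \<in> Hom E Y Z" "h \<in> Hom E Y Z" for g h
        unfolding l_def using vs.representation_add[OF b(4)] that b(5) by simp
      have ldiff: "l (g - h) = l g - l h" if "g \<in> Hom E Y Z" "h \<in> Hom E Y Z" for g h
        unfolding l_def using vs.representation_diff[OF b(4)] that b(5) by simp
      have lscale: "l (Scale E c h) = c * l h" if "h \<in> Hom E Y Z" for c h
        unfolding l_def using vs.representation_scale[OF b(4)] that b(5) by simp
      define L where "L = restrict (\<lambda>u. l (SOME h. h \<in> Hom E Y Z \<and> u = stable_class E Y Z h)) (stable_hom E Y Z)"
      have L: "L (stable_class E Y Z h) = l h" if h: "h \<in> Hom E Y Z" for h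
      proof -
        define h' where "h' = (SOME h'. h' \<in> Hom E Y Z \<and> stable_class E Y Z h = stable_class E Y Z h')"
        have h': "h' \<in> Hom E Y Z \<and> stable_class E Y Z h = stable_class E Y Z h'"
          unfolding h'_def by (rule someI[of _ h]) (use h in simp)
        then have "l (h - h') = 0" using stable_class_eq[OF h, of h'] lproj by simp
        then have "l h' = l h" using ldiff[OF h, of h'] h' by simp
        moreover have "L (stable_class E Y Z h) = l h'" unfolding L_def h'_def using h by (simp add: stable_hom_def)
        ultimately show ?thesis by simp
      qed
      have "L \<in> stable_dual E Y Z"
        unfolding stable_dual_def using L ladd lscale by (auto simp: L_def)
      then obtain u where u: "u \<in> stable_hom E X Y" "D u = L"
        using bij unfolding bij_betw_def by (metis imageE)
      obtain f where f: "f \<in> Hom E X Y" "u = stable_class E X Y f" using u(1) unfolding stable_hom_def by blast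
      have "B f h = (if h = h0 then 1 else 0)" if "h \<in> bs" for h
      proof -
        have "h \<in> b" using that unfolding bs_def by simp
        then show ?thesis unfolding B_def using u f L[of h] that bs(2) vs.representation_basis[OF b(4), of h]
          by (auto simp: l_def)
      qed
      then have "\<Phi> f = (\<Sum>h\<in>bs. if h = h0 then h else 0)" unfolding \<Phi>_def
        by (intro sum.cong) auto
      also have "\<dots> = h0" using bs(1) h0 by simp
      finally show "h0 \<in> \<Phi> ` Hom E X Y" using f(1) by blast
    qed
    then show "x \<in> \<Phi> ` Hom E X Y" if "x \<in> vs.span bs" for x
      using that vs.span_minimal[OF _ sub] by blast
  qed
  moreover have "vs.dim (vs.span bs) = card bs" using vs.dim_span_eq_card_independent[OF bs(3)] .
  ultimately have "int (hom_dim E X Y) = int (vs.dim (proj_maps E X Y)) + int (card bs)"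
    unfolding hom_dim_def by simp
  then show ?thesis using cbs unfolding sdim_def by simp
qed

text \<open>The duality gives the stable spaces from \<open>X\<close> to \<open>S T\<close> and from
  \<open>S T\<close> to \<open>S (S X)\<close> the same dimension. To strip one suspension from the
  latter no inverse functor is constructed; \<open>balance\<close> compares the suspension
  conflations of \<open>T\<close> and of \<open>S X\<close>.\<close>

lemma ext_symmetric:
  obtains Q S i p where "suspension E Q S i p" "\<And>X T. sdim X (S T) = sdim T (S X)"
proof -
  obtain Q S i p and D :: "'o \<Rightarrow> 'o \<Rightarrow> 'm set \<Rightarrow> 'm set \<Rightarrow> 'k" where
    s: "suspension E Q S i p" and
    bij: "\<forall>X Y. bij_betw (D X Y) (stable_hom E X Y) (stable_dual E Y (S (S X)))" and
    add: "\<forall>X Y. \<forall>f\<in>Hom E X Y. \<forall>g\<in>Hom E X Y. \<forall>h\<in>Hom E Y (S (S X)).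
        D X Y (stable_class E X Y (f + g)) (stable_class E Y (S (S X)) h) =
        D X Y (stable_class E X Y f) (stable_class E Y (S (S X)) h) +
        D X Y (stable_class E X Y g) (stable_class E Y (S (S X)) h)" and
    scale: "\<forall>X Y c. \<forall>f\<in>Hom E X Y. \<forall>h\<in>Hom E Y (S (S X)).
        D X Y (stable_class E X Y (Scale E c f)) (stable_class E Y (S (S X)) h) =
        c * D X Y (stable_class E X Y f) (stable_class E Y (S (S X)) h)"
    using calabi_yau unfolding stable_two_calabi_yau_def
    by (elim exE conjE) (rule that; assumption)
  have inj: "injective E (Q X)" and c: "(X, i X, Q X, p X, S X) \<in> Confl E" for X
    using s unfolding suspension_def by auto
  have "sdim X (S T) = sdim T (S X)" for X T
  proof -
    have "sdim X (S T) = sdim (S T) (S (S X))"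
      by (rule sdim_eq_of_duality[of "D X (S T)"]) (use bij add scale in blast)+
    also have "\<dots> = int (hom_dim E (S T) (S (S X))) - int (hom_dim E (S T) (Q (S X))) + int (hom_dim E (S T) (S X))"
      by (rule sdim_target[OF c inj])
    also have "hom_dim E T (S X) + hom_dim E (S T) (Q (S X)) = hom_dim E (S T) (S (S X)) + hom_dim E (Q T) (S X)"
      using inj projective_iff_injective by (intro balance[OF c c] ext_van_projective ext_van_injective) simp_all
    then have "int (hom_dim E (S T) (S (S X))) - int (hom_dim E (S T) (Q (S X))) + int (hom_dim E (S T) (S X)) =
        int (hom_dim E T (S X)) - int (hom_dim E (Q T) (S X)) + int (hom_dim E (S T) (S X))"
      by simp
    also have "\<dots> = sdim T (S X)"
      by (rule sdim_source[OF c inj, symmetric])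
    finally show ?thesis .
  qed
  then show thesis using that s by blast
qed

text \<open>The common value is \<open>dim Ext\<^sup>1(X, T) = dim Ext\<^sup>1(T, X)\<close>.\<close>

lemma euler_symmetric:
  assumes K: "(K, i, R, p, X) \<in> Confl E" and L: "(X, j, L, q, C) \<in> Confl E"
    and vR: "ext_van R T" and vL: "ext_van T L"
  shows "int (hom_dim E X T) - int (hom_dim E R T) + int (hom_dim E K T) =
    int (hom_dim E T C) - int (hom_dim E T L) + int (hom_dim E T X)"
proof -
  obtain Q S i' p' where s: "suspension E Q S i' p'" and sym: "\<And>X T. sdim X (S T) = sdim T (S X)"
    by (rule ext_symmetric) blast
  have inj: "injective E (Q X)" and c: "(X, i' X, Q X, p' X, S X) \<in> Confl E" for X
    using s unfolding suspension_def by auto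
  obtain O1 i1 P p1 where O1: "(O1, i1, P, p1, T) \<in> Confl E" "projective E P" by (rule projective_cover)
  have 1: "hom_dim E K T + hom_dim E X (Q T) = hom_dim E X (S T) + hom_dim E R T"
    by (intro balance[OF K c] vR ext_van_injective inj)
  have 2: "hom_dim E O1 X + hom_dim E T L = hom_dim E T C + hom_dim E P X"
    by (intro balance[OF O1(1) L] vL ext_van_projective O1(2))
  have 3: "hom_dim E O1 X + hom_dim E T (Q X) = hom_dim E T (S X) + hom_dim E P X"
    by (intro balance[OF O1(1) c] ext_van_injective inj ext_van_projective O1(2))
  show ?thesis
    using 1 2 3 sym[of X T] sdim_target[OF c inj, of X T] sdim_target[OF c inj, of T X] by simp
qed

end

section \<open>Cluster-tilting subcategories\<close>

locale cluster_tilting_sub = frobenius_cy E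
  for E :: "('o, 'm::ab_group_add, 'k::field) exact_cat" +
  fixes \<T> :: "'o set"
  assumes ct: "cluster_tilting E \<T>"
begin

lemma mem_iff_right: "X \<in> \<T> \<longleftrightarrow> (\<forall>T\<in>\<T>. ext_van T X)"
  using ct unfolding cluster_tilting_def ext_van_iff by blast

lemma mem_iff_left: "X \<in> \<T> \<longleftrightarrow> (\<forall>T\<in>\<T>. ext_van X T)"
  using ct unfolding cluster_tilting_def ext_van_iff by blast

lemma ext_van: "S \<in> \<T> \<Longrightarrow> T \<in> \<T> \<Longrightarrow> ext_van S T"
  using mem_iff_right by blast

lemma summand_mem: "S \<in> \<T> \<Longrightarrow> direct_sum E A B S \<Longrightarrow> A \<in> \<T>"
  using mem_iff_right ext_van_summand by blast

lemma summand_mem2: "S \<in> \<T> \<Longrightarrow> direct_sum E A B S \<Longrightarrow> B \<in> \<T>"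
  using summand_mem direct_sum_sym by blast

lemma projective_mem: "projective E P \<Longrightarrow> P \<in> \<T>"
  using mem_iff_right ext_van_injective projective_iff_injective by blast

sublocale sum_closed E \<T>
proof
  show "Z \<in> \<T>" if "is_zero E Z" for Z
    using that mem_iff_right ext_van_zero by blast
  show "S \<in> \<T>" if "A \<in> \<T>" "B \<in> \<T>" "direct_sum E A B S" for A B S
    using that mem_iff_right ext_van_sum by blast
qed

text \<open>The kernel \<open>K\<close> of an approximation has no extensions by objects
  \<open>T\<close> of \<open>\<T>\<close>: given one, \<open>i\<close> extends to its middle term,
  and the induced map from \<open>T\<close> to \<open>X\<close> factors through the approximation.
  Subtracting this factor leaves a map into \<open>K\<close>, which is a retraction.
  \<open>coresolution\<close> is dual.\<close>

lemma resolution: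
  obtains K i R p where "K \<in> \<T>" "R \<in> \<T>" "(K, i, R, p, X) \<in> Confl E"
proof -
  have "\<forall>X. \<exists>R p. right_approx E \<T> R X p \<and> deflation E R X p"
    using ct unfolding cluster_tilting_def by (elim conjE)
  then obtain R p where rp: "right_approx E \<T> R X p" "deflation E R X p" by blast
  from rp(2) obtain K i where c: "(K, i, R, p, X) \<in> Confl E" unfolding deflation_def by blast
  interpret c: conflation E K i R p X using c by (rule conflI)
  have R: "R \<in> \<T>" and lift: "\<And>T f. T \<in> \<T> \<Longrightarrow> f \<in> Hom E T X \<Longrightarrow> \<exists>g\<in>Hom E T R. cm T R X p g = f"
    using rp(1) unfolding right_approx_def cm_def by blast+
  have "ext_van T K" if T: "T \<in> \<T>" for T
  proof (rule ext_vanI_retraction)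
    fix j F q assume d: "(K, j, F, q, T) \<in> Confl E"
    interpret d: conflation E K j F q T using d by (rule conflI)
    obtain g where g: "g \<in> Hom E F R" "cm K F R g j = i" using ext_van_extend[OF d ext_van[OF T R] c.i] .
    have "cm K F X (cm F R X p g) j = 0" using g by simp
    then obtain f where f: "f \<in> Hom E T X" "cm F T X f q = cm F R X p g"
      using d.colift[of "cm F R X p g" X] g(1) by auto
    obtain f' where f': "f' \<in> Hom E T R" "cm T R X p f' = f" using lift[OF T f(1)] by blast
    have "cm F R X p (g - cm F T R f' q) = 0" using g(1) f f' by (simp add: cm_red[OF f'(2)])
    then obtain u where u: "u \<in> Hom E F K" "cm F K R i u = g - cm F T R f' q"
      using c.lift[of "g - cm F T R f' q" F] g(1) f'(1) by auto
    have "cm K F K u j = Idm E K"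
      by (rule c.mono_eq[where W = K]) (use u(1) g f'(1) in \<open>simp_all add: cm_red[OF u(2)]\<close>)
    then show "\<exists>r\<in>Hom E F K. cm K F K r j = Idm E K" using u(1) by blast
  qed
  then have "K \<in> \<T>" using mem_iff_right by blast
  then show thesis using that R c by blast
qed

lemma coresolution:
  obtains L i C p where "L \<in> \<T>" "C \<in> \<T>" "(X, i, L, p, C) \<in> Confl E"
proof -
  have "\<forall>X. \<exists>L i. left_approx E \<T> X L i \<and> inflation E X L i"
    using ct unfolding cluster_tilting_def by (elim conjE)
  then obtain L i where rp: "left_approx E \<T> X L i" "inflation E X L i" by blast
  from rp(2) obtain C p where c: "(X, i, L, p, C) \<in> Confl E" unfolding inflation_def by blast
  interpret c: conflation E X i L p C using c by (rule conflI)
  have L: "L \<in> \<T>" and ext: "\<And>T f. T \<in> \<T> \<Longrightarrow> f \<in> Hom E X T \<Longrightarrow> \<exists>g\<in>Hom E L T. cm X L T g i = f"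
    using rp(1) unfolding left_approx_def cm_def by blast+
  have "ext_van C T" if T: "T \<in> \<T>" for T
    unfolding ext_van_def
  proof (intro allI impI)
    fix j F q assume d: "(T, j, F, q, C) \<in> Confl E"
    interpret d: conflation E T j F q C using d by (rule conflI)
    obtain g where g: "g \<in> Hom E L F" "cm L F C q g = p" using ext_van_lift[OF d ext_van[OF L T] c.p] .
    have "cm X F C q (cm X L F g i) = 0" using g by (simp add: cm_red[OF g(2)])
    then obtain f where f: "f \<in> Hom E X T" "cm X T F j f = cm X L F g i"
      using d.lift[of "cm X L F g i" X] g(1) by auto
    obtain f' where f': "f' \<in> Hom E L T" "cm X L T f' i = f" using ext[OF T f(1)] by blast
    have "cm X L F (g - cm L T F j f') i = 0" using g(1) f f' by simp
    then obtain u where u: "u \<in> Hom E C F" "cm L C F u p = g - cm L T F j f'"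
      using c.colift[of "g - cm L T F j f'" F] g(1) f'(1) by auto
    have "cm C F C q u = Idm E C"
      by (rule c.epi_eq[where W = C]) (use u g f'(1) in simp_all)
    then show "\<exists>s\<in>Hom E C F. cm C F C q s = Idm E C" using u(1) by blast
  qed
  then have "C \<in> \<T>" using mem_iff_left by blast
  then show thesis using that L c by blast
qed

subsection \<open>The index\<close>

lemma K0_class_eq: "K0_class E \<T> X = K0.cl (frag_of X)"
  unfolding K0_class_def by (rule K0.class_eq)

lemma K0_eq: "K0 E \<T> = K0.G"
  unfolding K0_def ..

lemma ind_diff_eq:
  assumes "R \<in> \<T>" "K \<in> \<T>"
  shows "K0_class E \<T> R \<otimes>\<^bsub>K0 E \<T>\<^esub> inv\<^bsub>K0 E \<T>\<^esub> K0_class E \<T> K = K0.cl (frag_of R - frag_of K)"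
  unfolding K0_class_eq K0_eq using assms by (simp add: K0.cl_diff)

lemma indE:
  obtains K i R p where "K \<in> \<T>" "R \<in> \<T>" "(K, i, R, p, X) \<in> Confl E" "ind E \<T> X = K0.cl (frag_of R - frag_of K)"
proof -
  have "\<exists>u. \<exists>K\<in>\<T>. \<exists>R\<in>\<T>. \<exists>i p. (K, i, R, p, X) \<in> Confl E \<and>
     u = K0_class E \<T> R \<otimes>\<^bsub>K0 E \<T>\<^esub> inv\<^bsub>K0 E \<T>\<^esub> K0_class E \<T> K"
    using resolution[of X] by metis
  then have "\<exists>K\<in>\<T>. \<exists>R\<in>\<T>. \<exists>i p. (K, i, R, p, X) \<in> Confl E \<and>
     ind E \<T> X = K0_class E \<T> R \<otimes>\<^bsub>K0 E \<T>\<^esub> inv\<^bsub>K0 E \<T>\<^esub> K0_class E \<T> K"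
    unfolding ind_def by (rule someI_ex)
  then show thesis using that ind_diff_eq by auto
qed

lemma coindE:
  obtains L i C p where "L \<in> \<T>" "C \<in> \<T>" "(X, i, L, p, C) \<in> Confl E" "coind E \<T> X = K0.cl (frag_of L - frag_of C)"
proof -
  have "\<exists>u. \<exists>L\<in>\<T>. \<exists>C\<in>\<T>. \<exists>i p. (X, i, L, p, C) \<in> Confl E \<and>
     u = K0_class E \<T> L \<otimes>\<^bsub>K0 E \<T>\<^esub> inv\<^bsub>K0 E \<T>\<^esub> K0_class E \<T> C"
    using coresolution[of X] by metis
  then have "\<exists>L\<in>\<T>. \<exists>C\<in>\<T>. \<exists>i p. (X, i, L, p, C) \<in> Confl E \<and>
     coind E \<T> X = K0_class E \<T> L \<otimes>\<^bsub>K0 E \<T>\<^esub> inv\<^bsub>K0 E \<T>\<^esub> K0_class E \<T> C"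
    unfolding coind_def by (rule someI_ex)
  then show thesis using that ind_diff_eq by auto
qed

text \<open>Exhibits the expression defining the index as an Euler characteristic, so that
  properties of the index follow from the horseshoe and comparison lemmas.\<close>

lemma tres_conflation:
  assumes "K \<in> \<T>" "R \<in> \<T>" "(K, i, R, p, X) \<in> Confl E"
  shows "tres 1 R (\<lambda>S. {f \<in> Hom E S R. cm S R X p f = 0}) (frag_of R - frag_of K)"
proof -
  interpret c: conflation E K i R p X using assms(3) by (rule conflI)
  have "{f \<in> Hom E S R. cm S R X p f = 0} = cm S K R i ` Hom E S K" for S
    using c.lift[of _ S] by (auto simp: image_iff)
  moreover have "{f \<in> Hom E S K. cm S K R i f = 0} = {0}" for S
    using c.mono[of _ S] by auto
  ultimately have "tres (Suc 0) R (\<lambda>S. {f \<in> Hom E S R. cm S R X p f = 0}) (frag_of R - frag_of K)"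
    using assms(1,2) c.i by (auto intro!: exI[of _ K] exI[of _ i])
  then show ?thesis by simp
qed

text \<open>The resolutions chosen for \<open>A\<close>, \<open>B\<close> and \<open>S\<close> are
  unrelated. The horseshoe lemma adds the first two, with \<open>M\<close> the kernel of the summed
  map to \<open>S\<close>, and \<open>tres_compare\<close> matches the result with the third. The
  comparison maps exist because objects of \<open>\<T>\<close> have no extensions among each
  other.\<close>

lemma ind_add:
  assumes "direct_sum E A B S"
  shows "ind E \<T> S = ind E \<T> A \<otimes>\<^bsub>K0 E \<T>\<^esub> ind E \<T> B"
proof -
  obtain i1 i2 p1 p2 where "biproduct E A B S i1 i2 p1 p2" using assms unfolding direct_sum_def by blast
  then interpret b: biprod E A B S i1 i2 p1 p2 by unfold_locales
  obtain K1 k1 R1 r1 where 1: "K1 \<in> \<T>" "R1 \<in> \<T>" "(K1, k1, R1, r1, A) \<in> Confl E"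
    "ind E \<T> A = K0.cl (frag_of R1 - frag_of K1)" by (rule indE)
  obtain K2 k2 R2 r2 where 2: "K2 \<in> \<T>" "R2 \<in> \<T>" "(K2, k2, R2, r2, B) \<in> Confl E"
    "ind E \<T> B = K0.cl (frag_of R2 - frag_of K2)" by (rule indE)
  obtain K k R r where 3: "K \<in> \<T>" "R \<in> \<T>" "(K, k, R, r, S) \<in> Confl E"
    "ind E \<T> S = K0.cl (frag_of R - frag_of K)" by (rule indE)
  interpret c1: conflation E K1 k1 R1 r1 A using 1(3) by (rule conflI)
  interpret c2: conflation E K2 k2 R2 r2 B using 2(3) by (rule conflI)
  interpret c: conflation E K k R r S using 3(3) by (rule conflI)
  obtain W j1 j2 q1 q2 where W: "biproduct E R1 R2 W j1 j2 q1 q2"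
    using ex_direct_sum unfolding direct_sum_def by blast
  interpret W: biprod E R1 R2 W j1 j2 q1 q2 using W by unfold_locales
  have WT: "W \<in> \<T>" using sum_mem[OF 1(2) 2(2) W.direct_sum] .
  define M where "M = (\<lambda>S. {h \<in> Hom E S W. cm S R1 A r1 (cm S W R1 q1 h) = 0 \<and> cm S R2 B r2 (cm S W R2 q2 h) = 0})"
  have sM: "subfun M W"
    unfolding M_def subfun_def by (auto simp flip: cm_assoc)
  have "\<exists>m. tres 1 W M m \<and> keq m ((frag_of R1 - frag_of K1) + (frag_of R2 - frag_of K2))"
  proof (rule tres_horseshoe[OF tres_conflation[OF 1(1-3)] tres_conflation[OF 2(1-3)] W sM])
    fix T f assume "f \<in> Hom E T R1"
    then show "cm T R1 W j1 f \<in> M T \<longleftrightarrow> f \<in> {f \<in> Hom E T R1. cm T R1 A r1 f = 0}" by (simp add: M_def)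
  next
    fix T h assume "h \<in> M T"
    then show "cm T W R2 q2 h \<in> {f \<in> Hom E T R2. cm T R2 B r2 f = 0}" by (simp add: M_def)
  next
    fix T g assume "g \<in> {f \<in> Hom E T R2. cm T R2 B r2 f = 0}"
    then show "\<exists>h\<in>M T. cm T W R2 q2 h = g" by (intro bexI[of _ "cm T R2 W j2 g"]) (simp_all add: M_def)
  qed
  then obtain m where m: "tres 1 W M m" "keq m ((frag_of R1 - frag_of K1) + (frag_of R2 - frag_of K2))" by blast
  obtain \<alpha> where \<alpha>: "\<alpha> \<in> Hom E R R1" "cm R R1 A r1 \<alpha> = cm R S A p1 r"
    using ext_van_lift[OF 1(3) ext_van[OF 3(2) 1(1)], of "cm R S A p1 r"] by auto
  obtain \<beta> where \<beta>: "\<beta> \<in> Hom E R R2" "cm R R2 B r2 \<beta> = cm R S B p2 r"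
    using ext_van_lift[OF 2(3) ext_van[OF 3(2) 2(1)], of "cm R S B p2 r"] by auto
  define a where "a = cm R R1 W j1 \<alpha> + cm R R2 W j2 \<beta>"
  have a: "a \<in> Hom E R W" unfolding a_def using \<alpha> \<beta> by simp
  obtain b where b: "b \<in> Hom E W R" "cm W R S r b = cm W A S i1 (cm W R1 A r1 q1) + cm W B S i2 (cm W R2 B r2 q2)"
    using ext_van_lift[OF 3(3) ext_van[OF WT 3(1)], of "cm W A S i1 (cm W R1 A r1 q1) + cm W B S i2 (cm W R2 B r2 q2)"]
    by auto
  have qa: "cm R W R1 q1 a = \<alpha>" "cm R W R2 q2 a = \<beta>" unfolding a_def using \<alpha> \<beta> by simp_all
  have "keq (frag_of R - frag_of K) m"
  proof (rule tres_compare[OF tres_conflation[OF 3(1-3)] m(1) subfun_ker[OF c.p] sM b(1) a])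
    fix T f assume "f \<in> {f \<in> Hom E T R. cm T R S r f = 0}"
    then have f: "f \<in> Hom E T R" "cm T R S r f = 0" by auto
    have "cm T R1 A r1 (cm T R R1 \<alpha> f) = 0" using f \<alpha>(1) by (simp add: cm_red[OF \<alpha>(2)])
    moreover have "cm T R2 B r2 (cm T R R2 \<beta> f) = 0" using f \<beta>(1) by (simp add: cm_red[OF \<beta>(2)])
    ultimately show "cm T R W a f \<in> M T" unfolding M_def using f a by (simp add: cm_red[OF qa(1)] cm_red[OF qa(2)])
  next
    fix T f assume "f \<in> M T"
    then have f: "f \<in> Hom E T W" "cm T R1 A r1 (cm T W R1 q1 f) = 0" "cm T R2 B r2 (cm T W R2 q2 f) = 0"
      unfolding M_def by auto
    then show "cm T W R b f \<in> {f \<in> Hom E T R. cm T R S r f = 0}" using b(1) by (simp add: cm_red[OF b(2)])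
  next
    have "cm R R S r (cm R W R b a) = cm R A S i1 (cm R S A p1 r) + cm R B S i2 (cm R S B p2 r)"
      using a b(1) by (simp add: cm_red[OF b(2)] qa \<alpha>(2) \<beta>(2))
    also have "\<dots> = r" using b.decomp[of r R] by simp
    finally show "Idm E R - cm R W R b a \<in> {f \<in> Hom E R R. cm R R S r f = 0}" using a b(1) by simp
  next
    have "cm W R1 A r1 (cm W R R1 \<alpha> b) = cm W R1 A r1 q1" "cm W R2 B r2 (cm W R R2 \<beta> b) = cm W R2 B r2 q2"
      using \<alpha>(1) \<beta>(1) b(1) by (simp_all add: cm_red[OF \<alpha>(2)] cm_red[OF \<beta>(2)] b(2))
    then show "Idm E W - cm W R W a b \<in> M W"
      unfolding M_def using a b(1) \<alpha>(1) \<beta>(1) by (simp add: cm_red[OF qa(1)] cm_red[OF qa(2)])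
  qed
  then have "keq (frag_of R - frag_of K) ((frag_of R1 - frag_of K1) + (frag_of R2 - frag_of K2))"
    using m(2) by (rule keq_trans)
  moreover have k: "Poly_Mapping.keys (frag_of R1 - frag_of K1) \<subseteq> \<T>" "Poly_Mapping.keys (frag_of R2 - frag_of K2) \<subseteq> \<T>"
    using 1(1,2) 2(1,2) keys_diff[of "frag_of R1" "frag_of K1"] keys_diff[of "frag_of R2" "frag_of K2"] by auto
  moreover have "Poly_Mapping.keys ((frag_of R1 - frag_of K1) + (frag_of R2 - frag_of K2)) \<subseteq> \<T>"
    using keys_add k by fastforce
  ultimately show ?thesis
    unfolding 1(4) 2(4) 3(4) K0_eq keq_def using K0.cl_add K0.cl_cong by metis
qed

lemma ind_closed: "ind E \<T> X \<in> carrier (K0 E \<T>)"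
proof -
  obtain K i R p where k: "K \<in> \<T>" "R \<in> \<T>" "ind E \<T> X = K0.cl (frag_of R - frag_of K)" by (rule indE)
  then have "Poly_Mapping.keys (frag_of R - frag_of K) \<subseteq> \<T>" using keys_diff[of "frag_of R" "frag_of K"] by auto
  then show ?thesis unfolding k(3) K0_eq by (rule K0.cl_closed)
qed

subsection \<open>The form\<close>

lemma bilinear_eqI:
  assumes "bilinear_form (K0 E \<T>) q" "bilinear_form (K0 E \<T>) q'"
    and "\<And>X Y. X \<in> \<T> \<Longrightarrow> Y \<in> \<T> \<Longrightarrow> q (K0_class E \<T> X) (K0_class E \<T> Y) = q' (K0_class E \<T> X) (K0_class E \<T> Y)"
    and "u \<in> carrier (K0 E \<T>)" "v \<in> carrier (K0 E \<T>)"
  shows "q u v = q' u v"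
proof -
  have h: "q w \<in> hom K0.G integer_group" "(\<lambda>v. q v w) \<in> hom K0.G integer_group"
     "q' w \<in> hom K0.G integer_group" "(\<lambda>v. q' v w) \<in> hom K0.G integer_group" if "w \<in> carrier K0.G" for w
    using assms(1,2) that unfolding bilinear_form_def K0_eq by auto
  have 1: "q (K0_class E \<T> X) v = q' (K0_class E \<T> X) v" if X: "X \<in> \<T>" and v: "v \<in> carrier K0.G" for X v
    by (rule K0.hom_ext[OF group_integer_group h(1) h(3) _ v])
      (use X assms(3) K0.class_closed in \<open>auto simp: K0_class_def\<close>)
  show ?thesis
    by (rule K0.hom_ext[OF group_integer_group h(2) h(4), of v v])
      (use 1 assms(4,5) in \<open>auto simp: K0_class_def K0_eq\<close>)
qed

text \<open>The universal property is used twice: for each \<open>X\<close> it gives a homomorphism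
  in the second variable, and then it is applied to the assignment of that homomorphism to
  \<open>X\<close>.\<close>

lemma bilinear_exists:
  fixes d :: "'o \<Rightarrow> 'o \<Rightarrow> int"
  assumes l: "\<And>A B S Y. direct_sum E A B S \<Longrightarrow> d S Y = d A Y + d B Y"
    and r: "\<And>A B S Y. direct_sum E A B S \<Longrightarrow> d Y S = d Y A + d Y B"
  obtains q where "bilinear_form (K0 E \<T>) q"
    "\<And>X Y. X \<in> \<T> \<Longrightarrow> Y \<in> \<T> \<Longrightarrow> q (K0_class E \<T> X) (K0_class E \<T> Y) = d X Y"
proof -
  have R: "split_relations E \<T> = {frag_of S - frag_of A - frag_of B | A B S.
     A \<in> \<T> \<and> B \<in> \<T> \<and> S \<in> \<T> \<and> direct_sum E A B S}" by (simp add: split_relations_def)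
  have "\<exists>h. h \<in> hom K0.G integer_group \<and> (\<forall>Y\<in>\<T>. h (K0_class E \<T> Y) = d X Y)" for X
    by (rule K0.hom_exists[OF abelian_integer_group _ R, of "d X"]) (use r in \<open>auto simp: K0_class_def\<close>)
  then obtain H where H: "\<And>X. H X \<in> hom K0.G integer_group" "\<And>X Y. Y \<in> \<T> \<Longrightarrow> H X (K0_class E \<T> Y) = d X Y"
    by metis
  \<comment> \<open>Cut off to zero outside the carrier, so that agreement on the carrier becomes
    equality of functions.\<close>
  define H' where "H' X v = (if v \<in> carrier K0.G then H X v else 0)" for X v
  \<comment> \<open>All integer-valued functions under pointwise addition serve as target; that the
    values of \<open>q\<close> are again homomorphisms is recovered in \<open>qr\<close> by
    induction over the group.\<close>
  define FG :: "(('o \<Rightarrow>\<^sub>0 int) set \<Rightarrow> int) monoid" where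
    "FG = \<lparr>carrier = UNIV, monoid.mult = (\<lambda>f g v. f v + g v), one = (\<lambda>v. 0)\<rparr>"
  have FG: "comm_group FG"
  proof (rule comm_groupI)
    fix x assume "x \<in> carrier FG"
    show "\<exists>y\<in>carrier FG. y \<otimes>\<^bsub>FG\<^esub> x = \<one>\<^bsub>FG\<^esub>"
      by (rule bexI[of _ "\<lambda>v. - x v"]) (simp_all add: FG_def)
  qed (auto simp: FG_def add.assoc add.commute)
  have "H' S = H' A \<otimes>\<^bsub>FG\<^esub> H' B" if s: "A \<in> \<T> \<and> B \<in> \<T> \<and> S \<in> \<T> \<and> direct_sum E A B S" for A B S
  proof -
    have "H S v = H A v + H B v" if v: "v \<in> carrier K0.G" for v
    proof (rule K0.hom_ext[OF group_integer_group H(1) _ _ v, of "\<lambda>v. H A v + H B v"])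
      have "H A (u \<otimes>\<^bsub>K0.G\<^esub> w) = H A u + H A w" "H B (u \<otimes>\<^bsub>K0.G\<^esub> w) = H B u + H B w"
        if "u \<in> carrier K0.G" "w \<in> carrier K0.G" for u w
        using hom_mult[OF H(1)] that by auto
      then show "(\<lambda>v. H A v + H B v) \<in> hom K0.G integer_group" by (intro homI) auto
    qed (use H(2) l s in \<open>auto simp flip: K0_class_def\<close>)
    then show ?thesis unfolding FG_def H'_def by auto
  qed
  moreover have "H' X \<in> carrier FG" for X by (simp add: FG_def)
  ultimately obtain q where q: "q \<in> hom K0.G FG" "\<And>X. X \<in> \<T> \<Longrightarrow> q (K0_class E \<T> X) = H' X"
    using K0.hom_exists[OF FG _ R, of H'] unfolding K0_class_def by blast
  have ql: "q (u \<otimes>\<^bsub>K0.G\<^esub> w) v = q u v + q w v" if "u \<in> carrier K0.G" "w \<in> carrier K0.G" for u w v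
    using hom_mult[OF q(1) that] by (simp add: FG_def)
  interpret q: group_hom K0.G FG q by (rule K0.group_homI[OF _ q(1)]) (use FG comm_group.axioms in blast)
  have FGinv: "inv\<^bsub>FG\<^esub> f = (\<lambda>v. - f v)" for f
    by (rule q.H.inv_equality) (simp_all add: FG_def)
  have qr: "q u \<in> hom K0.G integer_group" if "u \<in> carrier K0.G" for u
    using that
  proof (induction rule: K0.G_induct)
    case one
    show ?case by (intro homI) (simp_all add: FG_def)
  next
    case (diff u v)
    have "q (u \<otimes>\<^bsub>K0.G\<^esub> inv\<^bsub>K0.G\<^esub> v) w = q u w - q v w" for w
      using diff(1,2) FGinv by (simp add: FG_def)
    moreover have "q u (x \<otimes>\<^bsub>K0.G\<^esub> y) = q u x + q u y" "q v (x \<otimes>\<^bsub>K0.G\<^esub> y) = q v x + q v y"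
        if "x \<in> carrier K0.G" "y \<in> carrier K0.G" for x y
        using hom_mult[OF diff(3)] hom_mult[OF diff(4)] that by auto
    ultimately show ?case by (intro homI) auto
  next
    case (cls X)
    have "H X (x \<otimes>\<^bsub>K0.G\<^esub> y) = H X x + H X y" if "x \<in> carrier K0.G" "y \<in> carrier K0.G" for x y
      using hom_mult[OF H(1)] that by auto
    then have "H' X \<in> hom K0.G integer_group" by (intro homI) (auto simp: H'_def)
    then show ?case using q(2)[OF cls] unfolding K0_class_def by simp
  qed
  have "bilinear_form (K0 E \<T>) q"
    unfolding bilinear_form_def K0_eq using qr ql by (auto intro!: homI simp: eta_contract_eq)
  moreover have "q (K0_class E \<T> X) (K0_class E \<T> Y) = d X Y" if "X \<in> \<T>" "Y \<in> \<T>" for X Y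
    using q(2) H(2) K0.class_closed that unfolding H'_def K0_class_def by simp
  ultimately show thesis using that by blast
qed

definition hdiff :: "'o \<Rightarrow> 'o \<Rightarrow> int" where
  "hdiff X Y = int (hom_dim E X Y) - int (hom_dim E Y X)"

lemma hdiff_sum: "direct_sum E A B S \<Longrightarrow> hdiff S Y = hdiff A Y + hdiff B Y" "direct_sum E A B S \<Longrightarrow> hdiff Y S = hdiff Y A + hdiff Y B"
  unfolding hdiff_def by (simp_all add: hom_dim_sum_left[of A B S] hom_dim_sum_right[of A B S])

lemma hom_form:
  "bilinear_form (K0 E \<T>) (hom_form E \<T>)"
  "\<And>X Y. X \<in> \<T> \<Longrightarrow> Y \<in> \<T> \<Longrightarrow> hom_form E \<T> (K0_class E \<T> X) (K0_class E \<T> Y) = hdiff X Y"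
proof -
  obtain q where "bilinear_form (K0 E \<T>) q"
    "\<And>X Y. X \<in> \<T> \<Longrightarrow> Y \<in> \<T> \<Longrightarrow> q (K0_class E \<T> X) (K0_class E \<T> Y) = hdiff X Y"
    by (rule bilinear_exists[of hdiff]) (use hdiff_sum in blast)+
  then have "\<exists>q. bilinear_form (K0 E \<T>) q \<and> (\<forall>T1\<in>\<T>. \<forall>T2\<in>\<T>. q (K0_class E \<T> T1) (K0_class E \<T> T2) =
        int (hom_dim E T1 T2) - int (hom_dim E T2 T1))"
    unfolding hdiff_def by blast
  then have "bilinear_form (K0 E \<T>) (hom_form E \<T>) \<and> (\<forall>T1\<in>\<T>. \<forall>T2\<in>\<T>. hom_form E \<T> (K0_class E \<T> T1) (K0_class E \<T> T2) =
        int (hom_dim E T1 T2) - int (hom_dim E T2 T1))"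
    unfolding hom_form_def by (rule someI_ex)
  then show "bilinear_form (K0 E \<T>) (hom_form E \<T>)"
    "\<And>X Y. X \<in> \<T> \<Longrightarrow> Y \<in> \<T> \<Longrightarrow> hom_form E \<T> (K0_class E \<T> X) (K0_class E \<T> Y) = hdiff X Y"
    unfolding hdiff_def by auto
qed

lemma hom_form_hom:
  assumes "u \<in> carrier K0.G"
  shows "hom_form E \<T> u \<in> hom K0.G integer_group" "(\<lambda>v. hom_form E \<T> v u) \<in> hom K0.G integer_group"
  using hom_form(1) assms unfolding bilinear_form_def K0_eq by auto

lemma hom_form_skew:
  assumes "u \<in> carrier (K0 E \<T>)" "v \<in> carrier (K0 E \<T>)"
  shows "hom_form E \<T> u v = - hom_form E \<T> v u"
proof (rule bilinear_eqI[OF hom_form(1) _ _ assms])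
  have "hom_form E \<T> u (x \<otimes>\<^bsub>K0.G\<^esub> y) = hom_form E \<T> u x + hom_form E \<T> u y"
    "hom_form E \<T> (x \<otimes>\<^bsub>K0.G\<^esub> y) u = hom_form E \<T> x u + hom_form E \<T> y u"
    if "u \<in> carrier K0.G" "x \<in> carrier K0.G" "y \<in> carrier K0.G" for u x y
    using hom_mult[OF hom_form_hom(1)] hom_mult[OF hom_form_hom(2)] that by auto
  then show "bilinear_form (K0 E \<T>) (\<lambda>u v. - hom_form E \<T> v u)"
    unfolding bilinear_form_def K0_eq by (auto intro!: homI)
  show "hom_form E \<T> (K0_class E \<T> X) (K0_class E \<T> Y) = - hom_form E \<T> (K0_class E \<T> Y) (K0_class E \<T> X)"
    if "X \<in> \<T>" "Y \<in> \<T>" for X Y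
    using that by (simp add: hom_form(2) hdiff_def)
qed

lemma hom_form_diff:
  assumes "u \<in> carrier K0.G" "v \<in> carrier K0.G" "w \<in> carrier K0.G"
  shows "hom_form E \<T> (u \<otimes>\<^bsub>K0.G\<^esub> inv\<^bsub>K0.G\<^esub> v) w = hom_form E \<T> u w - hom_form E \<T> v w"
    "hom_form E \<T> w (u \<otimes>\<^bsub>K0.G\<^esub> inv\<^bsub>K0.G\<^esub> v) = hom_form E \<T> w u - hom_form E \<T> w v"
  using K0.hom_diff[OF group_integer_group hom_form_hom(1)[OF assms(3)] assms(1,2)]
    K0.hom_diff[OF group_integer_group hom_form_hom(2)[OF assms(3)] assms(1,2)] by auto

lemma class_diff_form:
  assumes "A \<in> \<T>" "B \<in> \<T>" "T \<in> \<T>"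
  shows "hom_form E \<T> (K0.cl (frag_of A - frag_of B)) (K0_class E \<T> T) = hdiff A T - hdiff B T"
  using hom_form_diff(1)[of "K0_class E \<T> A" "K0_class E \<T> B" "K0_class E \<T> T"] assms hom_form(2)
    K0.class_closed ind_diff_eq[of A B] unfolding K0_eq by (simp add: K0_class_def)

end

section \<open>Transport of the form along the index\<close>

lemma (in cluster_tilting_sub) ind_hom:
  assumes "cluster_tilting E \<U>"
  shows "ind_hom E \<U> \<T> \<in> hom (K0 E \<U>) (K0 E \<T>)"
    "\<And>U. U \<in> \<U> \<Longrightarrow> ind_hom E \<U> \<T> (K0_class E \<U> U) = ind E \<T> U"
proof -
  interpret U: cluster_tilting_sub E \<U> using assms by unfold_locales
  have R: "split_relations E \<U> = {frag_of S - frag_of A - frag_of B | A B S.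
     A \<in> \<U> \<and> B \<in> \<U> \<and> S \<in> \<U> \<and> direct_sum E A B S}" by (simp add: split_relations_def)
  have "\<exists>h. h \<in> hom U.K0.G (K0 E \<T>) \<and> (\<forall>U\<in>\<U>. h (K0_class E \<U> U) = ind E \<T> U)"
    by (rule U.K0.hom_exists[OF _ _ R, of "K0 E \<T>" "ind E \<T>"])
      (use ind_add ind_closed K0.comm_group_G K0_eq in \<open>auto simp: K0_class_def\<close>)
  then have "ind_hom E \<U> \<T> \<in> hom (K0 E \<U>) (K0 E \<T>) \<and> (\<forall>U\<in>\<U>. ind_hom E \<U> \<T> (K0_class E \<U> U) = ind E \<T> U)"
    unfolding ind_hom_def U.K0_eq by (rule someI_ex)
  then show "ind_hom E \<U> \<T> \<in> hom (K0 E \<U>) (K0 E \<T>)"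
    "\<And>U. U \<in> \<U> \<Longrightarrow> ind_hom E \<U> \<T> (K0_class E \<U> U) = ind E \<T> U" by auto
qed

text \<open>\<open>Hom\<close> from \<open>\<T>\<close> is exact on the resolutions defining the index, and so is \<open>Hom\<close> into an
  object of \<open>\<U>\<close>, as \<open>\<U>\<close> is rigid.\<close>

lemma (in cluster_tilting_sub) hom_form_invariant:
  assumes U: "cluster_tilting E \<U>" and u: "u \<in> carrier (K0 E \<U>)" "v \<in> carrier (K0 E \<U>)"
  shows "hom_form E \<T> (ind_hom E \<U> \<T> u) (ind_hom E \<U> \<T> v) = hom_form E \<U> u v"
proof -
  interpret U: cluster_tilting_sub E \<U> using U by unfold_locales
  note h = ind_hom[OF U]
  have hc: "ind_hom E \<U> \<T> w \<in> carrier K0.G" if "w \<in> carrier U.K0.G" for w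
    using h(1) that unfolding K0_eq U.K0_eq by (auto simp: hom_def)
  show ?thesis
  proof (rule U.bilinear_eqI[OF _ U.hom_form(1) _ u])
    have "ind_hom E \<U> \<T> (x \<otimes>\<^bsub>U.K0.G\<^esub> y) = ind_hom E \<U> \<T> x \<otimes>\<^bsub>K0.G\<^esub> ind_hom E \<U> \<T> y"
      if "x \<in> carrier U.K0.G" "y \<in> carrier U.K0.G" for x y
      using hom_mult[OF h(1)] that unfolding K0_eq U.K0_eq by auto
    moreover have "hom_form E \<T> u (x \<otimes>\<^bsub>K0.G\<^esub> y) = hom_form E \<T> u x + hom_form E \<T> u y"
      "hom_form E \<T> (x \<otimes>\<^bsub>K0.G\<^esub> y) u = hom_form E \<T> x u + hom_form E \<T> y u"
      if "u \<in> carrier K0.G" "x \<in> carrier K0.G" "y \<in> carrier K0.G" for u x y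
      using hom_mult[OF hom_form_hom(1)] hom_mult[OF hom_form_hom(2)] that by auto
    ultimately show "bilinear_form (K0 E \<U>) (\<lambda>u v. hom_form E \<T> (ind_hom E \<U> \<T> u) (ind_hom E \<U> \<T> v))"
      unfolding bilinear_form_def U.K0_eq using hc by (auto intro!: homI)
  next
    fix X Y assume X: "X \<in> \<U>" and Y: "Y \<in> \<U>"
    obtain K1 i1 R1 p1 where 1: "K1 \<in> \<T>" "R1 \<in> \<T>" "(K1, i1, R1, p1, X) \<in> Confl E"
      "ind E \<T> X = K0.cl (frag_of R1 - frag_of K1)" by (rule indE)
    obtain K2 i2 R2 p2 where 2: "K2 \<in> \<T>" "R2 \<in> \<T>" "(K2, i2, R2, p2, Y) \<in> Confl E"
      "ind E \<T> Y = K0.cl (frag_of R2 - frag_of K2)" by (rule indE)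
    have cl: "K0_class E \<T> T \<in> carrier K0.G" if "T \<in> \<T>" for T
      using K0.class_closed that by (simp add: K0_class_def)
    have "hom_form E \<T> (ind E \<T> X) (ind E \<T> Y) = (hdiff R1 R2 - hdiff K1 R2) - (hdiff R1 K2 - hdiff K1 K2)"
      unfolding 1(4) 2(4) ind_diff_eq[OF 2(2,1), symmetric] K0_eq
      using hom_form_diff(2)[OF cl[OF 2(2)] cl[OF 2(1)], of "ind E \<T> X"] ind_closed[of X]
        class_diff_form[OF 1(2,1)] 1(4) 2(1,2) unfolding K0_eq by simp
    \<comment> \<open>In the terms with first argument \<open>R1\<close> or \<open>K1\<close>, the
      difference of \<open>R2\<close> and \<open>K2\<close> is replaced by \<open>Y\<close>, since
      \<open>\<T>\<close> is rigid; what is left, \<open>R1\<close> against \<open>K1\<close> into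
      \<open>Y\<close>, gives \<open>X\<close>, since \<open>\<U>\<close> is rigid. The opposite
      terms are treated symmetrically.\<close>
    also have "\<dots> = hdiff X Y"
    proof -
      have "hom_dim E T R2 = hom_dim E T K2 + hom_dim E T Y" if "T \<in> \<T>" for T
        by (rule hom_dim_exact_post[OF 2(3) ext_van[OF that 2(1)]])
      moreover have "hom_dim E T R1 = hom_dim E T K1 + hom_dim E T X" if "T \<in> \<T>" for T
        by (rule hom_dim_exact_post[OF 1(3) ext_van[OF that 1(1)]])
      moreover have "hom_dim E R1 Y = hom_dim E X Y + hom_dim E K1 Y"
        by (rule hom_dim_exact_pre[OF 1(3) U.ext_van[OF X Y]])
      moreover have "hom_dim E R2 X = hom_dim E Y X + hom_dim E K2 X"
        by (rule hom_dim_exact_pre[OF 2(3) U.ext_van[OF Y X]])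
      ultimately show ?thesis unfolding hdiff_def using 1(1,2) 2(1,2) by simp
    qed
    finally show "hom_form E \<T> (ind_hom E \<U> \<T> (K0_class E \<U> X)) (ind_hom E \<U> \<T> (K0_class E \<U> Y)) =
      hom_form E \<U> (K0_class E \<U> X) (K0_class E \<U> Y)"
      using h(2) X Y U.hom_form(2) by simp
  qed
qed

section \<open>Pullbacks of a fixed extension\<close>

context exact_category
begin

text \<open>Pullback, pushout and Baer sum are defined as sets of extensions. A nonempty subset of a
  class that is closed under equivalence is the whole class, so one inclusion and one example settle
  each identity below.\<close>

lemma Ext1_eqI:
  assumes "B \<in> Ext1 E S X" "A \<subseteq> B" "A \<noteq> {}"
    and "\<And>x y. x \<in> A \<Longrightarrow> (x, y) \<in> ext_equiv E S X \<Longrightarrow> y \<in> A"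
  shows "A = B"
proof
  show "A \<subseteq> B" by fact
  obtain a where a: "a \<in> A" using assms(3) by blast
  have "(a, b) \<in> ext_equiv E S X" if "b \<in> B" for b
    using in_quotient_imp_in_rel[OF ext_equiv_equiv, of B S X a b] assms(1,2) a that unfolding Ext1_def by blast
  then show "B \<subseteq> A" using assms(4) a by blast
qed

lemma Ext1_nonempty: "B \<in> Ext1 E S X \<Longrightarrow> B \<noteq> {}"
  unfolding Ext1_def using in_quotient_imp_non_empty[OF ext_equiv_equiv] by blast

lemma Ext1_subset: "B \<in> Ext1 E S X \<Longrightarrow> B \<subseteq> extensions E S X"
  unfolding Ext1_def using in_quotient_imp_subset[OF ext_equiv_equiv] by blast

lemma Ext1_disj: "B \<in> Ext1 E S X \<Longrightarrow> C \<in> Ext1 E S X \<Longrightarrow> x \<in> B \<Longrightarrow> x \<in> C \<Longrightarrow> B = C"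
  unfolding Ext1_def using quotient_disj[OF ext_equiv_equiv] by blast

lemma push_closed:
  assumes "x \<in> ext_push E S X' a c" "(x, y) \<in> ext_equiv E S X'"
    and c: "\<And>i F p. (i, F, p) \<in> c \<Longrightarrow> i \<in> Hom E X F \<and> p \<in> Hom E F S" and a: "a \<in> Hom E X X'"
  shows "y \<in> ext_push E S X' a c"
proof -
  obtain i F p i' F' p' where xy: "x = (i, F, p)" "y = (i', F', p')" by (metis prod_cases3)
  obtain h where d: "(X', i, F, p, S) \<in> Confl E" "(X', i', F', p', S) \<in> Confl E"
    and h: "h \<in> Hom E F F'" "cm X' F F' h i = i'" "cm F F' S p' h = p"
    using assms(2) unfolding xy ext_equiv_cm is_iso_cm by blast
  interpret d: conflation E X' i F p S using d(1) by (rule conflI)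
  interpret d': conflation E X' i' F' p' S using d(2) by (rule conflI)
  obtain i0 F0 p0 g where g: "(i0, F0, p0) \<in> c" "g \<in> Hom E F0 F" "Comp E g i0 = Comp E i a" "Comp E p g = p0"
    using assms(1) unfolding xy ext_push_def by blast
  have t: "i0 \<in> Hom E X F0" "p0 \<in> Hom E F0 S" using c[OF g(1)] by auto
  have g3: "cm X F0 F g i0 = cm X X' F i a" "cm F0 F S p g = p0" using g(3,4) by (simp_all add: cm_def)
  have "cm X F0 F' (cm F0 F F' h g) i0 = cm X X' F' i' a"
    using h(1) t g(2) g3 a by (simp add: cm_red[OF h(2)])
  moreover have "cm F0 F' S p' (cm F0 F F' h g) = p0" using h(1) g(2) g3 by (simp add: cm_red[OF h(3)])
  moreover have "cm F0 F F' h g \<in> Hom E F0 F'" using h(1) g(2) by simp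
  ultimately show ?thesis
    unfolding xy ext_push_def extensions_def using d(2) g(1) by (auto simp: cm_def)
qed

lemma ext_addE:
  assumes "x \<in> ext_add E S X c d"
  obtains i1 F1 p1 i2 F2 p2 XX u1 u2 v1 v2 FF j1 j2 q1 q2 TT s1 s2 t1 t2 where
    "(i1, F1, p1) \<in> c" "(i2, F2, p2) \<in> d" "biproduct E X X XX u1 u2 v1 v2"
    "biproduct E F1 F2 FF j1 j2 q1 q2" "biproduct E S S TT s1 s2 t1 t2"
    "x \<in> ext_push E S X (v1 + v2) (ext_pull E S XX (s1 + s2)
       {(Comp E j1 (Comp E i1 v1) + Comp E j2 (Comp E i2 v2), FF,
         Comp E s1 (Comp E p1 q1) + Comp E s2 (Comp E p2 q2))})"
  using assms unfolding ext_add_def by clarsimp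

lemma ext_addI:
  assumes "(i1, F1, p1) \<in> c" "(i2, F2, p2) \<in> d" "biproduct E X X XX u1 u2 v1 v2"
    "biproduct E F1 F2 FF j1 j2 q1 q2" "biproduct E S S TT s1 s2 t1 t2"
    "x \<in> ext_push E S X (v1 + v2) (ext_pull E S XX (s1 + s2)
       {(Comp E j1 (Comp E i1 v1) + Comp E j2 (Comp E i2 v2), FF,
         Comp E s1 (Comp E p1 q1) + Comp E s2 (Comp E p2 q2))})"
  shows "x \<in> ext_add E S X c d"
  unfolding ext_add_def mem_Collect_eq
  apply (rule bexI[OF _ assms(1)])
  apply (simp only: prod.case)
  apply (rule bexI[OF _ assms(2)])
  apply (simp only: prod.case)
  apply (intro exI conjI)
     apply (rule assms)+
  done

end

context conflation
begin

text \<open>The connecting map from Hom(S, Y) to Ext^1(S, X): the class of all pullbacks of the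
  fixed conflation along \<open>f\<close>.\<close>

definition PB :: "'o \<Rightarrow> 'm \<Rightarrow> ('m \<times> 'o \<times> 'm) set" where
  "PB S f = {(i', F', p'). (X, i', F', p', S) \<in> Confl E \<and>
     (\<exists>g\<in>Hom E F' F. cm X F' F g i' = i \<and> cm F' F Y p g = cm F' S Y f p')}"

lemma PB_ex:
  assumes "f \<in> Hom E S Y"
  obtains i1 F1 p1 where "(i1, F1, p1) \<in> PB S f"
proof -
  obtain P j q g where "(X, j, P, q, S) \<in> Confl E" "g \<in> Hom E P F" "cm X P F g j = i"
    "cm P F Y p g = cm P S Y f q"
    using confl_pullback[OF confl assms] by metis
  then have "(j, P, q) \<in> PB S f" unfolding PB_def by blast
  then show thesis by (rule that)
qed

lemma PB_nonempty: "f \<in> Hom E S Y \<Longrightarrow> PB S f \<noteq> {}"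
  by (rule PB_ex) auto

lemma PB_closed:
  assumes f: "f \<in> Hom E S Y" and x: "x \<in> PB S f" and xy: "(x, y) \<in> ext_equiv E S X"
  shows "y \<in> PB S f"
proof -
  obtain i1 F1 p1 i2 F2 p2 where e: "y = (i1, F1, p1)" "x = (i2, F2, p2)" by (metis prod_cases3)
  have "(y, x) \<in> ext_equiv E S X" using xy by (rule ext_equiv_sym)
  then obtain h where d: "(X, i1, F1, p1, S) \<in> Confl E" "(X, i2, F2, p2, S) \<in> Confl E"
    and h: "h \<in> Hom E F1 F2" "cm X F1 F2 h i1 = i2" "cm F1 F2 S p2 h = p1"
    unfolding e ext_equiv_cm is_iso_cm by blast
  interpret d1: conflation E X i1 F1 p1 S using d(1) by (rule conflI)
  interpret d2: conflation E X i2 F2 p2 S using d(2) by (rule conflI)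
  obtain g where g: "g \<in> Hom E F2 F" "cm X F2 F g i2 = i" "cm F2 F Y p g = cm F2 S Y f p2"
    using x unfolding e PB_def by blast
  have "cm X F1 F (cm F1 F2 F g h) i1 = i" using g h by simp
  moreover have "cm F1 F Y p (cm F1 F2 F g h) = cm F1 S Y f p1"
    using g h(1) f by (simp add: cm_red[OF g(3)] h(3))
  ultimately show ?thesis unfolding e PB_def using d(1) cm_in[OF h(1) g(1)] by blast
qed

lemma PB_in_Ext1:
  assumes f: "f \<in> Hom E S Y"
  shows "PB S f \<in> Ext1 E S X"
proof -
  obtain x where x: "x \<in> PB S f" using PB_nonempty[OF f] by blast
  obtain i1 F1 p1 where e: "x = (i1, F1, p1)" by (metis prod_cases3)
  have c1: "(X, i1, F1, p1, S) \<in> Confl E" using x unfolding e PB_def by blast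
  have "ext_equiv E S X `` {x} = PB S f"
  proof (intro equalityI subsetI)
    fix y assume "y \<in> ext_equiv E S X `` {x}"
    then show "y \<in> PB S f" using PB_closed[OF f x] by blast
  next
    fix y assume y: "y \<in> PB S f"
    obtain i2 F2 p2 where e2: "y = (i2, F2, p2)" by (metis prod_cases3)
    obtain g1 where g1: "g1 \<in> Hom E F1 F" "cm X F1 F g1 i1 = i" "cm F1 F Y p g1 = cm F1 S Y f p1"
      using x unfolding e PB_def by blast
    have c2: "(X, i2, F2, p2, S) \<in> Confl E" using y unfolding e2 PB_def by blast
    obtain g2 where g2: "g2 \<in> Hom E F2 F" "cm X F2 F g2 i2 = i" "cm F2 F Y p g2 = cm F2 S Y f p2"
      using y unfolding e2 PB_def by blast
    obtain h where "is_iso E F1 F2 h" "cm X F1 F2 h i1 = i2" "cm F1 F2 S p2 h = p1"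
      using pullback_unique[OF confl f c1 g1 c2 g2] .
    then show "y \<in> ext_equiv E S X `` {x}" unfolding e e2 using c1 c2 ext_equiv_cm by blast
  qed
  then show ?thesis unfolding Ext1_def quotient_def using c1 unfolding e extensions_def by blast
qed

lemma PB_D:
  assumes "(i', F', p') \<in> PB S f"
  obtains g where "(X, i', F', p', S) \<in> Confl E" "i' \<in> Hom E X F'" "p' \<in> Hom E F' S" "g \<in> Hom E F' F"
    "cm X F' F g i' = i" "cm F' F Y p g = cm F' S Y f p'"
proof -
  have c: "(X, i', F', p', S) \<in> Confl E" using assms unfolding PB_def by blast
  then interpret c': conflation E X i' F' p' S by (rule conflI)
  show thesis using assms that c c'.i c'.p unfolding PB_def by blast
qed

text \<open>Exactness of the long sequence at Hom(S, Y). If one extension lies over both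
  \<open>f\<close> and \<open>f'\<close>, its two maps to \<open>F\<close> agree on
  \<open>X\<close>; their difference descends to \<open>S\<close> and lifts
  \<open>f - f'\<close>.\<close>

lemma PB_eq_iff:
  assumes f: "f \<in> Hom E S Y" and f': "f' \<in> Hom E S Y"
  shows "PB S f = PB S f' \<longleftrightarrow> (\<exists>u\<in>Hom E S F. cm S F Y p u = f - f')"
proof
  assume eq: "PB S f = PB S f'"
  obtain i1 F1 p1 where x: "(i1, F1, p1) \<in> PB S f" using PB_ex[OF f] .
  obtain g where g: "(X, i1, F1, p1, S) \<in> Confl E" "g \<in> Hom E F1 F" "cm X F1 F g i1 = i" "cm F1 F Y p g = cm F1 S Y f p1"
    using PB_D[OF x] by metis
  obtain g' where g': "g' \<in> Hom E F1 F" "cm X F1 F g' i1 = i" "cm F1 F Y p g' = cm F1 S Y f' p1"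
    using PB_D[OF x[unfolded eq]] by metis
  interpret c1: conflation E X i1 F1 p1 S using g(1) by (rule conflI)
  have "cm X F1 F (g - g') i1 = 0" using g g' by simp
  then obtain u where u: "u \<in> Hom E S F" "cm F1 S F u p1 = g - g'"
    using c1.colift[of "g - g'" F] g g' by auto
  have "cm S F Y p u = f - f'"
    by (rule c1.epi_eq[where W = Y]) (use u f f' g g' in simp_all)
  then show "\<exists>u\<in>Hom E S F. cm S F Y p u = f - f'" using u(1) by blast
next
  assume "\<exists>u\<in>Hom E S F. cm S F Y p u = f - f'"
  then obtain u where u: "u \<in> Hom E S F" "cm S F Y p u = f - f'" by blast
  obtain i1 F1 p1 where x: "(i1, F1, p1) \<in> PB S f" using PB_ex[OF f] .
  obtain g where g: "(X, i1, F1, p1, S) \<in> Confl E" "g \<in> Hom E F1 F" "cm X F1 F g i1 = i" "cm F1 F Y p g = cm F1 S Y f p1"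
    using PB_D[OF x] by metis
  interpret c1: conflation E X i1 F1 p1 S using g(1) by (rule conflI)
  have "cm X F1 F (g - cm F1 S F u p1) i1 = i" using g u by simp
  moreover have "cm F1 F Y p (g - cm F1 S F u p1) = cm F1 S Y f' p1" using g u f f' by (simp add: cm_red[OF u(2)])
  moreover have "g - cm F1 S F u p1 \<in> Hom E F1 F" using g u by simp
  ultimately have "(i1, F1, p1) \<in> PB S f'" unfolding PB_def using g(1) by blast
  then show "PB S f = PB S f'" using x Ext1_disj PB_in_Ext1 f f' by blast
qed

text \<open>Exactness at Ext^1(S, X): as Ext^1(S, F) vanishes, \<open>i\<close> extends to the
  middle term of any extension, and the map induced on quotients is \<open>f\<close>.\<close>

lemma PB_surj:
  assumes "x \<in> Ext1 E S X" "ext_van S F"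
  obtains f where "f \<in> Hom E S Y" "x = PB S f"
proof -
  obtain i1 F1 p1 where e: "(i1, F1, p1) \<in> x" using Ext1_nonempty[OF assms(1)] by (metis all_not_in_conv prod_cases3)
  have c: "(X, i1, F1, p1, S) \<in> Confl E" using Ext1_subset[OF assms(1)] e unfolding extensions_def by blast
  interpret c1: conflation E X i1 F1 p1 S using c by (rule conflI)
  obtain g where g: "g \<in> Hom E F1 F" "cm X F1 F g i1 = i" using ext_van_extend[OF c assms(2) i] .
  have "cm X F1 Y (cm F1 F Y p g) i1 = 0" using g by simp
  then obtain f where f: "f \<in> Hom E S Y" "cm F1 S Y f p1 = cm F1 F Y p g"
    using c1.colift[of "cm F1 F Y p g" Y] g by auto
  then have "(i1, F1, p1) \<in> PB S f" unfolding PB_def using c g f(2)[symmetric] by blast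
  then show thesis using that f(1) e Ext1_disj[OF assms(1) PB_in_Ext1[OF f(1)]] by blast
qed

lemma PB_pull:
  assumes f: "f \<in> Hom E S Y" and g: "g \<in> Hom E S' S"
  shows "ext_pull E S' X g (PB S f) = PB S' (cm S' S Y f g)"
proof (rule Ext1_eqI)
  have fg: "cm S' S Y f g \<in> Hom E S' Y" using f g by simp
  then show "PB S' (cm S' S Y f g) \<in> Ext1 E S' X" by (rule PB_in_Ext1)
  show "ext_pull E S' X g (PB S f) \<subseteq> PB S' (cm S' S Y f g)"
  proof
    fix x assume x: "x \<in> ext_pull E S' X g (PB S f)"
    obtain i2 F2 p2 where e: "x = (i2, F2, p2)" by (metis prod_cases3)
    obtain i1 F1 p1 h where h: "(i1, F1, p1) \<in> PB S f" "(X, i2, F2, p2, S') \<in> Confl E" "h \<in> Hom E F2 F1"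
      "cm X F2 F1 h i2 = i1" "cm F2 F1 S p1 h = cm F2 S' S g p2"
      using x unfolding e ext_pull_def extensions_def cm_def by blast
    interpret c2: conflation E X i2 F2 p2 S' using h(2) by (rule conflI)
    obtain k where k: "i1 \<in> Hom E X F1" "p1 \<in> Hom E F1 S" "k \<in> Hom E F1 F" "cm X F1 F k i1 = i" "cm F1 F Y p k = cm F1 S Y f p1"
      using PB_D[OF h(1)] by metis
    have "cm X F2 F (cm F2 F1 F k h) i2 = i" using h k by simp
    moreover have "cm F2 F Y p (cm F2 F1 F k h) = cm F2 S' Y (cm S' S Y f g) p2"
      using h(3) k f g by (simp add: cm_red[OF k(5)] h(5))
    ultimately show "x \<in> PB S' (cm S' S Y f g)" unfolding e PB_def using h(2) cm_in[OF h(3) k(3)] by blast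
  qed
  obtain i1 F1 p1 where x: "(i1, F1, p1) \<in> PB S f" using PB_ex[OF f] .
  then have c1: "(X, i1, F1, p1, S) \<in> Confl E" unfolding PB_def by blast
  obtain P j q h where P: "(X, j, P, q, S') \<in> Confl E" "h \<in> Hom E P F1" "cm X P F1 h j = i1" "cm P F1 S p1 h = cm P S' S g q"
    using confl_pullback[OF c1 g] by metis
  then have "(j, P, q) \<in> ext_pull E S' X g (PB S f)" unfolding ext_pull_def extensions_def using x by (auto simp: cm_def)
  then show "ext_pull E S' X g (PB S f) \<noteq> {}" by blast
next
  fix x y assume x: "x \<in> ext_pull E S' X g (PB S f)" and xy: "(x, y) \<in> ext_equiv E S' X"
  obtain i1 F1 p1 i2 F2 p2 where e: "x = (i1, F1, p1)" "y = (i2, F2, p2)" by (metis prod_cases3)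
  obtain k where d: "(X, i2, F2, p2, S') \<in> Confl E" "(X, i1, F1, p1, S') \<in> Confl E"
    and k: "k \<in> Hom E F2 F1" "cm X F2 F1 k i2 = i1" "cm F2 F1 S' p1 k = p2"
    using ext_equiv_sym[OF xy] unfolding e ext_equiv_cm is_iso_cm by blast
  interpret d1: conflation E X i1 F1 p1 S' using d(2) by (rule conflI)
  interpret d2: conflation E X i2 F2 p2 S' using d(1) by (rule conflI)
  obtain i0 F0 p0 h where h: "(i0, F0, p0) \<in> PB S f" "h \<in> Hom E F1 F0"
      "cm X F1 F0 h i1 = i0" "cm F1 F0 S p0 h = cm F1 S' S g p1"
      using x unfolding e ext_pull_def extensions_def cm_def by blast
  have p0: "p0 \<in> Hom E F0 S" using PB_D[OF h(1)] by metis
  have "cm X F2 F0 (cm F2 F1 F0 h k) i2 = i0" using h k by simp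
  moreover have "cm F2 F0 S p0 (cm F2 F1 F0 h k) = cm F2 S' S g p2" using h(2) k(1) g p0 by (simp add: cm_red[OF h(4)] k(3))
  moreover have "cm F2 F1 F0 h k \<in> Hom E F2 F0" using h k by simp
  ultimately show "y \<in> ext_pull E S' X g (PB S f)" unfolding e ext_pull_def extensions_def
    using d(1) h(1) unfolding cm_def by blast
qed

text \<open>A member of the scaled class is a pushout along multiplication by \<open>c\<close>. The
  map to \<open>F\<close> over \<open>f\<close>, scaled by \<open>c\<close>, descends to that
  pushout and lies over the scaled \<open>f\<close>.\<close>

lemma PB_scale:
  assumes f: "f \<in> Hom E S Y"
  shows "ext_scale E S X c (PB S f) = PB S (Scale E c f)"
proof (rule Ext1_eqI)
  show "PB S (Scale E c f) \<in> Ext1 E S X" using f by (intro PB_in_Ext1) simp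
  have t: "i1 \<in> Hom E X F1 \<and> p1 \<in> Hom E F1 S" if "(i1, F1, p1) \<in> PB S f" for i1 F1 p1
    using PB_D[OF that] by metis
  show "ext_scale E S X c (PB S f) \<subseteq> PB S (Scale E c f)"
  proof
    fix x assume x: "x \<in> ext_scale E S X c (PB S f)"
    obtain i2 F2 p2 where e: "x = (i2, F2, p2)" by (metis prod_cases3)
    obtain i1 F1 p1 h where h: "(i1, F1, p1) \<in> PB S f" "(X, i2, F2, p2, S) \<in> Confl E" "h \<in> Hom E F1 F2"
      "cm X F1 F2 h i1 = cm X X F2 i2 (Scale E c (Idm E X))" "cm F1 F2 S p2 h = p1"
      using x unfolding e ext_scale_def ext_push_def extensions_def cm_def by blast
    interpret c2: conflation E X i2 F2 p2 S using h(2) by (rule conflI)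
    obtain k where k: "(X, i1, F1, p1, S) \<in> Confl E" "i1 \<in> Hom E X F1" "p1 \<in> Hom E F1 S" "k \<in> Hom E F1 F"
       "cm X F1 F k i1 = i" "cm F1 F Y p k = cm F1 S Y f p1"
      using PB_D[OF h(1)] by metis
    interpret c1: conflation E X i1 F1 p1 S using k(1) by (rule conflI)
    have "Scale E c (Idm E X) \<in> Hom E X X" "Scale E c k \<in> Hom E F1 F"
      "cm X F1 F (Scale E c k) i1 = cm X X F i (Scale E c (Idm E X))" using k by simp_all
    then obtain m where m: "m \<in> Hom E F2 F" "cm F1 F2 F m h = Scale E c k" "cm X F2 F m i2 = i"
      using pushout_of_morphism[OF k(1) h(2) _ h(3,4,5) _ i] by metis
    \<comment> \<open>The two sides agree on \<open>X\<close>, so their difference descends to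
      \<open>S\<close>; there it vanishes after composition with the epimorphism
      \<open>p1\<close>.\<close>
    have pm: "cm F2 F Y p m = cm F2 S Y (Scale E c f) p2"
    proof -
      have "cm X F2 Y (cm F2 F Y p m - cm F2 S Y (Scale E c f) p2) i2 = 0" using m f by simp
      then obtain d where d: "d \<in> Hom E S Y" "cm F2 S Y d p2 = cm F2 F Y p m - cm F2 S Y (Scale E c f) p2"
        using c2.colift[of "cm F2 F Y p m - cm F2 S Y (Scale E c f) p2" Y] m f by auto
      have "cm F1 S Y d p1 = cm F1 F2 Y (cm F2 S Y d p2) h" using d(1) h by simp
      also have "\<dots> = 0" unfolding d(2) using m h k f by simp
      finally have "d = 0" using c1.epi d(1) by blast
      then show ?thesis using d(2) by simp
    qed
    show "x \<in> PB S (Scale E c f)" unfolding e PB_def using h(2) m(1,3) pm by blast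
  qed
  obtain i1 F1 p1 where x: "(i1, F1, p1) \<in> PB S f" using PB_ex[OF f] .
  then have c1: "(X, i1, F1, p1, S) \<in> Confl E" unfolding PB_def by blast
  obtain P j q h where P: "(X, j, P, q, S) \<in> Confl E" "h \<in> Hom E F1 P" "cm F1 P S q h = p1"
      "cm X F1 P h i1 = cm X X P j (Scale E c (Idm E X))"
    using confl_pushout[OF c1, of "Scale E c (Idm E X)" X] by (metis hom_scale id_in)
  then have "(j, P, q) \<in> ext_scale E S X c (PB S f)" unfolding ext_scale_def ext_push_def extensions_def using x
    by (auto simp: cm_def)
  then show "ext_scale E S X c (PB S f) \<noteq> {}" by blast
  show "y \<in> ext_scale E S X c (PB S f)" if "x \<in> ext_scale E S X c (PB S f)" "(x, y) \<in> ext_equiv E S X" for x y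
    using that unfolding ext_scale_def by (rule push_closed) (use t in auto)
qed

text \<open>For the inclusion, the maps from \<open>F1\<close> and \<open>F2\<close> to
  \<open>F\<close> are added on the pullback along the diagonal, and the sum descends to the pushout
  along the codiagonal. The rest shows that a Baer sum exists at all and that the set is closed
  under equivalence.\<close>

lemma PB_add:
  assumes f: "f \<in> Hom E S Y" and g: "g \<in> Hom E S Y"
  shows "ext_add E S X (PB S f) (PB S g) = PB S (f + g)"
proof (rule Ext1_eqI)
  show "PB S (f + g) \<in> Ext1 E S X" using f g by (intro PB_in_Ext1) simp
  show "ext_add E S X (PB S f) (PB S g) \<subseteq> PB S (f + g)"
  proof
    fix x assume x: "x \<in> ext_add E S X (PB S f) (PB S g)"
    obtain i3 F3 p3 where e: "x = (i3, F3, p3)" by (metis prod_cases3)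
    obtain i1 F1 p1 i2 F2 p2 XX u1 u2 v1 v2 FF j1 j2 q1 q2 TT s1 s2 t1 t2 where
      e1: "(i1, F1, p1) \<in> PB S f" and e2: "(i2, F2, p2) \<in> PB S g" and
      bX: "biproduct E X X XX u1 u2 v1 v2" and bF: "biproduct E F1 F2 FF j1 j2 q1 q2" and
      bT: "biproduct E S S TT s1 s2 t1 t2" and
      x': "(i3, F3, p3) \<in> ext_push E S X (v1 + v2) (ext_pull E S XX (s1 + s2)
         {(Comp E j1 (Comp E i1 v1) + Comp E j2 (Comp E i2 v2), FF,
           Comp E s1 (Comp E p1 q1) + Comp E s2 (Comp E p2 q2))})"
      using x unfolding e by (rule ext_addE)
    interpret bX: biprod E X X XX u1 u2 v1 v2 using bX by unfold_locales
    interpret bF: biprod E F1 F2 FF j1 j2 q1 q2 using bF by unfold_locales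
    interpret bT: biprod E S S TT s1 s2 t1 t2 using bT by unfold_locales
    obtain g1 where g1: "(X, i1, F1, p1, S) \<in> Confl E" "g1 \<in> Hom E F1 F"
       "cm X F1 F g1 i1 = i" "cm F1 F Y p g1 = cm F1 S Y f p1"
      using PB_D[OF e1] by metis
    obtain g2 where g2: "(X, i2, F2, p2, S) \<in> Confl E" "g2 \<in> Hom E F2 F"
       "cm X F2 F g2 i2 = i" "cm F2 F Y p g2 = cm F2 S Y g p2"
      using PB_D[OF e2] by metis
    interpret c1: conflation E X i1 F1 p1 S using g1(1) by (rule conflI)
    interpret c2: conflation E X i2 F2 p2 S using g2(1) by (rule conflI)
    obtain iy Z py G where c3: "(X, i3, F3, p3, S) \<in> Confl E" and
      y: "(iy, Z, py) \<in> ext_pull E S XX (s1 + s2)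
         {(Comp E j1 (Comp E i1 v1) + Comp E j2 (Comp E i2 v2), FF,
           Comp E s1 (Comp E p1 q1) + Comp E s2 (Comp E p2 q2))}"
      and G: "G \<in> Hom E Z F3" "cm XX Z F3 G iy = cm XX X F3 i3 (v1 + v2)" "cm Z F3 S p3 G = py"
      using x' unfolding ext_push_def extensions_def cm_def by blast
    interpret c3: conflation E X i3 F3 p3 S using c3 by (rule conflI)
    obtain h where cy: "(XX, iy, Z, py, S) \<in> Confl E" and h: "h \<in> Hom E Z FF"
      "cm XX Z FF h iy = cm XX F1 FF j1 (cm XX X F1 i1 v1) + cm XX F2 FF j2 (cm XX X F2 i2 v2)"
      "cm Z FF TT (cm FF S TT s1 (cm FF F1 S p1 q1) + cm FF S TT s2 (cm FF F2 S p2 q2)) h = cm Z S TT (s1 + s2) py"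
      using y unfolding ext_pull_def extensions_def cm_def by blast
    interpret cy: conflation E XX iy Z py S using cy by (rule conflI)
    have h': "cm Z S TT s1 (cm Z F1 S p1 (cm Z FF F1 q1 h)) + cm Z S TT s2 (cm Z F2 S p2 (cm Z FF F2 q2 h)) =
        cm Z S TT s1 py + cm Z S TT s2 py" using h(3) h(1) by simp
    \<comment> \<open>Both components in \<open>T \<oplus> T\<close> are read off: the two
      projections of \<open>Z\<close> have the same image \<open>py\<close> in \<open>S\<close>,
      because the pullback was taken along the diagonal.\<close>
    have qh: "cm Z F1 S p1 (cm Z FF F1 q1 h) = py" "cm Z F2 S p2 (cm Z FF F2 q2 h) = py"
      using arg_cong[OF h', of "cm Z TT S t1"] arg_cong[OF h', of "cm Z TT S t2"] h(1) by simp_all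
    define H where "H = cm Z F1 F g1 (cm Z FF F1 q1 h) + cm Z F2 F g2 (cm Z FF F2 q2 h)"
    have H: "H \<in> Hom E Z F" unfolding H_def using g1 g2 h(1) by simp
    have Hi: "cm XX Z F H iy = cm XX X F i (v1 + v2)"
      unfolding H_def using g1(2) g2(2) h(1) by (simp add: h(2) cm_red[OF g1(3)] cm_red[OF g2(3)])
    have pH: "cm Z F Y p H = cm Z S Y (f + g) py"
      unfolding H_def using g1(2) g2(2) h(1) f g by (simp add: cm_red[OF g1(4)] cm_red[OF g2(4)] qh)
    obtain m where m: "m \<in> Hom E F3 F" "cm Z F3 F m G = H" "cm X F3 F m i3 = i"
      using pushout_of_morphism[OF cy c3 _ G H i Hi] by (metis hom_add bX.p1 bX.p2)
    have pm: "cm F3 F Y p m = cm F3 S Y (f + g) p3"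
    proof -
      have fg: "f + g \<in> Hom E S Y" using f g by simp
      have "cm X F3 Y (cm F3 F Y p m - cm F3 S Y (f + g) p3) i3 = 0" using m fg by simp
      then obtain d where d: "d \<in> Hom E S Y" "cm F3 S Y d p3 = cm F3 F Y p m - cm F3 S Y (f + g) p3"
        using c3.colift[of "cm F3 F Y p m - cm F3 S Y (f + g) p3" Y] m fg by auto
      have "cm Z S Y d py = cm Z F3 Y (cm F3 S Y d p3) G" using d(1) G by simp
      also have "\<dots> = cm Z F Y p (cm Z F3 F m G) - cm Z S Y (f + g) (cm Z F3 S p3 G)"
        unfolding d(2) using m(1) G(1) fg by simp
      also have "\<dots> = 0" unfolding m(2) G(3) pH by simp
      finally have "d = 0" using cy.epi d(1) by blast
      then show ?thesis using d(2) by simp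
    qed
    show "x \<in> PB S (f + g)" unfolding e PB_def using c3 m(1,3) pm by blast
  qed
  show "ext_add E S X (PB S f) (PB S g) \<noteq> {}"
  proof -
    obtain i1 F1 p1 where e1: "(i1, F1, p1) \<in> PB S f" using PB_ex[OF f] .
    obtain i2 F2 p2 where e2: "(i2, F2, p2) \<in> PB S g" using PB_ex[OF g] .
    have c1: "(X, i1, F1, p1, S) \<in> Confl E" and c2: "(X, i2, F2, p2, S) \<in> Confl E"
      using e1 e2 unfolding PB_def by blast+
    interpret c1: conflation E X i1 F1 p1 S using c1 by (rule conflI)
    interpret c2: conflation E X i2 F2 p2 S using c2 by (rule conflI)
    obtain XX u1 u2 v1 v2 where bX: "biproduct E X X XX u1 u2 v1 v2" using ex_direct_sum unfolding direct_sum_def by blast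
    obtain FF j1 j2 q1 q2 where bF: "biproduct E F1 F2 FF j1 j2 q1 q2" using ex_direct_sum unfolding direct_sum_def by blast
    obtain TT s1 s2 t1 t2 where bT: "biproduct E S S TT s1 s2 t1 t2" using ex_direct_sum unfolding direct_sum_def by blast
    interpret bX: biprod E X X XX u1 u2 v1 v2 using bX by unfold_locales
    interpret bF: biprod E F1 F2 FF j1 j2 q1 q2 using bF by unfold_locales
    interpret bT: biprod E S S TT s1 s2 t1 t2 using bT by unfold_locales
    \<comment> \<open>The fibre product of \<open>F1\<close> and \<open>F2\<close> over
      \<open>S\<close> is the middle term of the pullback of the summed extension along the
      diagonal. Its map to \<open>S\<close> is a deflation, being a composite of two.\<close>
    obtain P j q k where P: "(X, j, P, q, F2) \<in> Confl E" "k \<in> Hom E P F1" "cm P F1 S p1 k = cm P F2 S p2 q"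
      and ex: "\<And>W a b. a \<in> Hom E W F1 \<Longrightarrow> b \<in> Hom E W F2 \<Longrightarrow> cm W F1 S p1 a = cm W F2 S p2 b \<Longrightarrow>
        \<exists>u\<in>Hom E W P. cm W P F1 k u = a \<and> cm W P F2 q u = b"
      and jm: "\<And>W u. u \<in> Hom E W P \<Longrightarrow> cm W P F1 k u = 0 \<Longrightarrow> cm W P F2 q u = 0 \<Longrightarrow> u = 0"
      using confl_pullback[OF c1 c2.p] by metis
    interpret P: conflation E X j P q F2 using P(1) by (rule conflI)
    define py where "py = cm P F2 S p2 q"
    have py: "py \<in> Hom E P S" unfolding py_def by simp
    have "deflation E P F2 q" "deflation E F2 S p2" using P(1) c2 unfolding deflation_def by blast+
    then have defl: "deflation E P S py" unfolding py_def cm_def by (rule deflation_Comp)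
    obtain iy where iy: "iy \<in> Hom E XX P" "cm XX P F1 k iy = cm XX X F1 i1 v1" "cm XX P F2 q iy = cm XX X F2 i2 v2"
      using ex[of "cm XX X F1 i1 v1" XX "cm XX X F2 i2 v2"] by auto
    \<comment> \<open>An element of the fibre product lying over zero has components in the two
      kernels, hence comes from two copies of \<open>X\<close>.\<close>
    have "is_kernel E XX P S iy py"
      unfolding is_kernel_cm
    proof (intro conjI allI ballI impI)
      show "cm XX P S py iy = 0" unfolding py_def using iy by simp
    next
      fix W a assume a: "a \<in> Hom E W P" "cm W P S py a = 0"
      have "cm W F2 S p2 (cm W P F2 q a) = 0" using a unfolding py_def by simp
      then obtain a2 where a2: "a2 \<in> Hom E W X" "cm W X F2 i2 a2 = cm W P F2 q a"
        using c2.lift[of "cm W P F2 q a" W] a by auto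
      have "cm W F1 S p1 (cm W P F1 k a) = 0" using a P(2) unfolding py_def by (simp add: cm_red[OF P(3)])
      then obtain a1 where a1: "a1 \<in> Hom E W X" "cm W X F1 i1 a1 = cm W P F1 k a"
        using c1.lift[of "cm W P F1 k a" W] a P(2) by auto
      define b where "b = cm W X XX u1 a1 + cm W X XX u2 a2"
      have b: "b \<in> Hom E W XX" unfolding b_def using a1 a2 by simp
      have vb: "cm W XX X v1 b = a1" "cm W XX X v2 b = a2" unfolding b_def using a1 a2 by simp_all
      have "cm W XX P iy b - a = 0"
        by (rule jm[where W = W]) (use a b iy(1) P(2) a1(2) a2(2) in
          \<open>simp_all add: cm_red[OF iy(2)] cm_red[OF iy(3)] vb\<close>)
      then show "\<exists>b\<in>Hom E W XX. cm W XX P iy b = a" using b by auto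
    next
      fix W b assume b: "b \<in> Hom E W XX" "cm W XX P iy b = 0"
      have "cm W X F1 i1 (cm W XX X v1 b) = cm W P F1 k (cm W XX P iy b)"
        using b(1) iy(1) P(2) by (simp add: cm_red[OF iy(2)])
      then have z1: "cm W XX X v1 b = 0" using b c1.mono[of "cm W XX X v1 b" W] P(2) by simp
      have "cm W X F2 i2 (cm W XX X v2 b) = cm W P F2 q (cm W XX P iy b)"
        using b(1) iy(1) by (simp add: cm_red[OF iy(3)])
      then have "cm W XX X v2 b = 0" using b c2.mono[of "cm W XX X v2 b" W] by simp
      then show "b = 0" using z1 b by (intro bX.eqI[of b W 0]) simp_all
    qed (use iy py in auto)
    then have cy: "(XX, iy, P, py, S) \<in> Confl E" by (rule deflation_kernel[OF defl])
    interpret cy: conflation E XX iy P py S using cy by (rule conflI)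
    define h where "h = cm P F1 FF j1 k + cm P F2 FF j2 q"
    have h: "h \<in> Hom E P FF" unfolding h_def using P(2) by simp
    have hi: "cm XX P FF h iy = cm XX F1 FF j1 (cm XX X F1 i1 v1) + cm XX F2 FF j2 (cm XX X F2 i2 v2)"
      unfolding h_def using iy P(2) by simp
    have ph: "cm P FF TT (cm FF S TT s1 (cm FF F1 S p1 q1) + cm FF S TT s2 (cm FF F2 S p2 q2)) h = cm P S TT (s1 + s2) py"
      unfolding h_def py_def using P(2) by (simp add: P(3))
    have y: "(iy, P, py) \<in> ext_pull E S XX (s1 + s2)
         {(Comp E j1 (Comp E i1 v1) + Comp E j2 (Comp E i2 v2), FF,
           Comp E s1 (Comp E p1 q1) + Comp E s2 (Comp E p2 q2))}"
      unfolding ext_pull_def extensions_def using cy h hi ph unfolding cm_def by blast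
    have "v1 + v2 \<in> Hom E XX X" by simp
    then obtain Q jx qx G where Q: "(X, jx, Q, qx, S) \<in> Confl E" "G \<in> Hom E P Q" "cm P Q S qx G = py"
      "cm XX P Q G iy = cm XX X Q jx (v1 + v2)"
      using confl_pushout[OF cy] by metis
    have "(jx, Q, qx) \<in> ext_push E S X (v1 + v2) (ext_pull E S XX (s1 + s2)
         {(Comp E j1 (Comp E i1 v1) + Comp E j2 (Comp E i2 v2), FF,
           Comp E s1 (Comp E p1 q1) + Comp E s2 (Comp E p2 q2))})"
      unfolding ext_push_def extensions_def using Q y unfolding cm_def by blast
    then have "(jx, Q, qx) \<in> ext_add E S X (PB S f) (PB S g)"
      by (rule ext_addI[OF e1 e2 bX bF bT])
    then show ?thesis by blast
  qed
next
  fix x y assume x: "x \<in> ext_add E S X (PB S f) (PB S g)" and xy: "(x, y) \<in> ext_equiv E S X"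
  obtain i1 F1 p1 i2 F2 p2 XX u1 u2 v1 v2 FF j1 j2 q1 q2 TT s1 s2 t1 t2 where
    e1: "(i1, F1, p1) \<in> PB S f" and e2: "(i2, F2, p2) \<in> PB S g" and
    bX: "biproduct E X X XX u1 u2 v1 v2" and bF: "biproduct E F1 F2 FF j1 j2 q1 q2" and
    bT: "biproduct E S S TT s1 s2 t1 t2" and
    x': "x \<in> ext_push E S X (v1 + v2) (ext_pull E S XX (s1 + s2)
       {(Comp E j1 (Comp E i1 v1) + Comp E j2 (Comp E i2 v2), FF,
         Comp E s1 (Comp E p1 q1) + Comp E s2 (Comp E p2 q2))})"
    using x by (rule ext_addE)
  interpret bX: biprod E X X XX u1 u2 v1 v2 using bX by unfold_locales
  have t: "i0 \<in> Hom E XX F0 \<and> p0 \<in> Hom E F0 S" if "(i0, F0, p0) \<in> ext_pull E S XX (s1 + s2) B" for i0 F0 p0 B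
  proof -
    have "(XX, i0, F0, p0, S) \<in> Confl E" using that unfolding ext_pull_def extensions_def by blast
    then interpret c0: conflation E XX i0 F0 p0 S by (rule conflI)
    show ?thesis by simp
  qed
  have "y \<in> ext_push E S X (v1 + v2) (ext_pull E S XX (s1 + s2)
       {(Comp E j1 (Comp E i1 v1) + Comp E j2 (Comp E i2 v2), FF,
         Comp E s1 (Comp E p1 q1) + Comp E s2 (Comp E p2 q2))})"
    using x' xy by (rule push_closed[where X = XX]) (use t in auto)
  then show "y \<in> ext_add E S X (PB S f) (PB S g)"
    by (rule ext_addI[OF e1 e2 bX bF bT])
qed

end

section \<open>Modules and their presentations\<close>

lemma vector_space_smult: "vector_space (smult :: 'k::field \<Rightarrow> 'k poly \<Rightarrow> 'k poly)"
  by unfold_locales (simp_all add: smult_add_right smult_add_left)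

interpretation pv: vector_space "smult :: 'k::field \<Rightarrow> 'k poly \<Rightarrow> 'k poly"
  by (rule vector_space_smult)

locale cluster_module = cluster_tilting_sub E \<T>
  for E :: "('o, 'm::ab_group_add, 'k::field) exact_cat" and \<T> +
  fixes M :: "('o, 'm, 'k poly) cat_module"
  assumes module: "is_module E \<T> M"
begin

abbreviation act where "act \<equiv> Act M"

lemmas module_laws = module[unfolded is_module_def]

lemma Val_subspace: "T \<in> \<T> \<Longrightarrow> pv.subspace (Val M T)"
  by (rule module_laws[THEN conjunct1, rule_format])

lemma Val_0 [simp]: "T \<in> \<T> \<Longrightarrow> 0 \<in> Val M T"
  and Val_add [simp]: "T \<in> \<T> \<Longrightarrow> v \<in> Val M T \<Longrightarrow> w \<in> Val M T \<Longrightarrow> v + w \<in> Val M T"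
  and Val_diff [simp]: "T \<in> \<T> \<Longrightarrow> v \<in> Val M T \<Longrightarrow> w \<in> Val M T \<Longrightarrow> v - w \<in> Val M T"
  and Val_neg [simp]: "T \<in> \<T> \<Longrightarrow> v \<in> Val M T \<Longrightarrow> - v \<in> Val M T"
  and Val_smult [simp]: "T \<in> \<T> \<Longrightarrow> v \<in> Val M T \<Longrightarrow> smult c v \<in> Val M T"
  by (simp_all add: Val_subspace pv.subspace_0 pv.subspace_add pv.subspace_diff pv.subspace_neg pv.subspace_scale)

lemma act_in [simp]: "S \<in> \<T> \<Longrightarrow> T \<in> \<T> \<Longrightarrow> f \<in> Hom E S T \<Longrightarrow> v \<in> Val M T \<Longrightarrow> act S T f v \<in> Val M S"
  by (rule module_laws[THEN conjunct2, THEN conjunct1, rule_format])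

lemma act_add [simp]: "S \<in> \<T> \<Longrightarrow> T \<in> \<T> \<Longrightarrow> f \<in> Hom E S T \<Longrightarrow> v \<in> Val M T \<Longrightarrow> w \<in> Val M T \<Longrightarrow>
    act S T f (v + w) = act S T f v + act S T f w"
  by (rule module_laws[THEN conjunct2, THEN conjunct2, THEN conjunct1, rule_format])

lemma act_smult [simp]: "S \<in> \<T> \<Longrightarrow> T \<in> \<T> \<Longrightarrow> f \<in> Hom E S T \<Longrightarrow> v \<in> Val M T \<Longrightarrow>
    act S T f (smult c v) = smult c (act S T f v)"
  by (rule module_laws[THEN conjunct2, THEN conjunct2, THEN conjunct2, THEN conjunct1, rule_format])

lemma act_add_left [simp]: "S \<in> \<T> \<Longrightarrow> T \<in> \<T> \<Longrightarrow> f \<in> Hom E S T \<Longrightarrow> g \<in> Hom E S T \<Longrightarrow> v \<in> Val M T \<Longrightarrow>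
    act S T (f + g) v = act S T f v + act S T g v"
  by (rule module_laws[THEN conjunct2, THEN conjunct2, THEN conjunct2, THEN conjunct2, THEN conjunct1, rule_format])

lemma act_scale_left [simp]: "S \<in> \<T> \<Longrightarrow> T \<in> \<T> \<Longrightarrow> f \<in> Hom E S T \<Longrightarrow> v \<in> Val M T \<Longrightarrow>
    act S T (Scale E c f) v = smult c (act S T f v)"
  by (rule module_laws[THEN conjunct2, THEN conjunct2, THEN conjunct2, THEN conjunct2, THEN conjunct2, THEN conjunct1, rule_format])

lemma act_id [simp]: "T \<in> \<T> \<Longrightarrow> v \<in> Val M T \<Longrightarrow> act T T (Idm E T) v = v"
  by (rule module_laws[THEN conjunct2, THEN conjunct2, THEN conjunct2, THEN conjunct2, THEN conjunct2, THEN conjunct2, THEN conjunct1, rule_format])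

lemma act_comp [simp]: "R \<in> \<T> \<Longrightarrow> S \<in> \<T> \<Longrightarrow> T \<in> \<T> \<Longrightarrow> f \<in> Hom E R S \<Longrightarrow> g \<in> Hom E S T \<Longrightarrow> v \<in> Val M T \<Longrightarrow>
    act R T (cm R S T g f) v = act R S f (act S T g v)"
  unfolding cm_def by (rule module_laws[THEN conjunct2, THEN conjunct2, THEN conjunct2, THEN conjunct2, THEN conjunct2, THEN conjunct2, THEN conjunct2, rule_format])

lemma act_0 [simp]: "S \<in> \<T> \<Longrightarrow> T \<in> \<T> \<Longrightarrow> f \<in> Hom E S T \<Longrightarrow> act S T f 0 = 0"
  using act_smult[of S T f 0 0] by simp

lemma act_0_left [simp]: "S \<in> \<T> \<Longrightarrow> T \<in> \<T> \<Longrightarrow> v \<in> Val M T \<Longrightarrow> act S T 0 v = 0"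
  using act_scale_left[of S T 0 v 0] by simp

lemma act_neg_left [simp]: "S \<in> \<T> \<Longrightarrow> T \<in> \<T> \<Longrightarrow> f \<in> Hom E S T \<Longrightarrow> v \<in> Val M T \<Longrightarrow>
    act S T (- f) v = - act S T f v"
  using act_add_left[of S T f "- f" v] by (simp add: eq_neg_iff_add_eq_0 add.commute)

lemma act_neg [simp]: "S \<in> \<T> \<Longrightarrow> T \<in> \<T> \<Longrightarrow> f \<in> Hom E S T \<Longrightarrow> v \<in> Val M T \<Longrightarrow>
    act S T f (- v) = - act S T f v"
  using act_add[of S T f v "- v"] by (simp add: eq_neg_iff_add_eq_0 add.commute)

lemma act_diff_left [simp]: "S \<in> \<T> \<Longrightarrow> T \<in> \<T> \<Longrightarrow> f \<in> Hom E S T \<Longrightarrow> g \<in> Hom E S T \<Longrightarrow> v \<in> Val M T \<Longrightarrow>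
    act S T (f - g) v = act S T f v - act S T g v"
  using act_add_left[of S T f "- g" v] by simp

lemma act_diff [simp]: "S \<in> \<T> \<Longrightarrow> T \<in> \<T> \<Longrightarrow> f \<in> Hom E S T \<Longrightarrow> v \<in> Val M T \<Longrightarrow> w \<in> Val M T \<Longrightarrow>
    act S T f (v - w) = act S T f v - act S T f w"
  using act_add[of S T f v "- w"] by simp

text \<open>Exactness of Hom(_, L) -> Hom(_, C) -> M -> 0 on \<open>\<T>\<close>, where by the
  Yoneda lemma the second map is encoded by the element \<open>v\<close>.\<close>

definition presents :: "'o \<Rightarrow> 'm \<Rightarrow> 'o \<Rightarrow> 'k poly \<Rightarrow> bool" where
  "presents L l C v \<longleftrightarrow> L \<in> \<T> \<and> C \<in> \<T> \<and> l \<in> Hom E L C \<and> v \<in> Val M C \<and>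
     (\<forall>S\<in>\<T>. (\<lambda>f. act S C f v) ` Hom E S C = Val M S \<and>
        {f \<in> Hom E S C. act S C f v = 0} = cm S L C l ` Hom E S L)"

lemma presentsD:
  assumes "presents L l C v" "S \<in> \<T>"
  shows "w \<in> Val M S \<Longrightarrow> \<exists>f\<in>Hom E S C. w = act S C f v"
    "f \<in> Hom E S C \<Longrightarrow> act S C f v = 0 \<longleftrightarrow> (\<exists>g\<in>Hom E S L. cm S L C l g = f)"
proof -
  have e: "(\<lambda>f. act S C f v) ` Hom E S C = Val M S" "{f \<in> Hom E S C. act S C f v = 0} = cm S L C l ` Hom E S L"
    using assms unfolding presents_def by blast+
  show "w \<in> Val M S \<Longrightarrow> \<exists>f\<in>Hom E S C. w = act S C f v" using e(1) by blast
  have "f \<in> {f \<in> Hom E S C. act S C f v = 0} \<longleftrightarrow> f \<in> cm S L C l ` Hom E S L" using e(2) by simp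
  then show "f \<in> Hom E S C \<Longrightarrow> act S C f v = 0 \<longleftrightarrow> (\<exists>g\<in>Hom E S L. cm S L C l g = f)" by auto
qed

lemma presentsI:
  assumes "L \<in> \<T>" "C \<in> \<T>" "l \<in> Hom E L C" "v \<in> Val M C"
    and "\<And>S w. S \<in> \<T> \<Longrightarrow> w \<in> Val M S \<Longrightarrow> \<exists>f\<in>Hom E S C. w = act S C f v"
    and "\<And>S f. S \<in> \<T> \<Longrightarrow> f \<in> Hom E S C \<Longrightarrow> act S C f v = 0 \<longleftrightarrow> (\<exists>g\<in>Hom E S L. cm S L C l g = f)"
  shows "presents L l C v"
proof -
  have "(\<lambda>f. act S C f v) ` Hom E S C = Val M S" if S: "S \<in> \<T>" for S
    using assms(2,4) assms(5)[OF S] S by auto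
  moreover have "{f \<in> Hom E S C. act S C f v = 0} = cm S L C l ` Hom E S L" if S: "S \<in> \<T>" for S
    using assms(6)[OF S] assms(3) cm_in by blast
  ultimately show ?thesis unfolding presents_def using assms(1-4) by blast
qed

lemma dim_Val:
  assumes p: "presents L l C v" and c: "(X, i, L, l, C) \<in> Confl E" and S: "S \<in> \<T>"
  shows "int (pv.dim (Val M S)) = int (hom_dim E S C) - int (hom_dim E S L) + int (hom_dim E S X)"
proof -
  interpret vp: vector_space_pair "Scale E" "smult :: 'k \<Rightarrow> 'k poly \<Rightarrow> 'k poly" by unfold_locales
  have C: "C \<in> \<T>" "v \<in> Val M C" using p unfolding presents_def by auto
  obtain B where B: "finite B" "vs.span B = Hom E S C" by (rule hom_basis)
  have "vs.dim (Hom E S C) = vs.dim {f \<in> Hom E S C. act S C f v = 0} + pv.dim ((\<lambda>f. act S C f v) ` Hom E S C)"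
    by (rule vp.rank_nullity_on[OF B]) (use C S in simp_all)
  moreover have "(\<lambda>f. act S C f v) ` Hom E S C = Val M S" "{f \<in> Hom E S C. act S C f v = 0} = cm S L C l ` Hom E S L"
    using p S unfolding presents_def by blast+
  ultimately show ?thesis using dim_ker_post[OF c, of S] unfolding hom_dim_def by simp
qed

text \<open>The generator \<open>v\<close> corresponds to the class of the conflation itself. By
  naturality, acting with \<open>f\<close> on \<open>v\<close> corresponds to pulling that
  conflation back along \<open>f\<close>, so the connecting map describes the module.\<close>

lemma presents_of_iso_Ext:
  assumes iso: "iso_Ext_module E \<T> M X" and c: "(X, i, L, l, C) \<in> Confl E" and L: "L \<in> \<T>" and C: "C \<in> \<T>"
  obtains v where "presents L l C v"
proof -
  interpret c: conflation E X i L l C using c by (rule conflI)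
  obtain \<phi> where
    \<phi>1: "\<forall>T\<in>\<T>. bij_betw (\<phi> T) (Val M T) (Ext1 E T X)" and
    \<phi>2: "\<forall>T\<in>\<T>. \<forall>c. \<forall>v\<in>Val M T. \<phi> T (smult c v) = ext_scale E T X c (\<phi> T v)" and
    \<phi>3: "\<forall>S\<in>\<T>. \<forall>T\<in>\<T>. \<forall>f\<in>Hom E S T. \<forall>v\<in>Val M T. \<phi> S (act S T f v) = ext_pull E S X f (\<phi> T v)"
    using iso unfolding iso_Ext_module_def by (elim exE conjE) (rule that; assumption)
  note bij = \<phi>1[rule_format] and scale = \<phi>2[rule_format] and nat = \<phi>3[rule_format]
  have "c.PB C (Idm E C) \<in> Ext1 E C X" by (rule c.PB_in_Ext1) simp
  then obtain v where v: "v \<in> Val M C" "\<phi> C v = c.PB C (Idm E C)"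
    using bij[OF C] unfolding bij_betw_def by (metis imageE)
  have \<phi>: "\<phi> S (act S C f v) = c.PB S f" if "S \<in> \<T>" "f \<in> Hom E S C" for S f
    using nat[OF that(1) C that(2) v(1)] c.PB_pull[OF id_in that(2)] that(2) v(2) by simp
  \<comment> \<open>That zero goes to the split class follows from compatibility with scalars,
    taking the scalar zero.\<close>
  have \<phi>0: "\<phi> S 0 = c.PB S 0" if S: "S \<in> \<T>" for S
  proof -
    have "\<phi> S 0 \<in> Ext1 E S X" using bij[OF S] Val_0[OF S] unfolding bij_betw_def by blast
    then obtain h where h: "h \<in> Hom E S C" "\<phi> S 0 = c.PB S h" using c.PB_surj ext_van[OF S L] by blast
    have "\<phi> S (smult 0 0) = ext_scale E S X 0 (\<phi> S 0)" by (rule scale[OF S Val_0[OF S]])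
    then show ?thesis using c.PB_scale[OF h(1), of 0] h(2) by simp
  qed
  have inj: "a = b" if "S \<in> \<T>" "a \<in> Val M S" "b \<in> Val M S" "\<phi> S a = \<phi> S b" for S a b
    using bij[OF that(1)] that unfolding bij_betw_def inj_on_def by blast
  have "presents L l C v"
  proof (rule presentsI[OF L C c.p v(1)])
    fix S w assume S: "S \<in> \<T>" and w: "w \<in> Val M S"
    have "\<phi> S w \<in> Ext1 E S X" using bij[OF S] w unfolding bij_betw_def by blast
    then obtain f where f: "f \<in> Hom E S C" "\<phi> S w = c.PB S f" using c.PB_surj ext_van[OF S L] by blast
    then have "\<phi> S w = \<phi> S (act S C f v)" using \<phi>[OF S] by simp
    then have "w = act S C f v" using inj[OF S w, of "act S C f v"] f(1) v(1) S C by simp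
    then show "\<exists>f\<in>Hom E S C. w = act S C f v" using f(1) by blast
  next
    fix S f assume S: "S \<in> \<T>" and f: "f \<in> Hom E S C"
    have "act S C f v = 0 \<longleftrightarrow> \<phi> S (act S C f v) = \<phi> S 0"
      using inj[OF S, of "act S C f v" 0] f v(1) S C by auto
    also have "\<dots> \<longleftrightarrow> (\<exists>g\<in>Hom E S L. cm S L C l g = f)"
      unfolding \<phi>[OF S f] \<phi>0[OF S] using c.PB_eq_iff[OF f, of 0] by simp
    finally show "act S C f v = 0 \<longleftrightarrow> (\<exists>g\<in>Hom E S L. cm S L C l g = f)" .
  qed
  then show thesis by (rule that)
qed

text \<open>Both \<open>Val M S\<close> and \<open>Ext1 E S X\<close> are \<open>Hom E S C\<close>
  modulo the maps that factor through \<open>l\<close>. The isomorphism chooses with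
  \<open>F\<close> a representative in \<open>Hom E S C\<close>, and \<open>eq\<close> makes this
  choice irrelevant.\<close>

lemma iso_Ext_of_presents:
  assumes p: "presents L l C v" and c: "(X, i, L, l, C) \<in> Confl E"
  shows "iso_Ext_module E \<T> M X"
proof -
  interpret c: conflation E X i L l C using c by (rule conflI)
  have L: "L \<in> \<T>" and C: "C \<in> \<T>" and v: "v \<in> Val M C" using p unfolding presents_def by auto
  define F where "F S w = (SOME f. f \<in> Hom E S C \<and> w = act S C f v)" for S w
  have F: "F S w \<in> Hom E S C" "w = act S C (F S w) v" if "S \<in> \<T>" "w \<in> Val M S" for S w
  proof -
    have "\<exists>f. f \<in> Hom E S C \<and> w = act S C f v" using presentsD(1)[OF p that] by blast
    then have "F S w \<in> Hom E S C \<and> w = act S C (F S w) v" unfolding F_def by (rule someI_ex)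
    then show "F S w \<in> Hom E S C" "w = act S C (F S w) v" by auto
  qed
  define \<phi> where "\<phi> S w = c.PB S (F S w)" for S w
  have eq: "act S C f v = act S C g v \<longleftrightarrow> c.PB S f = c.PB S g" if "S \<in> \<T>" "f \<in> Hom E S C" "g \<in> Hom E S C" for S f g
  proof -
    have "act S C f v = act S C g v \<longleftrightarrow> act S C (f - g) v = 0" using that C v by simp
    also have "\<dots> \<longleftrightarrow> (\<exists>h\<in>Hom E S L. cm S L C l h = f - g)" using presentsD(2)[OF p that(1)] that by simp
    finally show ?thesis using c.PB_eq_iff[OF that(2,3)] by simp
  qed
  have \<phi>: "\<phi> S (act S C f v) = c.PB S f" if "S \<in> \<T>" "f \<in> Hom E S C" for S f
    unfolding \<phi>_def using eq[OF that(1) F(1) that(2)] F(2) that C v by (metis act_in)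
  have bij: "bij_betw (\<phi> S) (Val M S) (Ext1 E S X)" if S: "S \<in> \<T>" for S
    unfolding bij_betw_def
  proof
    show "inj_on (\<phi> S) (Val M S)"
    proof (rule inj_onI)
      fix a b assume ab: "a \<in> Val M S" "b \<in> Val M S" "\<phi> S a = \<phi> S b"
      then have "act S C (F S a) v = act S C (F S b) v" unfolding \<phi>_def using eq[OF S] F(1)[OF S] by blast
      then show "a = b" using F(2)[OF S] ab by simp
    qed
    show "\<phi> S ` Val M S = Ext1 E S X"
    proof (intro equalityI subsetI)
      fix x assume "x \<in> \<phi> S ` Val M S"
      then show "x \<in> Ext1 E S X" unfolding \<phi>_def using c.PB_in_Ext1 F(1)[OF S] by blast
    next
      fix x assume "x \<in> Ext1 E S X"
      then obtain f where f: "f \<in> Hom E S C" "x = c.PB S f" using c.PB_surj ext_van[OF S L] by blast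
      then have "x = \<phi> S (act S C f v)" using \<phi>[OF S] by simp
      then show "x \<in> \<phi> S ` Val M S" using f(1) S C v by simp
    qed
  qed
  show ?thesis
    unfolding iso_Ext_module_def
  proof (intro exI[of _ \<phi>] conjI ballI allI)
    fix T assume T: "T \<in> \<T>"
    show "bij_betw (\<phi> T) (Val M T) (Ext1 E T X)" by (rule bij[OF T])
    fix a assume a: "a \<in> Val M T"
    note Fa = F[OF T a]
    {
      fix b assume b: "b \<in> Val M T"
      note Fb = F[OF T b]
      have "a + b = act T C (F T a + F T b) v" using Fa Fb C v T by simp
      then have "\<phi> T (a + b) = c.PB T (F T a + F T b)" using \<phi>[OF T] Fa(1) Fb(1) by simp
      then show "\<phi> T (a + b) = ext_add E T X (\<phi> T a) (\<phi> T b)"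
        unfolding \<phi>_def using c.PB_add[OF Fa(1) Fb(1)] by simp
    }
    fix k
    have "smult k a = act T C (Scale E k (F T a)) v" using Fa C v T by simp
    then have "\<phi> T (smult k a) = c.PB T (Scale E k (F T a))" using \<phi>[OF T] Fa(1) by simp
    then show "\<phi> T (smult k a) = ext_scale E T X k (\<phi> T a)"
      unfolding \<phi>_def using c.PB_scale[OF Fa(1)] by simp
  next
    fix S T f w assume S: "S \<in> \<T>" and T: "T \<in> \<T>" and f: "f \<in> Hom E S T" and w: "w \<in> Val M T"
    note Fw = F[OF T w]
    have "act S T f w = act S C (cm S T C (F T w) f) v" using Fw f S T C v by simp
    then have "\<phi> S (act S T f w) = c.PB S (cm S T C (F T w) f)" using \<phi>[OF S] Fw(1) f by simp
    then show "\<phi> S (act S T f w) = ext_pull E S X f (\<phi> T w)"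
      unfolding \<phi>_def using c.PB_pull[OF Fw(1) f] by simp
  qed
qed

end

section \<open>Krull--Schmidt properties\<close>

locale krull_schmidt = hom_finite_category E + additive_category E
  for E :: "('o, 'm::ab_group_add, 'k::field) exact_cat" +
  assumes idempotent_complete: "idempotent_complete E"
begin

lemma hom_dim_pos:
  assumes "\<not> is_zero E X" shows "hom_dim E X X > 0"
proof (rule ccontr)
  assume "\<not> hom_dim E X X > 0"
  then have z: "vs.dim (Hom E X X) = 0" unfolding hom_dim_def by simp
  obtain B where B: "finite B" "vs.span B = Hom E X X" by (rule hom_basis)
  have "{0} = Hom E X X"
    by (rule vs.dim_mono_finite(2)[OF B _ subspace_Hom]) (use z in \<open>auto simp: vs.subspace_def\<close>)
  then show False using assms is_zero_iff id_in by blast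
qed

text \<open>A nonzero complement has a nonzero endomorphism space, so both summands of a proper
  decomposition have smaller endomorphism spaces than \<open>X\<close>.\<close>

lemma decomposition_induct [case_names zero indec sum]:
  assumes zero: "\<And>X. is_zero E X \<Longrightarrow> P X"
    and indec: "\<And>X. indecomposable E X \<Longrightarrow> P X"
    and sum: "\<And>A B X. direct_sum E A B X \<Longrightarrow> P A \<Longrightarrow> P B \<Longrightarrow> P X"
  shows "P X"
proof (induction "hom_dim E X X" arbitrary: X rule: less_induct)
  case less
  show ?case
  proof (cases "is_zero E X \<or> indecomposable E X")
    case True
    then show ?thesis using zero indec by blast
  next
    case False
    then obtain A B where AB: "direct_sum E A B X" "\<not> is_zero E A" "\<not> is_zero E B"
      unfolding indecomposable_def by blast
    have "hom_dim E X X = hom_dim E A A + hom_dim E A B + (hom_dim E B A + hom_dim E B B)"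
      using hom_dim_sum_left[OF AB(1)] hom_dim_sum_right[OF AB(1)] by simp
    then have "hom_dim E A A < hom_dim E X X" "hom_dim E B B < hom_dim E X X"
      using hom_dim_pos[OF AB(2)] hom_dim_pos[OF AB(3)] by simp_all
    then show ?thesis using sum[OF AB(1)] less by blast
  qed
qed

lemma indecomposable_idempotent:
  assumes X: "indecomposable E X" and e: "e \<in> Hom E X X" "cm X X X e e = e"
  shows "e = 0 \<or> e = Idm E X"
proof -
  have split: "\<exists>Y r s. r \<in> Hom E X Y \<and> s \<in> Hom E Y X \<and> cm X Y X s r = e \<and> cm Y X Y r s = Idm E Y"
    if "e \<in> Hom E X X" "cm X X X e e = e" for e
    using idempotent_complete that unfolding idempotent_complete_def cm_def by blast
  obtain Y r s where rs: "r \<in> Hom E X Y" "s \<in> Hom E Y X" "cm X Y X s r = e" "cm Y X Y r s = Idm E Y"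
    using split[OF e] by blast
  obtain Z u t where ut: "u \<in> Hom E X Z" "t \<in> Hom E Z X" "cm X Z X t u = Idm E X - e" "cm Z X Z u t = Idm E Z"
    using split[of "Idm E X - e"] e by auto
  \<comment> \<open>The composite is zero because it contains \<open>(1 - e) e\<close>, once both
    idempotents are inserted next to their own splittings.\<close>
  have "cm Y X Z u s = cm Y X Z u (cm Y X X (cm X Z X t u) (cm Y X X (cm X Y X s r) s))"
    using rs(1,2) ut(1,2) by (simp add: rs(4) cm_red[OF ut(4)])
  also have "\<dots> = 0" unfolding ut(3) rs(3) using e ut rs by (simp add: cm_red[OF e(2)])
  finally have us: "cm Y X Z u s = 0" .
  have "cm Z X Y r t = cm Z X Y r (cm Z X X (cm X Y X s r) (cm Z X X (cm X Z X t u) t))"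
    using rs(1,2) ut(1,2) by (simp add: ut(4) cm_red[OF rs(4)])
  also have "\<dots> = 0" unfolding ut(3) rs(3) using e ut rs by (simp add: cm_red[OF e(2)])
  finally have rt: "cm Z X Y r t = 0" .
  have "biproduct E Y Z X s t r u" unfolding biproduct_cm using rs ut us rt by simp
  then have "is_zero E Y \<or> is_zero E Z" using X unfolding indecomposable_def direct_sum_def by blast
  then show ?thesis
  proof
    assume "is_zero E Y"
    then have "r = 0" using is_zeroD(1) rs(1) by blast
    then show ?thesis using rs by simp
  next
    assume "is_zero E Z"
    then have "u = 0" using is_zeroD(1) ut(1) by blast
    then show ?thesis using ut by simp
  qed
qed

primrec pw :: "'o \<Rightarrow> 'm \<Rightarrow> nat \<Rightarrow> 'm" where
  "pw X e 0 = Idm E X"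
| "pw X e (Suc n) = cm X X X e (pw X e n)"

lemma pw_in [simp]: "e \<in> Hom E X X \<Longrightarrow> pw X e n \<in> Hom E X X"
  by (induction n) auto

lemma pw_add: "e \<in> Hom E X X \<Longrightarrow> pw X e (m + n) = cm X X X (pw X e m) (pw X e n)"
  by (induction m) auto

lemma pw_Suc_right: "e \<in> Hom E X X \<Longrightarrow> pw X e (Suc n) = cm X X X (pw X e n) e"
  using pw_add[of e X n 1] by simp

text \<open>Fitting's lemma: for large \<open>n\<close> both one-sided ideals generated by \<open>e\<^sup>n\<close> are stationary,
  which produces an idempotent.\<close>

lemma fitting:
  assumes X: "indecomposable E X" and e: "e \<in> Hom E X X"
  shows "is_iso E X X e \<or> is_iso E X X (Idm E X - e)"
proof -
  obtain B where B: "finite B" "vs.span B = Hom E X X" by (rule hom_basis)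
  define L where "L n = cm X X X (pw X e n) ` Hom E X X" for n
  define R where "R n = (\<lambda>a. cm X X X a (pw X e n)) ` Hom E X X" for n
  have LR: "L n \<subseteq> Hom E X X" "R n \<subseteq> Hom E X X" "vs.subspace (L n)" "vs.subspace (R n)" for n
  proof -
    show "L n \<subseteq> Hom E X X" "R n \<subseteq> Hom E X X" unfolding L_def R_def using e by auto
    show "vs.subspace (L n)" "vs.subspace (R n)"
      unfolding L_def R_def by (rule subspace_image_Hom; use e in simp)+
  qed
  have mono: "L (m + n) \<subseteq> L m" "R (m + n) \<subseteq> R m" for m n
  proof -
    show "L (m + n) \<subseteq> L m" unfolding L_def using e by (auto simp: pw_add)
    have "R (n + m) \<subseteq> R m" unfolding R_def using e by (auto simp: pw_add simp flip: cm_assoc)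
    then show "R (m + n) \<subseteq> R m" by (simp add: add.commute)
  qed
  \<comment> \<open>Both chains of ideals decrease, so a minimum of the sum of dimensions makes them
    stationary at the same time. The shift by \<open>Suc\<close> keeps the exponent \<open>n\<close>
    positive, so that a factor \<open>e\<close> can be split off \<open>P\<close> at the
    end.\<close>
  define D where "D k = vs.dim (L (Suc k)) + vs.dim (R (Suc k))" for k
  obtain k where k: "\<And>j. D k \<le> D j" using ex_has_least_nat[of "\<lambda>_. True" 0 D] by blast
  define n where "n = Suc k"
  have nn: "n + n = Suc (k + n)" unfolding n_def by simp
  have "vs.dim (L (n + n)) \<le> vs.dim (L n)" "vs.dim (R (n + n)) \<le> vs.dim (R n)"
    using vs.dim_mono_finite(1)[OF B LR(3) LR(3) mono(1) LR(1)] vs.dim_mono_finite(1)[OF B LR(4) LR(4) mono(2) LR(2)] by blast+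
  moreover have "vs.dim (L n) + vs.dim (R n) \<le> vs.dim (L (n + n)) + vs.dim (R (n + n))"
    using k[of "k + n"] unfolding D_def nn[symmetric] n_def[symmetric] .
  ultimately have "vs.dim (L (n + n)) = vs.dim (L n)" "vs.dim (R (n + n)) = vs.dim (R n)" by linarith+
  then have "L (n + n) = L n" "R (n + n) = R n"
    using vs.dim_mono_finite(2)[OF B LR(3) LR(3) mono(1) LR(1)] vs.dim_mono_finite(2)[OF B LR(4) LR(4) mono(2) LR(2)] by blast+
  moreover have "pw X e n \<in> L n" "pw X e n \<in> R n"
    unfolding L_def R_def using e by (auto intro: image_eqI[of _ _ "Idm E X"])
  ultimately have "pw X e n \<in> L (n + n)" "pw X e n \<in> R (n + n)" by simp_all
  then obtain x y where x: "x \<in> Hom E X X" "pw X e n = cm X X X (pw X e (n + n)) x"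
    and y: "y \<in> Hom E X X" "pw X e n = cm X X X y (pw X e (n + n))"
    unfolding L_def R_def by blast
  define P where "P = pw X e n"
  have P: "P \<in> Hom E X X" unfolding P_def using e by simp
  have Px: "cm X X X P (cm X X X P x) = P" using x e unfolding P_def by (simp add: pw_add)
  have yP: "cm X X X y (cm X X X P P) = P" using y e unfolding P_def by (simp add: pw_add)
  \<comment> \<open>Stationarity gives \<open>P = P P x\<close> and \<open>P = y P P\<close>, whence
    \<open>P x = y P\<close>, and this element is idempotent.\<close>
  define \<epsilon> where "\<epsilon> = cm X X X P x"
  have \<epsilon>: "\<epsilon> \<in> Hom E X X" unfolding \<epsilon>_def using P x by simp
  have \<epsilon>y: "\<epsilon> = cm X X X y P"
  proof -
    have "cm X X X y P = cm X X X y (cm X X X P (cm X X X P x))" using Px by simp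
    also have "\<dots> = cm X X X (cm X X X y (cm X X X P P)) x" using P x(1) y(1) by simp
    finally show ?thesis unfolding \<epsilon>_def using yP by simp
  qed
  have "cm X X X \<epsilon> \<epsilon> = cm X X X (cm X X X y P) (cm X X X P x)" using \<epsilon>y \<epsilon>_def by simp
  also have "\<dots> = cm X X X (cm X X X y (cm X X X P P)) x" using P x(1) y(1) by simp
  also have "\<dots> = \<epsilon>" using yP unfolding \<epsilon>_def by simp
  finally have "\<epsilon> = 0 \<or> \<epsilon> = Idm E X" using indecomposable_idempotent[OF X \<epsilon>] by blast
  then show ?thesis
  proof
    assume "\<epsilon> = 0"
    then have "P = 0" using Px P unfolding \<epsilon>_def by simp
    \<comment> \<open>The partial sums of the geometric series invert \<open>1 - e\<close> up to the
      power \<open>m\<close> of \<open>e\<close>; for \<open>m = n\<close> the error term is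
      \<open>P = 0\<close>.\<close>
    have "\<exists>s\<in>Hom E X X. cm X X X (Idm E X - e) s = Idm E X - pw X e m \<and> cm X X X s (Idm E X - e) = Idm E X - pw X e m" for m
    proof (induction m)
      case 0
      show ?case using e by (intro bexI[of _ 0]) simp_all
    next
      case (Suc m)
      then obtain s where s: "s \<in> Hom E X X" "cm X X X (Idm E X - e) s = Idm E X - pw X e m"
        "cm X X X s (Idm E X - e) = Idm E X - pw X e m" by blast
      have "cm X X X (Idm E X - e) (s + pw X e m) = Idm E X - pw X e (Suc m)"
        using s e by simp
      moreover have "cm X X X (s + pw X e m) (Idm E X - e) = Idm E X - pw X e (Suc m)"
      proof -
        have "cm X X X (s + pw X e m) (Idm E X - e) = cm X X X s (Idm E X - e) + (pw X e m - cm X X X (pw X e m) e)"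
          using s(1) e by simp
        then show ?thesis unfolding s(3) pw_Suc_right[OF e, of m] by simp
      qed
      moreover have "s + pw X e m \<in> Hom E X X" using s e by simp
      ultimately show ?case by blast
    qed
    from this[of n] obtain s where "s \<in> Hom E X X" "cm X X X (Idm E X - e) s = Idm E X" "cm X X X s (Idm E X - e) = Idm E X"
      using \<open>P = 0\<close> unfolding P_def by auto
    then show ?thesis using e by (intro disjI2 is_isoI[of _ _ _ s]) simp_all
  next
    assume one: "\<epsilon> = Idm E X"
    define a where "a = cm X X X (pw X e k) x"
    define b where "b = cm X X X y (pw X e k)"
    have ab: "a \<in> Hom E X X" "b \<in> Hom E X X" unfolding a_def b_def using x y e by simp_all
    have ea: "cm X X X e a = Idm E X"
      using one e x unfolding a_def \<epsilon>_def P_def n_def by simp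
    have be: "cm X X X b e = Idm E X"
      using one \<epsilon>y pw_Suc_right[OF e, of k] e y unfolding b_def P_def n_def by simp
    have "b = cm X X X b (cm X X X e a)" using ab ea by simp
    also have "\<dots> = a" using ab e by (simp add: cm_red[OF be])
    finally show ?thesis using ea be e ab by (intro disjI1 is_isoI[of _ _ _ a]) simp_all
  qed
qed

definition split_epi :: "'o \<Rightarrow> 'o \<Rightarrow> 'm \<Rightarrow> bool" where
  "split_epi S C f \<longleftrightarrow> (\<exists>g\<in>Hom E C S. cm C S C f g = Idm E C)"

text \<open>Composing with a section writes the identity of \<open>C\<close> as a sum of two
  endomorphisms, one through \<open>A\<close> and one through \<open>B\<close>. By Fitting's lemma
  one of them is invertible.\<close>

lemma split_epi_sum:
  assumes C: "indecomposable E C" and W: "biproduct E A B W j1 j2 q1 q2"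
    and f: "f1 \<in> Hom E A C" "f2 \<in> Hom E B C"
    and s: "split_epi W C (cm W A C f1 q1 + cm W B C f2 q2)"
  shows "split_epi A C f1 \<or> split_epi B C f2"
proof -
  interpret W: biprod E A B W j1 j2 q1 q2 using W by unfold_locales
  obtain g where g: "g \<in> Hom E C W" "cm C W C (cm W A C f1 q1 + cm W B C f2 q2) g = Idm E C"
    using s unfolding split_epi_def by blast
  define e where "e = cm C A C f1 (cm C W A q1 g)"
  have e: "e \<in> Hom E C C" unfolding e_def using f g by simp
  have e': "Idm E C - e = cm C B C f2 (cm C W B q2 g)"
    using g f unfolding e_def by (simp add: algebra_simps)
  consider "is_iso E C C e" | "is_iso E C C (Idm E C - e)" using fitting[OF C e] by blast
  then show ?thesis
  proof cases
    case 1
    then obtain u where "u \<in> Hom E C C" "cm C C C e u = Idm E C" by (auto elim: is_isoE)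
    then have "split_epi A C f1" unfolding split_epi_def e_def using f(1) g(1)
      by (intro bexI[of _ "cm C C A (cm C W A q1 g) u"]) simp_all
    then show ?thesis by blast
  next
    case 2
    then obtain u where "u \<in> Hom E C C" "cm C C C (Idm E C - e) u = Idm E C" by (auto elim: is_isoE)
    then have "split_epi B C f2" unfolding split_epi_def e' using f(2) g(1)
      by (intro bexI[of _ "cm C C B (cm C W B q2 g) u"]) simp_all
    then show ?thesis by blast
  qed
qed

end

locale mutable_sub = cluster_tilting_sub E \<T> + krull_schmidt E
  for E :: "('o, 'm::ab_group_add, 'k::field) exact_cat" and \<T> +
  assumes maximally_mutable: "maximally_mutable E \<T>"
begin

lemma add_closure_subset:
  assumes "\<S> \<subseteq> \<T>" shows "add_closure E \<S> \<subseteq> \<T>"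
proof
  fix X assume "X \<in> add_closure E \<S>"
  then show "X \<in> \<T>"
    by induction (use assms zero_mem sum_mem summand_mem in blast)+
qed

text \<open>Combining the approximation supplied by mutation with a largest non-split map \<open>R0 \<rightarrow> C\<close>
  gives a sink map in \<open>\<T>\<close>, also in the presence of loops at \<open>C\<close>.\<close>

lemma sink_map:
  assumes C: "C \<in> \<T>" "indecomposable E C" "\<not> projective E C"
  obtains R r where "R \<in> \<T>" "r \<in> Hom E R C" "\<not> split_epi R C r"
    "\<And>S f. S \<in> \<T> \<Longrightarrow> f \<in> Hom E S C \<Longrightarrow> \<not> split_epi S C f \<Longrightarrow> \<exists>h\<in>Hom E S R. cm S R C r h = f"
proof -
  have "mutable_in E \<T> C" using maximally_mutable C unfolding maximally_mutable_def by blast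
  then obtain T' i B p where c: "(T', i, B, p, C) \<in> Confl E" "\<not> split_ext E C (i, B, p)"
      and ra: "right_approx E (remove_indec E \<T> C) B C p"
    unfolding mutable_in_def by blast
  interpret c: conflation E T' i B p C using c(1) by (rule conflI)
  have p: "\<not> split_epi B C p" using c(2) unfolding split_ext_cm split_epi_def .
  have B: "B \<in> \<T>"
    using ra add_closure_subset[of "{S \<in> \<T>. indecomposable E S \<and> \<not> iso_obj E S C}"]
    unfolding right_approx_def remove_indec_def by blast
  have approx: "\<exists>g\<in>Hom E S B. cm S B C p g = f"
    if "S \<in> \<T>" "indecomposable E S" "\<not> iso_obj E S C" "f \<in> Hom E S C" for S f
  proof -
    have S: "S \<in> remove_indec E \<T> C" unfolding remove_indec_def by (rule add_closure.base) (use that in simp)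
    have "\<forall>S\<in>remove_indec E \<T> C. \<forall>f\<in>Hom E S C. \<exists>g\<in>Hom E S B. cm S B C p g = f"
      using ra unfolding right_approx_def cm_def by simp
    then show ?thesis using S that(4) by blast
  qed
  obtain bs where bs: "finite bs" "vs.span bs = Hom E C C" by (rule hom_basis)
  define im where "im R r = cm C R C r ` Hom E C R" for R r
  have im_sub: "vs.subspace (im R r)" "im R r \<subseteq> Hom E C C" if r: "r \<in> Hom E R C" for R r
  proof -
    show "im R r \<subseteq> Hom E C C" unfolding im_def using r by auto
    show "vs.subspace (im R r)" unfolding im_def by (rule subspace_image_Hom) (use r in simp_all)
  qed
  define good where "good R r \<longleftrightarrow> R \<in> \<T> \<and> r \<in> Hom E R C \<and> \<not> split_epi R C r" for R r
  \<comment> \<open>Among the maps to \<open>C\<close> that are not split, one is chosen whose image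
    in the endomorphisms of \<open>C\<close> has the largest dimension; \<open>hom_dim E C C\<close>
    bounds it.\<close>
  define Q where "Q d \<longleftrightarrow> (\<exists>R r. good R r \<and> vs.dim (im R r) = d)" for d
  have "Q (vs.dim (im B p))" unfolding Q_def good_def using B p c.p by blast
  moreover have "\<forall>d. Q d \<longrightarrow> d \<le> hom_dim E C C"
    unfolding Q_def good_def hom_dim_def
    using vs.dim_mono_finite(1)[OF bs im_sub(1) subspace_Hom im_sub(2) order_refl] by blast
  ultimately obtain d where d: "Q d" "\<And>d'. Q d' \<Longrightarrow> d' \<le> d"
    using Nat.ex_has_greatest_nat[of Q _ "hom_dim E C C"] by blast
  then obtain R0 r0 where r0: "good R0 r0" "vs.dim (im R0 r0) = d" unfolding Q_def by blast
  have r0': "R0 \<in> \<T>" "r0 \<in> Hom E R0 C" "\<not> split_epi R0 C r0" using r0(1) unfolding good_def by auto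
  \<comment> \<open>Adding \<open>f\<close> as a further summand keeps the map non-split and can
    only enlarge the image. By maximality the image does not change, so it already contained
    \<open>f\<close>.\<close>
  have max: "\<exists>h\<in>Hom E C R0. cm C R0 C r0 h = f" if f: "f \<in> Hom E C C" "\<not> split_epi C C f" for f
  proof -
    obtain W j1 j2 q1 q2 where W: "biproduct E R0 C W j1 j2 q1 q2"
      using ex_direct_sum unfolding direct_sum_def by blast
    interpret W: biprod E R0 C W j1 j2 q1 q2 using W by unfold_locales
    define w where "w = cm W R0 C r0 q1 + cm W C C f q2"
    have w: "w \<in> Hom E W C" unfolding w_def using r0' f by simp
    have "\<not> split_epi W C w" unfolding w_def using split_epi_sum[OF C(2) W r0'(2) f(1)] r0'(3) f(2) by blast
    then have "good W w" unfolding good_def using w sum_mem[OF r0'(1) C(1) W.direct_sum] by blast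
    then have le: "vs.dim (im W w) \<le> d" using d(2) unfolding Q_def by blast
    have sub: "im R0 r0 \<subseteq> im W w"
    proof
      fix x assume "x \<in> im R0 r0"
      then obtain a where a: "a \<in> Hom E C R0" "x = cm C R0 C r0 a" unfolding im_def by blast
      then have "x = cm C W C w (cm C R0 W j1 a)" unfolding w_def using r0' f by simp
      then show "x \<in> im W w" unfolding im_def using a by simp
    qed
    have "vs.dim (im R0 r0) = vs.dim (im W w)"
      using vs.dim_mono_finite(1)[OF bs im_sub(1)[OF r0'(2)] im_sub(1)[OF w] sub im_sub(2)[OF w]] le r0(2) by simp
    then have "im R0 r0 = im W w"
      using vs.dim_mono_finite(2)[OF bs im_sub(1)[OF r0'(2)] im_sub(1)[OF w] sub im_sub(2)[OF w]] by blast
    moreover have "f = cm C W C w j2" unfolding w_def using r0' f by simp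
    then have "f \<in> im W w" unfolding im_def using W.i2 by blast
    ultimately have "f \<in> im R0 r0" by simp
    then show ?thesis unfolding im_def by auto
  qed
  obtain W j1 j2 q1 q2 where W: "biproduct E R0 B W j1 j2 q1 q2"
    using ex_direct_sum unfolding direct_sum_def by blast
  interpret W: biprod E R0 B W j1 j2 q1 q2 using W by unfold_locales
  define w where "w = cm W R0 C r0 q1 + cm W B C p q2"
  have w: "w \<in> Hom E W C" unfolding w_def using r0' by simp
  have WT: "W \<in> \<T>" using sum_mem[OF r0'(1) B W.direct_sum] .
  have nonsplit: "\<not> split_epi W C w" unfolding w_def using split_epi_sum[OF C(2) W r0'(2) c.p] r0'(3) p by blast
  have wj: "cm S W C w (cm S R0 W j1 h) = cm S R0 C r0 h" if "h \<in> Hom E S R0" for S h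
    unfolding w_def using that r0' by simp
  have wj2: "cm S W C w (cm S B W j2 h) = cm S B C p h" if "h \<in> Hom E S B" for S h
    unfolding w_def using that r0' by simp
  \<comment> \<open>Indecomposables not isomorphic to \<open>C\<close> are served by the
    approximation \<open>p\<close>, those isomorphic to \<open>C\<close> by \<open>r0\<close>. For a
    direct sum, restrictions of a non-split map to the summands are again non-split.\<close>
  have "S \<in> \<T> \<longrightarrow> (\<forall>f\<in>Hom E S C. \<not> split_epi S C f \<longrightarrow> (\<exists>h\<in>Hom E S W. cm S W C w h = f))" for S
  proof (induction S rule: decomposition_induct)
    case (zero S)
    then show ?case using is_zeroD(2)[OF zero] w by (auto intro!: bexI[of _ 0])
  next
    case (indec S)
    show ?case
    proof (intro impI ballI)
      fix f assume S: "S \<in> \<T>" and f: "f \<in> Hom E S C" and n: "\<not> split_epi S C f"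
      show "\<exists>h\<in>Hom E S W. cm S W C w h = f"
      proof (cases "iso_obj E S C")
        case True
        then obtain u v where u: "u \<in> Hom E S C" "v \<in> Hom E C S" "cm S C S v u = Idm E S" "cm C S C u v = Idm E C"
          unfolding iso_obj_def is_iso_cm by blast
        have "\<not> split_epi C C (cm C S C f v)"
        proof
          assume "split_epi C C (cm C S C f v)"
          then obtain g where "g \<in> Hom E C C" "cm C C C (cm C S C f v) g = Idm E C" unfolding split_epi_def by blast
          then have "split_epi S C f" unfolding split_epi_def using u(2) f
            by (intro bexI[of _ "cm C C S v g"]) simp_all
          then show False using n by blast
        qed
        then obtain h where h: "h \<in> Hom E C R0" "cm C R0 C r0 h = cm C S C f v"
          using max[of "cm C S C f v"] f u(2) by auto
        have "cm S R0 C r0 (cm S C R0 h u) = f" using h(1) u f r0' by (simp add: cm_red[OF h(2)])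
        then show ?thesis using h(1) u(1) wj[of "cm S C R0 h u" S]
          by (intro bexI[of _ "cm S R0 W j1 (cm S C R0 h u)"]) simp_all
      next
        case False
        then obtain g where "g \<in> Hom E S B" "cm S B C p g = f" using approx[OF S indec False f] by blast
        then show ?thesis using wj2[of g S] by (intro bexI[of _ "cm S B W j2 g"]) simp_all
      qed
    qed
  next
    case (sum A D S)
    show ?case
    proof (intro impI ballI)
      fix f assume S: "S \<in> \<T>" and f: "f \<in> Hom E S C" and n: "\<not> split_epi S C f"
      obtain i1 i2 p1 p2 where "biproduct E A D S i1 i2 p1 p2" using sum(1) unfolding direct_sum_def by blast
      then interpret b: biprod E A D S i1 i2 p1 p2 by unfold_locales
      have AD: "A \<in> \<T>" "D \<in> \<T>" using summand_mem[OF S sum(1)] summand_mem2[OF S sum(1)] .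
      have "\<not> split_epi A C (cm A S C f i1)"
      proof
        assume "split_epi A C (cm A S C f i1)"
        then obtain g where "g \<in> Hom E C A" "cm C A C (cm A S C f i1) g = Idm E C" unfolding split_epi_def by blast
        then have "split_epi S C f" unfolding split_epi_def using f by (intro bexI[of _ "cm C A S i1 g"]) simp_all
        then show False using n by blast
      qed
      then obtain h1 where h1: "h1 \<in> Hom E A W" "cm A W C w h1 = cm A S C f i1" using sum(2) AD f by auto
      have "\<not> split_epi D C (cm D S C f i2)"
      proof
        assume "split_epi D C (cm D S C f i2)"
        then obtain g where "g \<in> Hom E C D" "cm C D C (cm D S C f i2) g = Idm E C" unfolding split_epi_def by blast
        then have "split_epi S C f" unfolding split_epi_def using f by (intro bexI[of _ "cm C D S i2 g"]) simp_all
        then show False using n by blast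
      qed
      then obtain h2 where h2: "h2 \<in> Hom E D W" "cm D W C w h2 = cm D S C f i2" using sum(3) AD f by auto
      have "cm S W C w (cm S A W h1 p1 + cm S D W h2 p2) = cm S A C (cm A S C f i1) p1 + cm S D C (cm D S C f i2) p2"
        using h1(1) h2(1) w f by (simp add: cm_red[OF h1(2)] cm_red[OF h2(2)])
      also have "\<dots> = f" by (rule b.codecomp[OF f])
      finally show "\<exists>h\<in>Hom E S W. cm S W C w h = f" using h1(1) h2(1)
        by (intro bexI[of _ "cm S A W h1 p1 + cm S D W h2 p2"]) simp_all
    qed
  qed
  then show thesis using that[OF WT w nonsplit] by blast
qed

end

section \<open>Enlarging a map to a deflation\<close>

context exact_category
begin

text \<open>The summed map is a composite of two deflations. The pullback of \<open>\<pi>\<close>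
  along the projection from \<open>W = L \<oplus> C\<close> to \<open>C\<close> is isomorphic to
  \<open>L \<oplus> P\<close> and maps to \<open>W\<close> by a deflation; then follows
  \<open>p2 + l p1\<close>.\<close>

lemma deflation_sum:
  assumes K: "(K, k, P, \<pi>, C) \<in> Confl E" and l: "l \<in> Hom E L C" and D: "biproduct E L P D d1 d2 e1 e2"
  obtains X i where "(X, i, D, cm D L C l e1 + cm D P C \<pi> e2, C) \<in> Confl E"
proof -
  interpret K: conflation E K k P \<pi> C using K by (rule conflI)
  interpret D: biprod E L P D d1 d2 e1 e2 using D by unfold_locales
  obtain W i1 i2 p1 p2 where W: "biproduct E L C W i1 i2 p1 p2"
    using ex_direct_sum unfolding direct_sum_def by blast
  interpret W: biprod E L C W i1 i2 p1 p2 using W by unfold_locales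
  \<comment> \<open>A shear of the biproduct, after which \<open>p2 + l p1\<close> is a projection
    and hence a deflation.\<close>
  have "biproduct E L C W (i1 - cm L C W i2 l) i2 p1 (p2 + cm W L C l p1)"
    unfolding biproduct_cm using l W.id_sum by (simp add: algebra_simps)
  from biproduct_confl[OF this] have defl1: "deflation E W C (p2 + cm W L C l p1)"
    unfolding deflation_def by blast
  obtain Q j q g where Q: "(K, j, Q, q, W) \<in> Confl E" "g \<in> Hom E Q P" "cm Q P C \<pi> g = cm Q W C p2 q"
    and ex: "\<And>V a b. a \<in> Hom E V P \<Longrightarrow> b \<in> Hom E V W \<Longrightarrow> cm V P C \<pi> a = cm V W C p2 b \<Longrightarrow>
      \<exists>u\<in>Hom E V Q. cm V Q P g u = a \<and> cm V Q W q u = b"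
    and jm: "\<And>V u. u \<in> Hom E V Q \<Longrightarrow> cm V Q P g u = 0 \<Longrightarrow> cm V Q W q u = 0 \<Longrightarrow> u = 0"
    using confl_pullback[OF K W.p2] by metis
  interpret Q: conflation E K j Q q W using Q(1) by (rule conflI)
  define m where "m = p2 + cm W L C l p1"
  have m: "m \<in> Hom E W C" unfolding m_def using l by simp
  have "deflation E Q W q" using Q(1) unfolding deflation_def by blast
  then have "deflation E Q C (cm Q W C m q)" using defl1 unfolding m_def cm_def by (rule deflation_Comp)
  then obtain X i where X: "(X, i, Q, cm Q W C m q, C) \<in> Confl E" unfolding deflation_def by blast
  interpret X: conflation E X i Q "cm Q W C m q" C using X by (rule conflI)
  obtain h where h: "h \<in> Hom E D Q" "cm D Q P g h = e2" "cm D Q W q h = cm D L W i1 e1 + cm D C W i2 (cm D P C \<pi> e2)"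
    using ex[of e2 D "cm D L W i1 e1 + cm D C W i2 (cm D P C \<pi> e2)"] by auto
  define h' where "h' = cm Q L D d1 (cm Q W L p1 q) + cm Q P D d2 g"
  have h': "h' \<in> Hom E Q D" unfolding h'_def using Q(2) by simp
  have e: "cm Q D L e1 h' = cm Q W L p1 q" "cm Q D P e2 h' = g" unfolding h'_def using Q(2) by simp_all
  have "cm D Q D h' h = Idm E D"
  proof (rule D.eqI[where X = D])
    have "cm D W L p1 (cm D Q W q h) = e1" unfolding h(3) by simp
    then show "cm D D L e1 (cm D Q D h' h) = cm D D L e1 (Idm E D)" using h h' by (simp add: cm_red[OF e(1)] del: h(3))
    show "cm D D P e2 (cm D Q D h' h) = cm D D P e2 (Idm E D)" using h h' by (simp add: cm_red[OF e(2)])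
  qed (use h h' in simp_all)
  moreover have "cm Q D Q h h' - Idm E Q = 0"
  proof (rule jm[where V = Q])
    show "cm Q Q P g (cm Q D Q h h' - Idm E Q) = 0" using h(1) h' Q(2) by (simp add: cm_red[OF h(2)] e)
    have "cm Q Q W q (cm Q D Q h h') = cm Q L W i1 (cm Q W L p1 q) + cm Q C W i2 (cm Q W C p2 q)"
      using h(1) h' by (simp add: cm_red[OF h(3)] e Q(3))
    also have "\<dots> = q" by (rule W.decomp) simp
    finally show "cm Q Q W q (cm Q D Q h h' - Idm E Q) = 0" using h(1) h' by simp
  qed (use h h' in simp_all)
  ultimately have iso: "is_iso E Q D h'" using h(1) h' by (intro is_isoI[of _ _ _ h]) simp_all
  have mq: "cm D Q C (cm Q W C m q) h = cm D L C l e1 + cm D P C \<pi> e2"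
    using m h(1) unfolding cm_assoc[OF h(1) Q.p m] h(3) unfolding m_def using l by simp
  have "cm Q D C (cm D L C l e1 + cm D P C \<pi> e2) h' = cm Q W C m q"
    unfolding m_def using h' l by (simp add: e Q(3))
  then have "(X, cm X Q D h' i, D, cm D L C l e1 + cm D P C \<pi> e2, C) \<in> Confl E"
    by (intro Confl_iso_cm[OF X is_iso_id iso is_iso_id]) (use h' l m in simp_all)
  then show thesis by (rule that)
qed

end

section \<open>Finite-dimensional modules are finitely presented\<close>

locale fd_module = mutable_sub E \<T> + cluster_module E \<T> M
  for E :: "('o, 'm::ab_group_add, 'k::field) exact_cat" and \<T> and M :: "('o, 'm, 'k poly) cat_module" +
  assumes fd: "M \<in> fd_stable_modules E \<T>"
begin

lemma Val_projective: "P \<in> \<T> \<Longrightarrow> projective E P \<Longrightarrow> Val M P = {0}"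
  using fd unfolding fd_stable_modules_def by simp

lemma Val_basis: assumes "T \<in> \<T>" obtains B where "finite B" "pv.span B = Val M T"
  using fd assms unfolding fd_stable_modules_def by auto

lemma Val_zero: "Z \<in> \<T> \<Longrightarrow> is_zero E Z \<Longrightarrow> v \<in> Val M Z \<Longrightarrow> v = 0"
  using act_id[of Z v] act_0_left[of Z Z v] unfolding is_zero_iff by simp

lemma finite_support:
  obtains F where "finite F" "F \<subseteq> \<T>"
    "\<And>T. T \<in> \<T> \<Longrightarrow> indecomposable E T \<Longrightarrow> Val M T \<noteq> {0} \<Longrightarrow> \<exists>S\<in>F. iso_obj E T S"
proof -
  obtain F where F: "finite F" "\<forall>T\<in>\<T>. indecomposable E T \<and> Val M T \<noteq> {0} \<longrightarrow> (\<exists>S\<in>F. iso_obj E T S)"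
    using fd unfolding fd_stable_modules_def by auto
  define rep where "rep S = (SOME T. T \<in> \<T> \<and> iso_obj E T S)" for S
  define F' where "F' = rep ` {S \<in> F. \<exists>T\<in>\<T>. iso_obj E T S}"
  have rep: "rep S \<in> \<T> \<and> iso_obj E (rep S) S" if "T \<in> \<T>" "iso_obj E T S" for S T
    unfolding rep_def by (rule someI[of _ T]) (use that in simp)
  have "finite F'" unfolding F'_def using F(1) by simp
  moreover have "F' \<subseteq> \<T>" unfolding F'_def using rep by blast
  moreover have "\<exists>S\<in>F'. iso_obj E T S" if T: "T \<in> \<T>" "indecomposable E T" "Val M T \<noteq> {0}" for T
  proof -
    obtain S where S: "S \<in> F" "iso_obj E T S" using F(2) T by blast
    then have "iso_obj E T (rep S)" using rep[OF T(1) S(2)] iso_obj_trans iso_obj_sym by blast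
    moreover have "rep S \<in> F'" unfolding F'_def using S T(1) by blast
    ultimately show ?thesis by blast
  qed
  ultimately show thesis using that by blast
qed

section \<open>Submodules and a substitute for length\<close>

definition submodule :: "('o \<Rightarrow> 'k poly set) \<Rightarrow> bool" where
  "submodule U \<longleftrightarrow> (\<forall>S\<in>\<T>. pv.subspace (U S) \<and> U S \<subseteq> Val M S \<and>
     (\<forall>S'\<in>\<T>. \<forall>f\<in>Hom E S' S. \<forall>u\<in>U S. act S' S f u \<in> U S'))"

lemma submoduleD:
  assumes "submodule U" "S \<in> \<T>"
  shows "pv.subspace (U S)" "u \<in> U S \<Longrightarrow> u \<in> Val M S"
    "S' \<in> \<T> \<Longrightarrow> f \<in> Hom E S' S \<Longrightarrow> u \<in> U S \<Longrightarrow> act S' S f u \<in> U S'"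
  using assms unfolding submodule_def by blast+

lemma submodule_ops:
  assumes "submodule U" "S \<in> \<T>"
  shows "0 \<in> U S" "u \<in> U S \<Longrightarrow> v \<in> U S \<Longrightarrow> u + v \<in> U S" "u \<in> U S \<Longrightarrow> v \<in> U S \<Longrightarrow> u - v \<in> U S"
  using submoduleD(1)[OF assms] pv.subspace_0 pv.subspace_add pv.subspace_diff by blast+

definition gen :: "('o \<Rightarrow> 'k poly set) \<Rightarrow> 'o \<Rightarrow> 'k poly \<Rightarrow> 'o \<Rightarrow> 'k poly set" where
  "gen U C c S = {u + act S C f c | u f. u \<in> U S \<and> f \<in> Hom E S C}"

lemma submodule_gen:
  assumes U: "submodule U" and C: "C \<in> \<T>" "c \<in> Val M C"
  shows "submodule (gen U C c)"
  unfolding submodule_def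
proof (intro ballI conjI)
  fix S assume S: "S \<in> \<T>"
  show "pv.subspace (gen U C c S)"
    unfolding pv.subspace_def
  proof (intro conjI ballI allI)
    show "0 \<in> gen U C c S" unfolding gen_def using submodule_ops(1)[OF U S] S C
      by (intro CollectI exI[of _ 0]) simp
    fix x y assume "x \<in> gen U C c S" "y \<in> gen U C c S"
    then obtain u f v g where "u \<in> U S" "f \<in> Hom E S C" "x = u + act S C f c"
      "v \<in> U S" "g \<in> Hom E S C" "y = v + act S C g c" unfolding gen_def by blast
    then show "x + y \<in> gen U C c S" unfolding gen_def using submodule_ops(2)[OF U S] S C
      by (intro CollectI exI[of _ "u + v"] exI[of _ "f + g"]) simp
  next
    fix k x assume "x \<in> gen U C c S"
    then obtain u f where "u \<in> U S" "f \<in> Hom E S C" "x = u + act S C f c" unfolding gen_def by blast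
    then show "smult k x \<in> gen U C c S" unfolding gen_def using pv.subspace_scale[OF submoduleD(1)[OF U S]] S C
      by (intro CollectI exI[of _ "smult k u"] exI[of _ "Scale E k f"]) (simp add: smult_add_right)
  qed
  show "gen U C c S \<subseteq> Val M S" unfolding gen_def using submoduleD(2)[OF U S] S C by auto
  fix S' f x assume S': "S' \<in> \<T>" and f: "f \<in> Hom E S' S" and "x \<in> gen U C c S"
  then obtain u g where u: "u \<in> U S" "g \<in> Hom E S C" "x = u + act S C g c" unfolding gen_def by blast
  then have "act S' S f x = act S' S f u + act S' C (cm S' S C g f) c" using S S' C f submoduleD(2)[OF U S] by simp
  then show "act S' S f x \<in> gen U C c S'" unfolding gen_def using submoduleD(3)[OF U S S' f u(1)] u(2) f
    by (intro CollectI exI[of _ "act S' S f u"] exI[of _ "cm S' S C g f"]) simp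
qed

lemma gen_sup: "u \<in> U S \<Longrightarrow> S \<in> \<T> \<Longrightarrow> C \<in> \<T> \<Longrightarrow> c \<in> Val M C \<Longrightarrow> u \<in> gen U C c S"
  unfolding gen_def by (intro CollectI exI[of _ u] exI[of _ 0]) simp

lemma gen_mem: "submodule U \<Longrightarrow> S \<in> \<T> \<Longrightarrow> C \<in> \<T> \<Longrightarrow> f \<in> Hom E S C \<Longrightarrow> act S C f c \<in> gen U C c S"
  unfolding gen_def using submodule_ops(1) by (intro CollectI exI[of _ 0] exI[of _ f]) simp

lemma gen_mem_id: "submodule U \<Longrightarrow> C \<in> \<T> \<Longrightarrow> c \<in> Val M C \<Longrightarrow> c \<in> gen U C c C"
  using gen_mem[of U C C "Idm E C" c] by simp

lemma gen_least:
  assumes V: "submodule V" and C: "C \<in> \<T>" "c \<in> V C" and UV: "U S \<subseteq> V S" and S: "S \<in> \<T>"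
  shows "gen U C c S \<subseteq> V S"
  unfolding gen_def using UV submoduleD(3)[OF V C(1) S _ C(2)] submodule_ops(2)[OF V S] by blast

definition supp :: "'o set" where
  "supp = (SOME F. finite F \<and> F \<subseteq> \<T> \<and>
     (\<forall>T\<in>\<T>. indecomposable E T \<and> Val M T \<noteq> {0} \<longrightarrow> (\<exists>S\<in>F. iso_obj E T S)))"

lemma supp: "finite supp" "supp \<subseteq> \<T>"
  "\<And>T. T \<in> \<T> \<Longrightarrow> indecomposable E T \<Longrightarrow> Val M T \<noteq> {0} \<Longrightarrow> \<exists>S\<in>supp. iso_obj E T S"
proof -
  have "\<exists>F. finite F \<and> F \<subseteq> \<T> \<and> (\<forall>T\<in>\<T>. indecomposable E T \<and> Val M T \<noteq> {0} \<longrightarrow> (\<exists>S\<in>F. iso_obj E T S))"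
    by (rule finite_support) blast
  then have "finite supp \<and> supp \<subseteq> \<T> \<and> (\<forall>T\<in>\<T>. indecomposable E T \<and> Val M T \<noteq> {0} \<longrightarrow> (\<exists>S\<in>supp. iso_obj E T S))"
    unfolding supp_def by (rule someI_ex)
  then show "finite supp" "supp \<subseteq> \<T>"
    "\<And>T. T \<in> \<T> \<Longrightarrow> indecomposable E T \<Longrightarrow> Val M T \<noteq> {0} \<Longrightarrow> \<exists>S\<in>supp. iso_obj E T S" by auto
qed

text \<open>Plays the part of the length of a submodule. \<open>supp\<close> may list isomorphic
  objects more than once, which does no harm: only strict monotonicity on submodules matters, and
  \<open>tot_eq\<close> provides it.\<close>

definition tot :: "('o \<Rightarrow> 'k poly set) \<Rightarrow> nat" where
  "tot U = (\<Sum>S\<in>supp. pv.dim (U S))"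

lemma sub_dim:
  assumes "submodule U" "submodule V" "S \<in> \<T>" "U S \<subseteq> V S"
  shows "pv.dim (U S) \<le> pv.dim (V S)" "pv.dim (U S) = pv.dim (V S) \<Longrightarrow> U S = V S"
proof -
  obtain B where B: "finite B" "pv.span B = Val M S" using Val_basis[OF assms(3)] .
  have "V S \<subseteq> Val M S" using submoduleD(2)[OF assms(2,3)] by blast
  then show "pv.dim (U S) \<le> pv.dim (V S)" "pv.dim (U S) = pv.dim (V S) \<Longrightarrow> U S = V S"
    using pv.dim_mono_finite[OF B submoduleD(1)[OF assms(1,3)] submoduleD(1)[OF assms(2,3)] assms(4)] by blast+
qed

lemma tot_mono:
  assumes "submodule U" "submodule V" "\<And>S. S \<in> \<T> \<Longrightarrow> U S \<subseteq> V S"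
  shows "tot U \<le> tot V"
  unfolding tot_def by (rule sum_mono) (use sub_dim(1)[OF assms(1,2)] assms(3) supp(2) in blast)

text \<open>Equal totals force equal dimensions, hence equality, on \<open>supp\<close>.
  Isomorphisms carry this to the other indecomposables with nonzero value, and a decomposition into
  summands carries it to all objects.\<close>

lemma tot_eq:
  assumes U: "submodule U" and V: "submodule V" and UV: "\<And>S. S \<in> \<T> \<Longrightarrow> U S \<subseteq> V S" and eq: "tot V \<le> tot U"
    and S: "S \<in> \<T>"
  shows "U S = V S"
proof -
  have supp_eq: "U S = V S" if S: "S \<in> supp" for S
  proof -
    have le: "pv.dim (U T) \<le> pv.dim (V T)" if "T \<in> supp" for T
      using that supp(2) sub_dim(1)[OF U V] UV by blast
    have "pv.dim (U S) = pv.dim (V S)"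
    proof (rule ccontr)
      assume "pv.dim (U S) \<noteq> pv.dim (V S)"
      then have "pv.dim (U S) < pv.dim (V S)" using le[OF S] by simp
      then have "tot U < tot V" unfolding tot_def using le S supp(1) by (intro sum_strict_mono_ex1) auto
      then show False using eq by simp
    qed
    then show ?thesis using sub_dim(2)[OF U V _ UV] S supp(2) by blast
  qed
  have "S \<in> \<T> \<longrightarrow> V S \<subseteq> U S" for S
  proof (induction S rule: decomposition_induct)
    case (zero S)
    show ?case
    proof (intro impI subsetI)
      fix v assume "S \<in> \<T>" "v \<in> V S"
      then show "v \<in> U S" using Val_zero[OF _ zero] submoduleD(2)[OF V] submodule_ops(1)[OF U] by blast
    qed
  next
    case (indec S)
    show ?case
    proof (intro impI subsetI)
      fix v assume S: "S \<in> \<T>" and v: "v \<in> V S"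
      show "v \<in> U S"
      proof (cases "Val M S = {0}")
        case True
        then show ?thesis using submoduleD(2)[OF V S v] submodule_ops(1)[OF U S] by simp
      next
        case False
        then obtain T f g where T: "T \<in> supp" and fg: "f \<in> Hom E S T" "g \<in> Hom E T S" "cm S T S g f = Idm E S"
          using supp(3)[OF S indec] unfolding iso_obj_def is_iso_cm by blast
        have TT: "T \<in> \<T>" using T supp(2) by blast
        have "act T S g v \<in> V T" using submoduleD(3)[OF V S TT fg(2) v] .
        then have "act S T f (act T S g v) \<in> U S" using supp_eq[OF T] submoduleD(3)[OF U TT S fg(1)] by simp
        moreover have "act S T f (act T S g v) = v"
          using act_comp[OF S TT S fg(1,2) submoduleD(2)[OF V S v]] submoduleD(2)[OF V S v] S by (simp add: fg(3))
        ultimately show ?thesis by simp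
      qed
    qed
  next
    case (sum A B S)
    show ?case
    proof (intro impI subsetI)
      fix v assume S: "S \<in> \<T>" and v: "v \<in> V S"
      obtain i1 i2 p1 p2 where "biproduct E A B S i1 i2 p1 p2" using sum(1) unfolding direct_sum_def by blast
      then interpret b: biprod E A B S i1 i2 p1 p2 by unfold_locales
      have AB: "A \<in> \<T>" "B \<in> \<T>" using summand_mem[OF S sum(1)] summand_mem2[OF S sum(1)] .
      have vv: "v \<in> Val M S" using submoduleD(2)[OF V S v] .
      have "act A S i1 v \<in> U A" "act B S i2 v \<in> U B"
        using sum(2,3) AB submoduleD(3)[OF V S AB(1) b.i1 v] submoduleD(3)[OF V S AB(2) b.i2 v] by auto
      then have "act S A p1 (act A S i1 v) + act S B p2 (act B S i2 v) \<in> U S"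
        using submoduleD(3)[OF U AB(1) S b.p1] submoduleD(3)[OF U AB(2) S b.p2] submodule_ops(2)[OF U S] by blast
      moreover have "act S A p1 (act A S i1 v) + act S B p2 (act B S i2 v) = act S S (cm S A S i1 p1 + cm S B S i2 p2) v"
        using S AB vv by simp
      ultimately show "v \<in> U S" unfolding b.id_sum using vv S by simp
    qed
  qed
  then show ?thesis using UV S by blast
qed

text \<open>Devissage: induction on the length of the subquotient generated by \<open>c\<close>, and for given
  length on a decomposition of \<open>C\<close>. For indecomposable \<open>C\<close> the sink map at \<open>C\<close> replaces \<open>c\<close> by
  a generator of the radical.\<close>

lemma relative_annihilator:
  assumes "submodule U" "C \<in> \<T>" "c \<in> Val M C" "tot (gen U C c) \<le> tot U + n"
  shows "\<exists>L\<in>\<T>. \<exists>l\<in>Hom E L C. \<forall>S\<in>\<T>. \<forall>f\<in>Hom E S C. act S C f c \<in> U S \<longleftrightarrow> (\<exists>g\<in>Hom E S L. cm S L C l g = f)"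
  using assms
proof (induction n arbitrary: U C c rule: less_induct)
  case (less n)
  have trivial: "\<exists>L\<in>\<T>. \<exists>l\<in>Hom E L C. \<forall>S\<in>\<T>. \<forall>f\<in>Hom E S C. act S C f c \<in> U S \<longleftrightarrow> (\<exists>g\<in>Hom E S L. cm S L C l g = f)"
    if "submodule U" "C \<in> \<T>" "c \<in> U C" for U C c
  proof (intro bexI[of _ C] bexI[of _ "Idm E C"] ballI)
    fix S f assume "S \<in> \<T>" "f \<in> Hom E S C"
    then show "act S C f c \<in> U S \<longleftrightarrow> (\<exists>g\<in>Hom E S C. cm S C C (Idm E C) g = f)"
      using submoduleD(3)[OF that(1,2)] that(3) by auto
  qed (use that in simp_all)
  \<comment> \<open>\<open>U\<close> and \<open>c\<close> remain quantified in the inner induction,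
    because the second summand of a direct sum is treated relative to a larger submodule with the
    same bound \<open>n\<close>.\<close>
  have "\<forall>U c. submodule U \<longrightarrow> C \<in> \<T> \<longrightarrow> c \<in> Val M C \<longrightarrow> tot (gen U C c) \<le> tot U + n \<longrightarrow>
    (\<exists>L\<in>\<T>. \<exists>l\<in>Hom E L C. \<forall>S\<in>\<T>. \<forall>f\<in>Hom E S C. act S C f c \<in> U S \<longleftrightarrow> (\<exists>g\<in>Hom E S L. cm S L C l g = f))" for C
  proof (induction C rule: decomposition_induct)
    case (zero C)
    show ?case
    proof (intro allI impI)
      fix U c assume "submodule U" "C \<in> \<T>" "c \<in> Val M C"
      then show "\<exists>L\<in>\<T>. \<exists>l\<in>Hom E L C. \<forall>S\<in>\<T>. \<forall>f\<in>Hom E S C. act S C f c \<in> U S \<longleftrightarrow> (\<exists>g\<in>Hom E S L. cm S L C l g = f)"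
        using trivial[of U C c] Val_zero[OF _ zero, of c] submodule_ops(1)[of U C] by simp
    qed
  next
    case (indec C)
    show ?case
    proof (intro allI impI)
      fix U c assume U: "submodule U" and C: "C \<in> \<T>" and c: "c \<in> Val M C" and le: "tot (gen U C c) \<le> tot U + n"
      show "\<exists>L\<in>\<T>. \<exists>l\<in>Hom E L C. \<forall>S\<in>\<T>. \<forall>f\<in>Hom E S C. act S C f c \<in> U S \<longleftrightarrow> (\<exists>g\<in>Hom E S L. cm S L C l g = f)"
      proof (cases "c \<in> U C")
        case True
        then show ?thesis using trivial U C by blast
      next
        case False
        have "\<not> projective E C"
          using Val_projective[OF C] c False submodule_ops(1)[OF U C] by auto
        then obtain R r where R: "R \<in> \<T>" "r \<in> Hom E R C" "\<not> split_epi R C r"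
          and sink: "\<And>S f. S \<in> \<T> \<Longrightarrow> f \<in> Hom E S C \<Longrightarrow> \<not> split_epi S C f \<Longrightarrow> \<exists>h\<in>Hom E S R. cm S R C r h = f"
          using sink_map[OF C indec] by metis
        \<comment> \<open>The elements obtained from \<open>c'\<close> are those obtained from
          \<open>c\<close> by non-split maps, since these factor through the sink map
          \<open>r\<close>.\<close>
        define c' where "c' = act R C r c"
        have c': "c' \<in> Val M R" unfolding c'_def using R C c by simp
        have sub: "gen U R c' S \<subseteq> gen U C c S" if "S \<in> \<T>" for S
          by (rule gen_least[OF submodule_gen[OF U C c] R(1) _ _ that])
            (use gen_sup[OF _ that C c] gen_mem[OF U R(1) C R(2)] c'_def in auto)
        \<comment> \<open>Nakayama: otherwise \<open>c = u + c e\<close> with \<open>e = r h\<close>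
          and \<open>u\<close> in \<open>U\<close>. As \<open>r\<close> is not split,
          \<open>e\<close> is not invertible, so by Fitting's lemma \<open>1 - e\<close> is, and
          \<open>c\<close> would lie in \<open>U\<close>.\<close>
        have "tot (gen U R c') < tot (gen U C c)"
        proof (rule ccontr)
          assume "\<not> tot (gen U R c') < tot (gen U C c)"
          then have "gen U R c' C = gen U C c C"
            using tot_eq[OF submodule_gen[OF U R(1) c'] submodule_gen[OF U C c] sub _ C] by simp
          then obtain u h where u: "u \<in> U C" "h \<in> Hom E C R" "c = u + act C R h c'"
            using gen_mem_id[OF U C c] unfolding gen_def by blast
          define e where "e = cm C R C r h"
          have e: "e \<in> Hom E C C" unfolding e_def using R u by simp
          have "act C C (Idm E C - e) c = u"
            using u(3) e C R u(2) c unfolding e_def c'_def by (simp add: algebra_simps)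
          moreover have "\<not> is_iso E C C e"
          proof
            assume "is_iso E C C e"
            then obtain w where "w \<in> Hom E C C" "cm C C C e w = Idm E C" by (auto elim: is_isoE)
            then have "split_epi R C r" unfolding split_epi_def e_def using R u(2)
              by (intro bexI[of _ "cm C C R h w"]) simp_all
            then show False using R(3) by blast
          qed
          then have "is_iso E C C (Idm E C - e)" using fitting[OF indec e] by blast
          then obtain w where w: "w \<in> Hom E C C" "cm C C C (Idm E C - e) w = Idm E C" by (auto elim: is_isoE)
          have "act C C w u = c"
            using act_comp[OF C C C w(1) _ c, of "Idm E C - e"] calculation e w C c by simp
          then show False using False submoduleD(3)[OF U C C w(1) u(1)] by simp
        qed
        moreover have "tot U \<le> tot (gen U R c')"
          by (rule tot_mono[OF U submodule_gen[OF U R(1) c']]) (use gen_sup[OF _ _ R(1) c'] in blast)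
        ultimately obtain k where k: "k < n" "tot (gen U R c') \<le> tot U + k"
          using le by (intro that[of "tot (gen U R c') - tot U"]) linarith+
        obtain L l where L: "L \<in> \<T>" "l \<in> Hom E L R"
          "\<forall>S\<in>\<T>. \<forall>f\<in>Hom E S R. act S R f c' \<in> U S \<longleftrightarrow> (\<exists>g\<in>Hom E S L. cm S L R l g = f)"
          using less.IH[OF k(1) U R(1) c' k(2)] by blast
        show ?thesis
        proof (intro bexI[of _ L] bexI[of _ "cm L R C r l"] ballI)
          fix S f assume S: "S \<in> \<T>" and f: "f \<in> Hom E S C"
          show "act S C f c \<in> U S \<longleftrightarrow> (\<exists>g\<in>Hom E S L. cm S L C (cm L R C r l) g = f)"
          proof
            assume a: "act S C f c \<in> U S"
            \<comment> \<open>A section of \<open>f\<close> would recover \<open>c\<close> from an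
              element of \<open>U\<close>. So \<open>f\<close> factors through \<open>r\<close>, and
              the maps taking \<open>c\<close> into \<open>U\<close> are \<open>r\<close> composed
              with those taking \<open>c'\<close> into \<open>U\<close>.\<close>
            have "\<not> split_epi S C f"
            proof
              assume "split_epi S C f"
              then obtain g where g: "g \<in> Hom E C S" "cm C S C f g = Idm E C" unfolding split_epi_def by blast
              have "act C S g (act S C f c) = c" using act_comp[OF C S C g(1) f c] g(2) C c by simp
              then show False using False submoduleD(3)[OF U S C g(1) a] by simp
            qed
            then obtain h where h: "h \<in> Hom E S R" "cm S R C r h = f" using sink[OF S f] by blast
            then have "act S R h c' \<in> U S" using a act_comp[OF S R(1) C h(1) R(2) c] unfolding c'_def by simp
            then obtain g where "g \<in> Hom E S L" "cm S L R l g = h" using L(3) S h(1) by blast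
            then show "\<exists>g\<in>Hom E S L. cm S L C (cm L R C r l) g = f" using h L(2) R(2) by (intro bexI[of _ g]) simp_all
          next
            assume "\<exists>g\<in>Hom E S L. cm S L C (cm L R C r l) g = f"
            then obtain g where g: "g \<in> Hom E S L" "cm S L C (cm L R C r l) g = f" by blast
            have "act S R (cm S L R l g) c' \<in> U S" using L(2,3) S g(1) cm_in by blast
            moreover have "act S R (cm S L R l g) c' = act S C f c"
              unfolding g(2)[symmetric] c'_def using S L(1,2) R(1,2) C c g(1) by simp
            ultimately show "act S C f c \<in> U S" by simp
          qed
        qed (use L R in simp_all)
      qed
    qed
  next
    case (sum A B C)
    show ?case
    proof (intro allI impI)
      fix U c assume U: "submodule U" and C: "C \<in> \<T>" and c: "c \<in> Val M C" and le: "tot (gen U C c) \<le> tot U + n"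
      obtain i1 i2 p1 p2 where "biproduct E A B C i1 i2 p1 p2" using sum(1) unfolding direct_sum_def by blast
      then interpret b: biprod E A B C i1 i2 p1 p2 by unfold_locales
      have AB: "A \<in> \<T>" "B \<in> \<T>" using summand_mem[OF C sum(1)] summand_mem2[OF C sum(1)] .
      define a where "a = act A C i1 c"
      define d where "d = act B C i2 c"
      have ad: "a \<in> Val M A" "d \<in> Val M B" unfolding a_def d_def using AB C c by simp_all
      have act_c: "act S C f c = act S A (cm S C A p1 f) a + act S B (cm S C B p2 f) d"
        if "S \<in> \<T>" "f \<in> Hom E S C" for S f
      proof -
        have "act S A (cm S C A p1 f) a + act S B (cm S C B p2 f) d =
            act S C (cm S A C i1 (cm S C A p1 f) + cm S B C i2 (cm S C B p2 f)) c"
          unfolding a_def d_def using that AB C c by simp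
        then show ?thesis using b.decomp[OF that(2)] by simp
      qed
      \<comment> \<open>The component \<open>a\<close> is handled relative to \<open>U\<close>, the
        component \<open>d\<close> relative to \<open>V\<close>. All submodules involved lie between
        \<open>U\<close> and \<open>gen U C c\<close>, which keeps both lengths at most
        \<open>n\<close>.\<close>
      define V where "V = gen U A a"
      have V: "submodule V" unfolding V_def by (rule submodule_gen[OF U AB(1) ad(1)])
      note GC = submodule_gen[OF U C c]
      have aC: "a \<in> gen U C c A" unfolding a_def using gen_mem[OF U AB(1) C b.i1] .
      have dC: "d \<in> gen U C c B" unfolding d_def using gen_mem[OF U AB(2) C b.i2] .
      have VC: "V S \<subseteq> gen U C c S" if "S \<in> \<T>" for S
        unfolding V_def by (rule gen_least[OF GC AB(1) aC _ that]) (use gen_sup[OF _ that C c] in blast)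
      have WC: "gen V B d S \<subseteq> gen U C c S" if "S \<in> \<T>" for S
        by (rule gen_least[where V = "gen U C c" and U = V, OF GC AB(2) dC VC[OF that] that])
      have UV: "U S \<subseteq> V S" if "S \<in> \<T>" for S unfolding V_def using gen_sup[OF _ that AB(1) ad(1)] by blast
      have le1: "tot (gen U A a) \<le> tot U + n"
        using tot_mono[OF V GC VC] le unfolding V_def by simp
      have le2: "tot (gen V B d) \<le> tot V + n"
        using tot_mono[OF submodule_gen[OF V AB(2) ad(2)] GC WC] tot_mono[OF U V UV] le by simp
      obtain LA lA where LA: "LA \<in> \<T>" "lA \<in> Hom E LA A"
        "\<And>S f. S \<in> \<T> \<Longrightarrow> f \<in> Hom E S A \<Longrightarrow> act S A f a \<in> U S \<longleftrightarrow> (\<exists>g\<in>Hom E S LA. cm S LA A lA g = f)"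
        using sum(2)[rule_format, OF U AB(1) ad(1) le1] by blast
      obtain LB lB where LB: "LB \<in> \<T>" "lB \<in> Hom E LB B"
        "\<And>S f. S \<in> \<T> \<Longrightarrow> f \<in> Hom E S B \<Longrightarrow> act S B f d \<in> V S \<longleftrightarrow> (\<exists>g\<in>Hom E S LB. cm S LB B lB g = f)"
        using sum(3)[rule_format, OF V AB(2) ad(2) le2] by blast
      \<comment> \<open>Evaluating at the identity of \<open>LB\<close> expresses the image of
        \<open>d\<close> as \<open>u\<close> plus a multiple \<open>h\<close> of \<open>a\<close>;
        this \<open>h\<close> is the correction needed in \<open>l\<close>.\<close>
      have "act LB B lB d \<in> V LB" using LB(3)[OF LB(1,2)] bexI[of _ "Idm E LB" "Hom E LB LB"] LB(2) by auto
      then obtain u h where u: "u \<in> U LB" "h \<in> Hom E LB A" "act LB B lB d = u + act LB A h a"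
        unfolding V_def gen_def by blast
      have uv: "u \<in> Val M LB" using submoduleD(2)[OF U LB(1) u(1)] .
      obtain W j1 j2 q1 q2 where W: "biproduct E LA LB W j1 j2 q1 q2"
        using ex_direct_sum unfolding direct_sum_def by blast
      interpret W: biprod E LA LB W j1 j2 q1 q2 using W by unfold_locales
      have WT: "W \<in> \<T>" using sum_mem[OF LA(1) LB(1) W.direct_sum] .
      \<comment> \<open>On the pair (x, y) this map has the components \<open>lA x - h y\<close> and
        \<open>lB y\<close>. Subtracting \<open>h y\<close> cancels the multiple of \<open>a\<close>
        produced by \<open>lB y\<close> acting on \<open>d\<close>, up to an element of
        \<open>U\<close>.\<close>
      define l where "l = cm W A C i1 (cm W LA A lA q1 - cm W LB A h q2) + cm W B C i2 (cm W LB B lB q2)"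
      have l: "l \<in> Hom E W C" unfolding l_def using LA(2) LB(2) u(2) by simp
      show "\<exists>L\<in>\<T>. \<exists>l\<in>Hom E L C. \<forall>S\<in>\<T>. \<forall>f\<in>Hom E S C. act S C f c \<in> U S \<longleftrightarrow> (\<exists>g\<in>Hom E S L. cm S L C l g = f)"
      proof (intro bexI[of _ W] bexI[of _ l] ballI)
        fix S f assume S: "S \<in> \<T>" and f: "f \<in> Hom E S C"
        have lBy: "act S B (cm S LB B lB y) d = act S LB y u + act S A (cm S LB A h y) a"
          if "y \<in> Hom E S LB" for y
        proof -
          have "act S B (cm S LB B lB y) d = act S LB y (u + act LB A h a)"
            using that S LB(1,2) AB ad by (simp add: u(3))
          then show ?thesis using that S LB(1) AB ad u(2) uv by simp
        qed
        show "act S C f c \<in> U S \<longleftrightarrow> (\<exists>g\<in>Hom E S W. cm S W C l g = f)"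
        proof
          assume fU: "act S C f c \<in> U S"
          define f1 where "f1 = cm S C A p1 f"
          define f2 where "f2 = cm S C B p2 f"
          have f12: "f1 \<in> Hom E S A" "f2 \<in> Hom E S B" unfolding f1_def f2_def using f by simp_all
          have fc: "act S C f c = act S A f1 a + act S B f2 d" unfolding f1_def f2_def by (rule act_c[OF S f])
          have "act S B f2 d = act S C f c + act S A (- f1) a" using fc f12 S AB ad by simp
          then have "act S B f2 d \<in> V S" unfolding V_def gen_def using fU f12
            by (intro CollectI exI[of _ "act S C f c"] exI[of _ "- f1"]) simp
          then obtain y where y: "y \<in> Hom E S LB" "cm S LB B lB y = f2" using LB(3)[OF S f12(2)] by blast
          have "act S A (f1 + cm S LB A h y) a = act S C f c - act S LB y u"
            using fc lBy[OF y(1)] unfolding y(2) using f12 y(1) u(2) S AB ad by simp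
          then have "act S A (f1 + cm S LB A h y) a \<in> U S"
            using submodule_ops(3)[OF U S fU] submoduleD(3)[OF U LB(1) S y(1) u(1)] by simp
          then obtain x where x: "x \<in> Hom E S LA" "cm S LA A lA x = f1 + cm S LB A h y"
            using LA(3)[OF S, of "f1 + cm S LB A h y"] f12 y(1) u(2) by auto
          have "cm S W C l (cm S LA W j1 x + cm S LB W j2 y) = cm S A C i1 f1 + cm S B C i2 f2"
            unfolding l_def using x(1) y(1) LA(2) LB(2) u(2) f12 by (simp add: x(2) y(2))
          also have "\<dots> = f" unfolding f1_def f2_def by (rule b.decomp[OF f])
          finally show "\<exists>g\<in>Hom E S W. cm S W C l g = f" using x(1) y(1)
            by (intro bexI[of _ "cm S LA W j1 x + cm S LB W j2 y"]) simp_all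
        next
          assume "\<exists>g\<in>Hom E S W. cm S W C l g = f"
          then obtain g where g: "g \<in> Hom E S W" "cm S W C l g = f" by blast
          define x where "x = cm S W LA q1 g"
          define y where "y = cm S W LB q2 g"
          have xy: "x \<in> Hom E S LA" "y \<in> Hom E S LB" unfolding x_def y_def using g by simp_all
          have p: "cm S C A p1 f = cm S LA A lA x - cm S LB A h y" "cm S C B p2 f = cm S LB B lB y"
            unfolding g(2)[symmetric] l_def x_def y_def using g(1) LA(2) LB(2) u(2) by simp_all
          have "act S C f c = act S A (cm S LA A lA x) a + act S LB y u"
            unfolding act_c[OF S f] p lBy[OF xy(2)] using xy LA(2) u(2) S AB ad by simp
          moreover have "act S A (cm S LA A lA x) a \<in> U S" using LA(3)[OF S] LA(2) xy(1) by auto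
          ultimately show "act S C f c \<in> U S"
            using submodule_ops(2)[OF U S] submoduleD(3)[OF U LB(1) S xy(2) u(1)] by simp
        qed
      qed (use WT l in simp_all)
    qed
  qed
  then show ?case using less.prems by blast
qed

lemma submodule_zero: "submodule (\<lambda>S. {0})"
  unfolding submodule_def by (auto simp: pv.subspace_def)

lemma submodule_Val: "submodule (Val M)"
  unfolding submodule_def using Val_subspace by auto

text \<open>Elements at two objects combine to a single element at their direct sum, generating
  both. Hence a pair \<open>C\<close>, \<open>c\<close> with the largest total already generates
  everything.\<close>

lemma generator:
  obtains C c where "C \<in> \<T>" "c \<in> Val M C" "\<And>S w. S \<in> \<T> \<Longrightarrow> w \<in> Val M S \<Longrightarrow> \<exists>f\<in>Hom E S C. w = act S C f c"
proof -
  define U :: "'o \<Rightarrow> 'k poly set" where "U = (\<lambda>S. {0})"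
  have U: "submodule U" unfolding U_def by (rule submodule_zero)
  define Q where "Q k \<longleftrightarrow> (\<exists>C c. C \<in> \<T> \<and> c \<in> Val M C \<and> tot (gen U C c) = k)" for k
  obtain Z where "is_zero E Z" using ex_zero by blast
  then have "Z \<in> \<T>" by (rule zero_mem)
  then have "Q (tot (gen U Z 0))" unfolding Q_def by (intro exI[of _ Z] exI[of _ 0]) simp
  moreover have "\<forall>k. Q k \<longrightarrow> k \<le> tot (Val M)"
  proof (intro allI impI)
    fix k assume "Q k"
    then obtain C c where C: "C \<in> \<T>" "c \<in> Val M C" "tot (gen U C c) = k" unfolding Q_def by blast
    have "tot (gen U C c) \<le> tot (Val M)"
      by (rule tot_mono[OF submodule_gen[OF U C(1,2)] submodule_Val])
        (use submoduleD(2)[OF submodule_gen[OF U C(1,2)]] in blast)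
    then show "k \<le> tot (Val M)" using C(3) by simp
  qed
  ultimately obtain k where k: "Q k" "\<And>k'. Q k' \<Longrightarrow> k' \<le> k"
    using Nat.ex_has_greatest_nat[of Q _ "tot (Val M)"] by blast
  then obtain C c where C: "C \<in> \<T>" "c \<in> Val M C" "tot (gen U C c) = k" unfolding Q_def by blast
  have "\<exists>f\<in>Hom E S C. w = act S C f c" if S: "S \<in> \<T>" and w: "w \<in> Val M S" for S w
  proof -
    obtain W j1 j2 q1 q2 where W: "biproduct E C S W j1 j2 q1 q2"
      using ex_direct_sum unfolding direct_sum_def by blast
    interpret W: biprod E C S W j1 j2 q1 q2 using W by unfold_locales
    have WT: "W \<in> \<T>" using sum_mem[OF C(1) S W.direct_sum] .
    \<comment> \<open>The element with components \<open>c\<close> and \<open>w\<close>; restriction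
      along \<open>j1\<close> and \<open>j2\<close> recovers both.\<close>
    define x where "x = act W C q1 c + act W S q2 w"
    have x: "x \<in> Val M W" unfolding x_def using WT C S w by simp
    have jx: "act C W j1 x = c" "act S W j2 x = w"
    proof -
      have "act C W j1 x = act C C (cm C W C q1 j1) c + act C S (cm C W S q2 j1) w"
        unfolding x_def using WT C S w by (simp del: W.p1_i1 W.p2_i1)
      then show "act C W j1 x = c" using C S w by simp
      have "act S W j2 x = act S C (cm S W C q1 j2) c + act S S (cm S W S q2 j2) w"
        unfolding x_def using WT C S w by (simp del: W.p1_i2 W.p2_i2)
      then show "act S W j2 x = w" using C S w by simp
    qed
    note G = submodule_gen[OF U WT x]
    have "c \<in> gen U W x C" "w \<in> gen U W x S"
      using gen_mem[OF U C(1) WT W.i1, of x] gen_mem[OF U S WT W.i2, of x] jx by simp_all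
    have sub: "gen U C c T \<subseteq> gen U W x T" if "T \<in> \<T>" for T
      by (rule gen_least[OF G C(1) \<open>c \<in> gen U W x C\<close> _ that]) (use gen_sup[OF _ that WT x] in blast)
    have "tot (gen U W x) \<le> tot (gen U C c)" using k(2)[of "tot (gen U W x)"] WT x C(3) unfolding Q_def by blast
    then have "gen U C c S = gen U W x S"
      using tot_eq[OF submodule_gen[OF U C(1,2)] G sub _ S] by blast
    then have "w \<in> gen U C c S" using \<open>w \<in> gen U W x S\<close> by simp
    then show ?thesis unfolding gen_def U_def by auto
  qed
  then show thesis using that C by blast
qed

text \<open>\<open>relative_annihilator\<close> for the zero submodule gives a presentation by some
  \<open>l0\<close>. Adjoining a deflation from a projective \<open>P\<close> turns
  \<open>l0\<close> into a deflation without changing the cokernel on \<open>\<T>\<close>, as the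
  module vanishes on \<open>P\<close> and so \<open>\<pi>\<close> annihilates
  \<open>c\<close>.\<close>

lemma presentation:
  obtains X i L l C c where "(X, i, L, l, C) \<in> Confl E" "presents L l C c"
proof -
  obtain C c where C: "C \<in> \<T>" "c \<in> Val M C"
    and surj: "\<And>S w. S \<in> \<T> \<Longrightarrow> w \<in> Val M S \<Longrightarrow> \<exists>f\<in>Hom E S C. w = act S C f c" by (rule generator) blast
  obtain L0 l0 where L0: "L0 \<in> \<T>" "l0 \<in> Hom E L0 C"
    "\<forall>S\<in>\<T>. \<forall>f\<in>Hom E S C. act S C f c \<in> {0} \<longleftrightarrow> (\<exists>g\<in>Hom E S L0. cm S L0 C l0 g = f)"
    using relative_annihilator[OF submodule_zero C, of "tot (gen (\<lambda>S. {0}) C c)"] by auto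
  obtain K k P \<pi> where P: "(K, k, P, \<pi>, C) \<in> Confl E" "projective E P" by (rule projective_cover)
  interpret P: conflation E K k P \<pi> C using P(1) by (rule conflI)
  have PT: "P \<in> \<T>" using projective_mem[OF P(2)] .
  obtain D d1 d2 e1 e2 where D: "biproduct E L0 P D d1 d2 e1 e2"
    using ex_direct_sum unfolding direct_sum_def by blast
  interpret D: biprod E L0 P D d1 d2 e1 e2 using D by unfold_locales
  have DT: "D \<in> \<T>" using sum_mem[OF L0(1) PT D.direct_sum] .
  define l where "l = cm D L0 C l0 e1 + cm D P C \<pi> e2"
  have l: "l \<in> Hom E D C" unfolding l_def using L0(2) by simp
  obtain X i where X: "(X, i, D, l, C) \<in> Confl E"
    using deflation_sum[OF P(1) L0(2) D] unfolding l_def by blast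
  have \<pi>c: "act P C \<pi> c = 0" using act_in[OF PT C(1) P.p C(2)] Val_projective[OF PT P(2)] by simp
  have "presents D l C c"
  proof (rule presentsI[OF DT C(1) l C(2) surj])
    fix S f assume S: "S \<in> \<T>" and f: "f \<in> Hom E S C"
    have "(\<exists>g\<in>Hom E S L0. cm S L0 C l0 g = f) \<Longrightarrow> (\<exists>g\<in>Hom E S D. cm S D C l g = f)"
    proof -
      assume "\<exists>g\<in>Hom E S L0. cm S L0 C l0 g = f"
      then obtain g where g: "g \<in> Hom E S L0" "cm S L0 C l0 g = f" by blast
      then have "cm S D C l (cm S L0 D d1 g) = f" unfolding l_def using L0(2) by simp
      then show ?thesis using g(1) by (intro bexI[of _ "cm S L0 D d1 g"]) simp_all
    qed
    moreover have "(\<exists>g\<in>Hom E S D. cm S D C l g = f) \<Longrightarrow> act S C f c = 0"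
    proof -
      assume "\<exists>g\<in>Hom E S D. cm S D C l g = f"
      then obtain g where g: "g \<in> Hom E S D" "cm S D C l g = f" by blast
      have "act S C (cm S L0 C l0 (cm S D L0 e1 g)) c \<in> {0}"
        using L0(2,3) S g(1) cm_in by (metis D.p1)
      moreover have "act S C f c = act S C (cm S L0 C l0 (cm S D L0 e1 g)) c + act S P (cm S D P e2 g) (act P C \<pi> c)"
        unfolding g(2)[symmetric] l_def using g(1) L0(1,2) S C PT by simp
      ultimately show ?thesis unfolding \<pi>c using S PT g(1) by simp
    qed
    ultimately show "act S C f c = 0 \<longleftrightarrow> (\<exists>g\<in>Hom E S D. cm S D C l g = f)" using L0(3) S f by blast
  qed
  then show thesis using that X by blast
qed

end

section \<open>The homomorphism \<open>\<beta>\<close>\<close>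

context cluster_module
begin

definition ann :: "'o \<Rightarrow> 'k poly \<Rightarrow> 'o \<Rightarrow> 'm set" where
  "ann C v S = {f \<in> Hom E S C. act S C f v = 0}"

definition generates :: "'o \<Rightarrow> 'k poly \<Rightarrow> bool" where
  "generates C v \<longleftrightarrow> C \<in> \<T> \<and> v \<in> Val M C \<and> (\<forall>S\<in>\<T>. \<forall>w\<in>Val M S. \<exists>f\<in>Hom E S C. w = act S C f v)"

lemma subfun_ann: "C \<in> \<T> \<Longrightarrow> v \<in> Val M C \<Longrightarrow> subfun (ann C v) C"
  unfolding subfun_def ann_def by auto

lemma generates_of_presents: "presents L l C v \<Longrightarrow> generates C v"
  unfolding generates_def using presentsD(1) presents_def by metis

text \<open>Two generators express each other by maps \<open>b\<close> and \<open>a\<close>, so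
  \<open>1 - a b\<close> annihilates \<open>v\<close> and \<open>1 - b a\<close> annihilates
  \<open>v'\<close>. These are the data for \<open>tres_compare\<close>; the Euler characteristic
  thus depends on the module alone.\<close>

lemma tres_ann_unique:
  assumes g: "generates C v" "generates C' v'" and t: "tres n C (ann C v) e" "tres n C' (ann C' v') e'"
  shows "keq e e'"
proof -
  have C: "C \<in> \<T>" "v \<in> Val M C" "C' \<in> \<T>" "v' \<in> Val M C'" using g unfolding generates_def by auto
  obtain b where b: "b \<in> Hom E C C'" "v = act C C' b v'" using g(2) C(1,2) unfolding generates_def by blast
  obtain a where a: "a \<in> Hom E C' C" "v' = act C' C a v" using g(1) C(3,4) unfolding generates_def by blast
  have ab: "act C C (cm C C' C a b) v = v" "act C' C' (cm C' C C' b a) v' = v'"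
    using C a(1) b(1) by (simp_all flip: a(2) b(2))
  show ?thesis
  proof (rule tres_compare[OF t subfun_ann[OF C(1,2)] subfun_ann[OF C(3,4)] a(1) b(1)])
    fix S f assume S: "S \<in> \<T>" and "f \<in> ann C v S"
    then have f: "f \<in> Hom E S C" "act S C f v = 0" unfolding ann_def by auto
    have "act S C' (cm S C C' b f) v' = act S C f (act C C' b v')" using f S C b(1) by simp
    then show "cm S C C' b f \<in> ann C' v' S" using f b unfolding ann_def by simp
  next
    fix S f assume S: "S \<in> \<T>" and "f \<in> ann C' v' S"
    then have f: "f \<in> Hom E S C'" "act S C' f v' = 0" unfolding ann_def by auto
    have "act S C (cm S C' C a f) v = act S C' f (act C' C a v)" using f S C a(1) by simp
    then show "cm S C' C a f \<in> ann C v S" using f a unfolding ann_def by simp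
  next
    show "Idm E C - cm C C' C a b \<in> ann C v C"
      unfolding ann_def mem_Collect_eq using C a(1) b(1) ab by (simp del: act_comp)
    show "Idm E C' - cm C' C C' b a \<in> ann C' v' C'"
      unfolding ann_def mem_Collect_eq using C a(1) b(1) ab by (simp del: act_comp)
  qed
qed

text \<open>Splicing \<open>K \<rightarrow> R \<rightarrow> X\<close> and \<open>X \<rightarrow> L \<rightarrow> C\<close> gives a resolution of the module \<open>Ext\<^sup>1(_, X)\<close>.\<close>

lemma tres_of_iso_Ext:
  assumes iso: "iso_Ext_module E \<T> M X"
  obtains C v e where "generates C v" "tres 3 C (ann C v) e"
    "coind E \<T> X \<otimes>\<^bsub>K0 E \<T>\<^esub> inv\<^bsub>K0 E \<T>\<^esub> ind E \<T> X = K0.cl (- e)"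
proof -
  obtain K k R r where R: "K \<in> \<T>" "R \<in> \<T>" "(K, k, R, r, X) \<in> Confl E"
    "ind E \<T> X = K0.cl (frag_of R - frag_of K)" by (rule indE)
  obtain L i C l where L: "L \<in> \<T>" "C \<in> \<T>" "(X, i, L, l, C) \<in> Confl E"
    "coind E \<T> X = K0.cl (frag_of L - frag_of C)" by (rule coindE)
  interpret r: conflation E K k R r X using R(3) by (rule conflI)
  interpret l: conflation E X i L l C using L(3) by (rule conflI)
  obtain v where p: "presents L l C v" using presents_of_iso_Ext[OF iso L(3,1,2)] .
  have t1: "tres 1 R (\<lambda>S. {f \<in> Hom E S R. cm S R L (cm R X L i r) f = 0}) (frag_of R - frag_of K)"
  proof (rule tres_cong[OF tres_conflation[OF R(1-3)]])
    fix S
    have "cm S X L i (cm S R X r f) = 0 \<longleftrightarrow> cm S R X r f = 0" if "f \<in> Hom E S R" for f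
      using l.mono[of "cm S R X r f" S] that by auto
    then show "{f \<in> Hom E S R. cm S R X r f = 0} = {f \<in> Hom E S R. cm S R L (cm R X L i r) f = 0}" by auto
  qed
  \<comment> \<open>The splice: the kernel of composition with \<open>l\<close> is
    \<open>Hom E S X\<close>, and all of it comes from \<open>R\<close> because Ext^1(S, K)
    vanishes.\<close>
  have e1: "{f \<in> Hom E S L. cm S L C l f = 0} = cm S R L (cm R X L i r) ` Hom E S R" if S: "S \<in> \<T>" for S
  proof (intro equalityI subsetI)
    fix f assume "f \<in> {f \<in> Hom E S L. cm S L C l f = 0}"
    then have "f \<in> Hom E S L" "cm S L C l f = 0" by auto
    then obtain x where x: "x \<in> Hom E S X" "cm S X L i x = f" by (rule l.lift)
    obtain y where y: "y \<in> Hom E S R" "cm S R X r y = x" using ext_van_lift[OF R(3) ext_van[OF S R(1)] x(1)] .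
    then have "f = cm S R L (cm R X L i r) y" using x by simp
    then show "f \<in> cm S R L (cm R X L i r) ` Hom E S R" using y(1) by blast
  qed auto
  have "tres (Suc 1) L (\<lambda>S. {f \<in> Hom E S L. cm S L C l f = 0}) (frag_of L - (frag_of R - frag_of K))"
    unfolding tres.simps(2) using L(1) e1 t1 cm_in[OF r.p l.i] by blast
  moreover have "\<forall>S\<in>\<T>. ann C v S = cm S L C l ` Hom E S L" using p unfolding presents_def ann_def by blast
  ultimately have "tres (Suc (Suc 1)) C (ann C v) (frag_of C - (frag_of L - (frag_of R - frag_of K)))"
    unfolding tres.simps(2)[of "Suc 1"] using L(2) l.p by blast
  moreover have "Suc (Suc 1) = 3" by simp
  ultimately have "tres 3 C (ann C v) (frag_of C - (frag_of L - (frag_of R - frag_of K)))" by metis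
  \<comment> \<open>The length-three Euler characteristic is [C] - [L] + [R] - [K], whose negative
    is the coindex minus the index.\<close>
  moreover have "coind E \<T> X \<otimes>\<^bsub>K0 E \<T>\<^esub> inv\<^bsub>K0 E \<T>\<^esub> ind E \<T> X = K0.cl (- (frag_of C - (frag_of L - (frag_of R - frag_of K))))"
  proof -
    have "Poly_Mapping.keys (frag_of L - frag_of C) \<subseteq> \<T>" "Poly_Mapping.keys (frag_of R - frag_of K) \<subseteq> \<T>"
      using L(1,2) R(1,2) keys_diff[of "frag_of L" "frag_of C"] keys_diff[of "frag_of R" "frag_of K"] by auto
    then show ?thesis unfolding L(4) R(4) K0_eq by (simp add: K0.cl_diff[symmetric] algebra_simps)
  qed
  ultimately show thesis using that generates_of_presents[OF p] by blast
qed

end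

section \<open>Well-definedness and additivity of \<open>beta\<close>\<close>

context mutable_sub
begin

definition beta_obj :: "'o \<Rightarrow> ('o \<Rightarrow>\<^sub>0 int) set" where
  "beta_obj X = coind E \<T> X \<otimes>\<^bsub>K0 E \<T>\<^esub> inv\<^bsub>K0 E \<T>\<^esub> ind E \<T> X"

lemma fd_moduleI: "M \<in> fd_stable_modules E \<T> \<Longrightarrow> fd_module E \<T> M"
  by unfold_locales (simp_all add: fd_stable_modules_def)

lemma cl_neg_cong:
  assumes "keq e e'" "Poly_Mapping.keys e' \<subseteq> \<T>"
  shows "K0.cl (- e) = K0.cl (- e')"
proof (rule K0.cl_cong)
  show "Poly_Mapping.keys (- e') \<subseteq> \<T>" using assms(2) by simp
  show "- e - - e' \<in> K0.rel" using K0.rel_neg[of "e - e'"] assms(1) unfolding keq_def by simp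
qed

text \<open>A module does not determine \<open>X\<close>: a summand from \<open>\<T>\<close> is
  invisible to Ext^1(_, X) on \<open>\<T>\<close>. The value is nevertheless determined, as minus
  the Euler characteristic of any resolution of the module.\<close>

lemma beta_obj_unique:
  assumes "M \<in> fd_stable_modules E \<T>" "iso_Ext_module E \<T> M X" "iso_Ext_module E \<T> M X'"
  shows "beta_obj X = beta_obj X'"
proof -
  interpret M: fd_module E \<T> M using assms(1) by (rule fd_moduleI)
  obtain C v e where 1: "M.generates C v" "tres 3 C (M.ann C v) e" "beta_obj X = K0.cl (- e)"
    using M.tres_of_iso_Ext[OF assms(2)] unfolding beta_obj_def by blast
  obtain C' v' e' where 2: "M.generates C' v'" "tres 3 C' (M.ann C' v') e'" "beta_obj X' = K0.cl (- e')"
    using M.tres_of_iso_Ext[OF assms(3)] unfolding beta_obj_def by blast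
  show ?thesis unfolding 1(3) 2(3)
    using cl_neg_cong[OF M.tres_ann_unique[OF 1(1) 2(1) 1(2) 2(2)] tres_keys[OF 2(2)]] .
qed

text \<open>A generator of the submodule and a lift of a generator of the quotient combine to a
  generator of the middle module. The horseshoe lemma resolves it by the sum of the outer
  resolutions, and uniqueness identifies the result with the resolution coming from
  \<open>X2\<close>.\<close>

lemma beta_obj_exact:
  assumes fd: "M1 \<in> fd_stable_modules E \<T>" "M2 \<in> fd_stable_modules E \<T>" "M3 \<in> fd_stable_modules E \<T>"
    and ses: "module_short_exact E \<T> M1 M2 M3"
    and iso: "iso_Ext_module E \<T> M1 X1" "iso_Ext_module E \<T> M2 X2" "iso_Ext_module E \<T> M3 X3"
  shows "beta_obj X2 = beta_obj X1 \<otimes>\<^bsub>K0 E \<T>\<^esub> beta_obj X3"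
proof -
  interpret M1: fd_module E \<T> M1 using fd(1) by (rule fd_moduleI)
  interpret M2: fd_module E \<T> M2 using fd(2) by (rule fd_moduleI)
  interpret M3: fd_module E \<T> M3 using fd(3) by (rule fd_moduleI)
  obtain \<alpha> \<gamma> where \<alpha>: "module_hom E \<T> M1 M2 \<alpha>" and \<gamma>: "module_hom E \<T> M2 M3 \<gamma>"
    and ex: "\<forall>T\<in>\<T>. inj_on (\<alpha> T) (Val M1 T) \<and> \<gamma> T ` Val M2 T = Val M3 T \<and> \<alpha> T ` Val M1 T = {v \<in> Val M2 T. \<gamma> T v = 0}"
    using ses unfolding module_short_exact_def by blast
  have \<alpha>_in: "\<alpha> T v \<in> Val M2 T" if "T \<in> \<T>" "v \<in> Val M1 T" for T v
    using \<alpha> that unfolding module_hom_def by simp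
  have \<alpha>_nat: "\<alpha> S (Act M1 S T f v) = Act M2 S T f (\<alpha> T v)" if "S \<in> \<T>" "T \<in> \<T>" "f \<in> Hom E S T" "v \<in> Val M1 T" for S T f v
    using \<alpha> that unfolding module_hom_def by simp
  have \<gamma>_in: "\<gamma> T v \<in> Val M3 T" if "T \<in> \<T>" "v \<in> Val M2 T" for T v
    using \<gamma> that unfolding module_hom_def by simp
  have \<gamma>_nat: "\<gamma> S (Act M2 S T f v) = Act M3 S T f (\<gamma> T v)" if "S \<in> \<T>" "T \<in> \<T>" "f \<in> Hom E S T" "v \<in> Val M2 T" for S T f v
    using \<gamma> that unfolding module_hom_def by simp
  have \<gamma>_add: "\<gamma> T (v + w) = \<gamma> T v + \<gamma> T w" if "T \<in> \<T>" "v \<in> Val M2 T" "w \<in> Val M2 T" for T v w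
    using \<gamma> that unfolding module_hom_def by simp
  have \<gamma>_diff: "\<gamma> T (v - w) = \<gamma> T v - \<gamma> T w" if "T \<in> \<T>" "v \<in> Val M2 T" "w \<in> Val M2 T" for T v w
    using \<gamma>_add[OF that(1) M2.Val_diff[OF that] that(3)] by (simp add: algebra_simps)
  have \<alpha>0: "\<alpha> T 0 = 0" if "T \<in> \<T>" for T
  proof -
    have "\<alpha> T (smult 0 0) = smult 0 (\<alpha> T 0)" using \<alpha> that M1.Val_0[OF that] unfolding module_hom_def by blast
    then show ?thesis by simp
  qed
  have \<alpha>_zero: "\<alpha> T v = 0 \<longleftrightarrow> v = 0" if "T \<in> \<T>" "v \<in> Val M1 T" for T v
    using ex that M1.Val_0[OF that(1)] \<alpha>0[OF that(1)] unfolding inj_on_def by metis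
  have \<gamma>\<alpha>: "\<gamma> T (\<alpha> T v) = 0" if "T \<in> \<T>" "v \<in> Val M1 T" for T v
    using ex that by blast
  have \<gamma>_ker: "\<exists>m\<in>Val M1 T. v = \<alpha> T m" if "T \<in> \<T>" "v \<in> Val M2 T" "\<gamma> T v = 0" for T v
    using ex that by blast
  have \<gamma>_surj: "\<exists>m\<in>Val M2 T. v = \<gamma> T m" if "T \<in> \<T>" "v \<in> Val M3 T" for T v
    using ex that by blast
  obtain C1 v1 e1 where 1: "M1.generates C1 v1" "tres 3 C1 (M1.ann C1 v1) e1" "beta_obj X1 = K0.cl (- e1)"
    using M1.tres_of_iso_Ext[OF iso(1)] unfolding beta_obj_def by blast
  obtain C2 v2 e2 where 2: "M2.generates C2 v2" "tres 3 C2 (M2.ann C2 v2) e2" "beta_obj X2 = K0.cl (- e2)"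
    using M2.tres_of_iso_Ext[OF iso(2)] unfolding beta_obj_def by blast
  obtain C3 v3 e3 where 3: "M3.generates C3 v3" "tres 3 C3 (M3.ann C3 v3) e3" "beta_obj X3 = K0.cl (- e3)"
    using M3.tres_of_iso_Ext[OF iso(3)] unfolding beta_obj_def by blast
  have C: "C1 \<in> \<T>" "v1 \<in> Val M1 C1" "C3 \<in> \<T>" "v3 \<in> Val M3 C3"
    using 1(1) 3(1) unfolding M1.generates_def M3.generates_def by auto
  obtain w where w: "w \<in> Val M2 C3" "v3 = \<gamma> C3 w" using \<gamma>_surj[OF C(3,4)] by blast
  obtain G i1 i3 p1 p3 where G: "biproduct E C1 C3 G i1 i3 p1 p3"
    using ex_direct_sum unfolding direct_sum_def by blast
  interpret G: biprod E C1 C3 G i1 i3 p1 p3 using G by unfold_locales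
  have GT: "G \<in> \<T>" using sum_mem[OF C(1,3) G.direct_sum] .
  define a where "a = \<alpha> C1 v1"
  have a: "a \<in> Val M2 C1" unfolding a_def using \<alpha>_in C by blast
  \<comment> \<open>The element of \<open>G = C1 \<oplus> C3\<close> whose components are the image
    \<open>a\<close> of \<open>v1\<close> and the lift \<open>w\<close> of
    \<open>v3\<close>.\<close>
  define u where "u = Act M2 G C1 p1 a + Act M2 G C3 p3 w"
  have u: "u \<in> Val M2 G" unfolding u_def using GT C a w by simp
  have act_u: "Act M2 S G h u = Act M2 S C1 (cm S G C1 p1 h) a + Act M2 S C3 (cm S G C3 p3 h) w"
    if "S \<in> \<T>" "h \<in> Hom E S G" for S h
    unfolding u_def using that GT C a w by simp
  have a_nat: "Act M2 S C1 f a = \<alpha> S (Act M1 S C1 f v1)" if "S \<in> \<T>" "f \<in> Hom E S C1" for S f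
    unfolding a_def using \<alpha>_nat[OF that(1) C(1) that(2) C(2)] by simp
  have w_nat: "\<gamma> S (Act M2 S C3 f w) = Act M3 S C3 f v3" if "S \<in> \<T>" "f \<in> Hom E S C3" for S f
    using \<gamma>_nat[OF that(1) C(3) that(2) w(1)] w(2) by simp
  have \<gamma>a: "\<gamma> S (Act M2 S C1 f a) = 0" if "S \<in> \<T>" "f \<in> Hom E S C1" for S f
    unfolding a_nat[OF that] using \<gamma>\<alpha>[OF that(1)] that C by simp
  have gen: "M2.generates G u"
    unfolding M2.generates_def
  proof (intro conjI ballI GT u)
    fix S m assume S: "S \<in> \<T>" and m: "m \<in> Val M2 S"
    obtain g where g: "g \<in> Hom E S C3" "\<gamma> S m = Act M3 S C3 g v3"
      using 3(1) \<gamma>_in[OF S m] S unfolding M3.generates_def by blast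
    have gw: "Act M2 S C3 g w \<in> Val M2 S" using S C w g by simp
    have "\<gamma> S (m - Act M2 S C3 g w) = 0" using \<gamma>_diff[OF S m gw] w_nat[OF S g(1)] g(2) by simp
    then obtain m1 where m1: "m1 \<in> Val M1 S" "m - Act M2 S C3 g w = \<alpha> S m1"
      using \<gamma>_ker[OF S] m gw S by (metis M2.Val_diff)
    obtain f where f: "f \<in> Hom E S C1" "m1 = Act M1 S C1 f v1"
      using 1(1) m1(1) S unfolding M1.generates_def by blast
    have "m = Act M2 S C1 f a + Act M2 S C3 g w" using m1(2) a_nat[OF S f(1)] f(2) by (simp add: algebra_simps)
    also have "\<dots> = Act M2 S G (cm S C1 G i1 f + cm S C3 G i3 g) u"
      using act_u[OF S, of "cm S C1 G i1 f + cm S C3 G i3 g"] f(1) g(1) by simp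
    finally show "\<exists>f\<in>Hom E S G. m = Act M2 S G f u" using f(1) g(1)
      by (intro bexI[of _ "cm S C1 G i1 f + cm S C3 G i3 g"]) simp_all
  qed
  have "\<exists>e. tres 3 G (M2.ann G u) e \<and> keq e (e1 + e3)"
  proof (rule tres_horseshoe[OF 1(2) 3(2) G M2.subfun_ann[OF GT u]])
    fix S f assume S: "S \<in> \<T>" and f: "f \<in> Hom E S C1"
    have "Act M2 S G (cm S C1 G i1 f) u = Act M2 S C1 f a"
      using act_u[OF S, of "cm S C1 G i1 f"] f S C w by simp
    also have "\<dots> = 0 \<longleftrightarrow> Act M1 S C1 f v1 = 0"
      unfolding a_nat[OF S f] using \<alpha>_zero[OF S] S C f by simp
    finally show "cm S C1 G i1 f \<in> M2.ann G u S \<longleftrightarrow> f \<in> M1.ann C1 v1 S"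
      unfolding M1.ann_def M2.ann_def using f by simp
  next
    fix S h assume S: "S \<in> \<T>" and "h \<in> M2.ann G u S"
    then have h: "h \<in> Hom E S G" "Act M2 S G h u = 0" unfolding M2.ann_def by auto
    define x where "x = Act M2 S C1 (cm S G C1 p1 h) a"
    define y where "y = Act M2 S C3 (cm S G C3 p3 h) w"
    have xy: "x \<in> Val M2 S" "y \<in> Val M2 S" unfolding x_def y_def using S C a w h by simp_all
    have "x + y = 0" using act_u[OF S h(1)] h(2) unfolding x_def y_def by simp
    then have "y = 0 - x" by (simp add: eq_neg_iff_add_eq_0 add.commute)
    moreover have "\<gamma> S (0 - x) = \<gamma> S 0 - \<gamma> S x" using \<gamma>_diff[OF S M2.Val_0[OF S] xy(1)] .
    moreover have "\<gamma> S 0 = 0" using \<gamma>_diff[OF S xy(1) xy(1)] by simp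
    moreover have "\<gamma> S x = 0" unfolding x_def using \<gamma>a[OF S] h by simp
    ultimately have "\<gamma> S y = 0" by simp
    then show "cm S G C3 p3 h \<in> M3.ann C3 v3 S"
      unfolding M3.ann_def using w_nat[OF S, of "cm S G C3 p3 h"] h(1) unfolding y_def by simp
  next
    fix S g assume S: "S \<in> \<T>" and "g \<in> M3.ann C3 v3 S"
    then have g: "g \<in> Hom E S C3" "Act M3 S C3 g v3 = 0" unfolding M3.ann_def by auto
    have "\<gamma> S (Act M2 S C3 g w) = 0" using w_nat[OF S g(1)] g(2) by simp
    moreover have "Act M2 S C3 g w \<in> Val M2 S" using S C w g by simp
    ultimately obtain m1 where m1: "m1 \<in> Val M1 S" "Act M2 S C3 g w = \<alpha> S m1" using \<gamma>_ker[OF S] by blast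
    obtain f where f: "f \<in> Hom E S C1" "m1 = Act M1 S C1 f v1"
      using 1(1) m1(1) S unfolding M1.generates_def by blast
    have "Act M2 S G (cm S C3 G i3 g - cm S C1 G i1 f) u = Act M2 S C1 (- f) a + Act M2 S C3 g w"
      using act_u[OF S, of "cm S C3 G i3 g - cm S C1 G i1 f"] f(1) g(1) by simp
    also have "\<dots> = 0" using m1(2) f a_nat[OF S f(1)] S C a by simp
    finally show "\<exists>h\<in>M2.ann G u S. cm S G C3 p3 h = g"
      unfolding M2.ann_def using f(1) g(1) by (intro bexI[of _ "cm S C3 G i3 g - cm S C1 G i1 f"]) simp_all
  qed
  then obtain e where e: "tres 3 G (M2.ann G u) e" "keq e (e1 + e3)" by blast
  have "keq e2 (e1 + e3)"
    using keq_trans[OF M2.tres_ann_unique[OF 2(1) gen 2(2) e(1)] e(2)] .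
  moreover have k: "Poly_Mapping.keys e1 \<subseteq> \<T>" "Poly_Mapping.keys e3 \<subseteq> \<T>" using tres_keys 1(2) 3(2) by blast+
  moreover have "Poly_Mapping.keys (e1 + e3) \<subseteq> \<T>" using keys_add[of e1 e3] k by blast
  ultimately have "beta_obj X2 = K0.cl (- (e1 + e3))" unfolding 2(3) by (intro cl_neg_cong)
  also have "- (e1 + e3) = - e1 + - e3" by simp
  also have "K0.cl (- e1 + - e3) = beta_obj X1 \<otimes>\<^bsub>K0 E \<T>\<^esub> beta_obj X3"
    unfolding 1(3) 3(3) K0_eq using K0.cl_add[of "- e1" "- e3"] k by simp
  finally show ?thesis .
qed

lemma beta_obj_closed: "beta_obj X \<in> carrier (K0 E \<T>)"
proof -
  obtain L C where L: "L \<in> \<T>" "C \<in> \<T>" "coind E \<T> X = K0.cl (frag_of L - frag_of C)" by (rule coindE)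
  have "Poly_Mapping.keys (frag_of L - frag_of C) \<subseteq> \<T>"
    using L(1,2) keys_diff[of "frag_of L" "frag_of C"] by auto
  then have "coind E \<T> X \<in> carrier K0.G" unfolding L(3) by (rule K0.cl_closed)
  then show ?thesis unfolding beta_obj_def using ind_closed[of X] K0.group_G unfolding K0_eq
    by (meson group.inv_closed group.is_monoid monoid.m_closed)
qed

lemma iso_Ext_exists:
  assumes "M \<in> fd_stable_modules E \<T>"
  obtains X where "iso_Ext_module E \<T> M X"
proof -
  interpret M: fd_module E \<T> M using assms by (rule fd_moduleI)
  obtain X i L l C c where "(X, i, L, l, C) \<in> Confl E" "M.presents L l C c" by (rule M.presentation)
  then show thesis using that M.iso_Ext_of_presents by blast
qed

sublocale fd: grothendieck "fd_stable_modules E \<T>" "fd_relations E \<T>"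
proof
  fix r assume "r \<in> fd_relations E \<T>"
  then obtain L M N where s: "r = frag_of M - frag_of L - frag_of N" "L \<in> fd_stable_modules E \<T>"
    "M \<in> fd_stable_modules E \<T>" "N \<in> fd_stable_modules E \<T>"
    unfolding fd_relations_def by blast
  then show "Poly_Mapping.keys r \<subseteq> fd_stable_modules E \<T>"
    using keys_diff[of "frag_of M - frag_of L" "frag_of N"] keys_diff[of "frag_of M" "frag_of L"] by auto
qed

text \<open>The choice in \<open>beta\<close> becomes usable once a homomorphism with the prescribed
  values is known: choose an \<open>X\<close> for each module, use \<open>beta_obj_unique\<close> to
  drop the choice and \<open>beta_obj_exact\<close> for the relations.\<close>

lemma beta_class:
  assumes M: "M \<in> fd_stable_modules E \<T>" and X: "iso_Ext_module E \<T> M X"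
  shows "beta E \<T> (K0_fd_class E \<T> M) = beta_obj X"
proof -
  define f where "f M = beta_obj (SOME X. iso_Ext_module E \<T> M X)" for M
  have f: "f M = beta_obj X" if "M \<in> fd_stable_modules E \<T>" "iso_Ext_module E \<T> M X" for M X
    unfolding f_def by (rule beta_obj_unique[OF that(1) _ that(2)]) (rule someI[of "iso_Ext_module E \<T> M", OF that(2)])
  obtain b where b: "b \<in> hom fd.G (K0 E \<T>)"
    "\<And>M. M \<in> fd_stable_modules E \<T> \<Longrightarrow> b (grothendieck_class (fd_stable_modules E \<T>) (fd_relations E \<T>) M) = f M"
  proof (rule fd.hom_exists[where f = f and H = "K0 E \<T>" and Q = "\<lambda>L N M. L \<in> fd_stable_modules E \<T> \<and>
     M \<in> fd_stable_modules E \<T> \<and> N \<in> fd_stable_modules E \<T> \<and> module_short_exact E \<T> L M N"])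
    show "comm_group (K0 E \<T>)" unfolding K0_eq by (rule K0.comm_group_G)
    show "f M \<in> carrier (K0 E \<T>)" for M unfolding f_def by (rule beta_obj_closed)
    show "fd_relations E \<T> = {frag_of M - frag_of L - frag_of N | L N M. L \<in> fd_stable_modules E \<T> \<and>
     M \<in> fd_stable_modules E \<T> \<and> N \<in> fd_stable_modules E \<T> \<and> module_short_exact E \<T> L M N}"
      unfolding fd_relations_def by blast
  next
    fix L N M assume a: "L \<in> fd_stable_modules E \<T> \<and> M \<in> fd_stable_modules E \<T> \<and>
      N \<in> fd_stable_modules E \<T> \<and> module_short_exact E \<T> L M N"
    obtain X1 where 1: "iso_Ext_module E \<T> L X1" using iso_Ext_exists a by blast
    obtain X2 where 2: "iso_Ext_module E \<T> M X2" using iso_Ext_exists a by blast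
    obtain X3 where 3: "iso_Ext_module E \<T> N X3" using iso_Ext_exists a by blast
    show "L \<in> fd_stable_modules E \<T> \<and> N \<in> fd_stable_modules E \<T> \<and> M \<in> fd_stable_modules E \<T> \<and>
      f M = f L \<otimes>\<^bsub>K0 E \<T>\<^esub> f N"
      using a beta_obj_exact[OF _ _ _ _ 1 2 3] f[OF _ 1] f[OF _ 2] f[OF _ 3] by simp
  qed blast
  have "\<exists>b. b \<in> hom (K0_fd E \<T>) (K0 E \<T>) \<and>
     (\<forall>M\<in>fd_stable_modules E \<T>. \<forall>X. iso_Ext_module E \<T> M X \<longrightarrow>
        b (K0_fd_class E \<T> M) = coind E \<T> X \<otimes>\<^bsub>K0 E \<T>\<^esub> inv\<^bsub>K0 E \<T>\<^esub> ind E \<T> X)"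
    using b f unfolding K0_fd_def K0_fd_class_def beta_obj_def by auto
  then have "beta E \<T> \<in> hom (K0_fd E \<T>) (K0 E \<T>) \<and>
     (\<forall>M\<in>fd_stable_modules E \<T>. \<forall>X. iso_Ext_module E \<T> M X \<longrightarrow>
        beta E \<T> (K0_fd_class E \<T> M) = coind E \<T> X \<otimes>\<^bsub>K0 E \<T>\<^esub> inv\<^bsub>K0 E \<T>\<^esub> ind E \<T> X)"
    unfolding beta_def by (rule someI_ex)
  then show ?thesis unfolding beta_obj_def using M X by blast
qed

lemma hom_form_beta:
  assumes M: "M \<in> fd_stable_modules E \<T>" and T: "T \<in> \<T>"
  shows "hom_form E \<T> (beta E \<T> (K0_fd_class E \<T> M)) (K0_class E \<T> T) = 2 * int (pv.dim (Val M T))"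
proof -
  interpret M: fd_module E \<T> M using M by (rule fd_moduleI)
  obtain X where X: "iso_Ext_module E \<T> M X" using iso_Ext_exists[OF M] .
  obtain K k R r where R: "K \<in> \<T>" "R \<in> \<T>" "(K, k, R, r, X) \<in> Confl E"
    "ind E \<T> X = K0.cl (frag_of R - frag_of K)" by (rule indE)
  obtain L i C l where L: "L \<in> \<T>" "C \<in> \<T>" "(X, i, L, l, C) \<in> Confl E"
    "coind E \<T> X = K0.cl (frag_of L - frag_of C)" by (rule coindE)
  obtain v where p: "M.presents L l C v" using M.presents_of_iso_Ext[OF X L(3,1,2)] .
  have "Poly_Mapping.keys (frag_of L - frag_of C) \<subseteq> \<T>"
    using L(1,2) keys_diff[of "frag_of L" "frag_of C"] by auto
  then have cc: "coind E \<T> X \<in> carrier K0.G" unfolding L(4) by (rule K0.cl_closed)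
  have tc: "K0_class E \<T> T \<in> carrier K0.G" using K0.class_closed[OF T] unfolding K0_class_def .
  have ic: "ind E \<T> X \<in> carrier K0.G" using ind_closed[of X] unfolding K0_eq .
  have "hom_form E \<T> (beta E \<T> (K0_fd_class E \<T> M)) (K0_class E \<T> T) =
      hom_form E \<T> (coind E \<T> X) (K0_class E \<T> T) - hom_form E \<T> (ind E \<T> X) (K0_class E \<T> T)"
    unfolding beta_class[OF M X] beta_obj_def K0_eq by (rule hom_form_diff(1)[OF cc ic tc])
  also have "\<dots> = (hdiff L T - hdiff C T) - (hdiff R T - hdiff K T)"
    unfolding L(4) R(4) class_diff_form[OF L(1,2) T] class_diff_form[OF R(2,1) T] ..
  \<comment> \<open>Exactness of Hom(T, _) on the first conflation and of Hom(_, T) on the second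
    leaves the two sides of \<open>euler_symmetric\<close>, added. Each equals the dimension of
    \<open>Val M T\<close> by \<open>dim_Val\<close>, which is where the factor 2 comes
    from.\<close>
  also have "\<dots> = 2 * int (pv.dim (Val M T))"
    using M.dim_Val[OF p L(3) T] hom_dim_exact_post[OF R(3) ext_van[OF T R(1)]]
      hom_dim_exact_pre[OF L(3) ext_van[OF L(2) T]]
      euler_symmetric[OF R(3) L(3) ext_van[OF R(2) T] ext_van[OF T L(1)]]
    unfolding hdiff_def by simp
  finally show ?thesis .
qed

end

theorem theorem6p21:
  fixes E :: "('o, 'm::ab_group_add, 'k::field) exact_cat"
  assumes "perfect_field TYPE('k)"
    and "exact_cluster_category E"
    and "hom_finite E"
    and "weak_cluster_structure E"
  shows "quantum_structure E (hom_form E)"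
proof -
  have E: "exact_category E" "idempotent_complete E" "frobenius E" "stable_two_calabi_yau E"
    using assms(2) unfolding exact_cluster_category_def by blast+
  interpret exact_category E by (rule E(1))
  have ms: "mutable_sub E \<T>" if "cluster_tilting E \<T>" for \<T>
    by unfold_locales (use that E assms(3,4) in \<open>auto simp: weak_cluster_structure_def\<close>)
  show ?thesis
    unfolding quantum_structure_def
  proof (intro conjI allI impI ballI)
    fix \<T> assume T: "cluster_tilting E \<T>"
    interpret T: mutable_sub E \<T> using T by (rule ms)
    show "quantum_datum E \<T> (hom_form E \<T>)"
      unfolding quantum_datum_def using T.hom_form(1) T.hom_form_skew T.hom_form_beta by blast
  next
    fix \<T> \<U> u v assume TU: "cluster_tilting E \<T> \<and> cluster_tilting E \<U>"
      and uv: "u \<in> carrier (K0 E \<U>)" "v \<in> carrier (K0 E \<U>)"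
    interpret T: mutable_sub E \<T> using TU ms by blast
    show "hom_form E \<T> (ind_hom E \<U> \<T> u) (ind_hom E \<U> \<T> v) = hom_form E \<U> u v"
      using T.hom_form_invariant TU uv by blast
  qed
qed

end
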